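(* Let $(a,(\alpha_{ij}),(b_1,b_2),(\beta_{ij}),m,\mu)$ be a set of admissible parameters with $\beta_{22}<0$ and $\int_D|\xi_2|m(d\xi)<\infty$. Let $\sigma_0=\sqrt a$ and let $(\sigma_{ij})$ be a $(2\times2)$-matrix with $(\alpha_{ij})=(\sigma_{ij})(\sigma_{ij})^\tau$. Assume decompositions $\sigma_0=\sigma_0^+-\sigma_0^-$, $\sigma_{2j}=\sigma_{2j}^+-\sigma_{2j}^-$ ($j=1,2$), $b_2=b_2^+-b_2^-$, $\beta_{21}=\beta_{21}^+-\beta_{21}^-$. Let $\{\theta_k\}$ be a sequence with $1\le\theta_k\to\infty$. Let $x(0)$ be a nonnegative $\mathscr{F}_0$-measurable random variable and let $x(\cdot)$ be the nonnegative solution of $$x(t)=x(0)+\int_0^t(b_1+\beta_{11}x(s))ds+\int_0^t\sigma_{11}\sqrt{2x(s)}\,dB_1(s)+\int_0^t\sigma_{12}\sqrt{2x(s)}\,dB_2(s)+\int_0^t\int_D\xi_1N_0(ds,d\xi)+\int_0^t\int_0^{x(s-)}\int_D\xi_1\tilde N_1(ds,du,d\xi).$$ For each (sufficiently large) $k$ let $y_k^{\pm}(0)$ be nonnegative $\mathscr{F}_0$-measurable random variables and let $y_k^\pm(\cdot)$ be the nonnegative solutions of $$y_k^+(t)=y_k^+(0)+\int_0^t(-\theta_k\beta_{22}+\beta_{21}^+x(s)\tilde y_k^+(s)+b_2^+\tilde y_k^+(s)+\beta_{22}y_k^+(s))ds+\int_0^t\sigma_0^+\sqrt{2\tilde y_k^+(s)}\,dB_0(s)+\int_0^t\sigma_{21}^+\sqrt{2x(s)\tilde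 y_k^+(s)}\,dB_1(s)$$ $$\qquad+\int_0^t\sigma_{22}^+\sqrt{2x(s)\tilde y_k^+(s)}\,dB_2(s)+\int_0^t\int_{D_+}\xi_2\tilde N_0(ds,d\xi)+\int_0^t\int_0^{x(s-)\tilde y_k^+(s-)}\int_{D_+}\xi_2\tilde N_1(ds,du,d\xi),$$ $$y_k^-(t)=y_k^-(0)+\int_0^t(-\theta_k\beta_{22}+\beta_{21}^-x(s)\tilde y_k^-(s)+b_2^-\tilde y_k^-(s)+\beta_{22}y_k^-(s))ds+\int_0^t\sigma_0^-\sqrt{2\tilde y_k^-(s)}\,dB_0(s)+\int_0^t\sigma_{21}^-\sqrt{2x(s)\tilde y_k^-(s)}\,dB_1(s)$$ $$\qquad+\int_0^t\sigma_{22}^-\sqrt{2x(s)\tilde y_k^-(s)}\,dB_2(s)-\int_0^t\int_{D_-}\xi_2\tilde N_0(ds,d\xi)-\int_0^t\int_0^{x(s-)\tilde y_k^-(s-)}\int_{D_-}\xi_2\tilde N_1(ds,du,d\xi),$$ where $\tilde y_k^\pm(t)=y_k^\pm(t)/\theta_k$. Set $z_k^\pm(t)=y_k^\pm(t)-\theta_k$ and $z_k(t)=z_k^+(t)-z_k^-(t)$. Suppose that $z^+(0)$ and $z^-(0)$ are $\mathscr{F}_0$-measurable random variables with $\mathbf{E}[|z^+(0)|+|z^-(0)|]<\infty$ and $$\lim_{k\to\infty}\mathbf{E}[|z_k^+(0)-z^+(0)|+|z_k^-(0)-z^-(0)|]=0.$$ Then, as $k\to\infty$, $z_k(\cdot)$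 converges in probability by the topology of $D([0,\infty),\mathbb{R})$ to the solution $z(\cdot)$ of $$z(t)=z(0)+\int_0^t(b_2+\beta_{21}x(s)+\beta_{22}z(s))ds+\int_0^t\sqrt2\,\sigma_0\,dB_0(s)+\int_0^t\sigma_{21}\sqrt{2x(s)}\,dB_1(s)+\int_0^t\sigma_{22}\sqrt{2x(s)}\,dB_2(s)$$ $$\qquad+\int_0^t\int_D\xi_2\tilde N_0(ds,d\xi)+\int_0^t\int_0^{x(s-)}\int_D\xi_2\tilde N_1(ds,du,d\xi),$$ where $z(0)=z^+(0)-z^-(0)$.
   Context: $D=\mathbb{R}_+\times\mathbb{R}$, $D_+=\mathbb{R}_+\times\mathbb{R}_+$, $D_-=\mathbb{R}_+\times\mathbb{R}_-$, with $\mathbb{R}_+=[0,\infty)$, $\mathbb{R}_-=(-\infty,0]$; $l_1(x)=|x|$, $l_{12}(x)=|x|\wedge|x|^2$. $D([0,\infty),\mathbb{R})$ is the space of càdlàg functions with the Skorokhod topology. Admissible parameters $(a,(\alpha_{ij}),(b_1,b_2),(\beta_{ij}),m,\mu)$: $a\in\mathbb{R}_+$; $(\alpha_{ij})$ a symmetric nonnegative definite $2\times2$ matrix; $(b_1,b_2)\in D$; $(\beta_{ij})$ a $2\times2$ real matrix with $\beta_{12}=0$; $m$ and $\mu$ $\sigma$-finite measures on $D$ supported by $D\setminus\{0\}$ with $\int_D[l_1(\xi_1)+l_{12}(\xi_2)]m(d\xi)<\infty$ and $\int_D[l_{12}(\xi_1)+l_{12}(\xi_2)]\mu(d\xi)<\infty$.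 $(\Omega,\mathscr{F},\mathscr{F}_t,\mathbf{P})$ is a filtered probability space satisfying the usual hypotheses, carrying: a three-dimensional Brownian motion $B=(B_0,B_1,B_2)$; a Poisson random measure $N_0(ds,d\xi)$ on $(0,\infty)\times D$ with intensity $ds\,m(d\xi)$; a Poisson random measure $N_1(ds,du,d\xi)$ on $(0,\infty)^2\times D$ with intensity $ds\,du\,\mu(d\xi)$. $B$, $N_0$, $N_1$ are independent and $(\mathscr{F}_t)$ is the augmented natural filtration generated by them. $\tilde N_0=N_0-ds\,m(d\xi)$ and $\tilde N_1=N_1-ds\,du\,\mu(d\xi)$. Solutions are càdlàg progressive processes satisfying the equations a.s. for each $t\ge0$; "sufficiently large $k$" means $-\theta_k\beta_{22}\ge\int_{D}|\xi_2|m(d\xi)$, in which case the nonnegative solutions $y_k^\pm(\cdot)$ exist uniquely. *)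

theory Defs
  imports "HOL-Probability.Probability"
begin

section \<open>State space and admissible parameters\<close>

definition D_all :: "(real \<times> real) set" where
  "D_all = {0..} \<times> UNIV"

definition D_plus :: "(real \<times> real) set" where
  "D_plus = {0..} \<times> {0..}"

definition D_minus :: "(real \<times> real) set" where
  "D_minus = {0..} \<times> {..0}"

definition l1 :: "real \<Rightarrow> real" where
  "l1 x = \<bar>x\<bar>"

definition l12 :: "real \<Rightarrow> real" where
  "l12 x = min \<bar>x\<bar> (\<bar>x\<bar>\<^sup>2)"

definition sigma_finite_on_D :: "(real \<times> real) measure \<Rightarrow> bool" where
  "sigma_finite_on_D m \<longleftrightarrow>
     space m = D_all \<and> sets m = sets (restrict_space borel D_all) \<and>
     sigma_finite_measure m \<and> emeasure m {(0, 0)} = 0"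

definition admissible ::
  "real \<Rightarrow> real^2^2 \<Rightarrow> real \<times> real \<Rightarrow> real^2^2 \<Rightarrow> (real \<times> real) measure \<Rightarrow> (real \<times> real) measure \<Rightarrow> bool"
where
  "admissible a \<alpha> b \<beta> m \<mu> \<longleftrightarrow>
     0 \<le> a \<and>
     transpose \<alpha> = \<alpha> \<and> (\<forall>v. 0 \<le> v \<bullet> (\<alpha> *v v)) \<and>
     b \<in> D_all \<and>
     \<beta> $ 1 $ 2 = 0 \<and>
     sigma_finite_on_D m \<and>
     (\<integral>\<^sup>+\<xi>. ennreal (l1 (fst \<xi>) + l12 (snd \<xi>)) \<partial>m) < \<infinity> \<and>
     sigma_finite_on_D \<mu> \<and>
     (\<integral>\<^sup>+\<xi>. ennreal (l12 (fst \<xi>) + l12 (snd \<xi>)) \<partial>\<mu>) < \<infinity>"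


section \<open>Convergence in probability\<close>

text \<open>
  The sequence \<open>X n\<close> of \<open>[0,\<infinity>]\<close>-valued functions tends to 0 in probability.  On measurable sets
  the outer measure is the measure itself; using it avoids that a non-measurable event counts as
  an event of probability 0.
\<close>

definition tends_to_0_in_prob :: "'a measure \<Rightarrow> (nat \<Rightarrow> 'a \<Rightarrow> ennreal) \<Rightarrow> bool" where
  "tends_to_0_in_prob M X \<longleftrightarrow>
     (\<forall>\<epsilon>>0. (\<lambda>n. outer_measure_of M {\<omega> \<in> space M. \<epsilon> < X n \<omega>}) \<longlonglongrightarrow> 0)"


section \<open>Paths and the Skorokhod topology\<close>

definition cadlag :: "(real \<Rightarrow> real) \<Rightarrow> bool" where
  "cadlag f \<longleftrightarrow>
     (\<forall>t\<ge>0. (f \<longlongrightarrow> f t) (at_right t)) \<and> (\<forall>t>0. \<exists>l. (f \<longlongrightarrow> l) (at_left t))"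

definition left_lim :: "(real \<Rightarrow> real) \<Rightarrow> real \<Rightarrow> real" where
  "left_lim f t = Lim (at_left t) f"

text \<open>
  The metric of Ethier and Kurtz (Markov Processes, Section 3.5) for the Skorokhod topology on the
  cadlag functions on \<open>[0,\<infinity>)\<close>.  Time changes for which \<open>time_change_size\<close> is infinite do not
  contribute to the infimum.
\<close>

definition time_changes :: "(real \<Rightarrow> real) set" where
  "time_changes = {\<tau>. strict_mono_on {0..} \<tau> \<and> \<tau> ` {0..} = {0..}}"

definition time_change_size :: "(real \<Rightarrow> real) \<Rightarrow> ennreal" where
  "time_change_size \<tau> =
     (SUP (s, t) \<in> {(s, t). 0 \<le> t \<and> t < s}. ennreal \<bar>ln ((\<tau> s - \<tau> t) / (s - t))\<bar>)"

definition skorokhod_dist :: "(real \<Rightarrow> real) \<Rightarrow> (real \<Rightarrow> real) \<Rightarrow> ennreal" where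
  "skorokhod_dist f g =
     (INF \<tau> \<in> time_changes.
        max (time_change_size \<tau>)
          (\<integral>\<^sup>+u\<in>{0..}. ennreal (exp (- u)) *
             (SUP t\<in>{0..}. ennreal (min 1 \<bar>f (min t u) - g (min (\<tau> t) u)\<bar>)) \<partial>lborel))"

definition converges_in_prob_skorokhod ::
  "'a measure \<Rightarrow> (nat \<Rightarrow> real \<Rightarrow> 'a \<Rightarrow> real) \<Rightarrow> (real \<Rightarrow> 'a \<Rightarrow> real) \<Rightarrow> bool"
where
  "converges_in_prob_skorokhod M Z Y \<longleftrightarrow>
     tends_to_0_in_prob M (\<lambda>k \<omega>. skorokhod_dist (\<lambda>t. Z k t \<omega>) (\<lambda>t. Y t \<omega>))"


section \<open>Brownian motion and Poisson random measures\<close>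

definition standard_brownian_motion :: "'a measure \<Rightarrow> (real \<Rightarrow> 'a \<Rightarrow> real) \<Rightarrow> bool" where
  "standard_brownian_motion M W \<longleftrightarrow>
     (\<forall>t\<ge>0. W t \<in> borel_measurable M) \<and>
     (AE \<omega> in M. W 0 \<omega> = 0 \<and> continuous_on {0..} (\<lambda>t. W t \<omega>)) \<and>
     (\<forall>s t. 0 \<le> s \<and> s < t \<longrightarrow>
        distributed M lborel (\<lambda>\<omega>. W t \<omega> - W s \<omega>) (normal_density 0 (sqrt (t - s)))) \<and>
     (\<forall>(n::nat) \<tau>. 0 \<le> \<tau> 0 \<and> mono \<tau> \<longrightarrow>
        prob_space.indep_vars M (\<lambda>_. borel) (\<lambda>i \<omega>. W (\<tau> (Suc i)) \<omega> - W (\<tau> i) \<omega>) {..<n})"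

definition path_history :: "'a measure \<Rightarrow> (real \<Rightarrow> 'a \<Rightarrow> real) \<Rightarrow> real \<Rightarrow> 'a set set" where
  "path_history M W t = {W s -` A \<inter> space M | s A. 0 \<le> s \<and> s \<le> t \<and> A \<in> sets borel}"

definition path_events :: "'a measure \<Rightarrow> (real \<Rightarrow> 'a \<Rightarrow> real) \<Rightarrow> 'a set set" where
  "path_events M W = sigma_sets (space M) (\<Union>t. path_history M W t)"

text \<open>The coordinates \<open>B 0\<close>, \<open>B 1\<close>, \<open>B 2\<close> are those of a three-dimensional Brownian motion.\<close>

definition brownian_motion3 :: "'a measure \<Rightarrow> (nat \<Rightarrow> real \<Rightarrow> 'a \<Rightarrow> real) \<Rightarrow> bool" where
  "brownian_motion3 M B \<longleftrightarrow>
     (\<forall>i<3. standard_brownian_motion M (B i)) \<and>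
     prob_space.indep_sets M (\<lambda>i. path_events M (B i)) {..<3}"

abbreviation lebesgue_pos :: "real measure" where
  "lebesgue_pos \<equiv> restrict_space lborel {0<..}"

text \<open>A random measure is a map \<open>N\<close> assigning to each \<open>\<omega>\<close> a measure; \<open>\<Lambda>\<close> is its intensity.\<close>

definition poisson_random_measure :: "'a measure \<Rightarrow> 'e measure \<Rightarrow> ('a \<Rightarrow> 'e measure) \<Rightarrow> bool" where
  "poisson_random_measure M \<Lambda> N \<longleftrightarrow>
     (\<forall>\<omega>\<in>space M. space (N \<omega>) = space \<Lambda> \<and> sets (N \<omega>) = sets \<Lambda>) \<and>
     (\<forall>A\<in>sets \<Lambda>. (\<lambda>\<omega>. emeasure (N \<omega>) A) \<in> borel_measurable M) \<and>
     (\<forall>A\<in>sets \<Lambda>. emeasure \<Lambda> A < \<infinity> \<longrightarrow>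
        (\<forall>k::nat. measure M {\<omega> \<in> space M. emeasure (N \<omega>) A = of_nat k} =
           measure \<Lambda> A ^ k / fact k * exp (- measure \<Lambda> A))) \<and>
     (\<forall>A\<in>sets \<Lambda>. emeasure \<Lambda> A = \<infinity> \<longrightarrow> (AE \<omega> in M. emeasure (N \<omega>) A = \<infinity>)) \<and>
     (\<forall>(n::nat) A. (\<forall>i<n. A i \<in> sets \<Lambda>) \<and> disjoint_family_on A {..<n} \<longrightarrow>
        prob_space.indep_vars M (\<lambda>_. borel) (\<lambda>i \<omega>. emeasure (N \<omega>) (A i)) {..<n})"

definition measure_history ::
  "'a measure \<Rightarrow> (real \<times> 'b) measure \<Rightarrow> ('a \<Rightarrow> (real \<times> 'b) measure) \<Rightarrow> real \<Rightarrow> 'a set set"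
where
  "measure_history M \<Lambda> N t =
     {(\<lambda>\<omega>. emeasure (N \<omega>) A) -` C \<inter> space M | A C.
        A \<in> sets \<Lambda> \<and> A \<subseteq> {0<..t} \<times> UNIV \<and> C \<in> sets borel}"

definition measure_events ::
  "'a measure \<Rightarrow> (real \<times> 'b) measure \<Rightarrow> ('a \<Rightarrow> (real \<times> 'b) measure) \<Rightarrow> 'a set set"
where
  "measure_events M \<Lambda> N = sigma_sets (space M) (\<Union>t. measure_history M \<Lambda> N t)"


section \<open>The filtered probability space\<close>

definition usual_hypotheses :: "'a measure \<Rightarrow> (real \<Rightarrow> 'a measure) \<Rightarrow> bool" where
  "usual_hypotheses M F \<longleftrightarrow>
     prob_space M \<and> complete_measure M \<and>
     filtration (space M) F \<and> (\<forall>t. sets (F t) \<subseteq> sets M) \<and>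
     null_sets M \<subseteq> sets (F 0) \<and>
     (\<forall>t\<ge>0. sets (F t) = (\<Inter>s\<in>{t<..}. sets (F s)))"

text \<open>
  Coordinates of \<open>N0\<close> are \<open>(s, \<xi>)\<close> and those of \<open>N1\<close> are \<open>(s, u, \<xi>)\<close>, with \<open>\<xi>\<close> in \<open>D_all\<close>.
\<close>

definition augmented_natural_filtration ::
  "'a measure \<Rightarrow> (nat \<Rightarrow> real \<Rightarrow> 'a \<Rightarrow> real) \<Rightarrow>
   (real \<times> real \<times> real) measure \<Rightarrow> ('a \<Rightarrow> (real \<times> real \<times> real) measure) \<Rightarrow>
   (real \<times> real \<times> real \<times> real) measure \<Rightarrow> ('a \<Rightarrow> (real \<times> real \<times> real \<times> real) measure) \<Rightarrow>
   real \<Rightarrow> 'a measure"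
where
  "augmented_natural_filtration M B \<Lambda>0 N0 \<Lambda>1 N1 t =
     sigma (space M)
       ((\<Union>i<3. path_history M (B i) t) \<union> measure_history M \<Lambda>0 N0 t \<union>
        measure_history M \<Lambda>1 N1 t \<union> null_sets M)"

definition stochastic_basis ::
  "'a measure \<Rightarrow> (real \<Rightarrow> 'a measure) \<Rightarrow> (nat \<Rightarrow> real \<Rightarrow> 'a \<Rightarrow> real) \<Rightarrow>
   ('a \<Rightarrow> (real \<times> real \<times> real) measure) \<Rightarrow> ('a \<Rightarrow> (real \<times> real \<times> real \<times> real) measure) \<Rightarrow>
   (real \<times> real) measure \<Rightarrow> (real \<times> real) measure \<Rightarrow> bool"
where
  "stochastic_basis M F B N0 N1 m \<mu> \<longleftrightarrow>
     (let \<Lambda>0 = lebesgue_pos \<Otimes>\<^sub>M m; \<Lambda>1 = lebesgue_pos \<Otimes>\<^sub>M (lebesgue_pos \<Otimes>\<^sub>M \<mu>) in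
      usual_hypotheses M F \<and>
      brownian_motion3 M B \<and>
      poisson_random_measure M \<Lambda>0 N0 \<and>
      poisson_random_measure M \<Lambda>1 N1 \<and>
      prob_space.indep_sets M
        (\<lambda>j::nat. if j = 0 then sigma_sets (space M) (\<Union>i<3. path_events M (B i))
                  else if j = 1 then measure_events M \<Lambda>0 N0
                  else measure_events M \<Lambda>1 N1) {0, 1, 2} \<and>
      (\<forall>t. F t = augmented_natural_filtration M B \<Lambda>0 N0 \<Lambda>1 N1 t))"

definition progressive :: "(real \<Rightarrow> 'a measure) \<Rightarrow> (real \<Rightarrow> 'a \<Rightarrow> real) \<Rightarrow> bool" where
  "progressive F X \<longleftrightarrow>
     (\<forall>t\<ge>0. (\<lambda>(s, \<omega>). X s \<omega>) \<in> borel_measurable (restrict_space borel {0..t} \<Otimes>\<^sub>M F t))"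

definition cadlag_progressive :: "'a measure \<Rightarrow> (real \<Rightarrow> 'a measure) \<Rightarrow> (real \<Rightarrow> 'a \<Rightarrow> real) \<Rightarrow> bool" where
  "cadlag_progressive M F X \<longleftrightarrow> progressive F X \<and> (\<forall>\<omega>\<in>space M. cadlag (\<lambda>t. X t \<omega>))"

definition nonneg_process :: "'a measure \<Rightarrow> (real \<Rightarrow> 'a \<Rightarrow> real) \<Rightarrow> bool" where
  "nonneg_process M X \<longleftrightarrow> (\<forall>t\<ge>0. \<forall>\<omega>\<in>space M. 0 \<le> X t \<omega>)"


section \<open>Ito integrals\<close>

text \<open>
  A simple integrand is \<open>\<Sum>i<n. \<eta> i \<cdot> 1_{(\<tau> i, \<tau> (i+1)]}\<close> with \<open>\<eta> i\<close> bounded and measurable with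
  respect to the \<open>\<sigma>\<close>-algebra at time \<open>\<tau> i\<close>.
\<close>

definition simple_integrand ::
  "'a measure \<Rightarrow> (real \<Rightarrow> 'a measure) \<Rightarrow> nat \<Rightarrow> (nat \<Rightarrow> real) \<Rightarrow> (nat \<Rightarrow> 'a \<Rightarrow> real) \<Rightarrow> bool"
where
  "simple_integrand M F n \<tau> \<eta> \<longleftrightarrow>
     0 \<le> \<tau> 0 \<and>
     (\<forall>i<n. \<tau> i \<le> \<tau> (Suc i) \<and> \<eta> i \<in> borel_measurable (F (\<tau> i)) \<and> bounded (\<eta> i ` space M))"

definition step_process ::
  "nat \<Rightarrow> (nat \<Rightarrow> real) \<Rightarrow> (nat \<Rightarrow> 'a \<Rightarrow> real) \<Rightarrow> real \<Rightarrow> 'a \<Rightarrow> real"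
where
  "step_process n \<tau> \<eta> s \<omega> = (\<Sum>i<n. \<eta> i \<omega> * indicator {\<tau> i<..\<tau> (Suc i)} s)"

definition step_integral ::
  "(real \<Rightarrow> 'a \<Rightarrow> real) \<Rightarrow> nat \<Rightarrow> (nat \<Rightarrow> real) \<Rightarrow> (nat \<Rightarrow> 'a \<Rightarrow> real) \<Rightarrow> real \<Rightarrow> 'a \<Rightarrow> real"
where
  "step_integral W n \<tau> \<eta> t \<omega> =
     (\<Sum>i<n. \<eta> i \<omega> * (W (min t (\<tau> (Suc i))) \<omega> - W (min t (\<tau> i)) \<omega>))"

text \<open>
  \<open>J\<close> is (a version of) \<open>\<integral>\<^sub>0\<^sup>t H(s) dW(s)\<close>: approximation of \<open>H\<close> by simple integrands in
  \<open>L\<^sup>2([0,t], ds)\<close> in probability, which is possible exactly when \<open>\<integral>\<^sub>0\<^sup>t H(s)\<^sup>2 ds < \<infinity>\<close> almost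
  surely.  \<open>J\<close> is unique up to null events.
\<close>

definition has_ito_integral ::
  "'a measure \<Rightarrow> (real \<Rightarrow> 'a measure) \<Rightarrow> (real \<Rightarrow> 'a \<Rightarrow> real) \<Rightarrow> (real \<Rightarrow> 'a \<Rightarrow> real) \<Rightarrow> real \<Rightarrow>
   ('a \<Rightarrow> real) \<Rightarrow> bool"
where
  "has_ito_integral M F W H t J \<longleftrightarrow>
     progressive F H \<and> J \<in> borel_measurable M \<and>
     (\<exists>n \<tau> \<eta>.
        (\<forall>k. simple_integrand M F (n k) (\<tau> k) (\<eta> k)) \<and>
        tends_to_0_in_prob M
          (\<lambda>k \<omega>. \<integral>\<^sup>+s\<in>{0..t}. ennreal ((step_process (n k) (\<tau> k) (\<eta> k) s \<omega> - H s \<omega>)\<^sup>2) \<partial>lborel) \<and>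
        tends_to_0_in_prob M
          (\<lambda>k \<omega>. ennreal \<bar>step_integral W (n k) (\<tau> k) (\<eta> k) t \<omega> - J \<omega>\<bar>))"

definition ito_integrable ::
  "'a measure \<Rightarrow> (real \<Rightarrow> 'a measure) \<Rightarrow> (real \<Rightarrow> 'a \<Rightarrow> real) \<Rightarrow> (real \<Rightarrow> 'a \<Rightarrow> real) \<Rightarrow> real \<Rightarrow> bool"
where
  "ito_integrable M F W H t \<longleftrightarrow> (\<exists>J. has_ito_integral M F W H t J)"

definition ito_integral ::
  "'a measure \<Rightarrow> (real \<Rightarrow> 'a measure) \<Rightarrow> (real \<Rightarrow> 'a \<Rightarrow> real) \<Rightarrow> (real \<Rightarrow> 'a \<Rightarrow> real) \<Rightarrow> real \<Rightarrow>
   'a \<Rightarrow> real"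
where
  "ito_integral M F W H t = (SOME J. has_ito_integral M F W H t J)"


section \<open>Integrals with respect to Poisson random measures\<close>

text \<open>
  Integrands are \<open>K s v \<omega>\<close> with time \<open>s > 0\<close> and mark \<open>v\<close>; \<open>\<nu>\<close> is the intensity of the marks, so
  that the random measure \<open>N\<close> has intensity \<open>ds \<nu>(dv)\<close>.
\<close>

definition predictable_sigma :: "'a measure \<Rightarrow> (real \<Rightarrow> 'a measure) \<Rightarrow> (real \<times> 'a) measure" where
  "predictable_sigma M F =
     sigma ({0<..} \<times> space M) {{s<..t} \<times> A | s t A. 0 \<le> s \<and> s \<le> t \<and> A \<in> sets (F s)}"

definition predictable ::
  "'a measure \<Rightarrow> (real \<Rightarrow> 'a measure) \<Rightarrow> 'b measure \<Rightarrow> (real \<Rightarrow> 'b \<Rightarrow> 'a \<Rightarrow> real) \<Rightarrow> bool"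
where
  "predictable M F \<nu> K \<longleftrightarrow>
     (\<lambda>((s, \<omega>), v). K s v \<omega>) \<in> borel_measurable (predictable_sigma M F \<Otimes>\<^sub>M \<nu>)"

definition jump_integrable ::
  "'a measure \<Rightarrow> ('a \<Rightarrow> (real \<times> 'b) measure) \<Rightarrow> (real \<Rightarrow> 'b \<Rightarrow> 'a \<Rightarrow> real) \<Rightarrow> real \<Rightarrow> bool"
where
  "jump_integrable M N K t \<longleftrightarrow>
     (AE \<omega> in M. set_integrable (N \<omega>) ({0<..t} \<times> UNIV) (\<lambda>(s, v). K s v \<omega>))"

definition jump_integral ::
  "('a \<Rightarrow> (real \<times> 'b) measure) \<Rightarrow> (real \<Rightarrow> 'b \<Rightarrow> 'a \<Rightarrow> real) \<Rightarrow> real \<Rightarrow> 'a \<Rightarrow> real"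
where
  "jump_integral N K t \<omega> = (LINT (s, v):{0<..t} \<times> UNIV|N \<omega>. K s v \<omega>)"

text \<open>The pathwise compensated integral of \<open>K\<close> restricted to \<open>{\<bar>K\<bar> > \<epsilon>}\<close>.\<close>

definition truncated_compensated_integral ::
  "('a \<Rightarrow> (real \<times> 'b) measure) \<Rightarrow> 'b measure \<Rightarrow> (real \<Rightarrow> 'b \<Rightarrow> 'a \<Rightarrow> real) \<Rightarrow> real \<Rightarrow> real \<Rightarrow>
   'a \<Rightarrow> real"
where
  "truncated_compensated_integral N \<nu> K \<epsilon> t \<omega> =
     (let K\<epsilon> = (\<lambda>s v \<omega>. if \<epsilon> < \<bar>K s v \<omega>\<bar> then K s v \<omega> else 0)
      in jump_integral N K\<epsilon> t \<omega> - jump_integral (\<lambda>_. lebesgue_pos \<Otimes>\<^sub>M \<nu>) K\<epsilon> t \<omega>)"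

text \<open>
  \<open>J\<close> is (a version of) the integral over \<open>(0,t]\<close> of the predictable \<open>K\<close> with respect to the
  compensated measure \<open>N(ds, dv) - ds \<nu>(dv)\<close>.  The integrability condition is the usual one for
  integrals of this kind: the part \<open>\<bar>K\<bar> \<le> 1\<close> is locally square integrable and the part \<open>\<bar>K\<bar> > 1\<close>
  locally integrable.  Under it the truncated integrals are defined almost surely and converge in
  probability.
\<close>

definition has_compensated_integral ::
  "'a measure \<Rightarrow> (real \<Rightarrow> 'a measure) \<Rightarrow> ('a \<Rightarrow> (real \<times> 'b) measure) \<Rightarrow> 'b measure \<Rightarrow>
   (real \<Rightarrow> 'b \<Rightarrow> 'a \<Rightarrow> real) \<Rightarrow> real \<Rightarrow> ('a \<Rightarrow> real) \<Rightarrow> bool"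
where
  "has_compensated_integral M F N \<nu> K t J \<longleftrightarrow>
     predictable M F \<nu> K \<and> J \<in> borel_measurable M \<and>
     (AE \<omega> in M.
        (\<integral>\<^sup>+p\<in>{0<..t} \<times> UNIV. ennreal (l12 (K (fst p) (snd p) \<omega>)) \<partial>(lebesgue_pos \<Otimes>\<^sub>M \<nu>)) < \<infinity>) \<and>
     tends_to_0_in_prob M
       (\<lambda>n \<omega>. ennreal \<bar>truncated_compensated_integral N \<nu> K (1 / real (Suc n)) t \<omega> - J \<omega>\<bar>)"

definition compensated_integrable ::
  "'a measure \<Rightarrow> (real \<Rightarrow> 'a measure) \<Rightarrow> ('a \<Rightarrow> (real \<times> 'b) measure) \<Rightarrow> 'b measure \<Rightarrow>
   (real \<Rightarrow> 'b \<Rightarrow> 'a \<Rightarrow> real) \<Rightarrow> real \<Rightarrow> bool"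
where
  "compensated_integrable M F N \<nu> K t \<longleftrightarrow> (\<exists>J. has_compensated_integral M F N \<nu> K t J)"

definition compensated_integral ::
  "'a measure \<Rightarrow> (real \<Rightarrow> 'a measure) \<Rightarrow> ('a \<Rightarrow> (real \<times> 'b) measure) \<Rightarrow> 'b measure \<Rightarrow>
   (real \<Rightarrow> 'b \<Rightarrow> 'a \<Rightarrow> real) \<Rightarrow> real \<Rightarrow> 'a \<Rightarrow> real"
where
  "compensated_integral M F N \<nu> K t = (SOME J. has_compensated_integral M F N \<nu> K t J)"

text \<open>
  The integrand whose integral against \<open>N1(ds, du, d\<xi>)\<close> is
  \<open>\<integral>\<^sub>0\<^sup>t \<integral>\<^sub>0\<^bsup>r(s-)\<^esup> \<integral>\<^sub>E g(\<xi>) N1(ds, du, d\<xi>)\<close>.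
\<close>

definition rate_integrand ::
  "(real \<Rightarrow> 'a \<Rightarrow> real) \<Rightarrow> (real \<times> real) set \<Rightarrow> (real \<times> real \<Rightarrow> real) \<Rightarrow>
   real \<Rightarrow> real \<times> real \<times> real \<Rightarrow> 'a \<Rightarrow> real"
where
  "rate_integrand r E g s v \<omega> =
     (case v of (u, \<xi>) \<Rightarrow> indicator {0<..left_lim (\<lambda>q. r q \<omega>) s} u * indicator E \<xi> * g \<xi>)"

definition mark_integrand ::
  "(real \<times> real) set \<Rightarrow> (real \<times> real \<Rightarrow> real) \<Rightarrow> real \<Rightarrow> real \<times> real \<Rightarrow> 'a \<Rightarrow> real"
where
  "mark_integrand E g s \<xi> \<omega> = indicator E \<xi> * g \<xi>"


section \<open>The stochastic equations\<close>

definition solves_x ::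
  "'a measure \<Rightarrow> (real \<Rightarrow> 'a measure) \<Rightarrow> (nat \<Rightarrow> real \<Rightarrow> 'a \<Rightarrow> real) \<Rightarrow>
   ('a \<Rightarrow> (real \<times> real \<times> real) measure) \<Rightarrow> ('a \<Rightarrow> (real \<times> real \<times> real \<times> real) measure) \<Rightarrow>
   (real \<times> real) measure \<Rightarrow> real \<Rightarrow> real \<Rightarrow> real \<Rightarrow> real \<Rightarrow> (real \<Rightarrow> 'a \<Rightarrow> real) \<Rightarrow> bool"
where
  "solves_x M F B N0 N1 \<mu> b1 \<beta>11 \<sigma>11 \<sigma>12 x \<longleftrightarrow>
     (let H1 = (\<lambda>s \<omega>. \<sigma>11 * sqrt (2 * x s \<omega>));
          H2 = (\<lambda>s \<omega>. \<sigma>12 * sqrt (2 * x s \<omega>));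
          K0 = mark_integrand D_all fst;
          K1 = rate_integrand x D_all fst;
          \<nu>1 = lebesgue_pos \<Otimes>\<^sub>M \<mu>
      in cadlag_progressive M F x \<and>
         (\<forall>t\<ge>0.
            ito_integrable M F (B 1) H1 t \<and> ito_integrable M F (B 2) H2 t \<and>
            jump_integrable M N0 K0 t \<and> compensated_integrable M F N1 \<nu>1 K1 t \<and>
            (AE \<omega> in M.
               x t \<omega> = x 0 \<omega> + (LINT s:{0..t}|lborel. b1 + \<beta>11 * x s \<omega>)
                 + ito_integral M F (B 1) H1 t \<omega> + ito_integral M F (B 2) H2 t \<omega>
                 + jump_integral N0 K0 t \<omega>
                 + compensated_integral M F N1 \<nu>1 K1 t \<omega>)))"

text \<open>
  The equations of \<open>y\<^sub>k\<^sup>+\<close> (with \<open>E = D_plus\<close>, \<open>sg = 1\<close>) and of \<open>y\<^sub>k\<^sup>-\<close> (with \<open>E = D_minus\<close>,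
  \<open>sg = -1\<close>); \<open>th\<close> is \<open>\<theta>\<^sub>k\<close>, and \<open>b2\<close>, \<open>\<beta>21\<close>, \<open>\<sigma>0\<close>, \<open>\<sigma>21\<close>, \<open>\<sigma>22\<close> stand for the corresponding
  halves of the decompositions.
\<close>

definition solves_y ::
  "'a measure \<Rightarrow> (real \<Rightarrow> 'a measure) \<Rightarrow> (nat \<Rightarrow> real \<Rightarrow> 'a \<Rightarrow> real) \<Rightarrow>
   ('a \<Rightarrow> (real \<times> real \<times> real) measure) \<Rightarrow> ('a \<Rightarrow> (real \<times> real \<times> real \<times> real) measure) \<Rightarrow>
   (real \<times> real) measure \<Rightarrow> (real \<times> real) measure \<Rightarrow>
   real \<Rightarrow> real \<Rightarrow> real \<Rightarrow> real \<Rightarrow> real \<Rightarrow> real \<Rightarrow> real \<Rightarrow> (real \<times> real) set \<Rightarrow> real \<Rightarrow>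
   (real \<Rightarrow> 'a \<Rightarrow> real) \<Rightarrow> (real \<Rightarrow> 'a \<Rightarrow> real) \<Rightarrow> bool"
where
  "solves_y M F B N0 N1 m \<mu> th b2 \<beta>21 \<beta>22 \<sigma>0 \<sigma>21 \<sigma>22 E sg x y \<longleftrightarrow>
     (let yt = (\<lambda>s \<omega>. y s \<omega> / th);
          H0 = (\<lambda>s \<omega>. \<sigma>0 * sqrt (2 * yt s \<omega>));
          H1 = (\<lambda>s \<omega>. \<sigma>21 * sqrt (2 * x s \<omega> * yt s \<omega>));
          H2 = (\<lambda>s \<omega>. \<sigma>22 * sqrt (2 * x s \<omega> * yt s \<omega>));
          K0 = mark_integrand E snd;
          K1 = rate_integrand (\<lambda>s \<omega>. x s \<omega> * yt s \<omega>) E snd;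
          \<nu>1 = lebesgue_pos \<Otimes>\<^sub>M \<mu>
      in cadlag_progressive M F y \<and>
         (\<forall>t\<ge>0.
            ito_integrable M F (B 0) H0 t \<and> ito_integrable M F (B 1) H1 t \<and>
            ito_integrable M F (B 2) H2 t \<and>
            compensated_integrable M F N0 m K0 t \<and> compensated_integrable M F N1 \<nu>1 K1 t \<and>
            (AE \<omega> in M.
               y t \<omega> = y 0 \<omega>
                 + (LINT s:{0..t}|lborel.
                      - th * \<beta>22 + \<beta>21 * x s \<omega> * yt s \<omega> + b2 * yt s \<omega> + \<beta>22 * y s \<omega>)
                 + ito_integral M F (B 0) H0 t \<omega> + ito_integral M F (B 1) H1 t \<omega>
                 + ito_integral M F (B 2) H2 t \<omega>
                 + sg * compensated_integral M F N0 m K0 t \<omega>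
                 + sg * compensated_integral M F N1 \<nu>1 K1 t \<omega>)))"

definition solves_z ::
  "'a measure \<Rightarrow> (real \<Rightarrow> 'a measure) \<Rightarrow> (nat \<Rightarrow> real \<Rightarrow> 'a \<Rightarrow> real) \<Rightarrow>
   ('a \<Rightarrow> (real \<times> real \<times> real) measure) \<Rightarrow> ('a \<Rightarrow> (real \<times> real \<times> real \<times> real) measure) \<Rightarrow>
   (real \<times> real) measure \<Rightarrow> (real \<times> real) measure \<Rightarrow>
   real \<Rightarrow> real \<Rightarrow> real \<Rightarrow> real \<Rightarrow> real \<Rightarrow> real \<Rightarrow>
   (real \<Rightarrow> 'a \<Rightarrow> real) \<Rightarrow> ('a \<Rightarrow> real) \<Rightarrow> (real \<Rightarrow> 'a \<Rightarrow> real) \<Rightarrow> bool"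
where
  "solves_z M F B N0 N1 m \<mu> b2 \<beta>21 \<beta>22 \<sigma>0 \<sigma>21 \<sigma>22 x z0 z \<longleftrightarrow>
     (let H0 = (\<lambda>s \<omega>. sqrt 2 * \<sigma>0);
          H1 = (\<lambda>s \<omega>. \<sigma>21 * sqrt (2 * x s \<omega>));
          H2 = (\<lambda>s \<omega>. \<sigma>22 * sqrt (2 * x s \<omega>));
          K0 = mark_integrand D_all snd;
          K1 = rate_integrand x D_all snd;
          \<nu>1 = lebesgue_pos \<Otimes>\<^sub>M \<mu>
      in cadlag_progressive M F z \<and>
         (\<forall>t\<ge>0.
            ito_integrable M F (B 0) H0 t \<and> ito_integrable M F (B 1) H1 t \<and>
            ito_integrable M F (B 2) H2 t \<and>
            compensated_integrable M F N0 m K0 t \<and> compensated_integrable M F N1 \<nu>1 K1 t \<and>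
            (AE \<omega> in M.
               z t \<omega> = z0 \<omega>
                 + (LINT s:{0..t}|lborel. b2 + \<beta>21 * x s \<omega> + \<beta>22 * z s \<omega>)
                 + ito_integral M F (B 0) H0 t \<omega> + ito_integral M F (B 1) H1 t \<omega>
                 + ito_integral M F (B 2) H2 t \<omega>
                 + compensated_integral M F N0 m K0 t \<omega>
                 + compensated_integral M F N1 \<nu>1 K1 t \<omega>)))"

end

theory Submission
  imports Defs
begin

text \<open>
  All estimates are in probability, so no moments of \<open>x\<close> or \<open>y\<^sub>k\<close> enter.  Fix \<open>T\<close> and
  work on the event \<open>x \<le> n\<close> on \<open>[0, T]\<close>, whose complement is improbable for large \<open>n\<close>.

  Divided by \<open>\<theta>\<^sub>k\<close>, the five stochastic integrals in the equation of \<open>y\<^sub>k\<close> are small by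
  maximal inequalities as long as \<open>y\<^sub>k / \<theta>\<^sub>k \<le> 2\<close>; Gronwall's inequality and a bootstrap then give
  \<open>y\<^sub>k / \<theta>\<^sub>k \<rightarrow> 1\<close> uniformly on \<open>[0, T]\<close>.  In the equation of \<open>z\<^sub>k - z\<close> the large drifts
  \<open>- \<theta>\<^sub>k \<beta>\<^sub>2\<^sub>2\<close> cancel, and the diffusion coefficients and jump rates differ from those of the
  limit by multiples of \<open>y\<^sub>k / \<theta>\<^sub>k - 1\<close>; a second round of maximal inequalities and Gronwall's
  inequality shows \<open>z\<^sub>k \<rightarrow> z\<close> uniformly on \<open>[0, T]\<close>, which bounds the Skorokhod distance up to
  \<open>exp (- T)\<close>.

  The maximal inequalities need no integrability: an integrand is cut off predictably once its
  accumulated size exceeds \<open>\<delta>\<close>, and the statement only concerns paths that were not cut.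
\<close>

section \<open>Independence of the past\<close>

text \<open>The integrals in the equations are chosen separately for each time and are unique only
  up to null events, so their paths have no regularity and a supremum over uncountably many times is
  out of reach. Maximal inequalities are therefore stated over countable sets of times and with
  outer measure. What has regular paths is the residual, solution minus initial value minus drift:
  it is right-continuous, it equals the sum of the integrals at countably many times simultaneously,
  and its bound passes from these times to all others. The marks are only
  \<open>l12\<close>-integrable: large jumps may lack second moments and small ones first moments.
  Hence small jumps are estimated in second moment, large ones in first moment. Reading the
  integrals at countably many times has a price in the bootstrap: the ratio is under control
  strictly before t, while the integrals are read at times just after t. A short window, chosen path
  by path, absorbs this.\<close>

lemma (in prob_space) indep_past_component:
  assumes I: "finite I" "j0 \<in> I"
    and G: "\<And>j. j \<in> I \<Longrightarrow> sigma_algebra (space M) (G j)" "\<And>j. j \<in> I \<Longrightarrow> G j \<subseteq> events"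
    and prodf: "\<And>A. (\<And>j. j \<in> I \<Longrightarrow> A j \<in> G j) \<Longrightarrow> prob (\<Inter>j\<in>I. A j) = (\<Prod>j\<in>I. prob (A j))"
    and S: "\<And>j. j \<in> I \<Longrightarrow> S j \<subseteq> G j" "\<And>j. j \<in> I \<Longrightarrow> sigma_algebra (space M) (S j)"
    and E: "E \<in> G j0" "\<And>A. A \<in> S j0 \<Longrightarrow> prob (E \<inter> A) = prob E * prob A"
    and A: "A \<in> sigma_sets (space M) ((\<Union>j\<in>I. S j) \<union> null_sets M)"
  shows "prob (E \<inter> A) = prob E * prob A"
proof -
  \<comment> \<open>One event per source, intersected, plus the null events: this family is stable
    under intersection and generates the augmented past. Keeping the null events as separate members
    avoids treating them as another source.\<close>
  define P where "P = {(\<Inter>j\<in>I. A j) | A. \<forall>j\<in>I. A j \<in> S j} \<union> null_sets M"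
  have top: "space M \<in> S j" if "j \<in> I" for j
    using S(2)[OF that] by (simp add: sigma_algebra_iff algebra.top)
  have SE: "S j \<subseteq> events" if "j \<in> I" for j using S(1) G(2) that by blast
  have PE: "P \<subseteq> events"
    unfolding P_def using I SE by (auto intro!: sets.finite_INT)
  have EE: "E \<in> events" using E(1) G(2) I(2) by blast
  have Int: "Int_stable P"
    unfolding Int_stable_def
  proof (intro ballI)
    fix a b assume ab: "a \<in> P" "b \<in> P"
    show "a \<inter> b \<in> P"
    proof (cases "a \<in> null_sets M \<or> b \<in> null_sets M")
      case True
      then have "a \<inter> b \<in> null_sets M" using ab PE
        by (metis null_set_Int1 null_set_Int2 subsetD)
      then show ?thesis by (simp add: P_def)
    next
      case False
      then obtain A1 A2 where A12: "a = (\<Inter>j\<in>I. A1 j)" "\<forall>j\<in>I. A1 j \<in> S j"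
        "b = (\<Inter>j\<in>I. A2 j)" "\<forall>j\<in>I. A2 j \<in> S j"
        using ab unfolding P_def by blast
      have "A1 j \<inter> A2 j \<in> S j" if "j \<in> I" for j
      proof -
        interpret sigma_algebra "space M" "S j" using S(2)[OF that] .
        show ?thesis using A12 that by blast
      qed
      moreover have "a \<inter> b = (\<Inter>j\<in>I. A1 j \<inter> A2 j)" using A12 by auto
      ultimately show ?thesis unfolding P_def by blast
    qed
  qed
  have ind: "prob (E \<inter> a) = prob E * prob a" if "a \<in> P" for a
  proof (cases "a \<in> null_sets M")
    case True
    then have "E \<inter> a \<in> null_sets M" by (rule null_set_Int1[OF _ EE])
    with True show ?thesis by (simp add: measure_eq_0_null_sets)
  next
    case False
    with that obtain A1 where A1: "a = (\<Inter>j\<in>I. A1 j)" "\<forall>j\<in>I. A1 j \<in> S j"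
      unfolding P_def by blast
    \<comment> \<open>\<open>E\<close> enters only the component \<open>j0\<close>, where the
      intersection still belongs to \<open>G j0\<close>; so the product formula for the sources
      applies with \<open>E\<close> as well as without it.\<close>
    define A2 where "A2 = A1(j0 := E \<inter> A1 j0)"
    have "E \<inter> A1 j0 \<in> G j0"
    proof -
      interpret sigma_algebra "space M" "G j0" using G(1)[OF I(2)] .
      show ?thesis using A1 E(1) I(2) S(1)[OF I(2)] by blast
    qed
    then have A2: "A2 j \<in> G j" if "j \<in> I" for j
      using A1 S(1)[OF that] that by (auto simp: A2_def)
    have A1G: "A1 j \<in> G j" if "j \<in> I" for j using A1 S(1)[OF that] that by auto
    have "E \<inter> a = (\<Inter>j\<in>I. A2 j)" using I(2) A1(1) by (auto simp: A2_def)
    then have "prob (E \<inter> a) = (\<Prod>j\<in>I. prob (A2 j))" using prodf A2 by simp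
    also have "\<dots> = prob (A2 j0) * (\<Prod>j\<in>I-{j0}. prob (A2 j))" using I by (simp add: prod.remove)
    also have "(\<Prod>j\<in>I-{j0}. prob (A2 j)) = (\<Prod>j\<in>I-{j0}. prob (A1 j))"
      by (intro prod.cong) (auto simp: A2_def)
    also have "prob (A2 j0) = prob E * prob (A1 j0)" using E(2) A1 I(2) by (simp add: A2_def)
    finally have "prob (E \<inter> a) = prob E * (\<Prod>j\<in>I. prob (A1 j))" using I by (simp add: prod.remove mult.assoc)
    also have "(\<Prod>j\<in>I. prob (A1 j)) = prob a" using prodf[of A1] A1G A1(1) by simp
    finally show ?thesis .
  qed
  have "indep_set {E} P"
    using PE EE ind by (simp add: indep_sets2_eq)
  then have "indep_set (sigma_sets (space M) {E}) (sigma_sets (space M) P)"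
    by (rule indep_set_sigma_sets) (use Int in \<open>auto simp: Int_stable_def\<close>)
  then have *: "prob (E \<inter> b) = prob E * prob b" if "b \<in> sigma_sets (space M) P" for b
    using that by (auto simp: indep_sets2_eq)
  have "(\<Union>j\<in>I. S j) \<union> null_sets M \<subseteq> P"
  proof -
    have "a \<in> P" if "j \<in> I" "a \<in> S j" for a j
    proof -
      let ?A = "\<lambda>i. if i = j then a else space M"
      have "(\<Inter>i\<in>I. ?A i) = a"
      proof -
        have "a \<subseteq> space M" using that SE[OF that(1)] sets.sets_into_space by blast
        then show ?thesis using that(1) by auto
      qed
      moreover have "\<forall>i\<in>I. ?A i \<in> S i" using that top by auto
      ultimately have "a = (\<Inter>i\<in>I. ?A i) \<and> (\<forall>i\<in>I. ?A i \<in> S i)" by simp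
      then show ?thesis unfolding P_def by (intro UnI1 CollectI exI)
    qed
    then show ?thesis by (auto simp: P_def)
  qed
  then have "sigma_sets (space M) ((\<Union>j\<in>I. S j) \<union> null_sets M) \<subseteq> sigma_sets (space M) P"
    by (intro sigma_sets_mono) auto
  with A * show ?thesis by blast
qed

section \<open>A single noise and its own past\<close>

lemma finite_grid:
  fixes S :: "real set"
  assumes "finite S" "S \<noteq> {}"
  obtains g n where "mono g" "g ` {..n} = S" "strict_mono_on {..n::nat} g" "\<And>i. n \<le> i \<Longrightarrow> g i = Max S"
    "g 0 = Min S"
proof -
  define l where "l = sorted_list_of_set S"
  have l: "sorted l" "distinct l" "set l = S" "l \<noteq> []" using assms by (auto simp: l_def)
  define n where "n = length l - 1"
  \<comment> \<open>Freezing the enumeration at the maximum makes it monotone on all of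
    \<open>nat\<close>, the form in which grids of times are used for increments.\<close>
  define g where "g i = l ! (min i n)" for i
  have len: "length l = Suc n" using l(4) by (cases l) (auto simp: n_def)
  have mono: "mono g" unfolding g_def mono_def using l(1) len
    by (auto intro!: sorted_nth_mono)
  have img: "g ` {..n} = S"
  proof -
    have "g ` {..n} = (!) l ` {..n}" by (auto simp: g_def image_def)
    also have "\<dots> = set l" using len by (auto simp: set_conv_nth image_def less_Suc_eq_le)
    finally show ?thesis using l by simp
  qed
  have st: "strict_mono_on {..n} g"
  proof (rule strict_mono_onI)
    fix r s assume "r \<in> {..n}" "s \<in> {..n}" "r < s"
    moreover then have "g r \<le> g s" using mono by (simp add: monoD)
    moreover have "g r \<noteq> g s" using calculation l(2) len by (simp add: g_def nth_eq_iff_index_eq)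
    ultimately show "g r < g s" by simp
  qed
  have mx: "g i = Max S" if "n \<le> i" for i
  proof (rule Max_eqI[symmetric])
    have "g i = g n" using that by (simp add: g_def)
    then show "g i \<in> S" using img by auto
    fix y assume "y \<in> S"
    then obtain j where "j \<le> n" "y = g j" using img by auto
    then show "y \<le> g i" using that mono by (simp add: monoD)
  qed (use assms in auto)
  have mn: "g 0 = Min S"
  proof (rule Min_eqI[symmetric])
    show "g 0 \<in> S" using img by auto
    fix y assume "y \<in> S"
    then obtain j where "j \<le> n" "y = g j" using img by auto
    then show "g 0 \<le> y" using mono by (simp add: monoD)
  qed (use assms in auto)
  show ?thesis using that[OF mono img st mx mn] .
qed

text \<open>Only increments over disjoint intervals are known to be independent. A cylinder event of
  the past concerns finitely many times, and at each of them the path is a sum of increments over a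
  common grid ending at \<open>s\<close>; these are independent of the next increment, from
  \<open>s\<close> to \<open>t\<close>. Cylinder events form a pi-system that generates the
  history.\<close>

lemma (in prob_space) brownian_increment_indep_history:
  assumes W: "standard_brownian_motion M W" and st: "0 \<le> s" "s < t" and C: "C \<in> sets borel"
    and A: "A \<in> sigma_sets (space M) (path_history M W s)"
  shows "prob ((\<lambda>w. W t w - W s w) -` C \<inter> space M \<inter> A) =
    prob ((\<lambda>w. W t w - W s w) -` C \<inter> space M) * prob A"
proof -
  let ?E = "(\<lambda>w. W t w - W s w) -` C \<inter> space M"
  have Wm[measurable]: "W r \<in> borel_measurable M" if "0 \<le> r" for r using W that by (auto simp: standard_brownian_motion_def)
  have W0: "AE w in M. W 0 w = 0" using W by (auto simp: standard_brownian_motion_def)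
  \<comment> \<open>With finite lists of constraints the intersection of two cylinder events is a
    concatenation.\<close>
  define ev where "ev xs = {w\<in>space M. \<forall>(r,B)\<in>set xs. W r w \<in> B}" for xs
  define P where "P = {ev xs | xs. \<forall>(r,B)\<in>set xs. 0 \<le> r \<and> r \<le> s \<and> B \<in> sets borel}"
  have Em: "?E \<in> events" using st C by (intro measurable_sets[of _ M borel] borel_measurable_diff Wm) auto
  have evm: "ev xs \<in> events" if "\<forall>(r,B)\<in>set xs. 0 \<le> r \<and> r \<le> s \<and> B \<in> sets borel" for xs
  proof -
    have "ev xs = (\<Inter>p\<in>set xs. W (fst p) -` snd p \<inter> space M) \<inter> space M" by (auto simp: ev_def)
    moreover have "(\<Inter>p\<in>set xs. W (fst p) -` snd p \<inter> space M) \<inter> space M \<in> events"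
    proof (cases "xs = []")
      case False then show ?thesis using that by (intro sets.Int[OF sets.finite_INT sets.top]) (fastforce intro!: measurable_sets[OF Wm])+
    qed auto
    ultimately show ?thesis by simp
  qed
  have PE: "P \<subseteq> events" using evm by (auto simp: P_def)
  have Int: "Int_stable P" unfolding Int_stable_def P_def
  proof (safe)
    fix xs ys :: "(real \<times> real set) list"
    assume a: "\<forall>(r, B)\<in>set xs. 0 \<le> r \<and> r \<le> s \<and> B \<in> sets borel"  "\<forall>(r, B)\<in>set ys. 0 \<le> r \<and> r \<le> s \<and> B \<in> sets borel"
    have "ev xs \<inter> ev ys = ev (xs @ ys)" by (auto simp: ev_def)
    with a show "\<exists>zs. ev xs \<inter> ev ys = ev zs \<and> (\<forall>(r, B)\<in>set zs. 0 \<le> r \<and> r \<le> s \<and> B \<in> sets borel)"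
      by (intro exI[of _ "xs @ ys"]) auto
  qed
  have ind: "prob (?E \<inter> ev xs) = prob ?E * prob (ev xs)"
    if xs: "\<forall>(r,B)\<in>set xs. 0 \<le> r \<and> r \<le> s \<and> B \<in> sets borel" for xs
  proof -
    define S where "S = insert 0 (insert s (fst ` set xs))"
    have S: "finite S" "S \<noteq> {}" by (auto simp: S_def)
    have MaxS: "Max S = s" using xs st by (intro Max_eqI) (auto simp: S_def)
    have MinS: "Min S = 0" using xs st by (intro Min_eqI) (auto simp: S_def)
    from finite_grid[OF S] obtain g n where g: "mono g" "g ` {..n} = S"
      "strict_mono_on {..n::nat} g" "\<And>i. n \<le> i \<Longrightarrow> g i = Max S" "g 0 = Min S" by blast
    have gs: "g i \<le> s" "0 \<le> g i" for i
    proof -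
      have "g i \<le> g (max i n)" "g 0 \<le> g i" by (simp_all add: g(1) monoD)
      then show "g i \<le> s" "0 \<le> g i" using g(4)[of "max i n"] MaxS g(5) MinS by auto
    qed
    \<comment> \<open>The grid of the past has indices 0 to \<open>n\<close> with
      \<open>g n = s\<close>; prolonged by \<open>t\<close>, its increment number \<open>n\<close>
      is the one whose independence is claimed.\<close>
    define \<tau> where "\<tau> i = (if i \<le> n then g i else t)" for i
    have mono\<tau>: "mono \<tau>"
    proof (rule monoI)
      fix i j :: nat assume "i \<le> j"
      then show "\<tau> i \<le> \<tau> j" using monoD[OF g(1), of i j] gs(1)[of i] st by (simp add: \<tau>_def)
    qed
    define d where "d i w = W (\<tau> (Suc i)) w - W (\<tau> i) w" for i w
    have "indep_vars (\<lambda>_. borel) d {..<Suc n}"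
    proof -
      have "0 \<le> \<tau> 0" using gs(2)[of 0] by (simp add: \<tau>_def)
      then show ?thesis using W mono\<tau> unfolding standard_brownian_motion_def d_def[abs_def] by blast
    qed
    then have iv: "indep_var (PiM {..<n} (\<lambda>_. borel)) (\<lambda>w. restrict (\<lambda>i. d i w) {..<n}) (PiM {n} (\<lambda>_. borel)) (\<lambda>w. restrict (\<lambda>i. d i w) {n})"
      by (rule indep_var_restrict) auto
    define idx where "idx r = (SOME i. i \<le> n \<and> g i = r)" for r
    have idx: "idx r \<le> n" "g (idx r) = r" if "r \<in> S" for r
    proof -
      have "\<exists>i. i \<le> n \<and> g i = r" using that unfolding g(2)[symmetric] by auto
      then have "idx r \<le> n \<and> g (idx r) = r" unfolding idx_def by (rule someI_ex)
      then show "idx r \<le> n" "g (idx r) = r" by auto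
    qed
    \<comment> \<open>The telescoping sum starts from \<open>W 0\<close>, which vanishes only almost
      surely; hence the events below agree only up to a null event.\<close>
    have Wr: "W r w = (\<Sum>i<idx r. d i w)" if r: "r \<in> S" and w: "W 0 w = 0" for r w
    proof -
      have "(\<Sum>i<k. d i w) = W (\<tau> k) w - W (\<tau> 0) w" for k by (induction k) (auto simp: d_def)
      then show ?thesis using idx[OF r] w MinS g(5) by (simp add: \<tau>_def)
    qed
    define XA where "XA = {f\<in>space (PiM {..<n} (\<lambda>_. borel :: real measure)). \<forall>(r,B)\<in>set xs. (\<Sum>i<idx r. f i) \<in> B}"
    have XA: "XA \<in> sets (PiM {..<n} (\<lambda>_. borel))"
    proof -
      have "XA = (\<Inter>p\<in>set xs. {f\<in>space (PiM {..<n} (\<lambda>_. borel :: real measure)). (\<Sum>i<idx (fst p). f i) \<in> snd p}) \<inter> space (PiM {..<n} (\<lambda>_. borel :: real measure))"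
        unfolding XA_def by (auto simp del: Pi_iff) (metis fst_conv snd_conv)
      moreover have "{f\<in>space (PiM {..<n} (\<lambda>_. borel :: real measure)). (\<Sum>i<idx (fst p). f i) \<in> snd p} \<in> sets (PiM {..<n} (\<lambda>_. borel))" if "p \<in> set xs" for p
      proof -
        have [measurable]: "snd p \<in> sets borel" using xs that by auto
        have "fst p \<in> S" using that by (auto simp: S_def)
        then have "idx (fst p) \<le> n" by (rule idx)
        then have [measurable]: "(\<lambda>f. \<Sum>i<idx (fst p). f i :: real) \<in> borel_measurable (PiM {..<n} (\<lambda>_. borel))"
          by (intro borel_measurable_sum measurable_component_singleton) auto
        show ?thesis by measurable
      qed
      ultimately show ?thesis by (cases "xs = []") (auto intro!: sets.finite_INT)
    qed
    define XB where "XB = {f\<in>space (PiM {n} (\<lambda>_. borel :: real measure)). f n \<in> C}"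
    have XB: "XB \<in> sets (PiM {n} (\<lambda>_. borel))" unfolding XB_def using C by measurable
    let ?A = "(\<lambda>w. restrict (\<lambda>i. d i w) {..<n}) -` XA \<inter> space M"
    let ?B = "(\<lambda>w. restrict (\<lambda>i. d i w) {n}) -` XB \<inter> space M"
    have B: "?B = ?E"
      by (auto simp: XB_def d_def \<tau>_def g(4) MaxS space_PiM)
    have AE: "AE w in M. w \<in> ?A \<longleftrightarrow> w \<in> ev xs"
      using W0
    proof eventually_elim
      case (elim w)
      have "(\<Sum>i<idx r. restrict (\<lambda>i. d i w) {..<n} i) = W r w" if "(r,B) \<in> set xs" for r B
      proof -
        have "r \<in> S" using that by (force simp: S_def)
        moreover have "(\<Sum>i<idx r. restrict (\<lambda>i. d i w) {..<n} i) = (\<Sum>i<idx r. d i w)"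
          by (rule sum.cong) (use idx(1)[OF \<open>r \<in> S\<close>] in auto)
        ultimately show ?thesis using Wr[of r w] elim by simp
      qed
      then show ?case by (auto simp: XA_def ev_def space_PiM split: prod.splits)
    qed
    have mA: "?A \<in> events" using measurable_sets[OF indep_var_rv1[OF iv] XA] .
    have "prob (?E \<inter> ev xs) = prob (?A \<inter> ?E)"
      by (rule finite_measure_eq_AE) (use AE evm[OF xs] Em mA in auto)
    also have "?A \<inter> ?E = (\<lambda>w. (restrict (\<lambda>i. d i w) {..<n}, restrict (\<lambda>i. d i w) {n})) -` (XA \<times> XB) \<inter> space M"
      using B by auto
    also have "prob \<dots> = prob ?A * prob ?B" by (rule indep_varD[OF iv XA XB])
    also have "prob ?A = prob (ev xs)"
      by (rule finite_measure_eq_AE) (use AE evm[OF xs] mA in auto)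
    finally show ?thesis unfolding B by (simp only: mult.commute)
  qed
  have "indep_set {?E} P"
    using PE Em ind by (auto simp: indep_sets2_eq P_def)
  then have "indep_set (sigma_sets (space M) {?E}) (sigma_sets (space M) P)"
    by (rule indep_set_sigma_sets) (use Int in \<open>auto simp: Int_stable_def\<close>)
  then have *: "prob (?E \<inter> b) = prob ?E * prob b" if "b \<in> sigma_sets (space M) P" for b
    using that by (auto simp: indep_sets2_eq)
  have "path_history M W s \<subseteq> P"
  proof (safe)
    fix a assume "a \<in> path_history M W s"
    then obtain r B where "a = W r -` B \<inter> space M" "0 \<le> r" "r \<le> s" "B \<in> sets borel" by (auto simp: path_history_def)
    then have "a = ev [(r,B)]" "\<forall>(r,B)\<in>set [(r,B)]. 0 \<le> r \<and> r \<le> s \<and> B \<in> sets borel" by (auto simp: ev_def)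
    then show "a \<in> P" unfolding P_def by blast
  qed
  then have "sigma_sets (space M) (path_history M W s) \<subseteq> sigma_sets (space M) P"
    by (intro sigma_sets_mono) auto
  with A * show ?thesis by blast
qed

text \<open>Counts of a Poisson random measure are independent over disjoint sets; counts on
  overlapping sets become sums of counts on the atoms of a common refinement.\<close>

lemma finite_disjoint_refinement:
  assumes "finite \<A>" "\<A> \<subseteq> sets M"
  shows "\<exists>\<D>. finite \<D> \<and> \<D> \<subseteq> sets M \<and> disjoint \<D> \<and> \<Union>\<D> = \<Union>\<A> \<and> (\<forall>A\<in>\<A>. \<exists>\<J>\<subseteq>\<D>. A = \<Union>\<J>)"
  using assms
proof (induction \<A> rule: finite_induct)
  case empty
  show ?case by (intro exI[of _ "{}"]) auto
next
  case (insert A \<A>)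
  then obtain \<D> where D: "finite \<D>" "\<D> \<subseteq> sets M" "disjoint \<D>" "\<Union>\<D> = \<Union>\<A>" "\<forall>A\<in>\<A>. \<exists>\<J>\<subseteq>\<D>. A = \<Union>\<J>"
    by auto
  define E where "E = (\<lambda>d. d \<inter> A) ` \<D> \<union> (\<lambda>d. d - A) ` \<D> \<union> {A - \<Union>\<D>}"
  have D2: "\<Union>\<D> \<in> sets M" using D(1,2) by (simp add: sets.finite_Union)
  have A: "A \<in> sets M" using insert by auto
  show ?case
  proof (rule exI[of _ E], intro conjI ballI)
    show "finite E" using D by (simp add: E_def)
    show "E \<subseteq> sets M" using D A D2 by (auto simp: E_def)
    show "disjoint E" using D(3) unfolding E_def disjoint_def by auto
    show "\<Union>E = \<Union>(insert A \<A>)" using D(4) by (auto simp: E_def)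
    fix a assume "a \<in> insert A \<A>"
    show "\<exists>\<J>\<subseteq>E. a = \<Union>\<J>"
    proof (cases "a = A")
      case True
      show ?thesis unfolding True
        by (rule exI[of _ "(\<lambda>d. d \<inter> A) ` \<D> \<union> {A - \<Union>\<D>}"]) (auto simp: E_def)
    next
      case False
      then have "a \<in> \<A>" using \<open>a \<in> insert A \<A>\<close> by simp
      from bspec[OF D(5) this] obtain J where J: "J \<subseteq> \<D>" "a = \<Union>J" by (elim exE conjE)
      show ?thesis
        by (rule exI[of _ "(\<lambda>d. d \<inter> A) ` J \<union> (\<lambda>d. d - A) ` J"]) (use J in \<open>auto simp: E_def\<close>)
    qed
  qed
qed

text \<open>The finitely many sets observed up to time \<open>s\<close> are cut into disjoint atoms,
  all within times up to \<open>s\<close>, while \<open>U\<close> lies after \<open>s\<close>. So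
  the atoms together with \<open>U\<close> are a disjoint family with independent counts, and the
  observed counts are sums over atoms.\<close>

lemma (in prob_space) poisson_indep_history:
  fixes N :: "'a \<Rightarrow> (real \<times> 'b) measure"
  assumes N: "poisson_random_measure M \<Lambda> N" and U: "U \<in> sets \<Lambda>" "U \<subseteq> {s<..} \<times> UNIV" and C: "C \<in> sets borel"
    and A: "A \<in> sigma_sets (space M) (measure_history M \<Lambda> N s)"
  shows "prob ((\<lambda>w. emeasure (N w) U) -` C \<inter> space M \<inter> A) =
    prob ((\<lambda>w. emeasure (N w) U) -` C \<inter> space M) * prob A"
proof -
  let ?E = "(\<lambda>w. emeasure (N w) U) -` C \<inter> space M"
  have Nm: "(\<lambda>w. emeasure (N w) A) \<in> borel_measurable M" if "A \<in> sets \<Lambda>" for A using N that by (auto simp: poisson_random_measure_def)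
  have Ns: "sets (N w) = sets \<Lambda>" if "w \<in> space M" for w using N that by (auto simp: poisson_random_measure_def)
  define ok where "ok xs \<longleftrightarrow> (\<forall>(r,B)\<in>set xs. r \<in> sets \<Lambda> \<and> r \<subseteq> {0<..s} \<times> UNIV \<and> B \<in> sets borel)" for xs :: "((real \<times> 'b) set \<times> ennreal set) list"
  define ev where "ev xs = {w\<in>space M. \<forall>(r,B)\<in>set xs. emeasure (N w) r \<in> B}" for xs
  define P where "P = {ev xs | xs. ok xs}"
  have Em: "?E \<in> events" using U C by (intro measurable_sets[of _ M borel] Nm) auto
  have evm: "ev xs \<in> events" if xs: "ok xs" for xs
  proof -
    have "ev xs = (\<Inter>p\<in>set xs. (\<lambda>w. emeasure (N w) (fst p)) -` snd p \<inter> space M) \<inter> space M" by (auto simp: ev_def)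
    moreover have *: "(\<lambda>w. emeasure (N w) (fst p)) -` snd p \<inter> space M \<in> events" if "p \<in> set xs" for p
      using xs that unfolding ok_def by (intro measurable_sets[OF Nm]) auto
    moreover have "(\<Inter>p\<in>set xs. (\<lambda>w. emeasure (N w) (fst p)) -` snd p \<inter> space M) \<inter> space M \<in> events"
      by (cases "xs = []", simp, rule sets.Int[OF sets.finite_INT sets.top]) (use * in auto)
    ultimately show ?thesis by simp
  qed
  have PE: "P \<subseteq> events" using evm by (auto simp: P_def)
  have Int: "Int_stable P" unfolding Int_stable_def P_def
  proof (safe)
    fix xs ys assume a: "ok xs" "ok ys"
    have "ev xs \<inter> ev ys = ev (xs @ ys)" by (auto simp: ev_def)
    moreover have "ok (xs @ ys)" using a by (auto simp: ok_def)
    ultimately show "\<exists>zs. ev xs \<inter> ev ys = ev zs \<and> ok zs" by blast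
  qed
  have ind: "prob (?E \<inter> ev xs) = prob ?E * prob (ev xs)" if xs: "ok xs" for xs
  proof -
    obtain \<D> where D: "finite \<D>" "\<D> \<subseteq> sets \<Lambda>" "disjoint \<D>" "\<Union>\<D> = \<Union>(fst ` set xs)" "\<forall>A\<in>fst ` set xs. \<exists>\<J>\<subseteq>\<D>. A = \<Union>\<J>"
    proof -
      have "fst ` set xs \<subseteq> sets \<Lambda>" using xs by (auto simp: ok_def)
      from finite_disjoint_refinement[OF _ this] that show ?thesis by auto
    qed
    obtain h where h: "bij_betw h {0..<card \<D>} \<D>" using ex_bij_betw_nat_finite[OF D(1)] by blast
    define n where "n = card \<D>"
    have hD: "h i \<in> \<D>" if "i < n" for i using h that by (auto simp: bij_betw_def n_def)
    \<comment> \<open>The set \<open>U\<close> takes the last index, so that restricting the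
      independent family to \<open>{..<n}\<close> and to \<open>{n}\<close> separates past and
      future.\<close>
    define A where "A i = (if i < n then h i else U)" for i
    have sub: "d \<subseteq> {0<..s} \<times> UNIV" if "d \<in> \<D>" for d
    proof -
      have "d \<subseteq> \<Union>(fst ` set xs)" using that D(4) by auto
      then show ?thesis using xs unfolding ok_def by fastforce
    qed
    have disj: "({0<..s} \<times> UNIV) \<inter> ({s<..} \<times> (UNIV :: 'b set)) = {}" by auto
    have "disjoint_family_on A {..<Suc n}"
      unfolding disjoint_family_on_def
    proof (intro ballI impI)
      fix i j assume ij: "i \<in> {..<Suc n}" "j \<in> {..<Suc n}" "i \<noteq> j"
      consider "i < n" "j < n" | "i < n" "j = n" | "i = n" "j < n" using ij by force
      then show "A i \<inter> A j = {}"
      proof cases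
        case 1
        then have "h i \<noteq> h j" using h ij unfolding n_def bij_betw_def by (auto dest: inj_onD)
        with 1 show ?thesis using hD[of i] hD[of j] D(3) by (auto simp: A_def disjoint_def)
      next
        case 2
        then have "h i \<inter> U = {}" using sub[OF hD[of i]] U(2) disj by blast
        with 2 show ?thesis by (simp add: A_def)
      next
        case 3
        then have "h j \<inter> U = {}" using sub[OF hD[of j]] U(2) disj by blast
        with 3 show ?thesis by (simp add: A_def Int_commute)
      qed
    qed
    moreover have "\<forall>i<Suc n. A i \<in> sets \<Lambda>" using hD D(2) U by (auto simp: A_def)
    ultimately have "indep_vars (\<lambda>_. borel) (\<lambda>i w. emeasure (N w) (A i)) {..<Suc n}"
      using N unfolding poisson_random_measure_def by blast
    then have iv: "indep_var (PiM {..<n} (\<lambda>_. borel)) (\<lambda>w. restrict (\<lambda>i. emeasure (N w) (A i)) {..<n}) (PiM {n} (\<lambda>_. borel)) (\<lambda>w. restrict (\<lambda>i. emeasure (N w) (A i)) {n})"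
      by (rule indep_var_restrict) auto
    define J where "J r = {i. i < n \<and> h i \<subseteq> r}" for r
    have NJ: "emeasure (N w) r = (\<Sum>i\<in>J r. restrict (\<lambda>i. emeasure (N w) (A i)) {..<n} i)" if "r \<in> fst ` set xs" "w \<in> space M" for r w
    proof -
      from bspec[OF D(5) that(1)] obtain \<J> where K: "\<J> \<subseteq> \<D>" "r = \<Union>\<J>" by (elim exE conjE)
      have rU: "r = (\<Union>i\<in>J r. A i)"
      proof
        show "(\<Union>i\<in>J r. A i) \<subseteq> r" by (auto simp: J_def A_def)
        show "r \<subseteq> (\<Union>i\<in>J r. A i)"
        proof
          fix p assume "p \<in> r"
          then obtain d where d: "d \<in> \<J>" "p \<in> d" using K by auto
          have "d \<in> h ` {0..<n}" using d(1) K(1) h unfolding bij_betw_def n_def by blast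
          then obtain i where "i < n" "h i = d" by auto
          then show "p \<in> (\<Union>i\<in>J r. A i)" using d K by (auto simp: J_def A_def intro!: bexI[of _ i])
        qed
      qed
      have "emeasure (N w) r = emeasure (N w) (\<Union>i\<in>J r. A i)" using rU by simp
      also have "\<dots> = (\<Sum>i\<in>J r. emeasure (N w) (A i))"
      proof (rule sum_emeasure[symmetric])
        show "A ` J r \<subseteq> sets (N w)" using Ns[OF that(2)] hD D(2) by (auto simp: J_def A_def)
        show "disjoint_family_on A (J r)" using \<open>disjoint_family_on A {..<Suc n}\<close>
          by (rule disjoint_family_on_mono[rotated]) (auto simp: J_def)
      qed (auto simp: J_def)
      also have "\<dots> = (\<Sum>i\<in>J r. restrict (\<lambda>i. emeasure (N w) (A i)) {..<n} i)"
        by (rule sum.cong) (auto simp: J_def)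
      finally show ?thesis .
    qed
    define XA where "XA = {f\<in>space (PiM {..<n} (\<lambda>_. borel :: ennreal measure)). \<forall>(r,B)\<in>set xs. (\<Sum>i\<in>J r. f i) \<in> B}"
    have XA: "XA \<in> sets (PiM {..<n} (\<lambda>_. borel))"
    proof -
      have "XA = (\<Inter>p\<in>set xs. {f\<in>space (PiM {..<n} (\<lambda>_. borel :: ennreal measure)). (\<Sum>i\<in>J (fst p). f i) \<in> snd p}) \<inter> space (PiM {..<n} (\<lambda>_. borel :: ennreal measure))"
        by (auto simp: XA_def split: prod.splits simp del: Pi_iff) (metis fst_conv snd_conv)
      moreover have "{f\<in>space (PiM {..<n} (\<lambda>_. borel :: ennreal measure)). (\<Sum>i\<in>J (fst p). f i) \<in> snd p} \<in> sets (PiM {..<n} (\<lambda>_. borel))" if "p \<in> set xs" for p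
      proof -
        have [measurable]: "snd p \<in> sets borel" using xs that by (auto simp: ok_def)
        have [measurable]: "(\<lambda>f. \<Sum>i\<in>J (fst p). f i :: ennreal) \<in> borel_measurable (PiM {..<n} (\<lambda>_. borel))"
          by (intro borel_measurable_sum measurable_component_singleton) (auto simp: J_def)
        show ?thesis by measurable
      qed
      note * = this
      have "(\<Inter>p\<in>set xs. {f\<in>space (PiM {..<n} (\<lambda>_. borel :: ennreal measure)). (\<Sum>i\<in>J (fst p). f i) \<in> snd p}) \<inter> space (PiM {..<n} (\<lambda>_. borel :: ennreal measure)) \<in> sets (PiM {..<n} (\<lambda>_. borel))"
        by (cases "xs = []", simp, rule sets.Int[OF sets.finite_INT sets.top]) (use * in auto)
      ultimately show ?thesis by simp
    qed
    define XB where "XB = {f\<in>space (PiM {n} (\<lambda>_. borel :: ennreal measure)). f n \<in> C}"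
    have XB: "XB \<in> sets (PiM {n} (\<lambda>_. borel))" unfolding XB_def using C by measurable
    let ?A = "(\<lambda>w. restrict (\<lambda>i. emeasure (N w) (A i)) {..<n}) -` XA \<inter> space M"
    let ?B = "(\<lambda>w. restrict (\<lambda>i. emeasure (N w) (A i)) {n}) -` XB \<inter> space M"
    have B: "?B = ?E"
      by (auto simp: XB_def A_def space_PiM)
    have AE: "?A = ev xs"
    proof -
      have "(\<Sum>i\<in>J r. restrict (\<lambda>i. emeasure (N w) (A i)) {..<n} i) = emeasure (N w) r" if "(r,B) \<in> set xs" "w \<in> space M" for r B w
        using NJ[of r w] that by force
      then show ?thesis by (auto simp: XA_def ev_def space_PiM split: prod.splits simp del: restrict_apply)
    qed
    have mA: "?A \<in> events" using measurable_sets[OF indep_var_rv1[OF iv] XA] .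
    have "?A \<inter> ?B = (\<lambda>w. (restrict (\<lambda>i. emeasure (N w) (A i)) {..<n}, restrict (\<lambda>i. emeasure (N w) (A i)) {n})) -` (XA \<times> XB) \<inter> space M"
      by auto
    also have "prob \<dots> = prob ?A * prob ?B" by (rule indep_varD[OF iv XA XB])
    finally show ?thesis unfolding B AE by (simp only: mult.commute Int_commute)
  qed
  have "indep_set {?E} P"
    using PE Em ind by (auto simp: indep_sets2_eq P_def)
  then have "indep_set (sigma_sets (space M) {?E}) (sigma_sets (space M) P)"
    by (rule indep_set_sigma_sets) (use Int in \<open>auto simp: Int_stable_def\<close>)
  then have *: "prob (?E \<inter> b) = prob ?E * prob b" if "b \<in> sigma_sets (space M) P" for b
    using that by (auto simp: indep_sets2_eq)
  have "measure_history M \<Lambda> N s \<subseteq> P"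
  proof (safe)
    fix a assume "a \<in> measure_history M \<Lambda> N s"
    then obtain r B where "a = (\<lambda>w. emeasure (N w) r) -` B \<inter> space M" "r \<in> sets \<Lambda>" "r \<subseteq> {0<..s} \<times> UNIV" "B \<in> sets borel"
      by (auto simp: measure_history_def)
    then have "a = ev [(r,B)]" "ok [(r,B)]" by (auto simp: ev_def ok_def)
    then show "a \<in> P" unfolding P_def by blast
  qed
  then have "sigma_sets (space M) (measure_history M \<Lambda> N s) \<subseteq> sigma_sets (space M) P"
    by (intro sigma_sets_mono) auto
  with A * show ?thesis by blast
qed

section \<open>Filtrations and variables independent of the past\<close>

locale filtered_space = prob_space M for M :: "'a measure" +
  fixes F :: "real \<Rightarrow> 'a measure"
  assumes space_F: "space (F t) = space M"
    and sets_F: "sets (F t) \<subseteq> sets M"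
    and mono_F: "s \<le> t \<Longrightarrow> sets (F s) \<subseteq> sets (F t)"
begin

lemma measurable_F_mono: "s \<le> t \<Longrightarrow> f \<in> measurable (F s) N \<Longrightarrow> f \<in> measurable (F t) N"
  using mono_F[of s t] by (auto simp: measurable_def space_F)

lemma measurable_F_M: "f \<in> measurable (F s) N \<Longrightarrow> f \<in> measurable M N"
  using sets_F[of s] by (auto simp: measurable_def space_F)

text \<open>Independence of the sigma-algebra of \<open>X\<close> from \<open>F s\<close>, written
  on events so that one notion serves real increments and counts in \<open>ennreal\<close>.\<close>

definition indep_past :: "real \<Rightarrow> ('a \<Rightarrow> 'b::topological_space) \<Rightarrow> bool" where
  "indep_past s X \<longleftrightarrow> X \<in> borel_measurable M \<and>
     (\<forall>C\<in>sets borel. \<forall>A\<in>sets (F s). prob (X -` C \<inter> space M \<inter> A) = prob (X -` C \<inter> space M) * prob A)"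

lemma indep_past_compose:
  assumes X: "indep_past s X" and g: "g \<in> borel_measurable borel"
  shows "indep_past s (\<lambda>w. g (X w))"
  unfolding indep_past_def
proof (intro conjI ballI)
  show "(\<lambda>w. g (X w)) \<in> borel_measurable M"
    using X g by (auto simp: indep_past_def)
  fix C :: "'c set" and A assume C: "C \<in> sets borel" and A: "A \<in> sets (F s)"
  have "g -` C \<in> sets borel" using measurable_sets[OF g C] by simp
  moreover have "(\<lambda>w. g (X w)) -` C = X -` (g -` C)" by auto
  ultimately show "prob ((\<lambda>w. g (X w)) -` C \<inter> space M \<inter> A) = prob ((\<lambda>w. g (X w)) -` C \<inter> space M) * prob A"
    using X A by (simp add: indep_past_def)
qed

lemma indep_past_indep_var:
  fixes X Y :: "'a \<Rightarrow> real"
  assumes X: "indep_past s X" and Y: "Y \<in> borel_measurable (F s)"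
  shows "indep_var borel Y borel X"
proof -
  have Ym: "Y \<in> borel_measurable M" using measurable_F_M[OF Y] .
  let ?Y = "{Y -` A \<inter> space M | A. A \<in> sets borel}" and ?X = "{X -` A \<inter> space M | A. A \<in> sets borel}"
  have Xm: "X \<in> borel_measurable M" using X by (simp add: indep_past_def)
  have 1: "?Y \<subseteq> events" "?X \<subseteq> events" using measurable_sets[OF Ym] measurable_sets[OF Xm] by blast+
  have 2: "prob (a \<inter> b) = prob a * prob b" if "a \<in> ?Y" "b \<in> ?X" for a b
  proof -
    from that obtain A B where a: "a = Y -` A \<inter> space M" "A \<in> sets borel" and b: "b = X -` B \<inter> space M" "B \<in> sets borel" by blast
    have "a \<in> sets (F s)" using measurable_sets[OF Y a(2)] a(1) by (simp add: space_F)
    then have "prob (b \<inter> a) = prob b * prob a" using X b unfolding indep_past_def by blast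
    then show ?thesis by (simp add: Int_commute mult.commute)
  qed
  have "indep_set ?Y ?X" using 1 2 by (simp only: indep_sets2_eq) blast
  moreover have "Int_stable ?Y" unfolding Int_stable_def
  proof (safe)
    fix A B :: "real set" assume "A \<in> sets borel" "B \<in> sets borel"
    then show "\<exists>C. Y -` A \<inter> space M \<inter> (Y -` B \<inter> space M) = Y -` C \<inter> space M \<and> C \<in> sets borel"
      by (intro exI[of _ "A \<inter> B"]) auto
  qed
  moreover have "Int_stable ?X" unfolding Int_stable_def
  proof (safe)
    fix A B :: "real set" assume "A \<in> sets borel" "B \<in> sets borel"
    then show "\<exists>C. X -` A \<inter> space M \<inter> (X -` B \<inter> space M) = X -` C \<inter> space M \<and> C \<in> sets borel"
      by (intro exI[of _ "A \<inter> B"]) auto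
  qed
  ultimately have "indep_set (sigma_sets (space M) ?Y) (sigma_sets (space M) ?X)"
    by (rule indep_set_sigma_sets)
  then show ?thesis unfolding indep_var_eq using Xm Ym by blast
qed

text \<open>The replacement for conditional expectation: a factor known at time \<open>s\<close>
  separates from one that is independent of \<open>F s\<close>. The Ito isometry and the
  compensation formula on rectangles rest on this product rule.\<close>

lemma indep_past_integral:
  fixes X Y :: "'a \<Rightarrow> real"
  assumes X: "indep_past s X" "integrable M X" and Y: "Y \<in> borel_measurable (F s)" "integrable M Y"
  shows "integrable M (\<lambda>w. Y w * X w)" "(\<integral>w. Y w * X w \<partial>M) = (\<integral>w. Y w \<partial>M) * (\<integral>w. X w \<partial>M)"
  using indep_var_integrable[OF indep_past_indep_var[OF X(1) Y(1)] Y(2) X(2)]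
    indep_var_lebesgue_integral[OF indep_past_indep_var[OF X(1) Y(1)] Y(2) X(2)] by auto

end

locale filtered_brownian = filtered_space M F for M :: "'a measure" and F +
  fixes W :: "real \<Rightarrow> 'a \<Rightarrow> real"
  assumes adapted_W: "0 \<le> t \<Longrightarrow> W t \<in> borel_measurable (F t)"
    and indep_W: "0 \<le> s \<Longrightarrow> s < t \<Longrightarrow> indep_past s (\<lambda>w. W t w - W s w)"
    and law_W: "0 \<le> s \<Longrightarrow> s < t \<Longrightarrow>
      distributed M lborel (\<lambda>w. W t w - W s w) (normal_density 0 (sqrt (t - s)))"

text \<open>Counts of sets that lie after \<open>s\<close> play the role of increments. The marks
  may be of any type, so that both \<open>N0\<close> and \<open>N1\<close> are instances.\<close>

locale filtered_poisson = filtered_space M F for M :: "'a measure" and F +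
  fixes \<nu> :: "'b measure" and N :: "'a \<Rightarrow> (real \<times> 'b) measure"
  assumes sigma_finite_\<nu>: "sigma_finite_measure \<nu>" and space_\<nu>: "space \<nu> \<noteq> {}"
    and prm: "poisson_random_measure M (lebesgue_pos \<Otimes>\<^sub>M \<nu>) N"
    and adapted_N: "0 \<le> t \<Longrightarrow> A \<in> sets (lebesgue_pos \<Otimes>\<^sub>M \<nu>) \<Longrightarrow> A \<subseteq> {0<..t} \<times> UNIV \<Longrightarrow>
      (\<lambda>w. emeasure (N w) A) \<in> borel_measurable (F t)"
    and indep_N: "0 \<le> s \<Longrightarrow> A \<in> sets (lebesgue_pos \<Otimes>\<^sub>M \<nu>) \<Longrightarrow> A \<subseteq> {s<..t} \<times> UNIV \<Longrightarrow>
      indep_past s (\<lambda>w. emeasure (N w) A)"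

section \<open>The noises of the stochastic basis relative to the augmented filtration\<close>

context
  fixes M :: "'a measure" and F :: "real \<Rightarrow> 'a measure"
    and B :: "nat \<Rightarrow> real \<Rightarrow> 'a \<Rightarrow> real"
    and N0 :: "'a \<Rightarrow> (real \<times> real \<times> real) measure"
    and N1 :: "'a \<Rightarrow> (real \<times> real \<times> real \<times> real) measure"
    and m \<mu> :: "(real \<times> real) measure"
  assumes basis: "stochastic_basis M F B N0 N1 m \<mu>"
begin

private abbreviation "\<Lambda>0 \<equiv> lebesgue_pos \<Otimes>\<^sub>M m"
private abbreviation "\<Lambda>1 \<equiv> lebesgue_pos \<Otimes>\<^sub>M (lebesgue_pos \<Otimes>\<^sub>M \<mu>)"

text \<open>Numbers 0, 1, 2 are the Brownian coordinates, 3 is \<open>N0\<close> and 4 is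
  \<open>N1\<close>. The two levels of independence in the basis, between the coordinates of
  \<open>B\<close> and between \<open>B\<close>, \<open>N0\<close> and \<open>N1\<close>, are
  flattened to one family of five sources.\<close>

private definition "src j = (if j < 3 then path_events M (B j)
   else if j = (3::nat) then measure_events M \<Lambda>0 N0 else measure_events M \<Lambda>1 N1)"

private definition "past s j = (if j < 3 then sigma_sets (space M) (path_history M (B j) s)
   else if j = (3::nat) then sigma_sets (space M) (measure_history M \<Lambda>0 N0 s)
   else sigma_sets (space M) (measure_history M \<Lambda>1 N1 s))"

lemma basis_usual: "usual_hypotheses M F"
  and basis_brownian: "brownian_motion3 M B"
  and basis_poisson0: "poisson_random_measure M \<Lambda>0 N0"
  and basis_poisson1: "poisson_random_measure M \<Lambda>1 N1"
  and basis_indep: "prob_space.indep_sets M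
        (\<lambda>j::nat. if j = 0 then sigma_sets (space M) (\<Union>i<3. path_events M (B i))
                  else if j = 1 then measure_events M \<Lambda>0 N0
                  else measure_events M \<Lambda>1 N1) {0, 1, 2}"
  and basis_F: "F t = augmented_natural_filtration M B \<Lambda>0 N0 \<Lambda>1 N1 t"
  using basis unfolding stochastic_basis_def Let_def by blast+

lemma basis_filtered: "filtered_space M F"
proof -
  interpret prob_space M using basis_usual by (simp add: usual_hypotheses_def)
  show ?thesis
  proof
    have f: "filtration (space M) F" using basis_usual by (simp add: usual_hypotheses_def)
    show "space (F t) = space M" for t using f by (simp add: filtration_def)
    show "sets (F t) \<subseteq> events" for t using basis_usual by (simp add: usual_hypotheses_def)
    show "sets (F s) \<subseteq> sets (F t)" if "s \<le> t" for s t
      using f that by (simp add: filtration_def)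
  qed
qed

interpretation filtered_space M F by (rule basis_filtered)

private lemma path_history_Pow: "path_history M (B j) s \<subseteq> Pow (space M)"
  by (auto simp: path_history_def)

private lemma measure_history_Pow: "measure_history M \<Lambda> N s \<subseteq> Pow (space M)"
  by (auto simp: measure_history_def)

private lemma sets_F_eq: "sets (F t) = sigma_sets (space M)
       ((\<Union>i<3. path_history M (B i) t) \<union> measure_history M \<Lambda>0 N0 t \<union>
        measure_history M \<Lambda>1 N1 t \<union> null_sets M)"
  unfolding basis_F augmented_natural_filtration_def
proof (rule sets_measure_of)
  have "null_sets M \<subseteq> Pow (space M)" using sets.sets_into_space by (fastforce simp: null_sets_def)
  then show "(\<Union>i<3. path_history M (B i) t) \<union> measure_history M \<Lambda>0 N0 t \<union>
        measure_history M \<Lambda>1 N1 t \<union> null_sets M \<subseteq> Pow (space M)"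
    by (intro Un_least UN_least path_history_Pow measure_history_Pow)
qed

private lemma sets_F_past: "sets (F t) \<subseteq> sigma_sets (space M) ((\<Union>j\<in>{..<5}. past t j) \<union> null_sets M)"
  unfolding sets_F_eq
proof (rule sigma_sets_mono')
  let ?R = "(\<Union>j\<in>{..<5}. past t j) \<union> null_sets M"
  have R: "past t i \<subseteq> ?R" if "i < 5" for i using that by blast
  have p: "path_history M (B i) t \<subseteq> past t i" if "i < 3" for i
    using that by (auto simp: past_def)
  have q: "measure_history M \<Lambda>0 N0 t \<subseteq> past t 3" "measure_history M \<Lambda>1 N1 t \<subseteq> past t 4"
    by (auto simp: past_def)
  show "(\<Union>i<3. path_history M (B i) t) \<union> measure_history M \<Lambda>0 N0 t \<union> measure_history M \<Lambda>1 N1 t \<union> null_sets M \<subseteq> ?R"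
  proof (intro Un_least UN_least)
    fix i :: nat assume "i \<in> {..<3}"
    then show "path_history M (B i) t \<subseteq> ?R" using p[of i] R[of i] by (intro order_trans[OF p R]) auto
  next
    show "measure_history M \<Lambda>0 N0 t \<subseteq> ?R" by (rule order_trans[OF q(1) R]) simp
    show "measure_history M \<Lambda>1 N1 t \<subseteq> ?R" by (rule order_trans[OF q(2) R]) simp
  qed blast
qed

private lemma src_sigma: "sigma_algebra (space M) (src j)"
  unfolding src_def path_events_def measure_events_def
  by (auto intro!: sigma_algebra_sigma_sets simp: path_history_def measure_history_def)

private lemma past_sigma: "sigma_algebra (space M) (past s j)"
  unfolding past_def
  by (auto intro!: sigma_algebra_sigma_sets simp: path_history_def measure_history_def)

private lemma past_src: "past s j \<subseteq> src j"
  unfolding past_def src_def path_events_def measure_events_def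
  by (auto intro!: sigma_sets_mono' UN_upper del: subsetI)

private lemma src_events: "j < 5 \<Longrightarrow> src j \<subseteq> events"
proof -
  assume j: "j < 5"
  have 1: "src j \<subseteq> events" if "j < 3"
    using basis_brownian that unfolding brownian_motion3_def indep_sets_def src_def by auto
  have "measure_events M \<Lambda>0 N0 \<subseteq> events" "measure_events M \<Lambda>1 N1 \<subseteq> events"
    using basis_indep unfolding indep_sets_def by auto
  then show ?thesis using 1 by (auto simp: src_def)
qed

text \<open>The intersection of the three Brownian events is one event of the joint Brownian
  sigma-algebra, so the probability factors first between \<open>B\<close>, \<open>N0\<close>,
  \<open>N1\<close> and then between the coordinates.\<close>

private lemma src_prod:
  assumes A: "\<And>j. j \<in> {..<5} \<Longrightarrow> A j \<in> src j"
  shows "prob (\<Inter>j\<in>{..<5}. A j) = (\<Prod>j\<in>{..<5}. prob (A j))"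
proof -
  let ?X = "\<lambda>j::nat. if j = 0 then (\<Inter>i\<in>{..<3}. A i) else if j = 1 then A 3 else A 4"
  have Ai: "A i \<in> path_events M (B i)" if "i < 3" for i using A[of i] that by (simp add: src_def)
  interpret s: sigma_algebra "space M" "sigma_sets (space M) (\<Union>i<3. path_events M (B i))"
  proof (rule sigma_algebra_sigma_sets)
    have "path_events M (B i) \<subseteq> Pow (space M)" for i
      unfolding path_events_def
    proof (rule subsetI, rule PowI)
      have "(\<Union>t. path_history M (B i) t) \<subseteq> Pow (space M)" by (intro UN_least path_history_Pow)
      then show "a \<subseteq> space M" if "a \<in> sigma_sets (space M) (\<Union>t. path_history M (B i) t)" for a
        using sigma_sets_into_sp that by blast
    qed
    then show "(\<Union>i<3. path_events M (B i)) \<subseteq> Pow (space M)" by (intro UN_least)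
  qed
  have "?X 0 \<in> sigma_sets (space M) (\<Union>i<3. path_events M (B i))"
    using Ai by (auto intro!: s.finite_INT simp: lessThan_empty_iff)
  moreover have "A 3 \<in> measure_events M \<Lambda>0 N0" "A 4 \<in> measure_events M \<Lambda>1 N1"
    using A[of 3] A[of 4] by (auto simp: src_def)
  ultimately have "prob (\<Inter>j\<in>{0,1,2}. ?X j) = (\<Prod>j\<in>{0,1,2}. prob (?X j))"
    by (intro indep_setsD[OF basis_indep]) auto
  moreover have "prob (\<Inter>i\<in>{..<3}. A i) = (\<Prod>i\<in>{..<3}. prob (A i))"
    using basis_brownian Ai unfolding brownian_motion3_def by (intro indep_setsD) (auto simp: lessThan_empty_iff)
  moreover have "(\<Inter>j\<in>{0,1,2}. ?X j) = (\<Inter>j\<in>{..<5}. A j)"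
    by (auto simp: eval_nat_numeral lessThan_Suc)
  ultimately show ?thesis by (simp add: eval_nat_numeral lessThan_Suc mult.assoc mult.commute mult.left_commute)
qed

private lemma indep_F:
  assumes "j < 5" "E \<in> src j" "\<And>A. A \<in> past s j \<Longrightarrow> prob (E \<inter> A) = prob E * prob A" "A \<in> sets (F s)"
  shows "prob (E \<inter> A) = prob E * prob A"
  by (rule indep_past_component[where I = "{..<5}" and G = src and S = "past s" and ?j0.0 = j])
     (use assms src_sigma src_events src_prod past_src past_sigma sets_F_past[of s] in auto)

lemma basis_filtered_brownian:
  assumes i: "i < 3" shows "filtered_brownian M F (B i)"
proof
  have bm: "standard_brownian_motion M (B i)" using basis_brownian i by (simp add: brownian_motion3_def)
  have Bm: "B i t \<in> borel_measurable M" if "0 \<le> t" for t using bm that by (simp add: standard_brownian_motion_def)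
  show "B i t \<in> borel_measurable (F t)" if "0 \<le> t" for t
  proof (rule measurableI)
    fix A :: "real set" assume "A \<in> sets borel"
    then have "B i t -` A \<inter> space M \<in> path_history M (B i) t" using that by (auto simp: path_history_def)
    then show "B i t -` A \<inter> space (F t) \<in> sets (F t)"
      unfolding space_F sets_F_eq using i by (intro sigma_sets.Basic) blast
  qed auto
  show "distributed M lborel (\<lambda>w. B i t w - B i s w) (normal_density 0 (sqrt (t - s)))" if "0 \<le> s" "s < t" for s t
    using bm that unfolding standard_brownian_motion_def by blast
  show "indep_past s (\<lambda>w. B i t w - B i s w)" if st: "0 \<le> s" "s < t" for s t
    unfolding indep_past_def
  proof (intro conjI ballI)
    show "(\<lambda>w. B i t w - B i s w) \<in> borel_measurable M" using Bm[of t] Bm[of s] st by simp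
    fix C :: "real set" and A assume C: "C \<in> sets borel" and A: "A \<in> sets (F s)"
    let ?E = "(\<lambda>w. B i t w - B i s w) -` C \<inter> space M"
    \<comment> \<open>The increment is measurable for the sigma-algebra of this one path, so its
      events belong to the source \<open>i\<close>.\<close>
    let ?S = "sigma (space M) (\<Union>t. path_history M (B i) t)"
    have Pow: "(\<Union>t. path_history M (B i) t) \<subseteq> Pow (space M)" using path_history_Pow by blast
    have m: "B i r \<in> borel_measurable ?S" if "0 \<le> r" for r
    proof (rule measurableI)
      fix A :: "real set" assume "A \<in> sets borel"
      then have "B i r -` A \<inter> space M \<in> path_history M (B i) r" using that by (auto simp: path_history_def)
      then show "B i r -` A \<inter> space ?S \<in> sets ?S" using Pow
        by (simp add: space_measure_of_conv sets_measure_of) blast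
    qed auto
    have "(\<lambda>w. B i t w - B i s w) \<in> borel_measurable ?S" using m[of t] m[of s] st by simp
    from measurable_sets[OF this C] have E: "?E \<in> src i"
      using i Pow by (simp add: src_def path_events_def space_measure_of_conv sets_measure_of)
    show "prob (?E \<inter> A) = prob ?E * prob A"
    proof (rule indep_F[OF _ E _ A])
      show "i < 5" using i by simp
      show "prob (?E \<inter> H) = prob ?E * prob H" if "H \<in> past s i" for H
        using that i by (intro brownian_increment_indep_history[OF bm st C]) (simp add: past_def)
    qed
  qed
qed

private lemma basis_filtered_poisson:
  assumes \<nu>: "sigma_finite_measure \<nu>" "space \<nu> \<noteq> {}" and N: "poisson_random_measure M (lebesgue_pos \<Otimes>\<^sub>M \<nu>) N"
    and j: "j < 5" "src j = measure_events M (lebesgue_pos \<Otimes>\<^sub>M \<nu>) N"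
      "\<And>s. past s j = sigma_sets (space M) (measure_history M (lebesgue_pos \<Otimes>\<^sub>M \<nu>) N s)"
    and F: "\<And>t. measure_history M (lebesgue_pos \<Otimes>\<^sub>M \<nu>) N t \<subseteq> sets (F t)"
  shows "filtered_poisson M F \<nu> N"
proof (intro filtered_poisson.intro filtered_poisson_axioms.intro basis_filtered \<nu> N)
  show "(\<lambda>w. emeasure (N w) A) \<in> borel_measurable (F t)"
    if "0 \<le> t" "A \<in> sets (lebesgue_pos \<Otimes>\<^sub>M \<nu>)" "A \<subseteq> {0<..t} \<times> UNIV" for t A
  proof (rule measurableI)
    fix C :: "ennreal set" assume "C \<in> sets borel"
    then have "(\<lambda>w. emeasure (N w) A) -` C \<inter> space M \<in> measure_history M (lebesgue_pos \<Otimes>\<^sub>M \<nu>) N t"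
      using that by (auto simp: measure_history_def)
    then show "(\<lambda>w. emeasure (N w) A) -` C \<inter> space (F t) \<in> sets (F t)"
      unfolding space_F using F by blast
  qed auto
  show "indep_past s (\<lambda>w. emeasure (N w) A)"
    if st: "0 \<le> s" "A \<in> sets (lebesgue_pos \<Otimes>\<^sub>M \<nu>)" "A \<subseteq> {s<..t} \<times> UNIV" for s t A
    unfolding indep_past_def
  proof (intro conjI ballI)
    show "(\<lambda>w. emeasure (N w) A) \<in> borel_measurable M"
      using N st by (simp add: poisson_random_measure_def)
    fix C :: "ennreal set" and H assume C: "C \<in> sets borel" and H: "H \<in> sets (F s)"
    let ?E = "(\<lambda>w. emeasure (N w) A) -` C \<inter> space M"
    have A: "A \<subseteq> {s<..} \<times> UNIV" "A \<subseteq> {0<..t} \<times> UNIV" using st by auto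
    have "?E \<in> measure_history M (lebesgue_pos \<Otimes>\<^sub>M \<nu>) N t" using st A C by (auto simp: measure_history_def)
    then have E: "?E \<in> src j" by (auto simp: j(2) measure_events_def)
    show "prob (?E \<inter> H) = prob ?E * prob H"
    proof (rule indep_F[OF j(1) E _ H])
      show "prob (?E \<inter> G) = prob ?E * prob G" if "G \<in> past s j" for G
        using that by (intro poisson_indep_history[OF N st(2) A(1) C]) (simp add: j(3))
    qed
  qed
qed

lemma basis_filtered_poisson0:
  assumes "sigma_finite_measure m" "space m \<noteq> {}"
  shows "filtered_poisson M F m N0"
  by (rule basis_filtered_poisson[OF assms basis_poisson0, of 3]) (auto simp: src_def past_def sets_F_eq)

lemma basis_filtered_poisson1:
  assumes "sigma_finite_measure (lebesgue_pos \<Otimes>\<^sub>M \<mu>)" "space (lebesgue_pos \<Otimes>\<^sub>M \<mu>) \<noteq> {}"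
  shows "filtered_poisson M F (lebesgue_pos \<Otimes>\<^sub>M \<mu>) N1"
  by (rule basis_filtered_poisson[OF assms basis_poisson1, of 4]) (auto simp: src_def past_def sets_F_eq)

end

section \<open>Convergence in probability and outer measure\<close>

lemma outer_measure_of_Un_le:
  assumes "A \<subseteq> space M" "B \<subseteq> space M"
  shows "outer_measure_of M (A \<union> B) \<le> outer_measure_of M A + outer_measure_of M B"
proof -
  obtain A' where A': "A' \<in> sets M" "A \<subseteq> A'" "outer_measure_of M A = emeasure M A'"
    using outer_measure_of_attain[OF assms(1)] by blast
  obtain B' where B': "B' \<in> sets M" "B \<subseteq> B'" "outer_measure_of M B = emeasure M B'"
    using outer_measure_of_attain[OF assms(2)] by blast
  have "outer_measure_of M (A \<union> B) \<le> outer_measure_of M (A' \<union> B')"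
    by (intro outer_measure_of_mono) (use A' B' in auto)
  also have "\<dots> = emeasure M (A' \<union> B')" using A' B' by simp
  also have "\<dots> \<le> emeasure M A' + emeasure M B'" by (intro emeasure_subadditive A' B')
  finally show ?thesis using A' B' by simp
qed

lemma outer_measure_of_UN_le:
  assumes "finite I" "\<And>i. i \<in> I \<Longrightarrow> A i \<subseteq> space M"
  shows "outer_measure_of M (\<Union>i\<in>I. A i) \<le> (\<Sum>i\<in>I. outer_measure_of M (A i))"
  using assms
proof (induction I rule: finite_induct)
  case (insert i I)
  have "outer_measure_of M (\<Union>i\<in>insert i I. A i) \<le> outer_measure_of M (A i) + outer_measure_of M (\<Union>i\<in>I. A i)"
    unfolding UN_insert by (rule outer_measure_of_Un_le) (use insert in auto)
  also have "\<dots> \<le> outer_measure_of M (A i) + (\<Sum>i\<in>I. outer_measure_of M (A i))"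
    using insert by (intro add_left_mono) auto
  finally show ?case using insert by simp
qed simp

lemma tends_to_0_in_probD:
  "tends_to_0_in_prob M X \<Longrightarrow> 0 < e \<Longrightarrow> (\<lambda>n. outer_measure_of M {w \<in> space M. e < X n w}) \<longlonglongrightarrow> 0"
  by (simp add: tends_to_0_in_prob_def)

text \<open>\<open>tends_to_0_in_prob\<close> ranges over thresholds in \<open>ennreal\<close>, and
  below each positive one lies a positive real; so real thresholds and real bounds are
  enough.\<close>

lemma tends_to_0_in_probI_bound:
  assumes "\<And>e r :: real. 0 < e \<Longrightarrow> 0 < r \<Longrightarrow>
     \<forall>\<^sub>F n in sequentially. outer_measure_of M {w \<in> space M. ennreal e < X n w} \<le> ennreal r"
  shows "tends_to_0_in_prob M X"
  unfolding tends_to_0_in_prob_def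
proof (intro allI impI)
  fix e :: ennreal assume "0 < e"
  then obtain d where d: "0 < d" "d < e" using dense by blast
  then have dt: "d < top" using less_le_trans top_greatest by blast
  define d' where "d' = enn2real d"
  have d': "ennreal d' = d" "0 < d'" using d dt by (auto simp: d'_def enn2real_positive_iff)
  show "(\<lambda>n. outer_measure_of M {w \<in> space M. e < X n w}) \<longlonglongrightarrow> 0"
  proof (rule order_tendstoI)
    fix r :: ennreal assume "0 < r"
    then obtain q where q: "0 < q" "q < r" using dense by blast
    then have qt: "q < top" using less_le_trans top_greatest by blast
    have "0 < enn2real q" "ennreal (enn2real q) = q" using q qt by (auto simp: enn2real_positive_iff)
    with assms[OF d'(2), of "enn2real q"] have "\<forall>\<^sub>F n in sequentially. outer_measure_of M {w \<in> space M. d < X n w} \<le> q"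
      by (simp add: d')
    then show "\<forall>\<^sub>F n in sequentially. outer_measure_of M {w \<in> space M. e < X n w} < r"
    proof eventually_elim
      case (elim n)
      have "outer_measure_of M {w \<in> space M. e < X n w} \<le> outer_measure_of M {w \<in> space M. d < X n w}"
        by (intro outer_measure_of_mono) (use d in auto)
      then show ?case using elim q by (meson le_less_trans order_trans)
    qed
  qed simp
qed

lemma tends_to_0_in_prob_eventually_le:
  assumes "tends_to_0_in_prob M X" "0 < (e::real)" "0 < (r::real)"
  shows "\<forall>\<^sub>F n in sequentially. outer_measure_of M {w \<in> space M. ennreal e < X n w} \<le> ennreal r"
proof -
  have "0 < ennreal e" "0 < ennreal r" using assms by auto
  from order_tendstoD(2)[OF tends_to_0_in_probD[OF assms(1) this(1)] this(2)]
  show ?thesis by (rule eventually_mono) auto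
qed

lemma tends_to_0_in_prob_combine:
  assumes X: "tends_to_0_in_prob M X" and Y: "tends_to_0_in_prob M Y" and c: "0 < (c::real)"
    and Z: "\<And>n w. w \<in> space M \<Longrightarrow> Z n w \<le> ennreal c * (X n w + Y n w)"
  shows "tends_to_0_in_prob M Z"
proof (rule tends_to_0_in_probI_bound)
  fix e r :: real assume e: "0 < e" and r: "0 < r"
  define d where "d = e / (2 * c)"
  have d: "0 < d" using e c by (simp add: d_def)
  have "\<forall>\<^sub>F n in sequentially. outer_measure_of M {w \<in> space M. ennreal d < X n w} \<le> ennreal (r/2)"
    "\<forall>\<^sub>F n in sequentially. outer_measure_of M {w \<in> space M. ennreal d < Y n w} \<le> ennreal (r/2)"
    using r d by (intro tends_to_0_in_prob_eventually_le X Y; simp)+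
  then show "\<forall>\<^sub>F n in sequentially. outer_measure_of M {w \<in> space M. ennreal e < Z n w} \<le> ennreal r"
  proof eventually_elim
    case (elim n)
    have "{w \<in> space M. ennreal e < Z n w} \<subseteq> {w \<in> space M. ennreal d < X n w} \<union> {w \<in> space M. ennreal d < Y n w}"
    proof (rule subsetI, rule ccontr)
      fix w assume *: "w \<in> {w \<in> space M. ennreal e < Z n w}" "w \<notin> {w \<in> space M. ennreal d < X n w} \<union> {w \<in> space M. ennreal d < Y n w}"
      then have "Z n w \<le> ennreal c * (ennreal d + ennreal d)"
        by (intro order_trans[OF Z] mult_left_mono add_mono) auto
      also have "\<dots> = ennreal e" using c d by (simp add: ennreal_plus[symmetric] ennreal_mult[symmetric] d_def del: ennreal_plus)
      finally show False using * by auto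
    qed
    then have "outer_measure_of M {w \<in> space M. ennreal e < Z n w} \<le> outer_measure_of M ({w \<in> space M. ennreal d < X n w} \<union> {w \<in> space M. ennreal d < Y n w})"
      by (rule outer_measure_of_mono)
    also have "\<dots> \<le> outer_measure_of M {w \<in> space M. ennreal d < X n w} + outer_measure_of M {w \<in> space M. ennreal d < Y n w}"
      by (rule outer_measure_of_Un_le) auto
    also have "\<dots> \<le> ennreal (r/2) + ennreal (r/2)" using elim by (intro add_mono)
    also have "\<dots> = ennreal r" using r by (simp add: ennreal_plus[symmetric] del: ennreal_plus)
    finally show ?case .
  qed
qed

text \<open>Outer measures are continuous along increasing sequences of arbitrary sets, so a bound
  that is uniform over finite sets of times survives for countable ones.\<close>

lemma outer_measure_of_countable_union_le:
  fixes A :: "real \<Rightarrow> 'a set"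
  assumes Q: "countable Q" and A: "\<And>q. q \<in> Q \<Longrightarrow> A q \<subseteq> space M"
    and fin: "\<And>T. finite T \<Longrightarrow> T \<subseteq> Q \<Longrightarrow> outer_measure_of M (\<Union>t\<in>T. A t) \<le> c"
  shows "outer_measure_of M (\<Union>q\<in>Q. A q) \<le> c"
proof (cases "Q = {}")
  case True then show ?thesis using fin[of "{}"] by simp
next
  case False
  define T where "T n = from_nat_into Q ` {..n::nat}" for n
  have T: "T n \<subseteq> Q" "finite (T n)" for n using False by (auto simp: T_def intro: from_nat_into)
  have "(\<Union>n. T n) = Q"
  proof
    show "Q \<subseteq> (\<Union>n. T n)" using from_nat_into_surj[OF Q] by (fastforce simp: T_def image_iff)
  qed (use T in auto)
  then have "(\<Union>q\<in>Q. A q) = (\<Union>n. \<Union>t\<in>T n. A t)" by auto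
  moreover have "outer_measure_of M (\<Union>n. \<Union>t\<in>T n. A t) = (SUP n. outer_measure_of M (\<Union>t\<in>T n. A t))"
  proof (rule SUP_outer_measure_of_incseq[symmetric])
    show "incseq (\<lambda>n. \<Union>t\<in>T n. A t)"
      unfolding incseq_def T_def by (intro allI impI UN_mono image_mono) auto
  qed (use A T in auto)
  ultimately show ?thesis using fin T by (auto intro: SUP_least)
qed

section \<open>A maximal inequality for Ito integrals\<close>

lemma mult_product_integrable:
  fixes f g :: "'a \<Rightarrow> real"
  assumes [measurable]: "f \<in> borel_measurable M" "g \<in> borel_measurable M"
    and "integrable M (\<lambda>x. (f x)\<^sup>2)" "integrable M (\<lambda>x. (g x)\<^sup>2)"
  shows "integrable M (\<lambda>x. f x * g x)"
proof (rule Bochner_Integration.integrable_bound)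
  show "integrable M (\<lambda>x. (f x)\<^sup>2 + (g x)\<^sup>2)" using assms by simp
  show "AE x in M. norm (f x * g x) \<le> norm ((f x)\<^sup>2 + (g x)\<^sup>2)"
  proof (rule AE_I2)
    fix x
    have "2 * \<bar>f x * g x\<bar> \<le> (f x)\<^sup>2 + (g x)\<^sup>2"
      using sum_squares_bound[of "\<bar>f x\<bar>" "\<bar>g x\<bar>"] by (simp add: abs_mult)
    then show "norm (f x * g x) \<le> norm ((f x)\<^sup>2 + (g x)\<^sup>2)" by simp
  qed
qed simp

lemma (in finite_measure) second_moment_chebyshev:
  fixes X :: "'a \<Rightarrow> real"
  assumes X: "X \<in> borel_measurable M" "integrable M (\<lambda>x. (X x)\<^sup>2)" and e: "0 < e" and c: "(\<integral>x. (X x)\<^sup>2 \<partial>M) \<le> c"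
  shows "emeasure M {x \<in> space M. e < \<bar>X x\<bar>} \<le> ennreal (c / e\<^sup>2)"
proof -
  have [measurable]: "X \<in> borel_measurable M" by fact
  have "measure M {x \<in> space M. e\<^sup>2 \<le> (X x)\<^sup>2} \<le> (\<integral>x. (X x)\<^sup>2 \<partial>M) / e\<^sup>2"
    using X e by (intro integral_Markov_inequality_measure[where A="{}"]) auto
  also have "\<dots> \<le> c / e\<^sup>2" using c by (intro divide_right_mono) auto
  finally have *: "measure M {x \<in> space M. e\<^sup>2 \<le> (X x)\<^sup>2} \<le> c / e\<^sup>2" .
  have "emeasure M {x \<in> space M. e < \<bar>X x\<bar>} \<le> emeasure M {x \<in> space M. e\<^sup>2 \<le> (X x)\<^sup>2}"
  proof (rule emeasure_mono)
    show "{x \<in> space M. e < \<bar>X x\<bar>} \<subseteq> {x \<in> space M. e\<^sup>2 \<le> (X x)\<^sup>2}"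
      using e by (auto simp: abs_le_square_iff[symmetric])
  qed measurable
  also have "\<dots> \<le> ennreal (c / e\<^sup>2)" using * by (simp add: emeasure_eq_measure ennreal_leI)
  finally show ?thesis .
qed

context filtered_brownian
begin

text \<open>The case \<open>s = t\<close>, where the increment is the constant 0, is included
  because the grids in the discrete inequalities are only weakly monotone.\<close>

lemma W_increment:
  assumes "0 \<le> s" "s \<le> t"
  shows "indep_past s (\<lambda>w. W t w - W s w)"
    and "(\<lambda>w. W t w - W s w) \<in> borel_measurable M"
    and "integrable M (\<lambda>w. W t w - W s w)"
    and "(\<integral>w. W t w - W s w \<partial>M) = 0"
    and "integrable M (\<lambda>w. (W t w - W s w)\<^sup>2)"
    and "(\<integral>w. (W t w - W s w)\<^sup>2 \<partial>M) = t - s"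
proof -
  have Wm: "W r \<in> borel_measurable M" if "0 \<le> r" for r using measurable_F_M[OF adapted_W[OF that]] .
  show m: "(\<lambda>w. W t w - W s w) \<in> borel_measurable M" using Wm[of t] Wm[of s] assms by simp
  consider "s = t" | "s < t" using assms by linarith
  then have "indep_past s (\<lambda>w. W t w - W s w) \<and> integrable M (\<lambda>w. W t w - W s w) \<and> (\<integral>w. W t w - W s w \<partial>M) = 0
     \<and> integrable M (\<lambda>w. (W t w - W s w)\<^sup>2) \<and> (\<integral>w. (W t w - W s w)\<^sup>2 \<partial>M) = t - s"
  proof cases
    case 1
    have "indep_past s (\<lambda>w. 0 :: real)"
      unfolding indep_past_def
    proof (intro conjI ballI)
      fix C :: "real set" and A assume "A \<in> sets (F s)"
      then have "A \<in> events" using sets_F by blast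
      then have "space M \<inter> A = A" by (simp add: sets.Int_space_eq1)
      then show "prob ((\<lambda>w. 0) -` C \<inter> space M \<inter> A) = prob ((\<lambda>w. 0) -` C \<inter> space M) * prob A"
        by (cases "0 \<in> C") (auto simp: prob_space)
    qed simp
    with 1 show ?thesis by simp
  next
    case 2
    note D = law_W[OF assms(1) 2]
    have sd: "0 < sqrt (t - s)" using 2 by simp
    have nn: "0 \<le> normal_density 0 (sqrt (t - s)) x" for x by simp
    have e: "expectation (\<lambda>w. W t w - W s w) = 0" by (rule normal_distributed_expectation[OF sd D])
    have i1: "integrable M (\<lambda>w. W t w - W s w)"
      using integrable_normal_moment_nz_1[OF sd, of 0] nn
      by (intro distributed_integrable_var[OF D]) auto
    have i2: "integrable M (\<lambda>w. (W t w - W s w)\<^sup>2)"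
      using integrable_normal_moment[OF sd, of 0 2] distributed_integrable[OF D, of "\<lambda>x. x\<^sup>2"] nn by simp
    have v: "expectation (\<lambda>w. (W t w - W s w)\<^sup>2) = t - s"
      using normal_distributed_variance[OF sd D] 2 by (simp add: e)
    from i1 i2 e v indep_W[OF assms(1) 2] show ?thesis by auto
  qed
  then show "indep_past s (\<lambda>w. W t w - W s w)"
    "integrable M (\<lambda>w. W t w - W s w)"
    "(\<integral>w. W t w - W s w \<partial>M) = 0"
    "integrable M (\<lambda>w. (W t w - W s w)\<^sup>2)"
    "(\<integral>w. (W t w - W s w)\<^sup>2 \<partial>M) = t - s" by auto
qed

text \<open>The newest increment is independent of everything known at the start of its step and has
  mean 0, which removes the cross term of the square; its second moment is the length of the
  step.\<close>

lemma discrete_isometry: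
  assumes g: "mono g" "0 \<le> g 0"
    and z: "\<And>j. j < n \<Longrightarrow> \<zeta> j \<in> borel_measurable (F (g j))" "\<And>j. j < n \<Longrightarrow> \<exists>C. \<forall>w\<in>space M. \<bar>\<zeta> j w\<bar> \<le> C"
  shows "(\<lambda>w. \<Sum>j<n. \<zeta> j w * (W (g (Suc j)) w - W (g j) w)) \<in> borel_measurable (F (g n))"
    and "integrable M (\<lambda>w. (\<Sum>j<n. \<zeta> j w * (W (g (Suc j)) w - W (g j) w))\<^sup>2)"
    and "(\<integral>w. (\<Sum>j<n. \<zeta> j w * (W (g (Suc j)) w - W (g j) w))\<^sup>2 \<partial>M) =
      (\<integral>w. (\<Sum>j<n. (\<zeta> j w)\<^sup>2 * (g (Suc j) - g j)) \<partial>M)"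
proof -
  let ?S = "\<lambda>n w. \<Sum>j<n. \<zeta> j w * (W (g (Suc j)) w - W (g j) w)"
  let ?Q = "\<lambda>n w. \<Sum>j<n. (\<zeta> j w)\<^sup>2 * (g (Suc j) - g j)"
  have g0: "0 \<le> g j" for j using monoD[OF g(1), of 0 j] g(2) by simp
  have bint: "integrable M (\<lambda>w. (\<zeta> j w)^k)" if j: "j < n" for j and k :: nat
  proof -
    obtain C where C: "\<forall>w\<in>space M. \<bar>\<zeta> j w\<bar> \<le> C" using z(2)[OF j] by blast
    have [measurable]: "\<zeta> j \<in> borel_measurable M" using measurable_F_M z(1)[OF j] .
    show ?thesis
    proof (rule integrable_const_bound[of _ "C^k"])
      show "AE w in M. norm (\<zeta> j w ^ k) \<le> C ^ k"
        using C by (auto simp: power_abs intro!: power_mono AE_I2)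
    qed measurable
  qed
  have "?S m \<in> borel_measurable (F (g m)) \<and> integrable M (\<lambda>w. (?S m w)\<^sup>2) \<and> (\<integral>w. (?S m w)\<^sup>2 \<partial>M) = (\<integral>w. ?Q m w \<partial>M)"
    if "m \<le> n" for m
    using that
  proof (induction m)
    case 0
    then show ?case by simp
  next
    case (Suc m)
    then have m: "m < n" by simp
    let ?d = "\<lambda>w. W (g (Suc m)) w - W (g m) w"
    have gm: "0 \<le> g m" "g m \<le> g (Suc m)" using g0 g(1) by (auto simp: monoD)
    note d = W_increment[OF gm]
    have IH: "?S m \<in> borel_measurable (F (g m))" "integrable M (\<lambda>w. (?S m w)\<^sup>2)" "(\<integral>w. (?S m w)\<^sup>2 \<partial>M) = (\<integral>w. ?Q m w \<partial>M)"
      using Suc by auto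
    have SM: "?S m \<in> borel_measurable M" using measurable_F_M[OF IH(1)] .
    have zF: "\<zeta> m \<in> borel_measurable (F (g m))" using z(1)[OF m] .
    then have zM: "\<zeta> m \<in> borel_measurable M" by (rule measurable_F_M)
    have meas: "?S (Suc m) \<in> borel_measurable (F (g (Suc m)))"
      using measurable_F_mono[OF gm(2) IH(1)] measurable_F_mono[OF gm(2) zF]
        adapted_W[OF g0[of "Suc m"]] measurable_F_mono[OF gm(2) adapted_W[OF gm(1)]] by simp
    have i1: "integrable M (\<lambda>w. ?S m w * \<zeta> m w)"
      by (rule mult_product_integrable[OF SM zM IH(2) bint[OF m]])
    have m1: "(\<lambda>w. ?S m w * \<zeta> m w) \<in> borel_measurable (F (g m))" using IH(1) zF by simp
    have c: "integrable M (\<lambda>w. ?S m w * \<zeta> m w * ?d w)" "(\<integral>w. ?S m w * \<zeta> m w * ?d w \<partial>M) = 0"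
      using indep_past_integral[OF d(1,3) m1 i1] d(4) by auto
    have d2: "indep_past (g m) (\<lambda>w. (?d w)\<^sup>2)" by (rule indep_past_compose[OF d(1)]) simp
    have m2: "(\<lambda>w. (\<zeta> m w)\<^sup>2) \<in> borel_measurable (F (g m))" using zF by simp
    have q: "integrable M (\<lambda>w. (\<zeta> m w)\<^sup>2 * (?d w)\<^sup>2)" "(\<integral>w. (\<zeta> m w)\<^sup>2 * (?d w)\<^sup>2 \<partial>M) = (\<integral>w. (\<zeta> m w)\<^sup>2 \<partial>M) * (g (Suc m) - g m)"
      using indep_past_integral[OF d2 d(5) m2 bint[OF m]] d(6) by auto
    have eq: "(?S (Suc m) w)\<^sup>2 = (?S m w)\<^sup>2 + 2 * (?S m w * \<zeta> m w * ?d w) + (\<zeta> m w)\<^sup>2 * (?d w)\<^sup>2" for w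
      by (simp add: power2_eq_square algebra_simps)
    have iQ: "integrable M (?Q m)" using Suc by (intro Bochner_Integration.integrable_sum integrable_mult_left bint) auto
    have "(\<integral>w. (?S (Suc m) w)\<^sup>2 \<partial>M) = (\<integral>w. (?S m w)\<^sup>2 \<partial>M) + (\<integral>w. (\<zeta> m w)\<^sup>2 * (?d w)\<^sup>2 \<partial>M)"
      unfolding eq using IH(2) c q(1) by simp
    also have "\<dots> = (\<integral>w. ?Q (Suc m) w \<partial>M)"
      using IH(3) q(2) iQ bint[OF m, of 2] by simp
    finally have "(\<integral>w. (?S (Suc m) w)\<^sup>2 \<partial>M) = (\<integral>w. ?Q (Suc m) w \<partial>M)" .
    moreover have "integrable M (\<lambda>w. (?S (Suc m) w)\<^sup>2)" unfolding eq using IH(2) c q(1) by simp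
    ultimately show ?case using meas by blast
  qed
  from this[of n] show "?S n \<in> borel_measurable (F (g n))" "integrable M (\<lambda>w. (?S n w)\<^sup>2)" "(\<integral>w. (?S n w)\<^sup>2 \<partial>M) = (\<integral>w. ?Q n w \<partial>M)"
    by auto
qed

text \<open>The transform is switched off when the sum leaves \<open>[-e, e]\<close> or its quadratic variation is
  about to exceed \<open>\<delta>\<close>; the stopped sum at the end point carries the maximum.\<close>

lemma discrete_maximal:
  assumes g: "mono g" "0 \<le> g 0"
    and z: "\<And>j. j < n \<Longrightarrow> \<xi> j \<in> borel_measurable (F (g j))" "\<And>j. j < n \<Longrightarrow> \<exists>C. \<forall>w\<in>space M. \<bar>\<xi> j w\<bar> \<le> C"
    and e: "0 < e" and \<delta>: "0 \<le> \<delta>"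
  shows "outer_measure_of M {w\<in>space M. \<exists>m\<le>n. e < \<bar>\<Sum>j<m. \<xi> j w * (W (g (Suc j)) w - W (g j) w)\<bar> \<and>
      (\<Sum>j<m. (\<xi> j w)\<^sup>2 * (g (Suc j) - g j)) \<le> \<delta>} \<le> ennreal (\<delta> / e\<^sup>2)"
proof -
  let ?d = "\<lambda>j w. W (g (Suc j)) w - W (g j) w"
  define S where "S m w = (\<Sum>j<m. \<xi> j w * ?d j w)" for m w
  define Q where "Q m w = (\<Sum>j<m. (\<xi> j w)\<^sup>2 * (g (Suc j) - g j))" for m w
  \<comment> \<open>\<open>Q (Suc j)\<close> counts the coming step in advance, which is allowed
    since \<open>\<xi> j\<close> is known at time \<open>g j\<close>; so the accumulated variation
    of the switched transform never exceeds \<open>\<delta>\<close>.\<close>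
  define \<zeta> where "\<zeta> j w = (if (\<forall>i\<le>j. \<bar>S i w\<bar> \<le> e) \<and> Q (Suc j) w \<le> \<delta> then \<xi> j w else 0)" for j w
  have gi: "0 \<le> g (Suc j) - g j" for j using g(1) by (simp add: monoD)
  have Sm: "S i \<in> borel_measurable (F (g j))" if "i \<le> j" "j < n" for i j
  proof -
    have "S i \<in> borel_measurable (F (g i))" unfolding S_def[abs_def] by (rule discrete_isometry(1)[OF g]) (use z that in auto)
    then show ?thesis using g(1) that by (intro measurable_F_mono[of "g i" "g j"]) (auto simp: monoD)
  qed
  have Qm: "Q (Suc j) \<in> borel_measurable (F (g j))" if "j < n" for j
  proof -
    have [measurable]: "\<xi> i \<in> borel_measurable (F (g j))" if "i < Suc j" for i
      using z(1)[of i] that \<open>j < n\<close> g(1) by (intro measurable_F_mono[of "g i" "g j"]) (auto simp: monoD)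
    show ?thesis unfolding Q_def[abs_def] by measurable
  qed
  have zm: "\<zeta> j \<in> borel_measurable (F (g j))" if "j < n" for j
  proof -
    have [measurable]: "S i \<in> borel_measurable (F (g j))" if "i \<in> {..j}" for i using Sm[of i j] that \<open>j < n\<close> by auto
    have [measurable]: "Q (Suc j) \<in> borel_measurable (F (g j))" "\<xi> j \<in> borel_measurable (F (g j))"
      using Qm z that by auto
    have "(\<lambda>w. if (\<forall>i\<in>{..j}. \<bar>S i w\<bar> \<le> e) \<and> Q (Suc j) w \<le> \<delta> then \<xi> j w else 0) \<in> borel_measurable (F (g j))"
      by measurable
    then show ?thesis by (simp add: \<zeta>_def[abs_def])
  qed
  have zb: "\<exists>C. \<forall>w\<in>space M. \<bar>\<zeta> j w\<bar> \<le> C" if j: "j < n" for j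
  proof -
    obtain C where C: "\<forall>w\<in>space M. \<bar>\<xi> j w\<bar> \<le> C" using z(2)[OF j] by blast
    then show ?thesis by (intro exI[of _ "max C 0"]) (auto simp: \<zeta>_def)
  qed
  define Z where "Z m w = (\<Sum>j<m. (\<zeta> j w)\<^sup>2 * (g (Suc j) - g j))" for m w
  have Z: "Z m w \<le> Q m w \<and> Z m w \<le> \<delta>" for m w
  proof (induction m)
    case 0
    then show ?case using \<delta> by (simp add: Z_def Q_def)
  next
    case (Suc m)
    have s: "Z (Suc m) w = Z m w + (\<zeta> m w)\<^sup>2 * (g (Suc m) - g m)" "Q (Suc m) w = Q m w + (\<xi> m w)\<^sup>2 * (g (Suc m) - g m)"
      by (simp_all add: Z_def Q_def)
    show ?case
    proof (cases "(\<forall>i\<le>m. \<bar>S i w\<bar> \<le> e) \<and> Q (Suc m) w \<le> \<delta>")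
      case True
      then have "\<zeta> m w = \<xi> m w" by (simp add: \<zeta>_def)
      with s Suc have "Z (Suc m) w \<le> Q (Suc m) w" by simp
      with True show ?thesis by simp
    next
      case False
      then have "\<zeta> m w = 0" unfolding \<zeta>_def by (rule if_not_P)
      with s Suc gi[of m] show ?thesis by (simp add: add_increasing2)
    qed
  qed
  define X where "X w = (\<Sum>j<n. \<zeta> j w * ?d j w)" for w
  note iso = discrete_isometry[OF g zm zb, of n, simplified]
  have XM: "X \<in> borel_measurable M" using measurable_F_M[OF iso(1)] unfolding X_def[abs_def] .
  have "(\<integral>w. (X w)\<^sup>2 \<partial>M) = (\<integral>w. Z n w \<partial>M)" using iso(3) by (simp add: X_def Z_def)
  also have "\<dots> \<le> \<delta>"
  proof (rule integral_le_const)
    have "integrable M (\<lambda>w. (\<zeta> j w)\<^sup>2)" if j: "j < n" for j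
    proof -
      obtain C where C: "\<forall>w\<in>space M. \<bar>\<zeta> j w\<bar> \<le> C" using zb[OF j] by blast
      have [measurable]: "\<zeta> j \<in> borel_measurable M" using measurable_F_M zm[OF j] .
      show ?thesis
        by (rule integrable_const_bound[of _ "C^2"]) (use C in \<open>auto simp: abs_le_square_iff[symmetric] intro: order_trans[OF _ abs_ge_self]\<close>)
    qed
    then show "integrable M (Z n)" unfolding Z_def[abs_def] by (intro Bochner_Integration.integrable_sum integrable_mult_left) auto
  qed (use Z in auto)
  finally have X2: "(\<integral>w. (X w)\<^sup>2 \<partial>M) \<le> \<delta>" .
  \<comment> \<open>With \<open>k\<close> the first index at which the sum leaves the band, the
    switched transform agrees with the original one below \<open>k\<close> and vanishes from
    \<open>k\<close> on, so it ends at \<open>S k\<close>.\<close>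
  have sub: "e < \<bar>X w\<bar>" if m: "m \<le> n" "e < \<bar>S m w\<bar>" "Q m w \<le> \<delta>" for m w
  proof -
    define k where "k = (LEAST k. e < \<bar>S k w\<bar>)"
    have k: "e < \<bar>S k w\<bar>" unfolding k_def by (rule LeastI[of "\<lambda>k. e < \<bar>S k w\<bar>", OF m(2)])
    have km: "k \<le> m" unfolding k_def by (rule Least_le[of "\<lambda>k. e < \<bar>S k w\<bar>", OF m(2)])
    have kl: "\<bar>S i w\<bar> \<le> e" if "i < k" for i using not_less_Least[of i "\<lambda>k. e < \<bar>S k w\<bar>"] that by (simp add: k_def)
    have Qmono: "Q i w \<le> Q j w" if "i \<le> j" for i j
      unfolding Q_def by (rule sum_mono2) (use that gi in auto)
    have "X w = (\<Sum>j<k. \<zeta> j w * ?d j w) + (\<Sum>j\<in>{k..<n}. \<zeta> j w * ?d j w)"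
    proof -
      have "{..<n} = {..<k} \<union> {k..<n}" using km m by auto
      then show ?thesis unfolding X_def by (simp add: sum.union_disjoint ivl_disj_int)
    qed
    also have "(\<Sum>j\<in>{k..<n}. \<zeta> j w * ?d j w) = 0"
    proof (rule sum.neutral, rule ballI)
      fix j assume "j \<in> {k..<n}"
      then have "\<not> (\<forall>i\<le>j. \<bar>S i w\<bar> \<le> e)" using k by (meson atLeastLessThan_iff leD)
      then have "\<zeta> j w = 0" unfolding \<zeta>_def by (intro if_not_P) blast
      then show "\<zeta> j w * ?d j w = 0" by simp
    qed
    also have "(\<Sum>j<k. \<zeta> j w * ?d j w) = S k w"
      unfolding S_def
    proof (rule sum.cong)
      fix j assume j: "j \<in> {..<k}"
      then have "Q (Suc j) w \<le> \<delta>" using Qmono[of "Suc j" m] km m by simp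
      moreover have "\<forall>i\<le>j. \<bar>S i w\<bar> \<le> e" using kl j by auto
      ultimately show "\<zeta> j w * ?d j w = \<xi> j w * ?d j w" by (simp add: \<zeta>_def)
    qed simp
    finally show ?thesis using k by simp
  qed
  have "outer_measure_of M {w\<in>space M. \<exists>m\<le>n. e < \<bar>S m w\<bar> \<and> Q m w \<le> \<delta>} \<le> outer_measure_of M {w\<in>space M. e < \<bar>X w\<bar>}"
    by (rule outer_measure_of_mono) (use sub in auto)
  also have "\<dots> = emeasure M {w\<in>space M. e < \<bar>X w\<bar>}" using XM by (intro outer_measure_of_eq) measurable
  also have "\<dots> \<le> ennreal (\<delta> / e\<^sup>2)"
    by (rule second_moment_chebyshev[OF XM _ e X2]) (use iso(2) in \<open>simp add: X_def\<close>)
  finally show ?thesis unfolding S_def Q_def .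
qed

text \<open>Simple integrands as lists of triples \<open>(a, b, \<eta>)\<close> standing for \<open>\<eta> \<cdot> 1_{(a, b]}\<close>; unlike
  step processes they are closed under addition by concatenation.\<close>

definition simple_ok :: "(real \<times> real \<times> ('a \<Rightarrow> real)) list \<Rightarrow> bool" where
  "simple_ok h \<longleftrightarrow> (\<forall>(a, b, \<eta>)\<in>set h. 0 \<le> a \<and> a \<le> b \<and> \<eta> \<in> borel_measurable (F a) \<and> (\<exists>C. \<forall>w\<in>space M. \<bar>\<eta> w\<bar> \<le> C))"

definition simple_proc :: "(real \<times> real \<times> ('a \<Rightarrow> real)) list \<Rightarrow> real \<Rightarrow> 'a \<Rightarrow> real" where
  "simple_proc h s w = (\<Sum>(a, b, \<eta>)\<leftarrow>h. \<eta> w * indicator {a<..b} s)"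

definition simple_int :: "(real \<times> real \<times> ('a \<Rightarrow> real)) list \<Rightarrow> real \<Rightarrow> 'a \<Rightarrow> real" where
  "simple_int h t w = (\<Sum>(a, b, \<eta>)\<leftarrow>h. \<eta> w * (W (min t b) w - W (min t a) w))"

lemma simple_append:
  "simple_proc (h @ h') s w = simple_proc h s w + simple_proc h' s w"
  "simple_int (h @ h') t w = simple_int h t w + simple_int h' t w"
  "simple_ok (h @ h') \<longleftrightarrow> simple_ok h \<and> simple_ok h'"
  by (simp_all only: simple_proc_def simple_int_def simple_ok_def map_append sum_list_append set_append ball_Un)

definition simple_scale :: "real \<Rightarrow> (real \<times> real \<times> ('a \<Rightarrow> real)) list \<Rightarrow> (real \<times> real \<times> ('a \<Rightarrow> real)) list" where
  "simple_scale c h = map (\<lambda>(a, b, \<eta>). (a, b, \<lambda>w. c * \<eta> w)) h"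

lemma simple_scale:
  "simple_proc (simple_scale c h) s w = c * simple_proc h s w"
  "simple_int (simple_scale c h) t w = c * simple_int h t w"
  "simple_ok h \<Longrightarrow> simple_ok (simple_scale c h)"
proof -
  show "simple_proc (simple_scale c h) s w = c * simple_proc h s w"
    by (induction h) (auto simp: simple_proc_def simple_scale_def algebra_simps)
  show "simple_int (simple_scale c h) t w = c * simple_int h t w"
    by (induction h) (auto simp: simple_int_def simple_scale_def algebra_simps)
  assume ok: "simple_ok h"
  show "simple_ok (simple_scale c h)"
    unfolding simple_ok_def
  proof (safe)
    fix a b \<eta> assume "(a, b, \<eta>) \<in> set (simple_scale c h)"
    then obtain \<eta>' where h: "(a, b, \<eta>') \<in> set h" "\<eta> = (\<lambda>w. c * \<eta>' w)" by (auto simp: simple_scale_def)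
    then have *: "0 \<le> a" "a \<le> b" "\<eta>' \<in> borel_measurable (F a)" "\<exists>C. \<forall>w\<in>space M. \<bar>\<eta>' w\<bar> \<le> C" using ok by (auto simp: simple_ok_def)
    then show "0 \<le> a" "a \<le> b" "\<eta> \<in> borel_measurable (F a)" using h by auto
    from *(4) obtain C where C: "\<forall>w\<in>space M. \<bar>\<eta>' w\<bar> \<le> C" by blast
    show "\<exists>C. \<forall>w\<in>space M. \<bar>\<eta> w\<bar> \<le> C"
      by (intro exI[of _ "\<bar>c\<bar> * C"] ballI) (use C h in \<open>simp add: abs_mult mult_left_mono\<close>)
  qed
qed

lemma step_process_simple:
  assumes "simple_integrand M F n \<tau> \<eta>"
  defines "h \<equiv> map (\<lambda>i. (\<tau> i, \<tau> (Suc i), \<eta> i)) [0..<n]"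
  shows "simple_ok h" "step_process n \<tau> \<eta> s w = simple_proc h s w" "step_integral W n \<tau> \<eta> t w = simple_int h t w"
proof -
  have pos: "0 \<le> \<tau> i" if "i \<le> n" for i
    using that
  proof (induction i)
    case (Suc i)
    then have "\<tau> i \<le> \<tau> (Suc i)" using assms by (simp add: simple_integrand_def)
    with Suc show ?case by simp
  qed (use assms in \<open>simp add: simple_integrand_def\<close>)
  have b: "\<exists>C. \<forall>w\<in>space M. \<bar>\<eta> i w\<bar> \<le> C" if "i < n" for i
    using assms that by (auto simp: simple_integrand_def bounded_iff)
  show "simple_ok h"
    unfolding simple_ok_def h_def using assms(1) pos b by (auto simp: simple_integrand_def)
  show "step_process n \<tau> \<eta> s w = simple_proc h s w"
    by (simp add: h_def simple_proc_def step_process_def sum_list_sum_nth atLeast0LessThan)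
  show "step_integral W n \<tau> \<eta> t w = simple_int h t w"
    by (simp add: h_def simple_int_def step_integral_def sum_list_sum_nth atLeast0LessThan)
qed

lemma nn_integral_indicator_split:
  fixes f :: "real \<Rightarrow> ennreal"
  assumes "f \<in> borel_measurable lborel" "a \<le> b" "b \<le> c"
  shows "(\<integral>\<^sup>+s\<in>{a..c}. f s \<partial>lborel) = (\<integral>\<^sup>+s\<in>{a..b}. f s \<partial>lborel) + (\<integral>\<^sup>+s\<in>{b<..c}. f s \<partial>lborel)"
proof -
  have [measurable]: "f \<in> borel_measurable borel" using assms by simp
  have eq: "indicator {a..c} s = indicator {a..b} s + (indicator {b<..c} s :: ennreal)" for s
    using assms by (auto simp: indicator_def)
  have "(\<integral>\<^sup>+s\<in>{a..c}. f s \<partial>lborel) = (\<integral>\<^sup>+s. f s * indicator {a..b} s + f s * indicator {b<..c} s \<partial>lborel)"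
    unfolding eq by (simp add: distrib_left)
  also have "\<dots> = (\<integral>\<^sup>+s\<in>{a..b}. f s \<partial>lborel) + (\<integral>\<^sup>+s\<in>{b<..c}. f s \<partial>lborel)"
    by (rule nn_integral_add) measurable
  finally show ?thesis .
qed

lemma simple_proc_measurable[measurable]: "(\<lambda>s. simple_proc h s w) \<in> borel_measurable borel"
proof (induction h)
  case (Cons x h)
  obtain a b \<eta> where "x = (a, b, \<eta>)" by (cases x)
  with Cons show ?case by (simp add: simple_proc_def)
qed (simp add: simple_proc_def)

text \<open>A grid containing all end points in \<open>h\<close> and all times in \<open>T\<close>
  makes the integrand constant on each of its intervals; the integral and the integrated square at
  grid times are then the sums of \<open>discrete_maximal\<close>.\<close>

lemma simple_maximal:
  assumes h: "simple_ok h" and T: "finite T" "\<And>t. t \<in> T \<Longrightarrow> 0 \<le> t" and e: "0 < e" and \<delta>: "0 \<le> \<delta>"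
  shows "outer_measure_of M {w\<in>space M. \<exists>t\<in>T. e < \<bar>simple_int h t w\<bar> \<and>
      (\<integral>\<^sup>+s\<in>{0..t}. ennreal ((simple_proc h s w)\<^sup>2) \<partial>lborel) \<le> ennreal \<delta>} \<le> ennreal (\<delta> / e\<^sup>2)"
proof -
  define S where "S = insert 0 (T \<union> fst ` set h \<union> (fst \<circ> snd) ` set h)"
  have Spos: "0 \<le> r" if "r \<in> S" for r
    using that T(2) h by (fastforce simp: S_def simple_ok_def)
  have S: "finite S" "S \<noteq> {}" using T by (auto simp: S_def)
  from finite_grid[OF S] obtain g n where g: "mono g" "g ` {..n} = S" "strict_mono_on {..n::nat} g"
    "\<And>i. n \<le> i \<Longrightarrow> g i = Max S" "g 0 = Min S" by blast
  have g0: "g 0 = 0" unfolding g(5) using S Spos by (intro Min_eqI) (auto simp: S_def)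
  \<comment> \<open>The value on the grid interval from \<open>g j\<close> to
    \<open>g (Suc j)\<close>. An interval open on the left covers it exactly if
    \<open>a \<le> g j\<close> and \<open>g j < b\<close>, so only coefficients known at time
    \<open>g j\<close> enter.\<close>
  define \<xi> where "\<xi> j w = (\<Sum>(a, b, \<eta>)\<leftarrow>h. if a \<le> g j \<and> g j < b then \<eta> w else 0)" for j w
  have okx: "0 \<le> a \<and> a \<le> b \<and> \<eta> \<in> borel_measurable (F a) \<and> (\<exists>C. \<forall>w\<in>space M. \<bar>\<eta> w\<bar> \<le> C) \<and> a \<in> S \<and> b \<in> S" if "(a, b, \<eta>) \<in> set h" for a b \<eta>
  proof -
    have "a \<in> fst ` set h" "b \<in> (fst \<circ> snd) ` set h" using imageI[OF that, of fst] imageI[OF that, of "fst \<circ> snd"] by simp_all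
    then have "a \<in> S" "b \<in> S" by (simp_all add: S_def)
    moreover note bspec[OF h[unfolded simple_ok_def] that]
    ultimately show ?thesis by simp
  qed
  have gap: "g (Suc j) \<le> r" if "r \<in> S" "g j < r" "j < n" for r j
  proof -
    have "r \<in> g ` {..n}" using that(1) g(2) by simp
    then obtain i where i: "i \<le> n" "r = g i" by auto
    then have "j < i" using that g(1) by (meson leD leI monoD)
    then show ?thesis using i g(1) by (simp add: monoD)
  qed
  have gmono: "g j < g (Suc j)" if "j < n" for j using g(3) that by (auto simp: strict_mono_on_def)
  have sint: "(\<Sum>j<m. \<xi> j w * (W (g (Suc j)) w - W (g j) w)) = simple_int h (g m) w" if "m \<le> n" for m w
    using that
  proof (induction m)
    case 0
    have "simple_int h 0 w = sum_list (map (\<lambda>_. 0) h)"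
      unfolding simple_int_def
    proof (rule arg_cong[where f = sum_list], rule map_cong[OF refl], safe)
      fix a b \<eta> assume "(a, b, \<eta>) \<in> set h"
      from okx[OF this] have "min 0 b = 0" "min 0 a = 0" by auto
      then show "\<eta> w * (W (min 0 b) w - W (min 0 a) w) = 0" by simp
    qed
    then show ?case by (simp add: g0)
  next
    case (Suc m)
    have "simple_int h (g m) w + \<xi> m w * (W (g (Suc m)) w - W (g m) w) =
       (\<Sum>(a, b, \<eta>)\<leftarrow>h. \<eta> w * (W (min (g m) b) w - W (min (g m) a) w) + (if a \<le> g m \<and> g m < b then \<eta> w else 0) * (W (g (Suc m)) w - W (g m) w))"
      by (simp add: simple_int_def \<xi>_def sum_list_addf sum_list_mult_const case_prod_unfold)
    also have "\<dots> = simple_int h (g (Suc m)) w"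
      unfolding simple_int_def
    proof (rule arg_cong[where f = sum_list], rule map_cong[OF refl], safe)
      fix a b \<eta> assume x: "(a, b, \<eta>) \<in> set h"
      have m: "m < n" "g m < g (Suc m)" using Suc gmono by auto
      have ab: "a \<le> b" "g m < a \<Longrightarrow> g (Suc m) \<le> a" "g m < b \<Longrightarrow> g (Suc m) \<le> b"
        using okx[OF x] gap[of a m] gap[of b m] m by auto
      consider "a \<le> g m" "g m < b" | "g m < a" | "b \<le> g m" by linarith
      then show "\<eta> w * (W (min (g m) b) w - W (min (g m) a) w) + (if a \<le> g m \<and> g m < b then \<eta> w else 0) * (W (g (Suc m)) w - W (g m) w) = \<eta> w * (W (min (g (Suc m)) b) w - W (min (g (Suc m)) a) w)"
        by cases (use m ab in \<open>auto simp: min_def algebra_simps\<close>)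
    qed
    finally show ?case using Suc by simp
  qed
  have sproc: "simple_proc h s w = \<xi> j w" if "j < n" "g j < s" "s \<le> g (Suc j)" for j s w
    unfolding simple_proc_def \<xi>_def
  proof (rule arg_cong[where f = sum_list], rule map_cong[OF refl], safe)
    fix a b \<eta> assume x: "(a, b, \<eta>) \<in> set h"
    have "a < s \<longleftrightarrow> a \<le> g j" "s \<le> b \<longleftrightarrow> g j < b"
      using okx[OF x] gap[of a j] gap[of b j] that by (smt (verit))+
    then show "\<eta> w * indicator {a<..b} s = (if a \<le> g j \<and> g j < b then \<eta> w else 0)"
      by (simp add: indicator_def)
  qed
  have squad: "(\<integral>\<^sup>+s\<in>{0..g m}. ennreal ((simple_proc h s w)\<^sup>2) \<partial>lborel) = ennreal (\<Sum>j<m. (\<xi> j w)\<^sup>2 * (g (Suc j) - g j))" if "m \<le> n" for m w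
    using that
  proof (induction m)
    case 0
    have "AE s in lborel. s \<noteq> (0::real)" by (rule AE_lborel_singleton)
    then have "(\<integral>\<^sup>+s\<in>{0..0}. ennreal ((simple_proc h s w)\<^sup>2) \<partial>lborel) = (\<integral>\<^sup>+s. 0 \<partial>(lborel :: real measure))"
      by (intro nn_integral_cong_AE) (auto simp: indicator_def)
    then show ?case by (simp add: g0)
  next
    case (Suc m)
    have gm: "0 \<le> g m" "g m \<le> g (Suc m)" using g0 monoD[OF g(1), of 0 m] monoD[OF g(1), of m "Suc m"] by auto
    have "(\<integral>\<^sup>+s\<in>{g m<..g (Suc m)}. ennreal ((simple_proc h s w)\<^sup>2) \<partial>lborel) = (\<integral>\<^sup>+s. ennreal ((\<xi> m w)\<^sup>2) * indicator {g m<..g (Suc m)} s \<partial>lborel)"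
      using sproc[of m] Suc by (intro nn_integral_cong) (auto simp: indicator_def)
    also have "\<dots> = ennreal ((\<xi> m w)\<^sup>2 * (g (Suc m) - g m))"
      using gm by (simp add: nn_integral_cmult_indicator ennreal_mult)
    finally have "(\<integral>\<^sup>+s\<in>{0..g (Suc m)}. ennreal ((simple_proc h s w)\<^sup>2) \<partial>lborel) =
       ennreal (\<Sum>j<m. (\<xi> j w)\<^sup>2 * (g (Suc j) - g j)) + ennreal ((\<xi> m w)\<^sup>2 * (g (Suc m) - g m))"
      using Suc gm by (subst nn_integral_indicator_split[of _ _ "g m"]) auto
    also have "\<dots> = ennreal (\<Sum>j<Suc m. (\<xi> j w)\<^sup>2 * (g (Suc j) - g j))"
      using gm g(1) by (simp add: ennreal_plus[symmetric] sum_nonneg monoD del: ennreal_plus)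
    finally show ?case .
  qed
  have x1: "\<xi> j \<in> borel_measurable (F (g j))" for j
  proof -
    have "(\<lambda>w. \<Sum>(a, b, \<eta>)\<leftarrow>h'. if a \<le> g j \<and> g j < b then \<eta> w else 0) \<in> borel_measurable (F (g j))" if "set h' \<subseteq> set h" for h'
      using that
    proof (induction h')
      case (Cons x h')
      obtain a b \<eta> where x: "x = (a, b, \<eta>)" by (cases x)
      have "a \<le> g j \<Longrightarrow> \<eta> \<in> borel_measurable (F (g j))" using okx[of a b \<eta>] Cons x by (auto intro: measurable_F_mono[of a])
      with Cons x show ?case by (cases "a \<le> g j \<and> g j < b") auto
    qed simp
    then show ?thesis unfolding \<xi>_def[abs_def] by simp
  qed
  have x2: "\<exists>C. \<forall>w\<in>space M. \<bar>\<xi> j w\<bar> \<le> C" for j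
  proof -
    have "\<exists>C. \<forall>w\<in>space M. \<bar>\<Sum>(a, b, \<eta>)\<leftarrow>h'. if a \<le> g j \<and> g j < b then \<eta> w else 0\<bar> \<le> C" if "set h' \<subseteq> set h" for h'
      using that
    proof (induction h')
      case (Cons x h')
      obtain a b \<eta> where x: "x = (a, b, \<eta>)" by (cases x)
      obtain C1 where C1: "\<forall>w\<in>space M. \<bar>\<eta> w\<bar> \<le> C1" using okx[of a b \<eta>] Cons x by auto
      obtain C2 where C2: "\<forall>w\<in>space M. \<bar>\<Sum>(a, b, \<eta>)\<leftarrow>h'. if a \<le> g j \<and> g j < b then \<eta> w else 0\<bar> \<le> C2" using Cons by auto
      show ?case
      proof (intro exI[of _ "max 0 C1 + C2"] ballI)
        fix w assume w: "w \<in> space M"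
        have "\<bar>if a \<le> g j \<and> g j < b then \<eta> w else 0\<bar> \<le> max 0 C1" using C1 w by (auto simp: max_def intro: order_trans)
        then show "\<bar>\<Sum>(a, b, \<eta>)\<leftarrow>x # h'. if a \<le> g j \<and> g j < b then \<eta> w else 0\<bar> \<le> max 0 C1 + C2"
          using C2 w unfolding x by (simp only: list.map sum_list.Cons prod.case) (intro order_trans[OF abs_triangle_ineq] add_mono, auto)
      qed
    qed auto
    then show ?thesis unfolding \<xi>_def by blast
  qed
  have "{w\<in>space M. \<exists>t\<in>T. e < \<bar>simple_int h t w\<bar> \<and> (\<integral>\<^sup>+s\<in>{0..t}. ennreal ((simple_proc h s w)\<^sup>2) \<partial>lborel) \<le> ennreal \<delta>}
    \<subseteq> {w\<in>space M. \<exists>m\<le>n. e < \<bar>\<Sum>j<m. \<xi> j w * (W (g (Suc j)) w - W (g j) w)\<bar> \<and> (\<Sum>j<m. (\<xi> j w)\<^sup>2 * (g (Suc j) - g j)) \<le> \<delta>}"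
  proof (intro Collect_mono impI)
    fix w assume "w \<in> space M \<and> (\<exists>t\<in>T. e < \<bar>simple_int h t w\<bar> \<and> (\<integral>\<^sup>+s\<in>{0..t}. ennreal ((simple_proc h s w)\<^sup>2) \<partial>lborel) \<le> ennreal \<delta>)"
    then obtain t where w: "w \<in> space M" "t \<in> T" "e < \<bar>simple_int h t w\<bar>" "(\<integral>\<^sup>+s\<in>{0..t}. ennreal ((simple_proc h s w)\<^sup>2) \<partial>lborel) \<le> ennreal \<delta>" by blast
    have "t \<in> S" using w by (simp add: S_def)
    then have "t \<in> g ` {..n}" using g(2) by simp
    then obtain m where m: "m \<le> n" "t = g m" by auto
    show "w \<in> space M \<and> (\<exists>m\<le>n. e < \<bar>\<Sum>j<m. \<xi> j w * (W (g (Suc j)) w - W (g j) w)\<bar> \<and> (\<Sum>j<m. (\<xi> j w)\<^sup>2 * (g (Suc j) - g j)) \<le> \<delta>)"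
    proof (intro conjI exI[of _ m])
      show "e < \<bar>\<Sum>j<m. \<xi> j w * (W (g (Suc j)) w - W (g j) w)\<bar>" using w(3) m(2) sint[OF m(1)] by simp
      show "(\<Sum>j<m. (\<xi> j w)\<^sup>2 * (g (Suc j) - g j)) \<le> \<delta>"
        using w(4) squad[OF m(1)] \<delta> by (simp add: m(2) ennreal_le_iff)
    qed (use w m in auto)
  qed
  then have "outer_measure_of M {w\<in>space M. \<exists>t\<in>T. e < \<bar>simple_int h t w\<bar> \<and> (\<integral>\<^sup>+s\<in>{0..t}. ennreal ((simple_proc h s w)\<^sup>2) \<partial>lborel) \<le> ennreal \<delta>}
     \<le> outer_measure_of M {w\<in>space M. \<exists>m\<le>n. e < \<bar>\<Sum>j<m. \<xi> j w * (W (g (Suc j)) w - W (g j) w)\<bar> \<and> (\<Sum>j<m. (\<xi> j w)\<^sup>2 * (g (Suc j) - g j)) \<le> \<delta>}"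
    by (rule outer_measure_of_mono)
  also have "\<dots> \<le> ennreal (\<delta> / e\<^sup>2)"
    by (rule discrete_maximal[OF g(1) _ x1 x2 e \<delta>]) (simp add: g0)
  finally show ?thesis .
qed

end

text \<open>A progressive process is measurable along its paths on each \<open>[0, t]\<close>, and
  nothing is known of it at negative times; the indicator discards those.\<close>

definition meas_upto :: "real \<Rightarrow> (real \<Rightarrow> real) \<Rightarrow> bool" where
  "meas_upto t f \<longleftrightarrow> (\<lambda>s. f s * indicator {0..t} s) \<in> borel_measurable borel"

definition sq_int :: "real \<Rightarrow> (real \<Rightarrow> real) \<Rightarrow> ennreal" where
  "sq_int t f = (\<integral>\<^sup>+s\<in>{0..t}. ennreal ((f s)\<^sup>2) \<partial>lborel)"

lemma sq_int_alt: "sq_int t f = (\<integral>\<^sup>+s. ennreal ((f s * indicator {0..t} s)\<^sup>2) \<partial>lborel)"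
  unfolding sq_int_def by (intro nn_integral_cong) (auto simp: indicator_def)

lemma sq_int_mono_t: "s \<le> t \<Longrightarrow> sq_int s f \<le> sq_int t f"
  unfolding sq_int_def by (intro nn_integral_mono mult_left_mono) (auto simp: indicator_def)

lemma meas_upto_mono: "meas_upto t f \<Longrightarrow> s \<le> t \<Longrightarrow> meas_upto s f"
proof -
  assume f: "meas_upto t f" and st: "s \<le> t"
  have "(\<lambda>r. f r * indicator {0..s} r) = (\<lambda>r. (f r * indicator {0..t} r) * indicator {0..s} r)"
    using st by (auto simp: indicator_def)
  with f show "meas_upto s f" unfolding meas_upto_def by simp
qed

lemma meas_upto_lin: "meas_upto t f \<Longrightarrow> meas_upto t g \<Longrightarrow> meas_upto t (\<lambda>s. a * f s + b * g s)"
proof -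
  assume [unfolded meas_upto_def, measurable]: "meas_upto t f" "meas_upto t g"
  have eq: "(\<lambda>s. (a * f s + b * g s) * indicator {0..t} s) = (\<lambda>s. a * (f s * indicator {0..t} s) + b * (g s * indicator {0..t} s))"
    by (auto simp: algebra_simps)
  show ?thesis unfolding meas_upto_def eq by measurable
qed

lemma meas_upto_borel: "f \<in> borel_measurable borel \<Longrightarrow> meas_upto t f"
  by (simp add: meas_upto_def)

lemma sq_int_lin:
  assumes "meas_upto t f" "meas_upto t g"
  shows "sq_int t (\<lambda>s. a * f s + b * g s) \<le> ennreal (2 * a\<^sup>2) * sq_int t f + ennreal (2 * b\<^sup>2) * sq_int t g"
proof -
  have [measurable]: "(\<lambda>s. f s * indicator {0..t} s) \<in> borel_measurable borel" "(\<lambda>s. g s * indicator {0..t} s) \<in> borel_measurable borel"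
    using assms by (auto simp: meas_upto_def)
  have "sq_int t (\<lambda>s. a * f s + b * g s) \<le> (\<integral>\<^sup>+s. ennreal (2 * a\<^sup>2) * ennreal ((f s * indicator {0..t} s)\<^sup>2) + ennreal (2 * b\<^sup>2) * ennreal ((g s * indicator {0..t} s)\<^sup>2) \<partial>lborel)"
    unfolding sq_int_alt
  proof (rule nn_integral_mono)
    fix s
    let ?u = "f s * indicator {0..t} s" and ?v = "g s * indicator {0..t} s"
    have "((a * f s + b * g s) * indicator {0..t} s)\<^sup>2 = (a * ?u + b * ?v)\<^sup>2" by (simp add: algebra_simps)
    also have "\<dots> \<le> 2 * a\<^sup>2 * ?u\<^sup>2 + 2 * b\<^sup>2 * ?v\<^sup>2"
    proof -
      have "0 \<le> (a * ?u - b * ?v)\<^sup>2" by simp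
      then show ?thesis unfolding power2_diff power2_sum power_mult_distrib by simp
    qed
    finally show "ennreal (((a * f s + b * g s) * indicator {0..t} s)\<^sup>2) \<le> ennreal (2 * a\<^sup>2) * ennreal (?u\<^sup>2) + ennreal (2 * b\<^sup>2) * ennreal (?v\<^sup>2)"
      by (simp add: ennreal_plus[symmetric] ennreal_mult[symmetric] ennreal_leI del: ennreal_plus)
  qed
  also have "\<dots> = ennreal (2 * a\<^sup>2) * sq_int t f + ennreal (2 * b\<^sup>2) * sq_int t g"
    unfolding sq_int_alt by (subst nn_integral_add) (auto simp: nn_integral_cmult)
  finally show ?thesis .
qed

lemma progressive_section:
  assumes H: "progressive F H" and t: "0 \<le> t" and w: "w \<in> space (F t)"
  shows "meas_upto t (\<lambda>s. H s w)"
proof -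
  have "(\<lambda>(s, w). H s w) \<in> borel_measurable (restrict_space borel {0..t} \<Otimes>\<^sub>M F t)"
    using H t by (auto simp: progressive_def)
  from measurable_compose[OF measurable_Pair2'[OF w] this]
  have "(\<lambda>s. H s w) \<in> borel_measurable (restrict_space borel {0..t})" by simp
  then show ?thesis
    unfolding meas_upto_def by (subst (asm) borel_measurable_restrict_space_iff) (auto simp: mult.commute)
qed

section \<open>From simple integrands to general Ito integrals\<close>

context filtered_brownian
begin

text \<open>What is kept of \<open>has_ito_integral\<close>: measurability along paths and
  approximation by simple integrands, now as lists without a common grid. In this form a linear
  combination is approximated by concatenation, so the property is linear.\<close>

definition ito_approx :: "(real \<Rightarrow> 'a \<Rightarrow> real) \<Rightarrow> real \<Rightarrow> ('a \<Rightarrow> real) \<Rightarrow> bool" where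
  "ito_approx H t J \<longleftrightarrow> (\<forall>w\<in>space M. meas_upto t (\<lambda>s. H s w)) \<and>
     (\<exists>h. (\<forall>k::nat. simple_ok (h k)) \<and>
       tends_to_0_in_prob M (\<lambda>k w. sq_int t (\<lambda>s. simple_proc (h k) s w - H s w)) \<and>
       tends_to_0_in_prob M (\<lambda>k w. ennreal \<bar>simple_int (h k) t w - J w\<bar>))"

lemma has_ito_integral_approx:
  assumes "has_ito_integral M F W H t J" "0 \<le> t"
  shows "ito_approx H t J"
proof -
  from assms obtain n \<tau> \<eta> where *: "progressive F H" "\<forall>k. simple_integrand M F (n k) (\<tau> k) (\<eta> k)"
     "tends_to_0_in_prob M (\<lambda>k w. \<integral>\<^sup>+s\<in>{0..t}. ennreal ((step_process (n k) (\<tau> k) (\<eta> k) s w - H s w)\<^sup>2) \<partial>lborel)"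
     "tends_to_0_in_prob M (\<lambda>k w. ennreal \<bar>step_integral W (n k) (\<tau> k) (\<eta> k) t w - J w\<bar>)"
    unfolding has_ito_integral_def by blast
  define h where "h k = map (\<lambda>i. (\<tau> k i, \<tau> k (Suc i), \<eta> k i)) [0..<n k]" for k
  have h: "simple_ok (h k)" "step_process (n k) (\<tau> k) (\<eta> k) s w = simple_proc (h k) s w" "step_integral W (n k) (\<tau> k) (\<eta> k) t w = simple_int (h k) t w" for k s w
    unfolding h_def using step_process_simple[of "n k" "\<tau> k" "\<eta> k"] *(2) by blast+
  show ?thesis
    unfolding ito_approx_def
  proof (intro conjI ballI exI[of _ h] allI)
    show "meas_upto t (\<lambda>s. H s w)" if "w \<in> space M" for w
      using progressive_section[OF *(1) assms(2)] that by (simp add: space_F)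
  qed (use * h in \<open>auto simp: sq_int_def\<close>)
qed

lemma ito_approx_lin:
  assumes 1: "ito_approx H1 t J1" and 2: "ito_approx H2 t J2"
  shows "ito_approx (\<lambda>s w. a * H1 s w + b * H2 s w) t (\<lambda>w. a * J1 w + b * J2 w)"
proof -
  obtain h1 where h1: "\<And>k::nat. simple_ok (h1 k)" "tends_to_0_in_prob M (\<lambda>k w. sq_int t (\<lambda>s. simple_proc (h1 k) s w - H1 s w))"
       "tends_to_0_in_prob M (\<lambda>k w. ennreal \<bar>simple_int (h1 k) t w - J1 w\<bar>)" using 1 unfolding ito_approx_def by blast
  obtain h2 where h2: "\<And>k::nat. simple_ok (h2 k)" "tends_to_0_in_prob M (\<lambda>k w. sq_int t (\<lambda>s. simple_proc (h2 k) s w - H2 s w))"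
       "tends_to_0_in_prob M (\<lambda>k w. ennreal \<bar>simple_int (h2 k) t w - J2 w\<bar>)" using 2 unfolding ito_approx_def by blast
  have m: "meas_upto t (\<lambda>s. H1 s w)" "meas_upto t (\<lambda>s. H2 s w)" if "w \<in> space M" for w
    using 1 2 that by (auto simp: ito_approx_def)
  define h where "h k = simple_scale a (h1 k) @ simple_scale b (h2 k)" for k
  \<comment> \<open>One constant for both estimates: the integrated squares need
    \<open>2 * a\<^sup>2\<close> and \<open>2 * b\<^sup>2\<close>, the values need
    \<open>\<bar>a\<bar>\<close> and \<open>\<bar>b\<bar>\<close>; the summand 1 makes it
    positive.\<close>
  define c where "c = 2 * a\<^sup>2 + 2 * b\<^sup>2 + \<bar>a\<bar> + \<bar>b\<bar> + 1"
  have "0 \<le> a\<^sup>2" "0 \<le> b\<^sup>2" by auto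
  then have c: "0 < c" "2 * a\<^sup>2 \<le> c" "2 * b\<^sup>2 \<le> c" "\<bar>a\<bar> \<le> c" "\<bar>b\<bar> \<le> c" unfolding c_def by linarith+
  show ?thesis unfolding ito_approx_def
  proof (intro conjI ballI exI[of _ h] allI)
    show "meas_upto t (\<lambda>s. a * H1 s w + b * H2 s w)" if "w \<in> space M" for w
      using meas_upto_lin m[OF that] by blast
    show "simple_ok (h k)" for k by (simp add: h_def simple_append simple_scale h1 h2)
    show "tends_to_0_in_prob M (\<lambda>k w. sq_int t (\<lambda>s. simple_proc (h k) s w - (a * H1 s w + b * H2 s w)))"
    proof (rule tends_to_0_in_prob_combine[OF h1(2) h2(2) c(1)])
      fix k w assume w: "w \<in> space M"
      have mm: "meas_upto t (\<lambda>s. simple_proc (h1 k) s w - H1 s w)" "meas_upto t (\<lambda>s. simple_proc (h2 k) s w - H2 s w)"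
        using meas_upto_lin[OF meas_upto_borel[OF simple_proc_measurable] m(1)[OF w], of 1 "h1 k" w "-1"]
          meas_upto_lin[OF meas_upto_borel[OF simple_proc_measurable] m(2)[OF w], of 1 "h2 k" w "-1"] by auto
      have "sq_int t (\<lambda>s. simple_proc (h k) s w - (a * H1 s w + b * H2 s w)) =
         sq_int t (\<lambda>s. a * (simple_proc (h1 k) s w - H1 s w) + b * (simple_proc (h2 k) s w - H2 s w))"
        by (rule arg_cong[where f="sq_int t"]) (auto simp: h_def simple_append simple_scale algebra_simps)
      also have "\<dots> \<le> ennreal (2 * a\<^sup>2) * sq_int t (\<lambda>s. simple_proc (h1 k) s w - H1 s w) + ennreal (2 * b\<^sup>2) * sq_int t (\<lambda>s. simple_proc (h2 k) s w - H2 s w)"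
        by (rule sq_int_lin[OF mm])
      also have "\<dots> \<le> ennreal c * sq_int t (\<lambda>s. simple_proc (h1 k) s w - H1 s w) + ennreal c * sq_int t (\<lambda>s. simple_proc (h2 k) s w - H2 s w)"
        by (intro add_mono mult_right_mono ennreal_leI c) auto
      finally show "sq_int t (\<lambda>s. simple_proc (h k) s w - (a * H1 s w + b * H2 s w)) \<le> ennreal c * (sq_int t (\<lambda>s. simple_proc (h1 k) s w - H1 s w) + sq_int t (\<lambda>s. simple_proc (h2 k) s w - H2 s w))"
        by (simp add: distrib_left)
    qed
    show "tends_to_0_in_prob M (\<lambda>k w. ennreal \<bar>simple_int (h k) t w - (a * J1 w + b * J2 w)\<bar>)"
    proof (rule tends_to_0_in_prob_combine[OF h1(3) h2(3) c(1)])
      fix k w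
      let ?u = "simple_int (h1 k) t w - J1 w" and ?v = "simple_int (h2 k) t w - J2 w"
      have "simple_int (h k) t w - (a * J1 w + b * J2 w) = a * ?u + b * ?v"
        by (simp add: h_def simple_append simple_scale algebra_simps)
      then have "\<bar>simple_int (h k) t w - (a * J1 w + b * J2 w)\<bar> \<le> \<bar>a\<bar> * \<bar>?u\<bar> + \<bar>b\<bar> * \<bar>?v\<bar>"
        by (simp add: abs_mult[symmetric] abs_triangle_ineq)
      also have "\<dots> \<le> c * \<bar>?u\<bar> + c * \<bar>?v\<bar>" by (intro add_mono mult_right_mono c) auto
      finally show "ennreal \<bar>simple_int (h k) t w - (a * J1 w + b * J2 w)\<bar> \<le> ennreal c * (ennreal \<bar>?u\<bar> + ennreal \<bar>?v\<bar>)"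
        using c(1) by (simp add: ennreal_plus[symmetric] ennreal_mult[symmetric] ennreal_leI distrib_left del: ennreal_plus)
    qed
  qed
qed

text \<open>The maximal inequality at a single time, in Lenglart's manner: either the integrated
  square exceeds \<open>d\<close>, which is improbable, or the integral is bounded in probability by
  \<open>d / e\<^sup>2\<close>. The expectation of the integrated square never enters.\<close>

lemma simple_int_tends_to_0:
  assumes h: "\<And>k::nat. simple_ok (h k)" and t: "0 \<le> t"
    and c: "tends_to_0_in_prob M (\<lambda>k w. sq_int t (\<lambda>s. simple_proc (h k) s w))"
  shows "tends_to_0_in_prob M (\<lambda>k w. ennreal \<bar>simple_int (h k) t w\<bar>)"
proof (rule tends_to_0_in_probI_bound)
  fix e r :: real assume e: "0 < e" and r: "0 < r"
  \<comment> \<open>Chosen so that \<open>d / e\<^sup>2\<close> is half of the error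
    \<open>r\<close>.\<close>
  define d where "d = e\<^sup>2 * r / 2"
  have d: "0 < d" using e r by (simp add: d_def)
  have "\<forall>\<^sub>F k in sequentially. outer_measure_of M {w \<in> space M. ennreal d < sq_int t (\<lambda>s. simple_proc (h k) s w)} \<le> ennreal (r/2)"
    by (rule tends_to_0_in_prob_eventually_le[OF c d]) (use r in simp)
  then show "\<forall>\<^sub>F k in sequentially. outer_measure_of M {w \<in> space M. ennreal e < ennreal \<bar>simple_int (h k) t w\<bar>} \<le> ennreal r"
  proof eventually_elim
    case (elim k)
    let ?A = "{w \<in> space M. ennreal d < sq_int t (\<lambda>s. simple_proc (h k) s w)}"
    let ?B = "{w \<in> space M. \<exists>t\<in>{t}. e < \<bar>simple_int (h k) t w\<bar> \<and> (\<integral>\<^sup>+s\<in>{0..t}. ennreal ((simple_proc (h k) s w)\<^sup>2) \<partial>lborel) \<le> ennreal d}"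
    have "outer_measure_of M {w \<in> space M. ennreal e < ennreal \<bar>simple_int (h k) t w\<bar>} \<le> outer_measure_of M (?A \<union> ?B)"
      by (rule outer_measure_of_mono) (use e in \<open>auto simp: sq_int_def ennreal_less_iff not_less\<close>)
    also have "\<dots> \<le> outer_measure_of M ?A + outer_measure_of M ?B" by (rule outer_measure_of_Un_le) auto
    also have "\<dots> \<le> ennreal (r/2) + ennreal (d / e\<^sup>2)"
      by (intro add_mono elim simple_maximal h) (use t e d in auto)
    also have "\<dots> = ennreal r" using r e by (simp add: d_def ennreal_plus[symmetric] del: ennreal_plus)
    finally show ?case .
  qed
qed

text \<open>Each time in \<open>T\<close> comes with its own approximating sequence. The sequence of
  the latest time \<open>u\<close> serves them all: on \<open>[0, t]\<close> it differs from the
  sequence of \<open>t\<close> by simple integrands that tend to 0, hence so do the integrals of the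
  difference. The constant 16 arises from \<open>4 * \<delta>\<close>, which bounds the integrated
  square of the approximation, against \<open>(e/2)\<^sup>2\<close>.\<close>

lemma ito_maximal_finite:
  assumes T: "finite T" "\<And>t. t \<in> T \<Longrightarrow> 0 \<le> t" and J: "\<And>t. t \<in> T \<Longrightarrow> ito_approx H t (J t)"
    and e: "0 < e" and \<delta>: "0 < \<delta>"
  shows "outer_measure_of M {w\<in>space M. \<exists>t\<in>T. e < \<bar>J t w\<bar> \<and> sq_int t (\<lambda>s. H s w) \<le> ennreal \<delta>} \<le> ennreal (16 * \<delta> / e\<^sup>2)"
proof (cases "T = {}")
  case True then show ?thesis by simp
next
  case False
  define u where "u = Max T"
  have u: "u \<in> T" "\<And>t. t \<in> T \<Longrightarrow> t \<le> u" using False T by (auto simp: u_def)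
  obtain h where h: "\<And>k::nat. simple_ok (h k)" "tends_to_0_in_prob M (\<lambda>k w. sq_int u (\<lambda>s. simple_proc (h k) s w - H s w))"
     using J[OF u(1)] unfolding ito_approx_def by blast
  have mH: "meas_upto t (\<lambda>s. H s w)" if "w \<in> space M" "t \<in> T" for w t
    using J that by (auto simp: ito_approx_def)
  have mD: "meas_upto t (\<lambda>s. simple_proc g s w - H s w)" if "w \<in> space M" "t \<in> T" for w t g
    using meas_upto_lin[OF meas_upto_borel[OF simple_proc_measurable] mH[OF that], of 1 g w "-1"] by simp
  have lim: "tends_to_0_in_prob M (\<lambda>k w. ennreal \<bar>simple_int (h k) t w - J t w\<bar>)" if t: "t \<in> T" for t
  proof -
    obtain g where g: "\<And>k::nat. simple_ok (g k)" "tends_to_0_in_prob M (\<lambda>k w. sq_int t (\<lambda>s. simple_proc (g k) s w - H s w))"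
       "tends_to_0_in_prob M (\<lambda>k w. ennreal \<bar>simple_int (g k) t w - J t w\<bar>)" using J[OF t] unfolding ito_approx_def by blast
    define f where "f k = h k @ simple_scale (-1) (g k)" for k
    have "tends_to_0_in_prob M (\<lambda>k w. sq_int t (\<lambda>s. simple_proc (f k) s w))"
    proof (rule tends_to_0_in_prob_combine[OF h(2) g(2), of 2])
      fix k w assume w: "w \<in> space M"
      have "sq_int t (\<lambda>s. simple_proc (f k) s w) = sq_int t (\<lambda>s. 1 * (simple_proc (h k) s w - H s w) + (-1) * (simple_proc (g k) s w - H s w))"
        by (rule arg_cong[where f="sq_int t"]) (auto simp: f_def simple_append simple_scale algebra_simps)
      also have "\<dots> \<le> ennreal 2 * sq_int t (\<lambda>s. simple_proc (h k) s w - H s w) + ennreal 2 * sq_int t (\<lambda>s. simple_proc (g k) s w - H s w)"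
        using sq_int_lin[OF mD mD, OF w t w t, of 1 "h k" "-1" "g k"] by simp
      also have "\<dots> \<le> ennreal 2 * sq_int u (\<lambda>s. simple_proc (h k) s w - H s w) + ennreal 2 * sq_int t (\<lambda>s. simple_proc (g k) s w - H s w)"
        by (intro add_mono mult_left_mono sq_int_mono_t u t) auto
      finally show "sq_int t (\<lambda>s. simple_proc (f k) s w) \<le> ennreal 2 * (sq_int u (\<lambda>s. simple_proc (h k) s w - H s w) + sq_int t (\<lambda>s. simple_proc (g k) s w - H s w))"
        by (simp add: distrib_left)
    qed simp
    then have f0: "tends_to_0_in_prob M (\<lambda>k w. ennreal \<bar>simple_int (f k) t w\<bar>)"
      by (intro simple_int_tends_to_0 T(2) t) (simp add: f_def simple_append simple_scale h g)
    show ?thesis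
    proof (rule tends_to_0_in_prob_combine[OF f0 g(3), of 1])
      fix k w
      have "\<bar>simple_int (h k) t w - J t w\<bar> \<le> \<bar>simple_int (f k) t w\<bar> + \<bar>simple_int (g k) t w - J t w\<bar>"
        by (simp add: f_def simple_append simple_scale)
      then show "ennreal \<bar>simple_int (h k) t w - J t w\<bar> \<le> ennreal 1 * (ennreal \<bar>simple_int (f k) t w\<bar> + ennreal \<bar>simple_int (g k) t w - J t w\<bar>)"
        by (simp add: ennreal_plus[symmetric] ennreal_leI del: ennreal_plus)
    qed simp
  qed
  let ?A = "{w\<in>space M. \<exists>t\<in>T. e < \<bar>J t w\<bar> \<and> sq_int t (\<lambda>s. H s w) \<le> ennreal \<delta>}"
  have "outer_measure_of M ?A \<le> ennreal (16 * \<delta> / e\<^sup>2) + ennreal r" if r: "0 < r" for r :: real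
  proof -
    \<comment> \<open>The error \<open>r\<close> is shared by one event for each time in
      \<open>T\<close> and one more for the integrated square.\<close>
    define N where "N = real (card T) + 1"
    have N: "0 < N" by (simp add: N_def)
    have "\<forall>\<^sub>F k in sequentially. \<forall>t\<in>T. outer_measure_of M {w \<in> space M. ennreal (e/2) < ennreal \<bar>simple_int (h k) t w - J t w\<bar>} \<le> ennreal (r / N)"
      using T(1) by (intro eventually_ball_finite ballI tends_to_0_in_prob_eventually_le lim) (use e r N in auto)
    moreover have "\<forall>\<^sub>F k in sequentially. outer_measure_of M {w \<in> space M. ennreal \<delta> < sq_int u (\<lambda>s. simple_proc (h k) s w - H s w)} \<le> ennreal (r / N)"
      by (intro tends_to_0_in_prob_eventually_le h) (use \<delta> r N in auto)
    ultimately have "\<forall>\<^sub>F k in sequentially. outer_measure_of M ?A \<le> ennreal (16 * \<delta> / e\<^sup>2) + ennreal r"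
    proof eventually_elim
      case (elim k)
      let ?B = "{w \<in> space M. ennreal \<delta> < sq_int u (\<lambda>s. simple_proc (h k) s w - H s w)}"
      let ?C = "\<lambda>t. {w \<in> space M. ennreal (e/2) < ennreal \<bar>simple_int (h k) t w - J t w\<bar>}"
      let ?D = "{w\<in>space M. \<exists>t\<in>T. e/2 < \<bar>simple_int (h k) t w\<bar> \<and> (\<integral>\<^sup>+s\<in>{0..t}. ennreal ((simple_proc (h k) s w)\<^sup>2) \<partial>lborel) \<le> ennreal (4 * \<delta>)}"
      have "?A \<subseteq> ?D \<union> ((\<Union>t\<in>T. ?C t) \<union> ?B)"
      proof (rule subsetI, rule ccontr)
        fix w assume a: "w \<in> ?A" and n: "w \<notin> ?D \<union> ((\<Union>t\<in>T. ?C t) \<union> ?B)"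
        then obtain t where t: "t \<in> T" "e < \<bar>J t w\<bar>" "sq_int t (\<lambda>s. H s w) \<le> ennreal \<delta>" and w: "w \<in> space M" by blast
        have "w \<notin> ?C t" using n t by blast
        then have "\<bar>simple_int (h k) t w - J t w\<bar> \<le> e/2" using w e by (simp add: not_less)
        then have b: "e/2 < \<bar>simple_int (h k) t w\<bar>" using t(2) by linarith
        have "w \<notin> ?B" using n by blast
        then have c: "sq_int u (\<lambda>s. simple_proc (h k) s w - H s w) \<le> ennreal \<delta>" using w by simp
        have "sq_int t (\<lambda>s. simple_proc (h k) s w) = sq_int t (\<lambda>s. 1 * (simple_proc (h k) s w - H s w) + 1 * H s w)" by simp
        also have "\<dots> \<le> ennreal 2 * sq_int t (\<lambda>s. simple_proc (h k) s w - H s w) + ennreal 2 * sq_int t (\<lambda>s. H s w)"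
          using sq_int_lin[OF mD mH, OF w t(1) w t(1), of 1 "h k" 1] by simp
        also have "\<dots> \<le> ennreal 2 * ennreal \<delta> + ennreal 2 * ennreal \<delta>"
          by (intro add_mono mult_left_mono t(3) order_trans[OF sq_int_mono_t c] u t) auto
        also have "\<dots> = ennreal (4 * \<delta>)" using \<delta> ennreal_mult[of 2 \<delta>] ennreal_plus[of "2 * \<delta>" "2 * \<delta>"] by simp
        finally have "sq_int t (\<lambda>s. simple_proc (h k) s w) \<le> ennreal (4 * \<delta>)" .
        then have "w \<in> ?D" using w t(1) b by (auto simp: sq_int_def)
        with n show False by blast
      qed
      then have "outer_measure_of M ?A \<le> outer_measure_of M (?D \<union> ((\<Union>t\<in>T. ?C t) \<union> ?B))" by (rule outer_measure_of_mono)
      also have "\<dots> \<le> outer_measure_of M ?D + outer_measure_of M ((\<Union>t\<in>T. ?C t) \<union> ?B)" by (rule outer_measure_of_Un_le) auto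
      also have "\<dots> \<le> outer_measure_of M ?D + (outer_measure_of M (\<Union>t\<in>T. ?C t) + outer_measure_of M ?B)"
        by (intro add_left_mono outer_measure_of_Un_le) auto
      also have "\<dots> \<le> ennreal (4 * \<delta> / (e/2)\<^sup>2) + ((\<Sum>t\<in>T. outer_measure_of M (?C t)) + ennreal (r / N))"
      proof (intro add_mono elim)
        show "outer_measure_of M ?D \<le> ennreal (4 * \<delta> / (e/2)\<^sup>2)"
          by (rule simple_maximal[OF h(1) T]) (use e \<delta> in auto)
        show "outer_measure_of M (\<Union>t\<in>T. ?C t) \<le> (\<Sum>t\<in>T. outer_measure_of M (?C t))"
          by (rule outer_measure_of_UN_le[OF T(1)]) auto
      qed
      also have "\<dots> \<le> ennreal (4 * \<delta> / (e/2)\<^sup>2) + ((\<Sum>t\<in>T. ennreal (r / N)) + ennreal (r / N))"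
        by (intro add_mono sum_mono order_refl) (use elim in auto)
      also have "(\<Sum>t\<in>T. ennreal (r / N)) + ennreal (r / N) = ennreal ((\<Sum>t\<in>T. r / N) + r / N)"
        using r N by (subst ennreal_plus) (auto simp: sum_ennreal sum_nonneg simp del: sum_constant)
      also have "(\<Sum>t\<in>T. r / N) + r / N = N * (r / N)" unfolding sum_constant by (simp add: N_def distrib_right del: times_divide_eq_right)
      also have "\<dots> = r" using N by simp
      finally show ?case by (simp add: power2_eq_square)
    qed
    then show ?thesis by simp
  qed
  then show ?thesis by (rule ennreal_le_epsilon)
qed

lemma ito_maximal:
  assumes T: "countable T" "\<And>t. t \<in> T \<Longrightarrow> 0 \<le> t" and J: "\<And>t. t \<in> T \<Longrightarrow> ito_approx H t (J t)"
    and e: "0 < e" and \<delta>: "0 < \<delta>"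
  shows "outer_measure_of M {w\<in>space M. \<exists>t\<in>T. e < \<bar>J t w\<bar> \<and> sq_int t (\<lambda>s. H s w) \<le> ennreal \<delta>} \<le> ennreal (16 * \<delta> / e\<^sup>2)"
proof -
  let ?A = "\<lambda>t. {w\<in>space M. e < \<bar>J t w\<bar> \<and> sq_int t (\<lambda>s. H s w) \<le> ennreal \<delta>}"
  have *: "{w\<in>space M. \<exists>t\<in>S. e < \<bar>J t w\<bar> \<and> sq_int t (\<lambda>s. H s w) \<le> ennreal \<delta>} = (\<Union>t\<in>S. ?A t)" for S by blast
  show ?thesis unfolding *
  proof (rule outer_measure_of_countable_union_le[OF T(1)])
    fix S assume "finite S" "S \<subseteq> T"
    then show "outer_measure_of M (\<Union>t\<in>S. ?A t) \<le> ennreal (16 * \<delta> / e\<^sup>2)"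
      unfolding *[symmetric] using T J by (intro ito_maximal_finite e \<delta>) auto
  qed auto
qed

end

section \<open>Integrals against Poisson random measures\<close>

lemma sigma_finite_lebesgue_pos: "sigma_finite_measure lebesgue_pos"
  by (rule sigma_finite_measure_restrict_space[OF sigma_finite_lborel]) simp

text \<open>Shifting the index turns \<open>k * p k\<close> into \<open>l\<close> times the previous
  weight; two shifts give the second factorial moment. That moment is also the useful one later,
  since \<open>k * (k - 1)\<close> vanishes for a single point.\<close>

lemma poisson_sums:
  fixes l :: real
  defines "p \<equiv> \<lambda>k. l ^ k / fact k * exp (- l)"
  shows "p sums 1" "(\<lambda>k. real k * p k) sums l" "(\<lambda>k. real k * (real k - 1) * p k) sums l\<^sup>2"
proof -
  have "(\<lambda>k. l ^ k /\<^sub>R fact k * exp (- l)) sums (exp l * exp (- l))" by (intro sums_mult2 exp_converges)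
  then show 1: "p sums 1" by (simp add: p_def exp_minus divide_inverse mult.commute)
  have s: "real (Suc k) * p (Suc k) = l * p k" for k by (simp add: p_def field_simps del: of_nat_Suc)
  have "(\<lambda>k. real (Suc k) * p (Suc k)) sums (l * 1)" unfolding s by (rule sums_mult[OF 1])
  then show 2: "(\<lambda>k. real k * p k) sums l" using sums_Suc[of "\<lambda>k. real k * p k" "l * 1"] by simp
  have s2: "real (Suc k) * (real (Suc k) - 1) * p (Suc k) = l * (real k * p k)" for k
  proof -
    have "real (Suc k) * (real (Suc k) - 1) * p (Suc k) = real k * (real (Suc k) * p (Suc k))" by simp
    then show ?thesis unfolding s by simp
  qed
  have "(\<lambda>k. real (Suc k) * (real (Suc k) - 1) * p (Suc k)) sums (l * l)" unfolding s2 by (rule sums_mult[OF 2])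
  then show "(\<lambda>k. real k * (real k - 1) * p k) sums l\<^sup>2"
    using sums_Suc[of "\<lambda>k. real k * (real k - 1) * p k" "l * l"] by (simp add: power2_eq_square)
qed

context prob_space
begin

text \<open>The probabilities of the natural numbers already sum to 1, so all other values form a
  null event and an expectation becomes a series.\<close>

lemma countable_law:
  fixes c :: "'a \<Rightarrow> ennreal"
  assumes c[measurable]: "c \<in> borel_measurable M"
    and p: "\<And>k::nat. prob {w \<in> space M. c w = of_nat k} = p k" "p sums 1"
  shows "AE w in M. \<exists>k::nat. c w = of_nat k"
    and "\<And>g h s. h \<in> borel_measurable M \<Longrightarrow> (\<And>w k. c w = of_nat k \<Longrightarrow> h w = g k) \<Longrightarrow>
      (\<And>k. 0 \<le> g k) \<Longrightarrow> (\<lambda>k. g k * p k) sums s \<Longrightarrow> integrable M h \<and> (\<integral>w. h w \<partial>M) = (s::real)"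
proof -
  let ?A = "\<lambda>k::nat. {w \<in> space M. c w = of_nat k}"
  have A[measurable]: "?A k \<in> events" for k by measurable
  have p0: "0 \<le> p k" for k using measure_nonneg[of M "?A k"] by (simp add: p(1))
  have disj: "disjoint_family ?A" by (auto simp: disjoint_family_on_def)
  have "emeasure M (\<Union>k. ?A k) = (\<Sum>k. emeasure M (?A k))"
    by (intro suminf_emeasure[symmetric] disj) auto
  also have "\<dots> = (\<Sum>k. ennreal (p k))" by (simp add: emeasure_eq_measure p(1))
  also have "\<dots> = ennreal 1" using p0 p(2) by (intro suminf_ennreal_eq) auto
  finally have "prob (\<Union>k. ?A k) = 1" by (simp add: measure_def)
  then have "AE w in M. w \<in> (\<Union>k. ?A k)" by (intro AE_prob_1)
  then show AE: "AE w in M. \<exists>k::nat. c w = of_nat k" by (rule AE_mp) auto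
  fix g :: "nat \<Rightarrow> real" and h :: "'a \<Rightarrow> real" and s
  assume h[measurable]: "h \<in> borel_measurable M" and hg: "\<And>w k. c w = of_nat k \<Longrightarrow> h w = g k"
    and g: "\<And>k. 0 \<le> g k" and s: "(\<lambda>k. g k * p k) sums s"
  have h0: "AE w in M. 0 \<le> h w" using AE by eventually_elim (use hg g in auto)
  have "(\<integral>\<^sup>+w. ennreal (h w) \<partial>M) = (\<integral>\<^sup>+w. (\<Sum>k. ennreal (g k) * indicator (?A k) w) \<partial>M)"
  proof (rule nn_integral_cong_AE, rule AE_mp[OF AE], intro AE_I2 impI)
    fix w assume w: "w \<in> space M" and "\<exists>k::nat. c w = of_nat k"
    then obtain k :: nat where k: "c w = of_nat k" by blast
    have "(\<Sum>j. ennreal (g j) * indicator (?A j) w) = (\<Sum>j\<in>{k}. ennreal (g j) * indicator (?A j) w)"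
      by (intro suminf_finite) (auto simp: k)
    then show "ennreal (h w) = (\<Sum>k. ennreal (g k) * indicator (?A k) w)" using k hg w by simp
  qed
  also have "\<dots> = (\<Sum>k. \<integral>\<^sup>+w. ennreal (g k) * indicator (?A k) w \<partial>M)" by (rule nn_integral_suminf) measurable
  also have "\<dots> = (\<Sum>k. ennreal (g k * p k))"
    using g p0 by (simp add: nn_integral_cmult_indicator emeasure_eq_measure p(1) ennreal_mult)
  also have "\<dots> = ennreal s" using g p0 s by (intro suminf_ennreal_eq) auto
  finally have e: "(\<integral>\<^sup>+w. ennreal (h w) \<partial>M) = ennreal s" .
  have "0 \<le> s" using sums_le[OF _ sums_zero s] g p0 by simp
  then show "integrable M h \<and> (\<integral>w. h w \<partial>M) = s"
    using nn_integral_eq_integrable[OF h h0] e by blast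
qed

end

context filtered_poisson
begin

abbreviation L :: "(real \<times> 'b) measure" where "L \<equiv> lebesgue_pos \<Otimes>\<^sub>M \<nu>"

lemma sigma_finite_L: "sigma_finite_measure L"
proof -
  interpret sigma_finite_measure lebesgue_pos by (rule sigma_finite_lebesgue_pos)
  interpret v: sigma_finite_measure \<nu> by (rule sigma_finite_\<nu>)
  interpret pair_sigma_finite lebesgue_pos \<nu> ..
  show ?thesis ..
qed

sublocale L: sigma_finite_measure L by (rule sigma_finite_L)

lemma space_L: "space L = {0<..} \<times> space \<nu>"
  by (simp add: space_pair_measure space_restrict_space)

lemma sets_N[simp]: "w \<in> space M \<Longrightarrow> sets (N w) = sets L"
  and space_N[simp]: "w \<in> space M \<Longrightarrow> space (N w) = space L"
  and N_measurable: "A \<in> sets L \<Longrightarrow> (\<lambda>w. emeasure (N w) A) \<in> borel_measurable M"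
  using prm by (auto simp: poisson_random_measure_def)

lemma measurable_N_cong[simp]: "w \<in> space M \<Longrightarrow> measurable (N w) X = measurable L X"
  by (rule measurable_cong_sets) auto

lemma poisson_moments:
  assumes S: "S \<in> sets L" "emeasure L S < \<infinity>"
  shows "AE w in M. \<exists>k::nat. emeasure (N w) S = of_nat k"
    and "integrable M (\<lambda>w. measure (N w) S)" "(\<integral>w. measure (N w) S \<partial>M) = measure L S"
    and "integrable M (\<lambda>w. measure (N w) S * (measure (N w) S - 1))"
    and "(\<integral>w. measure (N w) S * (measure (N w) S - 1) \<partial>M) = (measure L S)\<^sup>2"
proof -
  let ?p = "\<lambda>k. measure L S ^ k / fact k * exp (- measure L S)"
  have p: "prob {w \<in> space M. emeasure (N w) S = of_nat k} = ?p k" for k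
    using prm S by (auto simp: poisson_random_measure_def)
  note law = countable_law[OF N_measurable[OF S(1)] p poisson_sums(1)]
  show "AE w in M. \<exists>k::nat. emeasure (N w) S = of_nat k" by (rule law(1))
  have m[measurable]: "(\<lambda>w. measure (N w) S) \<in> borel_measurable M"
    unfolding measure_def using N_measurable[OF S(1)] by measurable
  have 1: "measure (N w) S = real k" if "emeasure (N w) S = of_nat k" for w k
    using that by (simp add: measure_def ennreal_of_nat_eq_real_of_nat)
  have "integrable M (\<lambda>w. measure (N w) S) \<and> (\<integral>w. measure (N w) S \<partial>M) = measure L S"
    by (rule law(2)[where g = "\<lambda>k. real k"]) (use 1 poisson_sums(2) in auto)
  then show "integrable M (\<lambda>w. measure (N w) S)" "(\<integral>w. measure (N w) S \<partial>M) = measure L S" by auto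
  have "0 \<le> real k * (real k - 1)" for k by (cases k) auto
  then have "integrable M (\<lambda>w. measure (N w) S * (measure (N w) S - 1)) \<and> (\<integral>w. measure (N w) S * (measure (N w) S - 1) \<partial>M) = (measure L S)\<^sup>2"
    by (intro law(2)[where g = "\<lambda>k. real k * (real k - 1)"]) (use 1 poisson_sums(3) in auto)
  then show "integrable M (\<lambda>w. measure (N w) S * (measure (N w) S - 1))"
    "(\<integral>w. measure (N w) S * (measure (N w) S - 1) \<partial>M) = (measure L S)\<^sup>2" by auto
qed

lemma poisson_AE_finite:
  assumes S: "S \<in> sets L" "emeasure L S < \<infinity>"
  shows "AE w in M. emeasure (N w) S < \<infinity>"
  using poisson_moments(1)[OF S]
proof (rule AE_mp, intro AE_I2 impI)
  fix w assume "\<exists>k::nat. emeasure (N w) S = of_nat k"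
  then show "emeasure (N w) S < \<infinity>" by (auto simp: ennreal_of_nat_eq_real_of_nat)
qed

text \<open>The value on the null event of infinite mass is fixed to \<open>0\<close> to keep adaptedness.\<close>

definition NI :: "(real \<times> 'b) set \<Rightarrow> ('a \<Rightarrow> real \<times> 'b \<Rightarrow> ennreal) \<Rightarrow> 'a \<Rightarrow> ennreal" where
  "NI S f w = (if emeasure (N w) S < \<infinity> then \<integral>\<^sup>+p\<in>S. f w p \<partial>N w else 0)"

text \<open>Divided by its mass, \<open>N\<close> restricted to \<open>S\<close> is a subprobability
  kernel, whose integrals depend measurably on the outcome; the mass is multiplied back afterwards.
  With \<open>G\<close> left free the lemma yields both measurability on \<open>M\<close> and
  adaptedness.\<close>

lemma NI_measurable:
  assumes G: "space G = space M" and S: "S \<in> sets L"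
    and N: "\<And>A. A \<in> sets L \<Longrightarrow> A \<subseteq> S \<Longrightarrow> (\<lambda>w. emeasure (N w) A) \<in> borel_measurable G"
    and f: "(\<lambda>(w, p). f w p) \<in> borel_measurable (G \<Otimes>\<^sub>M L)"
  shows "NI S f \<in> borel_measurable G"
proof -
  \<comment> \<open>Division makes no sense where the mass is 0 or infinite; the null measure is
    harmless there, since \<open>NI\<close> is 0 in both cases.\<close>
  define \<kappa> where "\<kappa> w = (if 0 < emeasure (N w) S \<and> emeasure (N w) S < \<infinity>
    then density (N w) (\<lambda>p. indicator S p / emeasure (N w) S) else null_measure L)" for w
  have Lne: "space L \<noteq> {}" using space_\<nu> by (auto simp: space_L)
  have k: "emeasure (\<kappa> w) A = (if 0 < emeasure (N w) S \<and> emeasure (N w) S < \<infinity> then emeasure (N w) (S \<inter> A) / emeasure (N w) S else 0)"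
    if "A \<in> sets L" "w \<in> space M" for A w
  proof (cases "0 < emeasure (N w) S \<and> emeasure (N w) S < \<infinity>")
    case True
    have "emeasure (density (N w) (\<lambda>p. indicator S p / emeasure (N w) S)) A = (\<integral>\<^sup>+p. indicator S p / emeasure (N w) S * indicator A p \<partial>N w)"
      using that S by (intro emeasure_density) auto
    also have "\<dots> = (\<integral>\<^sup>+p. (1 / emeasure (N w) S) * indicator (S \<inter> A) p \<partial>N w)"
      by (intro nn_integral_cong) (auto simp: indicator_def)
    also have "\<dots> = emeasure (N w) (S \<inter> A) / emeasure (N w) S"
      using that S by (subst nn_integral_cmult_indicator) (auto simp: ennreal_times_divide mult.commute[of "1 / _"])
    finally show ?thesis unfolding \<kappa>_def if_P[OF True] .
  next
    case False
    show ?thesis unfolding \<kappa>_def if_not_P[OF False] by simp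
  qed
  have \<kappa>: "\<kappa> \<in> measurable G (subprob_algebra L)"
  proof (rule measurable_subprob_algebra)
    fix w assume w: "w \<in> space G"
    then have w: "w \<in> space M" by (simp add: G)
    show sets: "sets (\<kappa> w) = sets L" using w by (simp add: \<kappa>_def)
    then have sp: "space (\<kappa> w) = space L" by (rule sets_eq_imp_space_eq)
    show "subprob_space (\<kappa> w)"
    proof
      show "space (\<kappa> w) \<noteq> {}" using Lne sp by simp
      have "S \<inter> space L = S" using S sets.sets_into_space by blast
      then show "emeasure (\<kappa> w) (space (\<kappa> w)) \<le> 1" unfolding sp
        by (subst k[OF _ w]) (auto simp: ennreal_divide_self intro!: order_eq_refl)
    qed
  next
    fix A assume A: "A \<in> sets L"
    have [measurable]: "(\<lambda>w. emeasure (N w) S) \<in> borel_measurable G" "(\<lambda>w. emeasure (N w) (S \<inter> A)) \<in> borel_measurable G"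
      using S A by (auto intro!: N)
    have "(\<lambda>w. if 0 < emeasure (N w) S \<and> emeasure (N w) S < \<infinity> then emeasure (N w) (S \<inter> A) / emeasure (N w) S else 0) \<in> borel_measurable G"
      by measurable
    then show "(\<lambda>w. emeasure (\<kappa> w) A) \<in> borel_measurable G"
      by (rule measurable_cong[THEN iffD2, rotated]) (use A k in \<open>simp add: G\<close>)
  qed
  have m: "(\<lambda>w. \<integral>\<^sup>+p. f w p \<partial>\<kappa> w) \<in> borel_measurable G"
    by (rule nn_integral_measurable_subprob_algebra2[OF f \<kappa>])
  have [measurable]: "(\<lambda>w. emeasure (N w) S) \<in> borel_measurable G" using S by (auto intro!: N)
  have eq: "NI S f w = (if emeasure (N w) S < \<infinity> then emeasure (N w) S * (\<integral>\<^sup>+p. f w p \<partial>\<kappa> w) else 0)" if w: "w \<in> space G" for w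
  proof -
    have wM: "w \<in> space M" using w G by simp
    have fm: "f w \<in> borel_measurable L" using measurable_compose[OF measurable_Pair1'[OF w] f] by simp
    consider "emeasure (N w) S = 0" | "0 < emeasure (N w) S" "emeasure (N w) S < \<infinity>" | "emeasure (N w) S = \<infinity>"
      by (metis infinity_ennreal_def not_gr_zero top.not_eq_extremum)
    then show ?thesis
    proof cases
      case 1
      have "AE p in N w. p \<notin> S" using 1 S wM by (intro AE_not_in) (auto simp: null_sets_def)
      then have "(\<integral>\<^sup>+p\<in>S. f w p \<partial>N w) = (\<integral>\<^sup>+p. 0 \<partial>N w)" by (intro nn_integral_cong_AE) auto
      then show ?thesis using 1 by (simp add: NI_def)
    next
      case 2
      have "(\<integral>\<^sup>+p. f w p \<partial>\<kappa> w) = (\<integral>\<^sup>+p. indicator S p / emeasure (N w) S * f w p \<partial>N w)"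
        using 2 S wM fm by (simp add: \<kappa>_def) (subst nn_integral_density, auto)
      then have "emeasure (N w) S * (\<integral>\<^sup>+p. f w p \<partial>\<kappa> w) = (\<integral>\<^sup>+p. emeasure (N w) S * (indicator S p / emeasure (N w) S * f w p) \<partial>N w)"
        using S wM fm by (subst nn_integral_cmult) auto
      also have "\<dots> = (\<integral>\<^sup>+p\<in>S. f w p \<partial>N w)"
      proof (rule nn_integral_cong)
        fix p
        have "emeasure (N w) S * (1 / emeasure (N w) S) = 1"
          using 2 by (simp add: ennreal_times_divide ennreal_divide_self)
        then show "emeasure (N w) S * (indicator S p / emeasure (N w) S * f w p) = f w p * indicator S p"
          by (cases "p \<in> S") (auto simp: mult.assoc[symmetric])
      qed
      finally show ?thesis using 2 by (simp add: NI_def)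
    qed (simp add: NI_def)
  qed
  have "(\<lambda>w. if emeasure (N w) S < \<infinity> then emeasure (N w) S * (\<integral>\<^sup>+p. f w p \<partial>\<kappa> w) else 0) \<in> borel_measurable G"
    using m by measurable
  then show ?thesis by (rule measurable_cong[THEN iffD2, rotated]) (use eq in simp)
qed

section \<open>The compensation formula\<close>

abbreviation PS :: "(real \<times> 'a) measure" where "PS \<equiv> predictable_sigma M F"

abbreviation BP :: "((real \<times> 'a) \<times> 'b \<Rightarrow> 'c::topological_space) set" where "BP \<equiv> borel_measurable (PS \<Otimes>\<^sub>M \<nu>)"

lemma predictable_gen_Pow: "{{s<..t} \<times> A | s t A. 0 \<le> s \<and> s \<le> t \<and> A \<in> sets (F s)} \<subseteq> Pow ({0<..} \<times> space M)"
proof -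
  have "A \<subseteq> space M" if "A \<in> sets (F s)" for A s using sets.sets_into_space[OF that] by (simp add: space_F)
  then show ?thesis by fastforce
qed

lemma space_PS: "space PS = {0<..} \<times> space M"
  unfolding predictable_sigma_def by (rule space_measure_of[OF predictable_gen_Pow])

lemma sets_PS: "sets PS = sigma_sets ({0<..} \<times> space M) {{s<..t} \<times> A | s t A. 0 \<le> s \<and> s \<le> t \<and> A \<in> sets (F s)}"
  unfolding predictable_sigma_def by (rule sets_measure_of[OF predictable_gen_Pow])

lemma predictable_rect:
  assumes "0 \<le> s" "A \<in> sets (F s)" shows "{s<..} \<times> A \<in> sets PS"
proof -
  have "{s<..s + real n} \<times> A \<in> sets PS" for n :: nat
    unfolding sets_PS
    by (rule sigma_sets.Basic, unfold mem_Collect_eq, rule exI[of _ s], rule exI[of _ "s + real n"], rule exI[of _ A])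
      (use assms in auto)
  then have "(\<Union>n::nat. {s<..s + real n} \<times> A) \<in> sets PS" by blast
  moreover have "{s<..} \<times> A = (\<Union>n::nat. {s<..s + real n} \<times> A)"
  proof -
    have "\<exists>n::nat. x \<le> s + real n" for x
      using real_arch_simple[of "x - s"] by (auto simp: algebra_simps)
    then show ?thesis by auto
  qed
  ultimately show ?thesis by simp
qed

text \<open>It suffices to test the generating rectangles. Those that start at or above all values
  of \<open>f\<close> have empty preimage, so measurability of \<open>h\<close> is asked only for
  events at times that \<open>f\<close> exceeds; this is what admits \<open>F t\<close> in place of
  \<open>M\<close>.\<close>

lemma measurable_into_PS:
  assumes f: "f \<in> measurable X (borel :: real measure)" and g: "\<And>w. w \<in> space X \<Longrightarrow> 0 < f w" "h \<in> space X \<rightarrow> space M"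
    and A: "\<And>a A. 0 \<le> a \<Longrightarrow> A \<in> sets (F a) \<Longrightarrow> (\<exists>w\<in>space X. a < f w) \<Longrightarrow> h -` A \<inter> space X \<in> sets X"
  shows "(\<lambda>x. (f x, h x)) \<in> measurable X PS"
  unfolding predictable_sigma_def
proof (rule measurable_measure_of[OF predictable_gen_Pow])
  show "(\<lambda>x. (f x, h x)) \<in> space X \<rightarrow> {0<..} \<times> space M" using g by auto
  fix y assume "y \<in> {{s<..t} \<times> A | s t A. 0 \<le> s \<and> s \<le> t \<and> A \<in> sets (F s)}"
  then obtain s t B where y: "y = {s<..t} \<times> B" "0 \<le> s" "B \<in> sets (F s)" by blast
  show "(\<lambda>x. (f x, h x)) -` y \<inter> space X \<in> sets X"
  proof (cases "\<exists>w\<in>space X. s < f w")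
    case True
    have "(\<lambda>x. (f x, h x)) -` y \<inter> space X = (f -` {s<..t} \<inter> space X) \<inter> (h -` B \<inter> space X)" using y by auto
    also have "\<dots> \<in> sets X" by (rule sets.Int[OF measurable_sets[OF f] A[OF y(2,3) True]]) auto
    finally show ?thesis .
  next
    case False
    then have "(\<lambda>x. (f x, h x)) -` y \<inter> space X = {}" using y by auto
    then show ?thesis by simp
  qed
qed

lemma measurable_fst_L: "fst \<in> measurable L (borel :: real measure)"
proof -
  have "(\<lambda>x::real. x) \<in> measurable lebesgue_pos borel" by (rule measurable_restrict_space1) simp
  with measurable_fst show ?thesis by (rule measurable_compose)
qed

lemma measurable_M_L_PS: "(\<lambda>(w, (s, v)). ((s, w), v)) \<in> measurable (M \<Otimes>\<^sub>M L) (PS \<Otimes>\<^sub>M \<nu>)"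
proof -
  have "(\<lambda>x. (fst (snd x), fst x)) \<in> measurable (M \<Otimes>\<^sub>M L) PS"
  proof (rule measurable_into_PS)
    have "fst \<in> measurable L (borel :: real measure)"
      by (rule measurable_fst_L)
    show "(\<lambda>x. fst (snd x)) \<in> borel_measurable (M \<Otimes>\<^sub>M L)"
      by (rule measurable_compose[OF measurable_snd \<open>fst \<in> measurable L borel\<close>])
    show "fst -` A \<inter> space (M \<Otimes>\<^sub>M L) \<in> sets (M \<Otimes>\<^sub>M L)" if "A \<in> sets (F a)" for A a
      using that sets_F by (intro measurable_sets[OF measurable_fst]) auto
  qed (auto simp: space_pair_measure space_L space_restrict_space)
  then have "(\<lambda>x. ((fst (snd x), fst x), snd (snd x))) \<in> measurable (M \<Otimes>\<^sub>M L) (PS \<Otimes>\<^sub>M \<nu>)"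
    by (intro measurable_Pair) (auto intro: measurable_compose[OF measurable_snd measurable_snd])
  then show ?thesis by (simp add: case_prod_unfold)
qed

text \<open>With the time capped at \<open>t\<close>, every generating rectangle that can be hit
  starts before \<open>t\<close>, so its event belongs to \<open>F t\<close>.\<close>

lemma measurable_F_L_PS:
  assumes t: "0 < t"
  shows "(\<lambda>(w, (s, v)). ((min s t, w), v)) \<in> measurable (F t \<Otimes>\<^sub>M L) (PS \<Otimes>\<^sub>M \<nu>)"
proof -
  have "(\<lambda>x. (min (fst (snd x)) t, fst x)) \<in> measurable (F t \<Otimes>\<^sub>M L) PS"
  proof (rule measurable_into_PS)
    have "fst \<in> measurable L (borel :: real measure)"
      by (rule measurable_fst_L)
    then have "(\<lambda>x. fst (snd x)) \<in> borel_measurable (F t \<Otimes>\<^sub>M L)"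
      by (rule measurable_compose[OF measurable_snd])
    then show "(\<lambda>x. min (fst (snd x)) t) \<in> borel_measurable (F t \<Otimes>\<^sub>M L)" by measurable
    show "fst -` A \<inter> space (F t \<Otimes>\<^sub>M L) \<in> sets (F t \<Otimes>\<^sub>M L)" if "A \<in> sets (F a)" "\<exists>x\<in>space (F t \<Otimes>\<^sub>M L). a < min (fst (snd x)) t" for A a
    proof -
      have "a \<le> t" using that(2) by auto
      then show ?thesis using that(1) mono_F[of a t] by (intro measurable_sets[OF measurable_fst]) auto
    qed
  qed (use t in \<open>auto simp: space_pair_measure space_L space_restrict_space space_F\<close>)
  then have "(\<lambda>x. ((min (fst (snd x)) t, fst x), snd (snd x))) \<in> measurable (F t \<Otimes>\<^sub>M L) (PS \<Otimes>\<^sub>M \<nu>)"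
    by (intro measurable_Pair) (auto intro: measurable_compose[OF measurable_snd measurable_snd])
  then show ?thesis by (simp add: case_prod_unfold)
qed

lemma predictable_measurable_M:
  assumes "f \<in> measurable (PS \<Otimes>\<^sub>M \<nu>) X"
  shows "(\<lambda>(w, (s, v)). f ((s, w), v)) \<in> measurable (M \<Otimes>\<^sub>M L) X"
  using measurable_compose[OF measurable_M_L_PS assms] by (simp add: case_prod_unfold)

text \<open>Up to time \<open>t\<close> the cap \<open>min s t\<close> changes nothing, and beyond
  \<open>t\<close> the indicator hides the change.\<close>

lemma predictable_measurable_F:
  fixes f :: "_ \<Rightarrow> ennreal"
  assumes t: "0 \<le> t" and f: "f \<in> BP"
  shows "(\<lambda>(w, (s, v)). f ((s, w), v) * indicator {0<..t} s) \<in> borel_measurable (F t \<Otimes>\<^sub>M L)"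
proof (cases "t = 0")
  case True then show ?thesis by simp
next
  case False
  then have m[measurable]: "(\<lambda>(w, (s, v)). f ((min s t, w), v)) \<in> borel_measurable (F t \<Otimes>\<^sub>M L)"
    using measurable_compose[OF measurable_F_L_PS f, of t] t by (simp add: case_prod_unfold)
  have "fst \<in> measurable L (borel :: real measure)"
    by (rule measurable_fst_L)
  then have [measurable]: "(\<lambda>x. fst (snd x)) \<in> borel_measurable (F t \<Otimes>\<^sub>M L)"
    by (rule measurable_compose[OF measurable_snd])
  have "(\<lambda>x. (case x of (w, (s, v)) \<Rightarrow> f ((min s t, w), v)) * indicator {0<..t} (fst (snd x))) \<in> borel_measurable (F t \<Otimes>\<^sub>M L)"
    by measurable
  moreover have "(\<lambda>x. (case x of (w, (s, v)) \<Rightarrow> f ((min s t, w), v)) * indicator {0<..t} (fst (snd x))) = (\<lambda>(w, (s, v)). f ((s, w), v) * indicator {0<..t} s)"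
    by (auto simp: fun_eq_iff indicator_def min_def)
  ultimately show ?thesis by simp
qed

lemma box_sets: "0 \<le> s \<Longrightarrow> V \<in> sets \<nu> \<Longrightarrow> {s<..t} \<times> V \<in> sets L"
proof -
  assume s: "0 \<le> s" and V: "V \<in> sets \<nu>"
  have "{s<..t} = {0<..} \<inter> {s<..t}" using s by auto
  moreover have "{0<..} \<inter> {s<..t} \<in> sets lebesgue_pos" by (auto simp: sets_restrict_space)
  ultimately show ?thesis using V by (intro pair_measureI) auto
qed

lemma emeasure_box: "0 \<le> s \<Longrightarrow> s \<le> t \<Longrightarrow> V \<in> sets \<nu> \<Longrightarrow> emeasure L ({s<..t} \<times> V) = ennreal (t - s) * emeasure \<nu> V"
proof -
  assume s: "0 \<le> s" "s \<le> t" and V: "V \<in> sets \<nu>"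
  interpret v: sigma_finite_measure \<nu> by (rule sigma_finite_\<nu>)
  have e: "{s<..t} = {0<..} \<inter> {s<..t}" using s by auto
  have m: "{s<..t} \<in> sets lebesgue_pos" by (subst e) (auto simp: sets_restrict_space)
  have "emeasure lebesgue_pos {s<..t} = emeasure lborel {s<..t}"
    by (rule emeasure_restrict_space) (use s in auto)
  then show ?thesis using s v.emeasure_pair_measure_Times[OF m V] by simp
qed

definition rect_gen :: "((real \<times> 'a) \<times> 'b) set set" where
  "rect_gen = {({s<..t} \<times> A) \<times> V | s t A V. 0 \<le> s \<and> s \<le> t \<and> A \<in> sets (F s) \<and> V \<in> sets \<nu>}"

lemma sets_PS_\<nu>: "sets (PS \<Otimes>\<^sub>M \<nu>) = sigma_sets (({0<..} \<times> space M) \<times> space \<nu>) rect_gen"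
proof -
  let ?Ea = "{{s<..t} \<times> A | s t A. 0 \<le> s \<and> s \<le> t \<and> A \<in> sets (F s)}"
  let ?Ca = "(\<lambda>n::nat. {0<..real n} \<times> space M) ` UNIV"
  have top: "space M \<in> sets (F 0)" using sets.top[of "F 0"] by (simp add: space_F)
  have "sets (PS \<Otimes>\<^sub>M \<nu>) = sets (sigma (space PS \<times> space \<nu>) {a \<times> b | a b. a \<in> ?Ea \<and> b \<in> sets \<nu>})"
  proof (rule sets_pair_eq[where Ca = ?Ca and Cb = "{space \<nu>}"])
    show "?Ea \<subseteq> Pow (space PS)" unfolding space_PS by (rule predictable_gen_Pow)
    show "sets PS = sigma_sets (space PS) ?Ea" unfolding space_PS by (rule sets_PS)
    show "?Ca \<subseteq> ?Ea"
    proof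
      fix x assume "x \<in> ?Ca"
      then obtain n :: nat where "x = {0<..real n} \<times> space M" by blast
      with top have "x = {0<..real n} \<times> space M \<and> 0 \<le> (0::real) \<and> 0 \<le> real n \<and> space M \<in> sets (F 0)" by simp
      then show "x \<in> ?Ea" by blast
    qed
    show "\<Union>?Ca = space PS" unfolding space_PS
      by (auto intro: real_arch_simple)
    show "sets \<nu> \<subseteq> Pow (space \<nu>)" by (rule sets.space_closed)
    show "sets \<nu> = sigma_sets (space \<nu>) (sets \<nu>)" by (simp add: sets.sigma_sets_eq)
  qed auto
  also have "{a \<times> b | a b. a \<in> ?Ea \<and> b \<in> sets \<nu>} = rect_gen"
    unfolding rect_gen_def by blast
  also have "sets (sigma (space PS \<times> space \<nu>) rect_gen) = sigma_sets (space PS \<times> space \<nu>) rect_gen"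
  proof (rule sets_measure_of)
    show "rect_gen \<subseteq> Pow (space PS \<times> space \<nu>)"
    proof
      fix x assume "x \<in> rect_gen"
      then obtain s t A V where x: "x = ({s<..t} \<times> A) \<times> V" "0 \<le> s" "A \<in> sets (F s)" "V \<in> sets \<nu>" unfolding rect_gen_def by blast
      have "A \<subseteq> space M" "V \<subseteq> space \<nu>" using sets.sets_into_space[OF x(3)] sets.sets_into_space[OF x(4)] by (auto simp: space_F)
      then show "x \<in> Pow (space PS \<times> space \<nu>)" using x(1,2) by (auto simp: space_PS)
    qed
  qed
  finally show ?thesis by (simp add: space_PS)
qed

lemma Int_stable_rect_gen: "Int_stable rect_gen"
  unfolding Int_stable_def
proof (intro ballI)
  fix a b assume "a \<in> rect_gen" "b \<in> rect_gen"
  then obtain s t A V s' t' A' V' where a: "a = ({s<..t} \<times> A) \<times> V" "0 \<le> s" "s \<le> t" "A \<in> sets (F s)" "V \<in> sets \<nu>"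
    and b: "b = ({s'<..t'} \<times> A') \<times> V'" "0 \<le> s'" "s' \<le> t'" "A' \<in> sets (F s')" "V' \<in> sets \<nu>"
    unfolding rect_gen_def by blast
  define u where "u = max s s'"
  \<comment> \<open>The outer maximum keeps \<open>u \<le> w\<close> when the two time intervals do
    not meet; the intersection is then an empty rectangle of the family.\<close>
  define w where "w = max u (min t t')"
  have AA: "A \<in> sets (F u)" "A' \<in> sets (F u)" using a(4) b(4) mono_F[of s u] mono_F[of s' u] by (auto simp: u_def)
  have "a \<inter> b = ({u<..w} \<times> (A \<inter> A')) \<times> (V \<inter> V')" unfolding a(1) b(1) by (auto simp: u_def w_def)
  moreover have "0 \<le> u" "u \<le> w" using a by (auto simp: u_def w_def)
  moreover have "A \<inter> A' \<in> sets (F u)" "V \<inter> V' \<in> sets \<nu>" using AA a b by auto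
  ultimately show "a \<inter> b \<in> rect_gen" unfolding rect_gen_def by blast
qed

lemma NI_add:
  assumes S: "S \<in> sets L" and w: "w \<in> space M" and f: "f w \<in> borel_measurable L" "g w \<in> borel_measurable L"
  shows "NI S (\<lambda>w p. f w p + g w p) w = NI S f w + NI S g w"
proof -
  have "(\<integral>\<^sup>+p\<in>S. (f w p + g w p) \<partial>N w) = (\<integral>\<^sup>+p. f w p * indicator S p + g w p * indicator S p \<partial>N w)"
    by (simp add: distrib_right)
  also have "\<dots> = (\<integral>\<^sup>+p\<in>S. f w p \<partial>N w) + (\<integral>\<^sup>+p\<in>S. g w p \<partial>N w)"
    using S w f by (intro nn_integral_add) auto
  finally show ?thesis by (simp add: NI_def)
qed

lemma NI_suminf:
  assumes S: "S \<in> sets L" and w: "w \<in> space M" and f: "\<And>i::nat. f i w \<in> borel_measurable L"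
  shows "NI S (\<lambda>w p. \<Sum>i. f i w p) w = (\<Sum>i. NI S (f i) w)"
proof -
  have "(\<integral>\<^sup>+p\<in>S. (\<Sum>i. f i w p) \<partial>N w) = (\<integral>\<^sup>+p. (\<Sum>i. f i w p * indicator S p) \<partial>N w)"
    by (simp add: ennreal_suminf_multc)
  also have "\<dots> = (\<Sum>i. \<integral>\<^sup>+p\<in>S. f i w p \<partial>N w)"
    using S w f by (intro nn_integral_suminf) auto
  finally show ?thesis by (simp add: NI_def)
qed

text \<open>Predictability is a property of functions of ((s, w), v), whereas for a fixed outcome w
  the integral against \<open>N w\<close> runs over (s, v).\<close>

abbreviation pull :: "((real \<times> 'a) \<times> 'b \<Rightarrow> 'c) \<Rightarrow> 'a \<Rightarrow> real \<times> 'b \<Rightarrow> 'c" where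
  "pull f \<equiv> (\<lambda>w p. f ((fst p, w), snd p))"

definition LI :: "(real \<times> 'b) set \<Rightarrow> ('a \<Rightarrow> real \<times> 'b \<Rightarrow> ennreal) \<Rightarrow> 'a \<Rightarrow> ennreal" where
  "LI S f w = (\<integral>\<^sup>+p\<in>S. f w p \<partial>L)"

lemma pull_measurable_M:
  "f \<in> measurable (PS \<Otimes>\<^sub>M \<nu>) X \<Longrightarrow> (\<lambda>(w, p). pull f w p) \<in> measurable (M \<Otimes>\<^sub>M L) X"
  using predictable_measurable_M[of f X] by (simp add: case_prod_unfold)

lemma pull_section:
  assumes "f \<in> measurable (PS \<Otimes>\<^sub>M \<nu>) X" "w \<in> space M"
  shows "pull f w \<in> measurable L X"
  using measurable_compose[OF measurable_Pair1'[OF assms(2)] pull_measurable_M[OF assms(1)]] by simp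

lemma NI_pull_measurable:
  assumes "S \<in> sets L" "f \<in> BP"
  shows "NI S (pull f) \<in> borel_measurable M"
  by (rule NI_measurable[OF refl assms(1) N_measurable pull_measurable_M[OF assms(2)]])

lemma LI_pull_measurable:
  assumes S: "S \<in> sets L" and f: "f \<in> BP"
  shows "LI S (pull f) \<in> borel_measurable M"
proof -
  have [measurable]: "(\<lambda>(w, p). pull f w p) \<in> borel_measurable (M \<Otimes>\<^sub>M L)" using pull_measurable_M[OF f] .
  have "(\<lambda>(w, p). pull f w p * indicator S p) \<in> borel_measurable (M \<Otimes>\<^sub>M L)" using S by measurable
  from L.borel_measurable_nn_integral[OF this] show ?thesis by (simp add: LI_def[abs_def])
qed

text \<open>On a rectangle over \<open>{s<..t}\<close> with an event \<open>A\<close> of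
  \<open>F s\<close>, the count after \<open>s\<close> is independent of \<open>A\<close>, so both
  sides are \<open>prob A\<close> times an intensity. Dynkin's theorem extends this to all
  predictable sets; the finite intensity of \<open>S\<close> permits the subtraction for
  complements.\<close>

lemma compensation_sets:
  assumes S: "S \<in> sets L" "emeasure L S < \<infinity>" and C: "C \<in> sets (PS \<Otimes>\<^sub>M \<nu>)"
  shows "(\<integral>\<^sup>+w. NI S (pull (indicator C)) w \<partial>M) = (\<integral>\<^sup>+w. LI S (pull (indicator C)) w \<partial>M)"
proof -
  let ?\<Omega> = "({0<..} \<times> space M) \<times> space \<nu>"
  let ?P = "\<lambda>C. C \<in> sets (PS \<Otimes>\<^sub>M \<nu>) \<and> (\<integral>\<^sup>+w. NI S (pull (indicator C)) w \<partial>M) = (\<integral>\<^sup>+w. LI S (pull (indicator C)) w \<partial>M)"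
  have rect: "?P C" if CR: "C \<in> rect_gen" for C
  proof
    show Cs: "C \<in> sets (PS \<Otimes>\<^sub>M \<nu>)" unfolding sets_PS_\<nu> using that by (rule sigma_sets.Basic)
    obtain s t A V where x: "C = ({s<..t} \<times> A) \<times> V" "0 \<le> s" "A \<in> sets (F s)" "V \<in> sets \<nu>" using CR unfolding rect_gen_def by blast
    \<comment> \<open>On the rectangle the integral over \<open>S\<close> reduces to the count of
      \<open>U\<close>, which involves only times after \<open>s\<close>.\<close>
    define U where "U = S \<inter> {s<..t} \<times> V"
    have U: "U \<in> sets L" "U \<subseteq> {s<..t} \<times> UNIV" "U \<subseteq> S" using S box_sets[OF x(2,4)] by (auto simp: U_def)
    have "emeasure L U \<le> emeasure L S" by (rule emeasure_mono) (use U S in auto)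
    then have Uf: "emeasure L U < \<infinity>" using S(2) by (rule le_less_trans)
    have ind: "indicator C ((fst p, w), snd p) * indicator S p = (indicator A w * indicator U p :: ennreal)" for w p
      by (cases p) (auto simp: x U_def indicator_def)
    have Am: "A \<in> events" using x(3) sets_F by blast
    have ip: "indep_past s (\<lambda>w. measure (N w) U)"
      unfolding measure_def by (rule indep_past_compose[OF indep_N[OF x(2) U(1,2)]]) simp
    have Ai: "(indicator A :: 'a \<Rightarrow> real) \<in> borel_measurable (F s)" using x(3) by simp
    have Aint: "integrable M (indicator A :: 'a \<Rightarrow> real)"
      using Am by (intro integrable_real_indicator) (auto simp: emeasure_eq_measure)
    have "AE w in M. NI S (pull (indicator C)) w = ennreal (indicator A w * measure (N w) U)"
      using poisson_AE_finite[OF S]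
    proof (rule AE_mp, intro AE_I2 impI)
      fix w assume w: "w \<in> space M" and fin: "emeasure (N w) S < \<infinity>"
      have "emeasure (N w) U \<le> emeasure (N w) S" by (rule emeasure_mono) (use U S w in auto)
      then have "emeasure (N w) U < \<infinity>" using fin by (rule le_less_trans)
      then have "emeasure (N w) U = ennreal (measure (N w) U)" by (intro emeasure_eq_ennreal_measure) auto
      then have "(\<integral>\<^sup>+p. indicator A w * indicator U p \<partial>N w) = ennreal (indicator A w * measure (N w) U)"
        using U w by (subst nn_integral_cmult_indicator) (auto simp: indicator_def)
      then show "NI S (pull (indicator C)) w = ennreal (indicator A w * measure (N w) U)"
        using fin by (simp add: NI_def ind)
    qed
    then have "(\<integral>\<^sup>+w. NI S (pull (indicator C)) w \<partial>M) = (\<integral>\<^sup>+w. ennreal (indicator A w * measure (N w) U) \<partial>M)"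
      by (rule nn_integral_cong_AE)
    also have "\<dots> = ennreal (\<integral>w. indicator A w * measure (N w) U \<partial>M)"
    proof (rule nn_integral_eq_integral)
      show "integrable M (\<lambda>w. indicator A w * measure (N w) U)"
        by (rule indep_past_integral(1)[OF ip poisson_moments(2)[OF U(1) Uf] Ai Aint])
    qed simp
    also have "(\<integral>w. indicator A w * measure (N w) U \<partial>M) = prob A * measure L U"
    proof -
      from indep_past_integral(2)[OF ip poisson_moments(2)[OF U(1) Uf] Ai Aint] show ?thesis
        using Am sets.sets_into_space[OF Am] by (simp add: poisson_moments(3)[OF U(1) Uf] Int_absorb2)
    qed
    also have "ennreal (prob A * measure L U) = emeasure L U * emeasure M A"
      using Uf by (simp add: ennreal_mult emeasure_eq_measure emeasure_eq_ennreal_measure top.not_eq_extremum mult.commute)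
    also have "\<dots> = (\<integral>\<^sup>+w. emeasure L U * indicator A w \<partial>M)" using Am by (simp add: nn_integral_cmult_indicator)
    also have "\<dots> = (\<integral>\<^sup>+w. LI S (pull (indicator C)) w \<partial>M)"
      unfolding LI_def ind using U by (intro nn_integral_cong) (simp add: nn_integral_cmult_indicator mult.commute)
    finally show "(\<integral>\<^sup>+w. NI S (pull (indicator C)) w \<partial>M) = (\<integral>\<^sup>+w. LI S (pull (indicator C)) w \<partial>M)" .
  qed
  have NIS: "NI S (\<lambda>w p. 1) w = ennreal (measure (N w) S)" if "w \<in> space M" "emeasure (N w) S < \<infinity>" for w
    using that S by (simp add: NI_def emeasure_eq_ennreal_measure top.not_eq_extremum)
  have tot: "(\<integral>\<^sup>+w. NI S (\<lambda>w p. 1) w \<partial>M) = emeasure L S"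
  proof -
    have "(\<integral>\<^sup>+w. NI S (\<lambda>w p. 1) w \<partial>M) = (\<integral>\<^sup>+w. ennreal (measure (N w) S) \<partial>M)"
      by (rule nn_integral_cong_AE, rule AE_mp[OF poisson_AE_finite[OF S]]) (use NIS in auto)
    also have "\<dots> = ennreal (measure L S)"
      using poisson_moments(2,3)[OF S] by (subst nn_integral_eq_integral) auto
    finally show ?thesis using S(2) by (simp add: emeasure_eq_ennreal_measure top.not_eq_extremum)
  qed
  have secm: "pull (indicator C) w \<in> borel_measurable L" if "C \<in> sets (PS \<Otimes>\<^sub>M \<nu>)" "w \<in> space M" for C w
    by (rule pull_section) (use that in auto)
  show ?thesis
  proof -
    have "rect_gen \<subseteq> Pow ?\<Omega>" using rect sets.sets_into_space by (fastforce simp: space_pair_measure space_PS)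
    from Int_stable_rect_gen this C[unfolded sets_PS_\<nu>] have "?P C"
    proof (induction rule: sigma_sets_induct_disjoint)
      case (basic A)
      then show ?case by (rule rect)
    next
      case empty
      have "NI S (pull (indicator {})) = (\<lambda>w. 0)" by (auto simp: NI_def fun_eq_iff)
      then show ?case by (simp add: LI_def)
    next
      case (compl C)
      then have C: "C \<in> sets (PS \<Otimes>\<^sub>M \<nu>)" by simp
      have C': "?\<Omega> - C \<in> sets (PS \<Otimes>\<^sub>M \<nu>)" using sets.compl_sets[OF C] by (simp add: space_pair_measure space_PS)
      have one: "pull (indicator C) w p + pull (indicator (?\<Omega> - C)) w p = (1::ennreal)" if "w \<in> space M" "p \<in> S" for w p
        using that sets.sets_into_space[OF S(1)] by (auto simp: indicator_def space_L)
      have n: "NI S (pull (indicator C)) w + NI S (pull (indicator (?\<Omega> - C))) w = NI S (\<lambda>w p. 1) w" if w: "w \<in> space M" for w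
      proof -
        have "NI S (\<lambda>w p. pull (indicator C) w p + pull (indicator (?\<Omega> - C)) w p) w = NI S (\<lambda>w p. 1) w"
          unfolding NI_def using one[OF w] by (intro if_cong refl nn_integral_cong) (auto simp: indicator_def)
        then show ?thesis using NI_add[of S w "pull (indicator C)" "pull (indicator (?\<Omega> - C))", OF S(1) w secm[OF C w] secm[OF C' w]] by simp
      qed
      have l: "LI S (pull (indicator C)) w + LI S (pull (indicator (?\<Omega> - C))) w = emeasure L S" if w: "w \<in> space M" for w
      proof -
        have "LI S (pull (indicator C)) w + LI S (pull (indicator (?\<Omega> - C))) w = (\<integral>\<^sup>+p. pull (indicator C) w p * indicator S p + pull (indicator (?\<Omega> - C)) w p * indicator S p \<partial>L)"
          unfolding LI_def
          by (rule nn_integral_add[symmetric]; intro borel_measurable_times_ennreal borel_measurable_indicator secm C C' w S(1))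
        also have "\<dots> = (\<integral>\<^sup>+p. indicator S p \<partial>L)"
        proof (rule nn_integral_cong)
          fix p
          show "pull (indicator C) w p * indicator S p + pull (indicator (?\<Omega> - C)) w p * indicator S p = (indicator S p :: ennreal)"
          proof (cases "p \<in> S")
            case True then show ?thesis using one[OF w True] by simp
          qed simp
        qed
        finally show ?thesis using S by simp
      qed
      have "(\<integral>\<^sup>+w. NI S (pull (indicator C)) w \<partial>M) + (\<integral>\<^sup>+w. NI S (pull (indicator (?\<Omega> - C))) w \<partial>M) = (\<integral>\<^sup>+w. NI S (\<lambda>w p. 1) w \<partial>M)"
        using C C' by (subst nn_integral_add[symmetric]) (auto intro!: NI_pull_measurable S nn_integral_cong n)
      also have "\<dots> = (\<integral>\<^sup>+w. emeasure L S \<partial>M)" by (simp add: tot emeasure_space_1)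
      also have "\<dots> = (\<integral>\<^sup>+w. LI S (pull (indicator C)) w + LI S (pull (indicator (?\<Omega> - C))) w \<partial>M)"
        by (rule nn_integral_cong) (rule l[symmetric])
      also have "\<dots> = (\<integral>\<^sup>+w. LI S (pull (indicator C)) w \<partial>M) + (\<integral>\<^sup>+w. LI S (pull (indicator (?\<Omega> - C))) w \<partial>M)"
        using C C' by (intro nn_integral_add LI_pull_measurable S) auto
      finally have e: "(\<integral>\<^sup>+w. NI S (pull (indicator C)) w \<partial>M) + (\<integral>\<^sup>+w. NI S (pull (indicator (?\<Omega> - C))) w \<partial>M) =
        (\<integral>\<^sup>+w. LI S (pull (indicator C)) w \<partial>M) + (\<integral>\<^sup>+w. LI S (pull (indicator (?\<Omega> - C))) w \<partial>M)" .
      have "(\<integral>\<^sup>+w. LI S (pull (indicator C)) w \<partial>M) \<le> (\<integral>\<^sup>+w. emeasure L S \<partial>M)"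
        by (intro nn_integral_mono) (simp flip: l)
      also have "\<dots> < top" using S(2) by (simp add: emeasure_space_1)
      finally have fin: "(\<integral>\<^sup>+w. LI S (pull (indicator C)) w \<partial>M) \<noteq> \<infinity>" by simp
      have IH: "(\<integral>\<^sup>+w. NI S (pull (indicator C)) w \<partial>M) = (\<integral>\<^sup>+w. LI S (pull (indicator C)) w \<partial>M)" using compl(2) by blast
      have "(\<integral>\<^sup>+w. NI S (pull (indicator (?\<Omega> - C))) w \<partial>M) = (\<integral>\<^sup>+w. LI S (pull (indicator (?\<Omega> - C))) w \<partial>M)"
        using e fin unfolding IH ennreal_add_left_cancel by blast
      with C' show ?case by simp
    next
      case (union A)
      then have A: "A i \<in> sets (PS \<Otimes>\<^sub>M \<nu>)" for i by auto
      then have U: "(\<Union>i. A i) \<in> sets (PS \<Otimes>\<^sub>M \<nu>)" by auto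
      have ind: "pull (indicator (\<Union>i. A i)) w p = (\<Sum>i. pull (indicator (A i)) w p :: ennreal)" for w p
        by (rule suminf_indicator[OF union(1), symmetric])
      have "(\<integral>\<^sup>+w. NI S (pull (indicator (\<Union>i. A i))) w \<partial>M) = (\<integral>\<^sup>+w. (\<Sum>i. NI S (pull (indicator (A i))) w) \<partial>M)"
        unfolding ind by (intro nn_integral_cong NI_suminf[where f = "\<lambda>i. pull (indicator (A i))", OF S(1)] secm A)
      also have "\<dots> = (\<Sum>i. \<integral>\<^sup>+w. NI S (pull (indicator (A i))) w \<partial>M)"
        by (intro nn_integral_suminf NI_pull_measurable S) (use A in auto)
      also have "\<dots> = (\<Sum>i. \<integral>\<^sup>+w. LI S (pull (indicator (A i))) w \<partial>M)" using union(3) by simp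
      also have "\<dots> = (\<integral>\<^sup>+w. (\<Sum>i. LI S (pull (indicator (A i))) w) \<partial>M)"
        by (intro nn_integral_suminf[symmetric] LI_pull_measurable S) (use A in auto)
      also have "\<dots> = (\<integral>\<^sup>+w. LI S (pull (indicator (\<Union>i. A i))) w \<partial>M)"
      proof (rule nn_integral_cong)
        fix w assume w: "w \<in> space M"
        have "(\<Sum>i. LI S (pull (indicator (A i))) w) = (\<integral>\<^sup>+p. (\<Sum>i. pull (indicator (A i)) w p * indicator S p) \<partial>L)"
          unfolding LI_def
          by (rule nn_integral_suminf[symmetric]; intro borel_measurable_times_ennreal borel_measurable_indicator secm A w S(1))
        then show "(\<Sum>i. LI S (pull (indicator (A i))) w) = LI S (pull (indicator (\<Union>i. A i))) w"
          unfolding LI_def ind by (simp add: ennreal_suminf_multc)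
      qed
      finally show ?case using U by blast
    qed
    then show ?thesis by blast
  qed
qed

lemma NI_cmult:
  assumes "S \<in> sets L" "w \<in> space M" "f w \<in> borel_measurable L"
  shows "NI S (\<lambda>w p. c * f w p) w = c * NI S f w"
proof -
  have "(\<integral>\<^sup>+p\<in>S. (c * f w p) \<partial>N w) = (\<integral>\<^sup>+p. c * (f w p * indicator S p) \<partial>N w)" by (simp add: mult.assoc)
  also have "\<dots> = c * (\<integral>\<^sup>+p\<in>S. f w p \<partial>N w)" using assms by (intro nn_integral_cmult) auto
  finally show ?thesis by (simp add: NI_def)
qed

lemma NI_SUP:
  assumes S: "S \<in> sets L" and w: "w \<in> space M" and f: "\<And>i::nat. f i w \<in> borel_measurable L" and inc: "incseq (\<lambda>i. f i w)"
  shows "NI S (\<lambda>w p. SUP i. f i w p) w = (SUP i. NI S (f i) w)"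
proof -
  have "(\<integral>\<^sup>+p\<in>S. (SUP i. f i w p) \<partial>N w) = (\<integral>\<^sup>+p. (SUP i. f i w p * indicator S p) \<partial>N w)"
    by (simp add: SUP_mult_right_ennreal)
  also have "\<dots> = (SUP i. \<integral>\<^sup>+p\<in>S. f i w p \<partial>N w)"
    using S w f inc by (intro nn_integral_monotone_convergence_SUP) (auto simp: incseq_def le_fun_def intro!: mult_right_mono)
  finally show ?thesis by (simp add: NI_def)
qed

lemma LI_add:
  assumes "S \<in> sets L" "f w \<in> borel_measurable L" "g w \<in> borel_measurable L"
  shows "LI S (\<lambda>w p. f w p + g w p) w = LI S f w + LI S g w"
  using assms by (simp add: LI_def distrib_right nn_integral_add)

lemma LI_cmult:
  assumes "S \<in> sets L" "f w \<in> borel_measurable L"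
  shows "LI S (\<lambda>w p. c * f w p) w = c * LI S f w"
proof -
  have "LI S (\<lambda>w p. c * f w p) w = (\<integral>\<^sup>+p. c * (f w p * indicator S p) \<partial>L)" by (simp add: LI_def mult.assoc)
  also have "\<dots> = c * LI S f w" unfolding LI_def using assms by (intro nn_integral_cmult) auto
  finally show ?thesis .
qed

lemma LI_SUP:
  assumes S: "S \<in> sets L" and f: "\<And>i::nat. f i w \<in> borel_measurable L" and inc: "incseq (\<lambda>i. f i w)"
  shows "LI S (\<lambda>w p. SUP i. f i w p) w = (SUP i. LI S (f i) w)"
proof -
  have "LI S (\<lambda>w p. SUP i. f i w p) w = (\<integral>\<^sup>+p. (SUP i. f i w p * indicator S p) \<partial>L)"
    by (simp add: LI_def SUP_mult_right_ennreal)
  also have "\<dots> = (SUP i. LI S (f i) w)"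
    unfolding LI_def using S f inc by (intro nn_integral_monotone_convergence_SUP) (auto simp: incseq_def le_fun_def intro!: mult_right_mono)
  finally show ?thesis .
qed

lemma compensation:
  assumes S: "S \<in> sets L" "emeasure L S < \<infinity>" and f: "f \<in> BP"
  shows "(\<integral>\<^sup>+w. NI S (pull f) w \<partial>M) = (\<integral>\<^sup>+w. LI S (pull f) w \<partial>M)"
  using f
proof (induction rule: borel_measurable_induct)
  case (cong f g)
  have e: "pull f w p = pull g w p" if "w \<in> space M" "p \<in> S" for w p
    using cong(3)[of "((fst p, w), snd p)"] that sets.sets_into_space[OF S(1)]
    by (auto simp: space_pair_measure space_PS space_L)
  have i: "NI S (pull f) w = NI S (pull g) w" "LI S (pull f) w = LI S (pull g) w" if "w \<in> space M" for w
    unfolding NI_def LI_def by (intro if_cong refl nn_integral_cong; use e that in \<open>simp add: indicator_def\<close>)+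
  have "(\<integral>\<^sup>+w. NI S (pull f) w \<partial>M) = (\<integral>\<^sup>+w. NI S (pull g) w \<partial>M)" "(\<integral>\<^sup>+w. LI S (pull f) w \<partial>M) = (\<integral>\<^sup>+w. LI S (pull g) w \<partial>M)"
    by (intro nn_integral_cong i; assumption)+
  then show ?case using cong(4) by simp
next
  case (set A)
  then show ?case using compensation_sets[OF S] by simp
next
  case (mult u c)
  have "(\<integral>\<^sup>+w. NI S (pull (\<lambda>x. c * u x)) w \<partial>M) = (\<integral>\<^sup>+w. c * NI S (pull u) w \<partial>M)"
    by (intro nn_integral_cong NI_cmult[where f = "pull u"] S pull_section[OF mult(2)])
  also have "\<dots> = c * (\<integral>\<^sup>+w. NI S (pull u) w \<partial>M)"
    by (intro nn_integral_cmult NI_pull_measurable S mult)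
  also have "\<dots> = c * (\<integral>\<^sup>+w. LI S (pull u) w \<partial>M)" by (simp only: mult)
  also have "\<dots> = (\<integral>\<^sup>+w. c * LI S (pull u) w \<partial>M)"
    by (intro nn_integral_cmult[symmetric] LI_pull_measurable S mult)
  also have "\<dots> = (\<integral>\<^sup>+w. LI S (pull (\<lambda>x. c * u x)) w \<partial>M)"
    by (intro nn_integral_cong LI_cmult[where f = "pull u", symmetric] S pull_section[OF mult(2)])
  finally show ?case .
next
  case (add u v)
  have "(\<integral>\<^sup>+w. NI S (pull (\<lambda>x. v x + u x)) w \<partial>M) = (\<integral>\<^sup>+w. NI S (pull v) w + NI S (pull u) w \<partial>M)"
    by (intro nn_integral_cong NI_add[where f = "pull v" and g = "pull u"] S pull_section add)
  also have "\<dots> = (\<integral>\<^sup>+w. NI S (pull v) w \<partial>M) + (\<integral>\<^sup>+w. NI S (pull u) w \<partial>M)"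
    by (intro nn_integral_add NI_pull_measurable S add)
  also have "\<dots> = (\<integral>\<^sup>+w. LI S (pull v) w \<partial>M) + (\<integral>\<^sup>+w. LI S (pull u) w \<partial>M)" by (simp only: add)
  also have "\<dots> = (\<integral>\<^sup>+w. LI S (pull v) w + LI S (pull u) w \<partial>M)"
    by (intro nn_integral_add[symmetric] LI_pull_measurable S add)
  also have "\<dots> = (\<integral>\<^sup>+w. LI S (pull (\<lambda>x. v x + u x)) w \<partial>M)"
    by (intro nn_integral_cong LI_add[where f = "pull v" and g = "pull u", symmetric] S pull_section add)
  finally show ?case .
next
  case (seq U)
  have p: "pull (SUP i. U i) w p = (SUP i. pull (U i) w p)" for w p by (rule SUP_apply)
  have inc: "incseq (\<lambda>i. pull (U i) w)" for w using \<open>incseq U\<close> by (auto simp: incseq_def le_fun_def)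
  have NIinc: "incseq (\<lambda>i. NI S (pull (U i)))" "incseq (\<lambda>i. LI S (pull (U i)))"
    using \<open>incseq U\<close> unfolding incseq_def le_fun_def NI_def LI_def by (auto intro!: nn_integral_mono mult_right_mono)
  have "(\<integral>\<^sup>+w. NI S (pull (SUP i. U i)) w \<partial>M) = (\<integral>\<^sup>+w. (SUP i. NI S (pull (U i)) w) \<partial>M)"
    unfolding p by (intro nn_integral_cong NI_SUP[where f = "\<lambda>i. pull (U i)"] S pull_section seq inc)
  also have "\<dots> = (SUP i. \<integral>\<^sup>+w. NI S (pull (U i)) w \<partial>M)"
    by (intro nn_integral_monotone_convergence_SUP NIinc NI_pull_measurable S seq)
  also have "\<dots> = (SUP i. \<integral>\<^sup>+w. LI S (pull (U i)) w \<partial>M)" by (simp only: seq.IH)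
  also have "\<dots> = (\<integral>\<^sup>+w. (SUP i. LI S (pull (U i)) w) \<partial>M)"
    by (intro nn_integral_monotone_convergence_SUP[symmetric] NIinc LI_pull_measurable S seq)
  also have "\<dots> = (\<integral>\<^sup>+w. LI S (pull (SUP i. U i)) w \<partial>M)"
    unfolding p by (intro nn_integral_cong LI_SUP[where f = "\<lambda>i. pull (U i)", symmetric] S pull_section seq inc)
  finally show ?case .
qed

section \<open>Signed compensated integrals over sets of finite intensity\<close>

definition RI :: "(real \<times> 'b) set \<Rightarrow> ('a \<Rightarrow> real \<times> 'b \<Rightarrow> real) \<Rightarrow> 'a \<Rightarrow> real" where
  "RI S f w = (if emeasure (N w) S < \<infinity> then
     (\<integral>p. indicator S p * f w p \<partial>N w) - (\<integral>p. indicator S p * f w p \<partial>L) else 0)"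

lemma bounded_set_integrable:
  fixes f :: "'c \<Rightarrow> real"
  assumes "S \<in> sets X" "emeasure X S < \<infinity>" "f \<in> borel_measurable X" "\<And>p. p \<in> S \<Longrightarrow> \<bar>f p\<bar> \<le> c"
  shows "integrable X (\<lambda>p. indicator S p * f p)"
  using integrableI_bounded_set_indicator[of S X f c] assms by simp

lemma bounded_set_integral_le:
  fixes f :: "'c \<Rightarrow> real"
  assumes S: "S \<in> sets X" "emeasure X S < \<infinity>" and f: "f \<in> borel_measurable X" "\<And>p. p \<in> S \<Longrightarrow> \<bar>f p\<bar> \<le> c"
  shows "\<bar>\<integral>p. indicator S p * f p \<partial>X\<bar> \<le> c * measure X S"
proof -
  have "\<bar>\<integral>p. indicator S p * f p \<partial>X\<bar> \<le> (\<integral>p. indicator S p * c \<partial>X)"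
    unfolding real_norm_def[symmetric]
  proof (rule order_trans[OF integral_norm_bound integral_mono])
    show "integrable X (\<lambda>p. norm (indicator S p * f p))" by (rule integrable_norm) (rule bounded_set_integrable[OF S f])
    show "integrable X (\<lambda>p. indicator S p * c)" using S by (intro integrable_mult_left integrable_real_indicator) auto
    show "norm (indicator S p * f p) \<le> indicator S p * c" for p using f(2) by (auto simp: indicator_def)
  qed
  also have "\<dots> = c * measure X S" using S by simp
  finally show ?thesis .
qed

text \<open>Positive and negative parts express the signed integral through \<open>NI\<close> and
  \<open>LI\<close>, whose measurability and expectations are known.\<close>

lemma RI_alt:
  assumes S: "S \<in> sets L" "emeasure L S < \<infinity>" and f: "f w \<in> borel_measurable L" "\<And>p. p \<in> S \<Longrightarrow> \<bar>f w p\<bar> \<le> c" and w: "w \<in> space M"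
  shows "RI S f w = (if emeasure (N w) S < \<infinity> then
     (enn2real (NI S (\<lambda>w p. ennreal (f w p)) w) - enn2real (NI S (\<lambda>w p. ennreal (- f w p)) w)) -
     (enn2real (LI S (\<lambda>w p. ennreal (f w p)) w) - enn2real (LI S (\<lambda>w p. ennreal (- f w p)) w)) else 0)"
proof -
  have e: "ennreal (indicator S p * f w p) = ennreal (f w p) * indicator S p" "ennreal (- (indicator S p * f w p)) = ennreal (- f w p) * indicator S p" for p
    by (auto simp: indicator_def)
  have "integrable L (\<lambda>p. indicator S p * f w p)" by (rule bounded_set_integrable[OF S f])
  from real_lebesgue_integral_def[OF this] have l: "(\<integral>p. indicator S p * f w p \<partial>L) = enn2real (LI S (\<lambda>w p. ennreal (f w p)) w) - enn2real (LI S (\<lambda>w p. ennreal (- f w p)) w)"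
    by (simp add: LI_def e)
  show ?thesis
  proof (cases "emeasure (N w) S < \<infinity>")
    case True
    have "integrable (N w) (\<lambda>p. indicator S p * f w p)" using S f w True by (intro bounded_set_integrable[where c = c]) auto
    from real_lebesgue_integral_def[OF this] have "(\<integral>p. indicator S p * f w p \<partial>N w) = enn2real (NI S (\<lambda>w p. ennreal (f w p)) w) - enn2real (NI S (\<lambda>w p. ennreal (- f w p)) w)"
      using True by (simp add: NI_def e)
    then show ?thesis using l True by (simp add: RI_def)
  qed (simp add: RI_def)
qed

lemma RI_bound:
  assumes S: "S \<in> sets L" "emeasure L S < \<infinity>" and f: "f w \<in> borel_measurable L" "\<And>p. p \<in> S \<Longrightarrow> \<bar>f w p\<bar> \<le> c" and w: "w \<in> space M" and c: "0 \<le> c"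
  shows "\<bar>RI S f w\<bar> \<le> c * (measure (N w) S + measure L S)"
proof (cases "emeasure (N w) S < \<infinity>")
  case True
  have "\<bar>\<integral>p. indicator S p * f w p \<partial>N w\<bar> \<le> c * measure (N w) S"
    using S f w True by (intro bounded_set_integral_le) auto
  moreover have "\<bar>\<integral>p. indicator S p * f w p \<partial>L\<bar> \<le> c * measure L S"
    using S f by (intro bounded_set_integral_le) auto
  ultimately show ?thesis using True by (simp add: RI_def algebra_simps)
next
  case False
  then show ?thesis using c by (simp add: RI_def)
qed

lemma RI_measurable:
  assumes S: "S \<in> sets L" "emeasure L S < \<infinity>"
    and G: "space G = space M" "\<And>A. A \<in> sets L \<Longrightarrow> A \<subseteq> S \<Longrightarrow> (\<lambda>w. emeasure (N w) A) \<in> borel_measurable G"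
    and f: "(\<lambda>(w, p). f w p) \<in> borel_measurable (G \<Otimes>\<^sub>M L)" "\<And>w p. w \<in> space M \<Longrightarrow> p \<in> S \<Longrightarrow> \<bar>f w p\<bar> \<le> c"
  shows "RI S f \<in> borel_measurable G"
proof -
  have [measurable]: "(\<lambda>w. emeasure (N w) S) \<in> borel_measurable G" using G(2)[OF S(1)] by simp
  note [measurable] = f(1) S(1)
  have 1: "(\<lambda>(w, p). ennreal (f w p)) \<in> borel_measurable (G \<Otimes>\<^sub>M L)" "(\<lambda>(w, p). ennreal (- f w p)) \<in> borel_measurable (G \<Otimes>\<^sub>M L)"
    by measurable
  have n: "NI S (\<lambda>w p. ennreal (f w p)) \<in> borel_measurable G" "NI S (\<lambda>w p. ennreal (- f w p)) \<in> borel_measurable G"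
    by (rule NI_measurable[OF G(1) S(1) G(2) 1(1)] NI_measurable[OF G(1) S(1) G(2) 1(2)]; assumption)+
  have "(\<lambda>(w, p). ennreal (f w p) * indicator S p) \<in> borel_measurable (G \<Otimes>\<^sub>M L)" "(\<lambda>(w, p). ennreal (- f w p) * indicator S p) \<in> borel_measurable (G \<Otimes>\<^sub>M L)"
    by measurable
  from this[THEN L.borel_measurable_nn_integral]
  have l: "LI S (\<lambda>w p. ennreal (f w p)) \<in> borel_measurable G" "LI S (\<lambda>w p. ennreal (- f w p)) \<in> borel_measurable G"
    by (simp_all add: LI_def[abs_def])
  have "(\<lambda>w. if emeasure (N w) S < \<infinity> then
     (enn2real (NI S (\<lambda>w p. ennreal (f w p)) w) - enn2real (NI S (\<lambda>w p. ennreal (- f w p)) w)) -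
     (enn2real (LI S (\<lambda>w p. ennreal (f w p)) w) - enn2real (LI S (\<lambda>w p. ennreal (- f w p)) w)) else 0) \<in> borel_measurable G"
    using n l by measurable
  then show ?thesis
  proof (rule measurable_cong[THEN iffD2, rotated])
    fix w assume w: "w \<in> space G"
    have "f w \<in> borel_measurable L" using measurable_compose[OF measurable_Pair1'[OF w] f(1)] by simp
    from RI_alt[of S f w, OF S this f(2)] show "RI S f w = (if emeasure (N w) S < \<infinity> then
     (enn2real (NI S (\<lambda>w p. ennreal (f w p)) w) - enn2real (NI S (\<lambda>w p. ennreal (- f w p)) w)) -
     (enn2real (LI S (\<lambda>w p. ennreal (f w p)) w) - enn2real (LI S (\<lambda>w p. ennreal (- f w p)) w)) else 0)"
      using w by (simp add: G(1))
  qed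
qed

lemma RI_pull_measurable:
  assumes "S \<in> sets L" "emeasure L S < \<infinity>" "f \<in> BP" "\<And>x. \<bar>f x\<bar> \<le> c"
  shows "RI S (pull f) \<in> borel_measurable M"
  by (rule RI_measurable[where c = c, OF assms(1,2) refl N_measurable]) (use assms pull_measurable_M in auto)

lemma total_mass_square_integrable:
  assumes S: "S \<in> sets L" "emeasure L S < \<infinity>"
  shows "integrable M (\<lambda>w. (measure (N w) S + measure L S)\<^sup>2)"
proof -
  note m = poisson_moments[OF S]
  \<comment> \<open>Rewritten through the first moment and the second factorial moment of the
    count.\<close>
  have "(measure (N w) S + measure L S)\<^sup>2 = measure (N w) S * (measure (N w) S - 1) + (1 + 2 * measure L S) * measure (N w) S + (measure L S)\<^sup>2" for w
    by (simp add: power2_eq_square algebra_simps)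
  then show ?thesis using m(2,4) by simp
qed

lemma RI_square_integrable:
  assumes S: "S \<in> sets L" "emeasure L S < \<infinity>" and f: "f \<in> BP" "\<And>x. \<bar>f x\<bar> \<le> c"
  shows "integrable M (\<lambda>w. (RI S (pull f) w)\<^sup>2)" "integrable M (RI S (pull f))"
proof -
  have c: "0 \<le> c" using f(2)[of undefined] by simp
  have m[measurable]: "RI S (pull f) \<in> borel_measurable M" by (rule RI_pull_measurable[OF S f])
  have b: "\<bar>RI S (pull f) w\<bar> \<le> c * (measure (N w) S + measure L S)" if "w \<in> space M" for w
    by (rule RI_bound[where f = "pull f", OF S pull_section[OF f(1) that] f(2) that c])
  show i: "integrable M (\<lambda>w. (RI S (pull f) w)\<^sup>2)"
  proof (rule Bochner_Integration.integrable_bound)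
    show "integrable M (\<lambda>w. c\<^sup>2 * (measure (N w) S + measure L S)\<^sup>2)" using total_mass_square_integrable[OF S] by simp
    show "AE w in M. norm ((RI S (pull f) w)\<^sup>2) \<le> norm (c\<^sup>2 * (measure (N w) S + measure L S)\<^sup>2)"
    proof (rule AE_I2)
      fix w assume "w \<in> space M"
      from power_mono[OF b[OF this], of 2] show "norm ((RI S (pull f) w)\<^sup>2) \<le> norm (c\<^sup>2 * (measure (N w) S + measure L S)\<^sup>2)"
        by (simp add: power_mult_distrib)
    qed
  qed measurable
  from mult_product_integrable[OF m borel_measurable_const i, of 1] show "integrable M (RI S (pull f))" by simp
qed

text \<open>The compensation formula applied to the positive and to the negative part; the bound
  \<open>c\<close> on a set of finite intensity keeps all terms finite, so that they may be
  subtracted.\<close>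

lemma expectation_RI:
  assumes S: "S \<in> sets L" "emeasure L S < \<infinity>" and f: "f \<in> BP" "\<And>x. \<bar>f x\<bar> \<le> c"
  shows "(\<integral>w. RI S (pull f) w \<partial>M) = 0"
proof -
  have c: "0 \<le> c" using f(2)[of undefined] by simp
  have part: "integrable M (\<lambda>w. enn2real (NI S (pull g) w)) \<and> integrable M (\<lambda>w. enn2real (LI S (pull g) w)) \<and>
      (\<integral>w. enn2real (NI S (pull g) w) \<partial>M) = (\<integral>w. enn2real (LI S (pull g) w) \<partial>M)"
    if g: "g \<in> BP" "\<And>x. g x \<le> ennreal c" for g
  proof -
    note NIm = NI_pull_measurable[OF S(1) g(1)] and LIm = LI_pull_measurable[OF S(1) g(1)]
    have lb: "LI S (pull g) w \<le> ennreal c * emeasure L S" for w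
    proof -
      have "LI S (pull g) w \<le> (\<integral>\<^sup>+p. ennreal c * indicator S p \<partial>L)"
        unfolding LI_def by (intro nn_integral_mono mult_right_mono g) auto
      then show ?thesis using S by (simp add: nn_integral_cmult_indicator)
    qed
    have nb: "NI S (pull g) w < \<infinity>" if "w \<in> space M" for w
    proof (cases "emeasure (N w) S < \<infinity>")
      case True
      have "NI S (pull g) w \<le> (\<integral>\<^sup>+p. ennreal c * indicator S p \<partial>N w)"
        using True unfolding NI_def by (auto intro!: nn_integral_mono mult_right_mono g)
      also have "\<dots> = ennreal c * emeasure (N w) S" using S that by (simp add: nn_integral_cmult_indicator)
      also have "\<dots> < \<infinity>" using True by (simp add: ennreal_mult_less_top)
      finally show ?thesis .
    qed (simp add: NI_def)
    have cS: "ennreal c * emeasure L S < \<infinity>" using S by (simp add: ennreal_mult_less_top)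
    have ll: "LI S (pull g) w < \<infinity>" for w using lb cS by (rule le_less_trans)
    have "(\<integral>\<^sup>+w. LI S (pull g) w \<partial>M) \<le> (\<integral>\<^sup>+w. ennreal c * emeasure L S \<partial>M)" by (intro nn_integral_mono lb)
    also have "\<dots> < \<infinity>" using cS by (simp add: emeasure_space_1)
    finally have fin: "(\<integral>\<^sup>+w. LI S (pull g) w \<partial>M) < \<infinity>" .
    have 1: "(\<integral>\<^sup>+w. ennreal (enn2real (NI S (pull g) w)) \<partial>M) = (\<integral>\<^sup>+w. NI S (pull g) w \<partial>M)"
      using nb by (intro nn_integral_cong) simp
    have 2: "(\<integral>\<^sup>+w. ennreal (enn2real (LI S (pull g) w)) \<partial>M) = (\<integral>\<^sup>+w. LI S (pull g) w \<partial>M)"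
      using ll by (intro nn_integral_cong) simp
    have e: "(\<integral>\<^sup>+w. ennreal (enn2real (NI S (pull g) w)) \<partial>M) = (\<integral>\<^sup>+w. ennreal (enn2real (LI S (pull g) w)) \<partial>M)"
      unfolding 1 2 by (rule compensation[OF S g(1)])
    have i2: "integrable M (\<lambda>w. enn2real (LI S (pull g) w))"
      using LIm fin by (intro integrableI_nonneg) (auto simp: 2)
    have i1: "integrable M (\<lambda>w. enn2real (NI S (pull g) w))"
      using NIm fin e by (intro integrableI_nonneg) (auto simp: 2)
    have "(\<integral>w. enn2real (NI S (pull g) w) \<partial>M) = (\<integral>w. enn2real (LI S (pull g) w) \<partial>M)"
      using e i1 i2 NIm LIm by (subst (1 2) integral_eq_nn_integral) auto
    with i1 i2 show ?thesis by blast
  qed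
  have gp: "(\<lambda>x. ennreal (f x)) \<in> BP" "(\<lambda>x. ennreal (- f x)) \<in> BP"
    using f(1) by measurable
  have gb: "ennreal (f x) \<le> ennreal c" "ennreal (- f x) \<le> ennreal c" for x
    using f(2)[of x] by (auto intro!: ennreal_leI)
  note p = part[OF gp(1) gb(1)] and n = part[OF gp(2) gb(2)]
  have "AE w in M. RI S (pull f) w =
     (enn2real (NI S (pull (\<lambda>x. ennreal (f x))) w) - enn2real (NI S (pull (\<lambda>x. ennreal (- f x))) w)) -
     (enn2real (LI S (pull (\<lambda>x. ennreal (f x))) w) - enn2real (LI S (pull (\<lambda>x. ennreal (- f x))) w))"
    using poisson_AE_finite[OF S]
  proof (rule AE_mp, intro AE_I2 impI)
    fix w assume w: "w \<in> space M" and fin: "emeasure (N w) S < \<infinity>"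
    from RI_alt[of S "pull f" w c, OF S pull_section[OF f(1) w] f(2) w] fin
    show "RI S (pull f) w =
     (enn2real (NI S (pull (\<lambda>x. ennreal (f x))) w) - enn2real (NI S (pull (\<lambda>x. ennreal (- f x))) w)) -
     (enn2real (LI S (pull (\<lambda>x. ennreal (f x))) w) - enn2real (LI S (pull (\<lambda>x. ennreal (- f x))) w))" by simp
  qed
  then have "(\<integral>w. RI S (pull f) w \<partial>M) = (\<integral>w. (enn2real (NI S (pull (\<lambda>x. ennreal (f x))) w) - enn2real (NI S (pull (\<lambda>x. ennreal (- f x))) w)) -
     (enn2real (LI S (pull (\<lambda>x. ennreal (f x))) w) - enn2real (LI S (pull (\<lambda>x. ennreal (- f x))) w)) \<partial>M)"
    using p n RI_pull_measurable[OF S f] by (intro integral_cong_AE) (auto intro!: borel_measurable_diff dest: borel_measurable_integrable)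
  also have "\<dots> = 0" using p n by simp
  finally show ?thesis .
qed

section \<open>The second moment of compensated integrals\<close>

lemma box_finite:
  assumes "0 \<le> a" "V \<in> sets \<nu>" "emeasure \<nu> V < \<infinity>"
  shows "{a<..b} \<times> V \<in> sets L" "emeasure L ({a<..b} \<times> V) < \<infinity>"
proof -
  show "{a<..b} \<times> V \<in> sets L" by (rule box_sets) fact+
  show "emeasure L ({a<..b} \<times> V) < \<infinity>"
  proof (cases "a \<le> b")
    case True
    then show ?thesis using assms emeasure_box[of a b V] by (simp add: ennreal_mult_less_top)
  qed simp
qed

lemma RI_split:
  assumes V: "V \<in> sets \<nu>" "emeasure \<nu> V < \<infinity>" and t: "0 \<le> a" "a \<le> b" "b \<le> d" and w: "w \<in> space M" "emeasure (N w) ({a<..d} \<times> V) < \<infinity>"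
    and f: "f w \<in> borel_measurable L" "\<And>p. \<bar>f w p\<bar> \<le> c"
  shows "RI ({a<..d} \<times> V) f w = RI ({a<..b} \<times> V) f w + RI ({b<..d} \<times> V) f w"
proof -
  let ?S = "{a<..d} \<times> V" and ?A = "{a<..b} \<times> V" and ?B = "{b<..d} \<times> V"
  have s: "?A \<in> sets L" "?B \<in> sets L" "emeasure L ?A < \<infinity>" "emeasure L ?B < \<infinity>" "?S \<in> sets L"
    using box_finite[of a V b] box_finite[of b V d] box_finite[of a V d] V t by auto
  have sub: "?A \<subseteq> ?S" "?B \<subseteq> ?S" using t by auto
  have n: "emeasure (N w) ?A < \<infinity>" "emeasure (N w) ?B < \<infinity>"
    using le_less_trans[OF emeasure_mono[OF sub(1), of "N w"] w(2)] le_less_trans[OF emeasure_mono[OF sub(2), of "N w"] w(2)] s w(1) by auto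
  have i: "indicator ?S p * f w p = indicator ?A p * f w p + indicator ?B p * f w p" for p
    using t by (auto simp: indicator_def)
  have 1: "(\<integral>p. indicator ?S p * f w p \<partial>N w) = (\<integral>p. indicator ?A p * f w p \<partial>N w) + (\<integral>p. indicator ?B p * f w p \<partial>N w)"
    unfolding i by (intro Bochner_Integration.integral_add bounded_set_integrable[where c = c]) (use s n w f in auto)
  have 2: "(\<integral>p. indicator ?S p * f w p \<partial>L) = (\<integral>p. indicator ?A p * f w p \<partial>L) + (\<integral>p. indicator ?B p * f w p \<partial>L)"
    unfolding i by (intro Bochner_Integration.integral_add bounded_set_integrable[where c = c]) (use s f in auto)
  show ?thesis unfolding RI_def 1 2 using n w(2) by simp
qed

lemma RI_adapted:
  assumes V: "V \<in> sets \<nu>" "emeasure \<nu> V < \<infinity>" and t: "0 \<le> a"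
    and f: "f \<in> BP" "\<And>x. \<bar>f x\<bar> \<le> (c::real)"
  shows "RI ({a<..b} \<times> V) (pull f) \<in> borel_measurable (F b)"
proof (cases "a < b")
  case False
  then have e: "{a<..b} \<times> V = {}" by auto
  have "RI ({a<..b} \<times> V) (pull f) = (\<lambda>w. 0)" unfolding e by (auto simp: RI_def fun_eq_iff)
  then show ?thesis by simp
next
  case True
  then have b: "0 < b" using t by simp
  let ?S = "{a<..b} \<times> V"
  note S = box_finite[OF t V, of b]
  \<comment> \<open>The time is capped at \<open>b\<close> as in \<open>measurable_F_L_PS\<close>;
    on the block this is the same integrand, and it is measurable with respect to
    \<open>F b\<close>.\<close>
  let ?g = "\<lambda>w p. f ((min (fst p) b, w), snd p)"
  have "RI ?S ?g \<in> borel_measurable (F b)"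
  proof (rule RI_measurable[OF S space_F])
    show "(\<lambda>w. emeasure (N w) A) \<in> borel_measurable (F b)" if "A \<in> sets L" "A \<subseteq> ?S" for A
      by (rule adapted_N) (use b that t in \<open>auto dest: subsetD\<close>)
    show "(\<lambda>(w, p). ?g w p) \<in> borel_measurable (F b \<Otimes>\<^sub>M L)"
      using measurable_compose[OF measurable_F_L_PS[OF b] f(1)] by (simp add: case_prod_unfold)
    show "\<bar>?g w p\<bar> \<le> c" for w p using f(2) by simp
  qed
  moreover have "RI ?S ?g = RI ?S (pull f)"
  proof
    fix w
    have "indicator ?S p * ?g w p = indicator ?S p * pull f w p" for p
      by (auto simp: indicator_def min_def)
    then show "RI ?S ?g w = RI ?S (pull f) w" by (simp only: RI_def)
  qed
  ultimately show ?thesis by simp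
qed

text \<open>A variable known at time \<open>a\<close> becomes predictable on the left-open half line
  after \<open>a\<close>: its preimages there are rectangles over \<open>{a<..}\<close> with an
  event of \<open>F a\<close>.\<close>

lemma predictable_after:
  assumes a: "0 \<le> a" and Y: "Y \<in> borel_measurable (F a)"
  shows "(\<lambda>x. Y (snd x) * indicator {a<..} (fst x) :: real) \<in> borel_measurable PS"
proof (rule measurableI)
  fix B :: "real set" assume B: "B \<in> sets borel"
  have YB: "Y -` B \<inter> space M \<in> sets (F a)" using measurable_sets[OF Y B] by (simp add: space_F)
  have 1: "{a<..} \<times> (Y -` B \<inter> space M) \<in> sets PS" by (rule predictable_rect[OF a YB])
  have top: "space M \<in> sets (F 0)" "space M \<in> sets (F a)" using sets.top[of "F 0"] sets.top[of "F a"] by (simp_all add: space_F)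
  have "{0<..} \<times> space M - {a<..} \<times> space M \<in> sets PS"
    using predictable_rect[OF order_refl top(1)] predictable_rect[OF a top(2)] by blast
  then have 2: "{0<..a} \<times> space M \<in> sets PS"
    by (rule back_subst[where P = "\<lambda>x. x \<in> sets PS"]) (use a in auto)
  have "(\<lambda>x. Y (snd x) * indicator {a<..} (fst x)) -` B \<inter> space PS =
     {a<..} \<times> (Y -` B \<inter> space M) \<union> (if 0 \<in> B then {0<..a} \<times> space M else {})"
  proof (rule set_eqI)
    fix x :: "real \<times> 'a"
    obtain s w where x: "x = (s, w)" by (cases x)
    show "x \<in> (\<lambda>x. Y (snd x) * indicator {a<..} (fst x)) -` B \<inter> space PS \<longleftrightarrow>
       x \<in> {a<..} \<times> (Y -` B \<inter> space M) \<union> (if 0 \<in> B then {0<..a} \<times> space M else {})"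
      by (cases "a < s"; cases "0 \<in> B") (use a x in \<open>auto simp: space_PS\<close>)
  qed
  then show "(\<lambda>x. Y (snd x) * indicator {a<..} (fst x)) -` B \<inter> space PS \<in> sets PS" using 1 2 by auto
qed simp

text \<open>A factor known at time \<open>a\<close> can be moved into the integrand: after
  \<open>a\<close> the product of \<open>Y\<close> and \<open>f\<close> is again predictable and
  bounded, and the compensated integral of such an integrand has mean 0.\<close>

lemma RI_orthogonal_bounded:
  assumes V: "V \<in> sets \<nu>" "emeasure \<nu> V < \<infinity>" and a: "0 \<le> a"
    and f: "f \<in> BP" "\<And>x. \<bar>f x\<bar> \<le> (c::real)"
    and Y: "Y \<in> borel_measurable (F a)" "\<And>w. \<bar>Y w\<bar> \<le> (C::real)"
  shows "(\<integral>w. Y w * RI ({a<..b} \<times> V) (pull f) w \<partial>M) = 0"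
proof -
  let ?S = "{a<..b} \<times> V"
  define g where "g x = Y (snd (fst x)) * indicator {a<..} (fst (fst x)) * f x" for x
  have gm: "g \<in> BP"
    unfolding g_def[abs_def]
    by (rule borel_measurable_times[OF measurable_compose[OF measurable_fst predictable_after[OF a Y(1)]] f(1)])
  have C: "0 \<le> C" using Y(2)[of undefined] by simp
  have gb: "\<bar>g x\<bar> \<le> C * c" for x
  proof -
    have "\<bar>g x\<bar> \<le> \<bar>Y (snd (fst x))\<bar> * \<bar>f x\<bar>" by (auto simp: g_def abs_mult indicator_def)
    also have "\<dots> \<le> C * c" using Y(2) f(2) C by (intro mult_mono) auto
    finally show ?thesis .
  qed
  have e: "indicator ?S p * pull g w p = Y w * (indicator ?S p * pull f w p)" for p w
    by (auto simp: g_def indicator_def)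
  have "RI ?S (pull g) w = Y w * RI ?S (pull f) w" for w
    unfolding RI_def e by (simp add: algebra_simps)
  then show ?thesis using expectation_RI[OF box_finite[OF a V] gm gb, of b] by simp
qed

lemma RI_orthogonal:
  assumes V: "V \<in> sets \<nu>" "emeasure \<nu> V < \<infinity>" and a: "0 \<le> a"
    and f: "f \<in> BP" "\<And>x. \<bar>f x\<bar> \<le> (c::real)"
    and Y: "Y \<in> borel_measurable (F a)" "integrable M (\<lambda>w. (Y w)\<^sup>2 :: real)"
  shows "integrable M (\<lambda>w. Y w * RI ({a<..b} \<times> V) (pull f) w)" "(\<integral>w. Y w * RI ({a<..b} \<times> V) (pull f) w \<partial>M) = 0"
proof -
  let ?X = "RI ({a<..b} \<times> V) (pull f)"
  note S = box_finite[OF a V, of b]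
  have Xm[measurable]: "?X \<in> borel_measurable M" by (rule RI_pull_measurable[OF S f])
  have Ym[measurable]: "Y \<in> borel_measurable M" by (rule measurable_F_M[OF Y(1)])
  show i: "integrable M (\<lambda>w. Y w * ?X w)"
    by (rule mult_product_integrable[OF Ym Xm Y(2) RI_square_integrable(1)[OF S f]])
  \<comment> \<open>Truncation at level \<open>n\<close> reduces to bounded factors; the untruncated
    product is integrable and dominates.\<close>
  define Z where "Z n w = max (- real n) (min (real n) (Y w))" for n w
  have "(\<lambda>n. \<integral>w. Z n w * ?X w \<partial>M) \<longlonglongrightarrow> (\<integral>w. Y w * ?X w \<partial>M)"
  proof (rule integral_dominated_convergence[where w = "\<lambda>w. \<bar>Y w * ?X w\<bar>"])
    show "AE w in M. (\<lambda>n. Z n w * ?X w) \<longlonglongrightarrow> Y w * ?X w"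
    proof (rule AE_I2)
      fix w
      obtain n0 :: nat where n0: "\<bar>Y w\<bar> \<le> real n0" using real_arch_simple by blast
      have "\<forall>\<^sub>F n in sequentially. Z n w * ?X w = Y w * ?X w"
        using eventually_ge_at_top[of n0]
      proof eventually_elim
        case (elim n)
        then have "\<bar>Y w\<bar> \<le> real n" using n0 by linarith
        then show ?case by (auto simp: Z_def)
      qed
      then show "(\<lambda>n. Z n w * ?X w) \<longlonglongrightarrow> Y w * ?X w" by (rule tendsto_eventually)
    qed
    show "AE w in M. norm (Z n w * ?X w) \<le> \<bar>Y w * ?X w\<bar>" for n
    proof (rule AE_I2)
      fix w
      have "\<bar>Z n w\<bar> \<le> \<bar>Y w\<bar>" by (auto simp: Z_def max_def min_def)
      then show "norm (Z n w * ?X w) \<le> \<bar>Y w * ?X w\<bar>" by (simp add: abs_mult mult_right_mono)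
    qed
    show "integrable M (\<lambda>w. \<bar>Y w * ?X w\<bar>)" using i by (rule integrable_abs)
    show "(\<lambda>w. Z n w * ?X w) \<in> borel_measurable M" for n unfolding Z_def by measurable
  qed measurable
  moreover have "(\<integral>w. Z n w * ?X w \<partial>M) = 0" for n
  proof (rule RI_orthogonal_bounded[OF V a f])
    show "Z n \<in> borel_measurable (F a)" unfolding Z_def[abs_def] using Y(1) by measurable
    show "\<bar>Z n w\<bar> \<le> real n" for w by (auto simp: Z_def)
  qed
  ultimately show "(\<integral>w. Y w * ?X w \<partial>M) = 0" by (simp add: LIMSEQ_const_iff)
qed

text \<open>The spread of \<open>f\<close> around its mean value \<open>r\<close> on
  \<open>S\<close> is nonnegative, and expanding the square gives the inequality.\<close>

lemma finite_cauchy_schwarz: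
  fixes f :: "'c \<Rightarrow> real"
  assumes S: "S \<in> sets X" "emeasure X S < \<infinity>" and f: "f \<in> borel_measurable X" "\<And>p. p \<in> S \<Longrightarrow> \<bar>f p\<bar> \<le> 1"
  shows "(\<integral>p. indicator S p * f p \<partial>X)\<^sup>2 \<le> measure X S * (\<integral>p. indicator S p * (f p)\<^sup>2 \<partial>X)"
proof (cases "measure X S = 0")
  case True
  then show ?thesis using bounded_set_integral_le[OF S f] by simp
next
  case False
  then have n: "0 < measure X S" by (simp add: less_le)
  define a where "a = (\<integral>p. indicator S p * f p \<partial>X)"
  define r where "r = a / measure X S"
  have f2: "\<bar>(f p)\<^sup>2\<bar> \<le> 1" if "p \<in> S" for p using f(2)[OF that] by (simp add: abs_square_le_1)
  have i: "integrable X (\<lambda>p. indicator S p * f p)" "integrable X (\<lambda>p. indicator S p * (f p)\<^sup>2)" "integrable X (indicator S :: _ \<Rightarrow> real)"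
    using bounded_set_integrable[OF S f] bounded_set_integrable[OF S _ f2] f(1) S by auto
  have "0 \<le> (\<integral>p. indicator S p * (f p - r)\<^sup>2 \<partial>X)" by (intro integral_nonneg_AE AE_I2) auto
  also have "\<dots> = (\<integral>p. indicator S p * (f p)\<^sup>2 - 2 * r * (indicator S p * f p) + r\<^sup>2 * indicator S p \<partial>X)"
    by (intro Bochner_Integration.integral_cong refl) (simp add: power2_eq_square algebra_simps)
  also have "\<dots> = (\<integral>p. indicator S p * (f p)\<^sup>2 \<partial>X) - 2 * r * a + r\<^sup>2 * measure X S"
    using i S by (simp add: a_def)
  also have "\<dots> = (\<integral>p. indicator S p * (f p)\<^sup>2 \<partial>X) - a\<^sup>2 / measure X S"
    using n by (simp add: r_def power2_eq_square field_simps)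
  finally have "a\<^sup>2 / measure X S \<le> (\<integral>p. indicator S p * (f p)\<^sup>2 \<partial>X)" by simp
  then show ?thesis using n by (simp add: a_def divide_le_eq mult.commute)
qed

text \<open>Two or more points in the block cost at most \<open>n\<^sup>2 \<le> 2 n (n - 1)\<close>, which is of second
  order in the block length; a single point contributes its square.\<close>

lemma RI_block:
  fixes a b :: real
  assumes V: "V \<in> sets \<nu>" "emeasure \<nu> V < \<infinity>" and a: "0 \<le> a"
    and f: "f \<in> BP" "\<And>x. \<bar>f x\<bar> \<le> (1::real)"
  defines "S \<equiv> {a<..b} \<times> V"
  shows "(\<integral>\<^sup>+w. ennreal ((RI S (pull f) w)\<^sup>2) \<partial>M) \<le> 2 * (\<integral>\<^sup>+w. LI S (pull (\<lambda>x. ennreal ((f x)\<^sup>2))) w \<partial>M) + ennreal (6 * (measure L S)\<^sup>2)"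
proof -
  have S: "S \<in> sets L" "emeasure L S < \<infinity>" using box_finite[OF a V, of b] by (auto simp: S_def)
  define l where "l = measure L S"
  define n where "n w = measure (N w) S" for w
  let ?q = "\<lambda>x. ennreal ((f x)\<^sup>2)"
  have qm: "?q \<in> BP" using f(1) by measurable
  have nm[measurable]: "n \<in> borel_measurable M" using poisson_moments(2)[OF S] unfolding n_def[abs_def] by (rule borel_measurable_integrable)
  have "AE w in M. ennreal ((RI S (pull f) w)\<^sup>2) \<le> 2 * NI S (pull ?q) w + ennreal (4 * (n w * (n w - 1)) + 2 * l\<^sup>2) \<and> 0 \<le> n w * (n w - 1)"
    using poisson_moments(1)[OF S]
  proof (rule AE_mp, intro AE_I2 impI)
    fix w assume w: "w \<in> space M" and "\<exists>k::nat. emeasure (N w) S = of_nat k"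
    then obtain k :: nat where k: "emeasure (N w) S = of_nat k" by blast
    have fin: "emeasure (N w) S < \<infinity>" by (simp add: k ennreal_of_nat_eq_real_of_nat)
    have nk: "n w = real k" by (simp add: n_def measure_def k ennreal_of_nat_eq_real_of_nat)
    have fw: "pull f w \<in> borel_measurable L" by (rule pull_section[OF f(1) w])
    define A where "A = (\<integral>p. indicator S p * pull f w p \<partial>N w)"
    define B where "B = (\<integral>p. indicator S p * pull f w p \<partial>L)"
    define Q where "Q = (\<integral>p. indicator S p * (pull f w p)\<^sup>2 \<partial>N w)"
    have RI: "RI S (pull f) w = A - B" using fin by (simp add: RI_def A_def B_def)
    have "\<bar>B\<bar> \<le> 1 * measure L S" unfolding B_def by (rule bounded_set_integral_le[OF S fw f(2)])
    then have B: "B\<^sup>2 \<le> l\<^sup>2" by (simp add: l_def abs_le_square_iff[symmetric])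
    have iQ: "integrable (N w) (\<lambda>p. indicator S p * (pull f w p)\<^sup>2)"
      using S w fin fw f(2) by (intro bounded_set_integrable[where c = 1]) (auto simp: abs_square_le_1)
    have Q0: "0 \<le> Q" unfolding Q_def by (intro integral_nonneg_AE AE_I2) auto
    have Q: "ennreal Q = NI S (pull ?q) w"
    proof -
      have "ennreal Q = (\<integral>\<^sup>+p. ennreal (indicator S p * (pull f w p)\<^sup>2) \<partial>N w)"
        unfolding Q_def by (intro nn_integral_eq_integral[symmetric] iQ AE_I2) auto
      also have "\<dots> = NI S (pull ?q) w" using fin unfolding NI_def by (auto intro!: nn_integral_cong simp: indicator_def)
      finally show ?thesis .
    qed
    have Qk: "Q \<le> real k"
    proof -
      have "\<bar>Q\<bar> \<le> 1 * measure (N w) S" unfolding Q_def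
        using S w fin fw f(2) by (intro bounded_set_integral_le) (auto simp: abs_square_le_1)
      then show ?thesis using nk by (simp add: n_def)
    qed
    have CS: "A\<^sup>2 \<le> real k * Q"
      using finite_cauchy_schwarz[of S "N w" "pull f w"] S w fin fw f(2) nk by (simp add: A_def Q_def n_def)
    have k0: "0 \<le> real k * (real k - 1)" by (cases k) auto
    have A: "A\<^sup>2 \<le> Q + 2 * (real k * (real k - 1))"
    proof (cases "k \<le> 1")
      case True
      then have "k = 0 \<or> k = 1" by auto
      then show ?thesis using CS Q0 by auto
    next
      case False
      then have "2 \<le> real k" by simp
      have "A\<^sup>2 \<le> real k * real k" using CS mult_left_mono[OF Qk, of "real k"] by simp
      also have "\<dots> \<le> real k * (2 * (real k - 1))" using \<open>2 \<le> real k\<close> by (intro mult_left_mono) auto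
      finally show ?thesis using Q0 by (simp add: algebra_simps)
    qed
    have "(A - B)\<^sup>2 \<le> 2 * A\<^sup>2 + 2 * B\<^sup>2"
    proof -
      have "0 \<le> (A + B)\<^sup>2" by simp
      then show ?thesis unfolding power2_sum power2_diff by linarith
    qed
    also have "\<dots> \<le> 2 * Q + (4 * (n w * (n w - 1)) + 2 * l\<^sup>2)" using A B nk by simp
    finally have "ennreal ((RI S (pull f) w)\<^sup>2) \<le> ennreal (2 * Q + (4 * (n w * (n w - 1)) + 2 * l\<^sup>2))" unfolding RI by (rule ennreal_leI)
    also have "\<dots> = ennreal 2 * ennreal Q + ennreal (4 * (n w * (n w - 1)) + 2 * l\<^sup>2)"
      using Q0 k0 nk by (subst ennreal_plus) (auto simp: ennreal_mult)
    finally show "ennreal ((RI S (pull f) w)\<^sup>2) \<le> 2 * NI S (pull ?q) w + ennreal (4 * (n w * (n w - 1)) + 2 * l\<^sup>2) \<and> 0 \<le> n w * (n w - 1)"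
      using k0 nk by (simp add: Q)
  qed
  then have ae: "AE w in M. ennreal ((RI S (pull f) w)\<^sup>2) \<le> 2 * NI S (pull ?q) w + ennreal (4 * (n w * (n w - 1)) + 2 * l\<^sup>2)"
    and ae0: "AE w in M. 0 \<le> n w * (n w - 1)" by auto
  note NIq = NI_pull_measurable[OF S(1) qm]
  have "(\<integral>\<^sup>+w. ennreal ((RI S (pull f) w)\<^sup>2) \<partial>M) \<le> (\<integral>\<^sup>+w. 2 * NI S (pull ?q) w + ennreal (4 * (n w * (n w - 1)) + 2 * l\<^sup>2) \<partial>M)"
    by (rule nn_integral_mono_AE[OF ae])
  also have "\<dots> = 2 * (\<integral>\<^sup>+w. NI S (pull ?q) w \<partial>M) + (\<integral>\<^sup>+w. ennreal (4 * (n w * (n w - 1)) + 2 * l\<^sup>2) \<partial>M)"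
    using NIq by (simp add: nn_integral_add nn_integral_cmult)
  also have "(\<integral>\<^sup>+w. NI S (pull ?q) w \<partial>M) = (\<integral>\<^sup>+w. LI S (pull ?q) w \<partial>M)" by (rule compensation[OF S qm])
  also have "(\<integral>\<^sup>+w. ennreal (4 * (n w * (n w - 1)) + 2 * l\<^sup>2) \<partial>M) = ennreal (\<integral>w. 4 * (n w * (n w - 1)) + 2 * l\<^sup>2 \<partial>M)"
  proof (rule nn_integral_eq_integral)
    show "integrable M (\<lambda>w. 4 * (n w * (n w - 1)) + 2 * l\<^sup>2)" using poisson_moments(4)[OF S] by (simp add: n_def)
    show "AE w in M. 0 \<le> 4 * (n w * (n w - 1)) + 2 * l\<^sup>2" using ae0 by (rule AE_mp) auto
  qed
  \<comment> \<open>The second factorial moment of the count, equal to the square of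
    \<open>l\<close>, enters four times; the squared bound of the compensator enters twice.\<close>
  also have "(\<integral>w. 4 * (n w * (n w - 1)) + 2 * l\<^sup>2 \<partial>M) = 6 * l\<^sup>2"
    using poisson_moments(4,5)[OF S] by (simp add: n_def l_def prob_space)
  finally show ?thesis by (simp add: l_def)
qed

lemma LI_box_split:
  assumes V: "V \<in> sets \<nu>" and t: "0 \<le> a" "a \<le> b" "b \<le> d" and f: "f w \<in> borel_measurable L"
  shows "LI ({a<..d} \<times> V) f w = LI ({a<..b} \<times> V) f w + LI ({b<..d} \<times> V) f w"
proof -
  have s: "{a<..b} \<times> V \<in> sets L" "{b<..d} \<times> V \<in> sets L" using box_sets[of a V b] box_sets[of b V d] V t by auto
  have e: "f w p * indicator ({a<..d} \<times> V) p = f w p * indicator ({a<..b} \<times> V) p + f w p * indicator ({b<..d} \<times> V) p" for p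
    using t by (cases p) (auto simp: indicator_def)
  show ?thesis unfolding LI_def e using s f by (intro nn_integral_add) auto
qed

text \<open>Over consecutive blocks the integrals are orthogonal, so their second moments add up.
  Each of \<open>n\<close> equal blocks costs an error of order \<open>1 / n\<^sup>2\<close>, in
  total \<open>6 * (T * v)\<^sup>2 / n\<close>, which vanishes as the blocks shrink. The factor 2
  comes from splitting off the compensator in each block and does no harm in a maximal
  inequality.\<close>

lemma RI_second_moment:
  assumes V: "V \<in> sets \<nu>" "emeasure \<nu> V < \<infinity>" and T: "0 \<le> T"
    and f: "f \<in> BP" "\<And>x. \<bar>f x\<bar> \<le> (1::real)"
  shows "(\<integral>\<^sup>+w. ennreal ((RI ({0<..T} \<times> V) (pull f) w)\<^sup>2) \<partial>M) \<le> 2 * (\<integral>\<^sup>+w. LI ({0<..T} \<times> V) (pull (\<lambda>x. ennreal ((f x)\<^sup>2))) w \<partial>M)"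
proof -
  let ?q = "\<lambda>x. ennreal ((f x)\<^sup>2)"
  let ?S = "\<lambda>a b. {a<..b} \<times> V"
  have qm: "?q \<in> BP" using f(1) by measurable
  define v where "v = measure \<nu> V"
  have ev: "emeasure \<nu> V = ennreal v" using V(2) by (simp add: v_def emeasure_eq_ennreal_measure top.not_eq_extremum)
  have step: "(\<integral>\<^sup>+w. ennreal ((RI (?S 0 t) (pull f) w)\<^sup>2) \<partial>M) = (\<integral>\<^sup>+w. ennreal ((RI (?S 0 s) (pull f) w)\<^sup>2) \<partial>M) + (\<integral>\<^sup>+w. ennreal ((RI (?S s t) (pull f) w)\<^sup>2) \<partial>M)"
    if st: "0 \<le> s" "s \<le> t" for s t
  proof -
    let ?X = "RI (?S 0 s) (pull f)" and ?Y = "RI (?S s t) (pull f)"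
    note S0 = box_finite[OF order_refl V, of s] and S1 = box_finite[OF st(1) V, of t] and S2 = box_finite[OF order_refl V, of t]
    note iX = RI_square_integrable[OF S0 f] and iY = RI_square_integrable[OF S1 f]
    have X: "?X \<in> borel_measurable (F s)" by (rule RI_adapted[OF V order_refl f])
    note o = RI_orthogonal[OF V st(1) f X iX(1), of t]
    have sq: "(?X w + ?Y w)\<^sup>2 = (?X w)\<^sup>2 + (?Y w)\<^sup>2 + 2 * (?X w * ?Y w)" for w
      by (simp add: power2_sum mult.assoc)
    have i: "integrable M (\<lambda>w. (?X w + ?Y w)\<^sup>2)" unfolding sq using iX(1) iY(1) o(1) by simp
    have "AE w in M. RI (?S 0 t) (pull f) w = ?X w + ?Y w"
      using poisson_AE_finite[OF S2]
      by (rule AE_mp, intro AE_I2 impI) (intro RI_split[OF V order_refl st, where f = "pull f" and c = 1] pull_section[OF f(1)] f(2))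
    then have "(\<integral>\<^sup>+w. ennreal ((RI (?S 0 t) (pull f) w)\<^sup>2) \<partial>M) = (\<integral>\<^sup>+w. ennreal ((?X w + ?Y w)\<^sup>2) \<partial>M)"
      by (intro nn_integral_cong_AE) (rule AE_mp, auto)
    also have "\<dots> = ennreal (\<integral>w. (?X w + ?Y w)\<^sup>2 \<partial>M)"
      by (intro nn_integral_eq_integral AE_I2 i) auto
    also have "(\<integral>w. (?X w + ?Y w)\<^sup>2 \<partial>M) = (\<integral>w. (?X w)\<^sup>2 \<partial>M) + (\<integral>w. (?Y w)\<^sup>2 \<partial>M)"
      unfolding sq using iX(1) iY(1) o by simp
    also have "ennreal \<dots> = ennreal (\<integral>w. (?X w)\<^sup>2 \<partial>M) + ennreal (\<integral>w. (?Y w)\<^sup>2 \<partial>M)"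
      by (intro ennreal_plus integral_nonneg_AE AE_I2) auto
    also have "\<dots> = (\<integral>\<^sup>+w. ennreal ((?X w)\<^sup>2) \<partial>M) + (\<integral>\<^sup>+w. ennreal ((?Y w)\<^sup>2) \<partial>M)"
      using iX(1) iY(1) by (simp add: nn_integral_eq_integral)
    finally show ?thesis .
  qed
  have main: "(\<integral>\<^sup>+w. ennreal ((RI (?S 0 T) (pull f) w)\<^sup>2) \<partial>M) \<le> 2 * (\<integral>\<^sup>+w. LI (?S 0 T) (pull ?q) w \<partial>M) + ennreal (6 * (T * v)\<^sup>2 / real n)"
    if n: "0 < n" for n :: nat
  proof -
    define h where "h = T / real n"
    have h: "0 \<le> h" using T n by (simp add: h_def)
    have "(\<integral>\<^sup>+w. ennreal ((RI (?S 0 (real k * h)) (pull f) w)\<^sup>2) \<partial>M) \<le> 2 * (\<integral>\<^sup>+w. LI (?S 0 (real k * h)) (pull ?q) w \<partial>M) + ennreal (6 * real k * (h * v)\<^sup>2)" for k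
    proof (induction k)
      case 0
      have "RI {} (pull f) = (\<lambda>w. 0)" by (auto simp: RI_def fun_eq_iff)
      then show ?case by simp
    next
      case (Suc k)
      let ?s = "real k * h" and ?t = "real (Suc k) * h"
      have st: "0 \<le> ?s" "?s \<le> ?t" using h by (auto simp: distrib_right)
      have l: "measure L (?S ?s ?t) = h * v"
      proof -
        have d: "?t - ?s = h" by (simp add: algebra_simps)
        have "0 \<le> v" by (simp add: v_def)
        then have "emeasure L (?S ?s ?t) = ennreal (h * v)"
          using emeasure_box[OF st V(1)] h unfolding ev d by (simp add: ennreal_mult)
        then show ?thesis using h \<open>0 \<le> v\<close> by (simp add: measure_def)
      qed
      have LIs: "(\<integral>\<^sup>+w. LI (?S 0 ?t) (pull ?q) w \<partial>M) = (\<integral>\<^sup>+w. LI (?S 0 ?s) (pull ?q) w \<partial>M) + (\<integral>\<^sup>+w. LI (?S ?s ?t) (pull ?q) w \<partial>M)"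
      proof -
        have "(\<integral>\<^sup>+w. LI (?S 0 ?t) (pull ?q) w \<partial>M) = (\<integral>\<^sup>+w. LI (?S 0 ?s) (pull ?q) w + LI (?S ?s ?t) (pull ?q) w \<partial>M)"
          by (intro nn_integral_cong LI_box_split[OF V(1) order_refl st] pull_section[OF qm])
        also have "\<dots> = (\<integral>\<^sup>+w. LI (?S 0 ?s) (pull ?q) w \<partial>M) + (\<integral>\<^sup>+w. LI (?S ?s ?t) (pull ?q) w \<partial>M)"
          by (intro nn_integral_add LI_pull_measurable qm box_sets V st order_refl)
        finally show ?thesis .
      qed
      have "(\<integral>\<^sup>+w. ennreal ((RI (?S 0 ?t) (pull f) w)\<^sup>2) \<partial>M) \<le>
         (2 * (\<integral>\<^sup>+w. LI (?S 0 ?s) (pull ?q) w \<partial>M) + ennreal (6 * real k * (h * v)\<^sup>2)) +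
         (2 * (\<integral>\<^sup>+w. LI (?S ?s ?t) (pull ?q) w \<partial>M) + ennreal (6 * (h * v)\<^sup>2))"
        unfolding step[OF st] using RI_block[OF V st(1) f, of ?t, unfolded l] by (intro add_mono Suc)
      also have "\<dots> = 2 * (\<integral>\<^sup>+w. LI (?S 0 ?t) (pull ?q) w \<partial>M) + (ennreal (6 * real k * (h * v)\<^sup>2) + ennreal (6 * (h * v)\<^sup>2))"
        unfolding LIs by (simp add: distrib_left add.assoc add.left_commute)
      also have "ennreal (6 * real k * (h * v)\<^sup>2) + ennreal (6 * (h * v)\<^sup>2) = ennreal (6 * real (Suc k) * (h * v)\<^sup>2)"
        by (subst ennreal_plus[symmetric]) (auto simp: algebra_simps)
      finally show ?case .
    qed
    from this[of n] show ?thesis using n by (simp add: h_def power2_eq_square field_simps)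
  qed
  show ?thesis
  proof (rule ennreal_le_epsilon)
    fix e :: real assume e: "0 < e"
    obtain n :: nat where n: "6 * (T * v)\<^sup>2 / e < real n" using reals_Archimedean2 by blast
    have n0: "0 < n"
    proof -
      have "0 \<le> 6 * (T * v)\<^sup>2 / e" using e by simp
      with n show ?thesis by (metis le_less_trans of_nat_0_less_iff)
    qed
    have "6 * (T * v)\<^sup>2 / real n \<le> e" using n n0 e by (simp add: field_simps)
    then have "ennreal (6 * (T * v)\<^sup>2 / real n) \<le> ennreal e" by (rule ennreal_leI)
    then show "(\<integral>\<^sup>+w. ennreal ((RI (?S 0 T) (pull f) w)\<^sup>2) \<partial>M) \<le> 2 * (\<integral>\<^sup>+w. LI (?S 0 T) (pull ?q) w \<partial>M) + ennreal e"
      using order_trans[OF main[OF n0] add_left_mono] by blast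
  qed
qed

section \<open>A maximal inequality for compensated Poisson integrals\<close>

text \<open>Switching the integrand off after the first time in \<open>I\<close> at which the
  integral exceeds \<open>e\<close> freezes the integral there, so its value at \<open>T\<close>
  carries the maximum and Chebyshev's inequality applies to that single variable.\<close>

lemma RI_maximal:
  assumes V: "V \<in> sets \<nu>" "emeasure \<nu> V < \<infinity>"
    and f: "f \<in> BP" "\<And>x. \<bar>f x\<bar> \<le> (1::real)"
    and I: "finite I" "\<And>t. t \<in> I \<Longrightarrow> 0 \<le> t \<and> t \<le> T" and e: "0 < e" and \<delta>: "0 \<le> \<delta>"
    and q: "\<And>w. w \<in> space M \<Longrightarrow> LI ({0<..T} \<times> V) (pull (\<lambda>x. ennreal ((f x)\<^sup>2))) w \<le> ennreal \<delta>"
  shows "outer_measure_of M {w \<in> space M. \<exists>t\<in>I. e < \<bar>RI ({0<..t} \<times> V) (pull f) w\<bar>} \<le> ennreal (2 * \<delta> / e\<^sup>2)"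
proof (cases "I = {}")
  case True then show ?thesis by simp
next
  case False
  then have T: "0 \<le> T" using I(2) by force
  define X where "X t = RI ({0<..t} \<times> V) (pull f)" for t
  have Xm: "X t \<in> borel_measurable (F t)" for t unfolding X_def by (rule RI_adapted[OF V order_refl f])
  \<comment> \<open>Only times strictly after an exceedance are removed. An exceedance at
    \<open>t\<close> is an event of \<open>F t\<close>, so the removed sets are predictable.\<close>
  define DS where "DS = space PS - (\<Union>t\<in>I. {t<..} \<times> {w \<in> space M. e < \<bar>X t w\<bar>})"
  have DS: "DS \<in> sets PS"
    unfolding DS_def
  proof (intro sets.Diff sets.top sets.finite_UN I)
    fix t assume t: "t \<in> I"
    have "{w \<in> space (F t). e < \<bar>X t w\<bar>} \<in> sets (F t)" using Xm[of t] by measurable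
    then show "{t<..} \<times> {w \<in> space M. e < \<bar>X t w\<bar>} \<in> sets PS"
      using I(2)[OF t] by (intro predictable_rect) (auto simp: space_F)
  qed
  define g where "g x = f x * indicator DS (fst x)" for x
  have gm: "g \<in> BP" unfolding g_def[abs_def]
    by (intro borel_measurable_times f borel_measurable_indicator' measurable_fst'' DS) (use DS in \<open>auto intro: measurable_sets\<close>)
  have gb: "\<bar>g x\<bar> \<le> 1" for x using f(2)[of x] by (auto simp: g_def indicator_def)
  note S = box_finite[OF order_refl V, of T]
  let ?X = "RI ({0<..T} \<times> V) (pull g)"
  note Xi = RI_square_integrable[OF S gm gb]
  have Xg: "?X \<in> borel_measurable M" by (rule RI_pull_measurable[OF S gm gb])
  have "ennreal (\<integral>w. (?X w)\<^sup>2 \<partial>M) = (\<integral>\<^sup>+w. ennreal ((?X w)\<^sup>2) \<partial>M)"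
    by (intro nn_integral_eq_integral[symmetric] Xi AE_I2) auto
  also have "\<dots> \<le> 2 * (\<integral>\<^sup>+w. LI ({0<..T} \<times> V) (pull (\<lambda>x. ennreal ((g x)\<^sup>2))) w \<partial>M)"
    by (rule RI_second_moment[OF V T gm gb])
  also have "\<dots> \<le> 2 * (\<integral>\<^sup>+w. ennreal \<delta> \<partial>M)"
  proof (intro mult_left_mono nn_integral_mono)
    fix w assume w: "w \<in> space M"
    have "LI ({0<..T} \<times> V) (pull (\<lambda>x. ennreal ((g x)\<^sup>2))) w \<le> LI ({0<..T} \<times> V) (pull (\<lambda>x. ennreal ((f x)\<^sup>2))) w"
      unfolding LI_def by (intro nn_integral_mono mult_right_mono) (auto simp: g_def indicator_def)
    then show "LI ({0<..T} \<times> V) (pull (\<lambda>x. ennreal ((g x)\<^sup>2))) w \<le> ennreal \<delta>" using q[OF w] by simp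
  qed simp
  also have "\<dots> = ennreal (2 * \<delta>)" using \<delta> ennreal_mult[of 2 \<delta>] by (simp add: emeasure_space_1)
  finally have m2: "(\<integral>w. (?X w)\<^sup>2 \<partial>M) \<le> 2 * \<delta>" using \<delta> by (simp add: ennreal_le_iff)
  have key: "e < \<bar>?X w\<bar>" if w: "w \<in> space M" and fin: "emeasure (N w) ({0<..T} \<times> V) < \<infinity>" and t: "t \<in> I" "e < \<bar>X t w\<bar>" for w t
  proof -
    define u where "u = Min {t \<in> I. e < \<bar>X t w\<bar>}"
    have "u \<in> {t \<in> I. e < \<bar>X t w\<bar>}" unfolding u_def by (rule Min_in) (use I t in auto)
    then have u: "u \<in> I" "e < \<bar>X u w\<bar>" by auto
    have umin: "u \<le> r" if "r \<in> I" "e < \<bar>X r w\<bar>" for r unfolding u_def by (rule Min_le) (use I that in auto)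
    have uT: "0 \<le> u" "u \<le> T" using I(2)[OF u(1)] by auto
    have i: "indicator ({0<..T} \<times> V) p * pull g w p = indicator ({0<..u} \<times> V) p * pull f w p" for p
    proof (cases "0 < fst p")
      case True
      have "(fst p, w) \<in> DS \<longleftrightarrow> fst p \<le> u"
      proof
        assume "(fst p, w) \<in> DS"
        then show "fst p \<le> u" using u w by (force simp: DS_def not_less)
      next
        assume "fst p \<le> u"
        then show "(fst p, w) \<in> DS" using True w umin by (force simp: DS_def space_PS)
      qed
      then show ?thesis using True uT by (cases p) (auto simp: g_def indicator_def)
    next
      case False then show ?thesis by (cases p) (auto simp: indicator_def)
    qed
    have "{0<..u} \<times> V \<subseteq> {0<..T} \<times> V" using uT by auto
    then have "emeasure (N w) ({0<..u} \<times> V) < \<infinity>"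
      using le_less_trans[OF emeasure_mono fin] S(1) w by simp
    then have "?X w = X u w" unfolding X_def RI_def i using fin by simp
    then show ?thesis using u by simp
  qed
  let ?Z = "{w \<in> space M. \<not> emeasure (N w) ({0<..T} \<times> V) < \<infinity>}"
  have "{w \<in> space M. \<exists>t\<in>I. e < \<bar>RI ({0<..t} \<times> V) (pull f) w\<bar>} \<subseteq> {w \<in> space M. e < \<bar>?X w\<bar>} \<union> ?Z"
    using key by (auto simp: X_def)
  then have "outer_measure_of M {w \<in> space M. \<exists>t\<in>I. e < \<bar>RI ({0<..t} \<times> V) (pull f) w\<bar>} \<le> outer_measure_of M ({w \<in> space M. e < \<bar>?X w\<bar>} \<union> ?Z)"
    by (rule outer_measure_of_mono)
  also have "\<dots> \<le> outer_measure_of M {w \<in> space M. e < \<bar>?X w\<bar>} + outer_measure_of M ?Z"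
    by (rule outer_measure_of_Un_le) auto
  also have "outer_measure_of M ?Z = 0"
  proof -
    have [measurable]: "(\<lambda>w. emeasure (N w) ({0<..T} \<times> V)) \<in> borel_measurable M" by (rule N_measurable[OF S(1)])
    have "emeasure M ?Z = 0" using poisson_AE_finite[OF S] by (subst (asm) AE_iff_measurable[OF _ refl]) auto
    then show ?thesis by (subst outer_measure_of_eq) auto
  qed
  also have "outer_measure_of M {w \<in> space M. e < \<bar>?X w\<bar>} = emeasure M {w \<in> space M. e < \<bar>?X w\<bar>}"
    using Xg by (intro outer_measure_of_eq) measurable
  also have "\<dots> \<le> ennreal (2 * \<delta> / e\<^sup>2)" by (rule second_moment_chebyshev[OF Xg Xi(1) e m2])
  finally show ?thesis by simp
qed

text \<open>\<open>NI\<close>, \<open>LI\<close> and \<open>RI\<close> are over sets of finite intensity, \<open>NF\<close>, \<open>LF\<close> and \<open>CI\<close> over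
  the full strip up to time \<open>t\<close>.\<close>

definition NF :: "real \<Rightarrow> ('a \<Rightarrow> real \<times> 'b \<Rightarrow> ennreal) \<Rightarrow> 'a \<Rightarrow> ennreal" where
  "NF t f w = (\<integral>\<^sup>+p\<in>{0<..t} \<times> UNIV. f w p \<partial>N w)"

definition LF :: "real \<Rightarrow> ('a \<Rightarrow> real \<times> 'b \<Rightarrow> ennreal) \<Rightarrow> 'a \<Rightarrow> ennreal" where
  "LF t f w = (\<integral>\<^sup>+p\<in>{0<..t} \<times> UNIV. f w p \<partial>L)"

lemma indicator_strip: "indicator ({0<..t} \<times> UNIV) p = indicator {0<..t} (fst p)"
  by (cases p) (auto simp: indicator_def)

lemma strip_measurable[measurable]: "(indicator ({0<..t} \<times> UNIV) :: _ \<Rightarrow> ennreal) \<in> borel_measurable L"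
  "(indicator ({0<..t} \<times> UNIV) :: _ \<Rightarrow> real) \<in> borel_measurable L"
proof -
  have "(\<lambda>p. indicator {0<..t} (fst p) :: ennreal) \<in> borel_measurable L" "(\<lambda>p. indicator {0<..t} (fst p) :: real) \<in> borel_measurable L"
    by (rule measurable_compose[OF measurable_fst_L], simp)+
  then show "(indicator ({0<..t} \<times> UNIV) :: _ \<Rightarrow> ennreal) \<in> borel_measurable L"
    "(indicator ({0<..t} \<times> UNIV) :: _ \<Rightarrow> real) \<in> borel_measurable L"
    by (simp_all add: indicator_strip[abs_def])
qed

lemma exhaustion:
  obtains V where "\<And>m::nat. V m \<in> sets \<nu>" "\<And>m. emeasure \<nu> (V m) < \<infinity>" "incseq V" "(\<Union>m. V m) = space \<nu>"
proof -
  interpret v: sigma_finite_measure \<nu> by (rule sigma_finite_\<nu>)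
  obtain V where "range V \<subseteq> sets \<nu>" "(\<Union>i. V i) = space \<nu>" "\<And>i::nat. emeasure \<nu> (V i) \<noteq> \<infinity>" "incseq V"
    using v.sigma_finite_incseq by blast
  then show thesis by (intro that[of V]) (auto simp: top.not_eq_extremum)
qed

lemma LF_eq_LI: "LF t f w = LI ({0<..t} \<times> space \<nu>) f w"
  unfolding LF_def LI_def by (intro nn_integral_cong) (auto simp: indicator_def space_L)

text \<open>Along an exhaustion of the marks by sets of finite intensity, both sides increase to the
  full strip. The function \<open>h\<close> is a measurable version of the left integral: the two
  agree unless some piece of finite intensity has infinite mass.\<close>

lemma compensation_full:
  assumes t: "0 \<le> t" and f: "f \<in> BP"
  obtains h where "h \<in> borel_measurable M" "AE w in M. NF t (pull f) w = h w"
    "(\<integral>\<^sup>+w. h w \<partial>M) = (\<integral>\<^sup>+w. LF t (pull f) w \<partial>M)"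
proof -
  obtain V where V: "\<And>m::nat. V m \<in> sets \<nu>" "\<And>m. emeasure \<nu> (V m) < \<infinity>" "incseq V" "(\<Union>m. V m) = space \<nu>"
    using exhaustion by blast
  define S where "S m = {0<..t} \<times> V m" for m
  have S: "S m \<in> sets L" "emeasure L (S m) < \<infinity>" for m unfolding S_def using box_finite[OF order_refl V(1,2)] by auto
  define h where "h w = (SUP m. NI (S m) (pull f) w)" for w
  have hm: "h \<in> borel_measurable M" unfolding h_def[abs_def]
    by (intro borel_measurable_SUP NI_pull_measurable S f) auto
  have sup: "(SUP m. (indicator (S m) p :: ennreal)) = indicator ({0<..t} \<times> UNIV) p" if "p \<in> space L" for p
  proof (cases "p \<in> {0<..t} \<times> UNIV")
    case True
    then have "snd p \<in> (\<Union>m. V m)" using that V(4) by (auto simp: space_L)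
    then obtain m where "snd p \<in> V m" by blast
    with True have "p \<in> S m" by (auto simp: S_def mem_Times_iff)
    have "(SUP m. (indicator (S m) p :: ennreal)) = 1"
      by (intro antisym SUP_least SUP_upper2[of m]) (use \<open>p \<in> S m\<close> in \<open>auto simp: indicator_def\<close>)
    with True show ?thesis by simp
  next
    case False
    then have "p \<notin> S m" for m by (auto simp: S_def)
    then have "(indicator (S m) p :: ennreal) = 0" for m by simp
    with False show ?thesis by simp
  qed
  have Sinc: "S m \<subseteq> S n" if "m \<le> n" for m n using V(3) that by (auto simp: S_def incseq_def)
  have ind_mono: "(indicator (S m) p :: ennreal) \<le> indicator (S n) p" if "m \<le> n" for m n p
    using Sinc[OF that] by (auto split: split_indicator)
  have conv: "(SUP m. \<integral>\<^sup>+p\<in>S m. g p \<partial>X) = (\<integral>\<^sup>+p\<in>{0<..t} \<times> UNIV. g p \<partial>X)"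
    if X: "sets X = sets L" and g: "g \<in> borel_measurable L" for X g
  proof -
    have sp: "space X = space L" using X by (rule sets_eq_imp_space_eq)
    have "(SUP m. \<integral>\<^sup>+p\<in>S m. g p \<partial>X) = (\<integral>\<^sup>+p. (SUP m. g p * indicator (S m) p) \<partial>X)"
    proof (rule nn_integral_monotone_convergence_SUP[symmetric])
      show "incseq (\<lambda>m p. g p * indicator (S m) p)"
        unfolding incseq_def le_fun_def by (intro allI impI mult_left_mono ind_mono) auto
      show "(\<lambda>p. g p * indicator (S m) p) \<in> borel_measurable X" for m
        unfolding measurable_cong_sets[OF X refl] using g S(1) by simp
    qed
    also have "\<dots> = (\<integral>\<^sup>+p\<in>{0<..t} \<times> UNIV. g p \<partial>X)"
      by (intro nn_integral_cong) (simp add: SUP_mult_left_ennreal[symmetric] sup sp)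
    finally show ?thesis .
  qed
  have "AE w in M. \<forall>m. emeasure (N w) (S m) < \<infinity>" unfolding AE_all_countable using poisson_AE_finite[OF S] by blast
  then have ae: "AE w in M. NF t (pull f) w = h w"
  proof (rule AE_mp, intro AE_I2 impI)
    fix w assume w: "w \<in> space M" and fin: "\<forall>m. emeasure (N w) (S m) < \<infinity>"
    then show "NF t (pull f) w = h w"
      using conv[OF sets_N[OF w] pull_section[OF f w]] by (simp add: NF_def h_def NI_def)
  qed
  have NIinc: "incseq (\<lambda>m w. \<integral>\<^sup>+p\<in>S m. pull f w p \<partial>L)"
    unfolding incseq_def le_fun_def by (intro allI impI nn_integral_mono mult_left_mono ind_mono) auto
  have aeinc: "AE w in M. \<forall>m. NI (S m) (pull f) w \<le> NI (S (Suc m)) (pull f) w"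
    using \<open>AE w in M. \<forall>m. emeasure (N w) (S m) < \<infinity>\<close>
  proof (rule AE_mp, intro AE_I2 impI allI)
    fix w m assume fin: "\<forall>m. emeasure (N w) (S m) < \<infinity>"
    have "(\<integral>\<^sup>+p\<in>S m. pull f w p \<partial>N w) \<le> (\<integral>\<^sup>+p\<in>S (Suc m). pull f w p \<partial>N w)"
      by (intro nn_integral_mono mult_left_mono ind_mono) auto
    then show "NI (S m) (pull f) w \<le> NI (S (Suc m)) (pull f) w" using fin by (simp add: NI_def)
  qed
  have "(\<integral>\<^sup>+w. h w \<partial>M) = (SUP m. \<integral>\<^sup>+w. NI (S m) (pull f) w \<partial>M)"
    unfolding h_def using aeinc
    by (intro nn_integral_monotone_convergence_SUP_AE NI_pull_measurable S f) (auto simp: AE_all_countable)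
  also have "\<dots> = (SUP m. \<integral>\<^sup>+w. LI (S m) (pull f) w \<partial>M)" by (simp only: compensation[OF S f])
  also have "\<dots> = (\<integral>\<^sup>+w. (SUP m. LI (S m) (pull f) w) \<partial>M)"
    using NIinc by (intro nn_integral_monotone_convergence_SUP[symmetric] LI_pull_measurable S f) (simp add: LI_def[abs_def])
  also have "\<dots> = (\<integral>\<^sup>+w. LF t (pull f) w \<partial>M)"
    by (intro nn_integral_cong) (simp add: LI_def LF_def conv[OF refl pull_section[OF f]])
  finally show thesis using that[OF hm ae] by blast
qed

end

section \<open>Outer measure up to null events, and the function \<open>l12\<close>\<close>

lemma outer_measure_of_AE_mono:
  assumes "AE w in M. P w \<longrightarrow> Q w"
  shows "outer_measure_of M {w \<in> space M. P w} \<le> outer_measure_of M {w \<in> space M. Q w}"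
proof -
  obtain Z where Z: "Z \<in> null_sets M" "{w \<in> space M. \<not> (P w \<longrightarrow> Q w)} \<subseteq> Z" using assms by (auto simp: eventually_ae_filter)
  have "outer_measure_of M {w \<in> space M. P w} \<le> outer_measure_of M ({w \<in> space M. Q w} \<union> Z)"
    by (rule outer_measure_of_mono) (use Z in auto)
  also have "\<dots> \<le> outer_measure_of M {w \<in> space M. Q w} + outer_measure_of M Z"
    by (rule outer_measure_of_Un_le) (use Z sets.sets_into_space in \<open>auto simp: null_sets_def\<close>)
  also have "outer_measure_of M Z = 0" using Z by (simp add: null_sets_def)
  finally show ?thesis by simp
qed

lemma l12_nonneg: "0 \<le> l12 x"
  by (simp add: l12_def)

lemma l12_measurable[measurable]: "l12 \<in> borel_measurable borel"
  unfolding l12_def[abs_def] by measurable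

lemma l12_le_1: "\<bar>x\<bar> \<le> 1 \<Longrightarrow> l12 x = x\<^sup>2"
  using mult_left_le_one_le[of "\<bar>x\<bar>" "\<bar>x\<bar>"] by (simp add: l12_def min_def power2_eq_square)

lemma l12_ge_1: "1 < \<bar>x\<bar> \<Longrightarrow> l12 x = \<bar>x\<bar>"
  using mult_right_mono[of 1 "\<bar>x\<bar>" "\<bar>x\<bar>"] by (auto simp: l12_def min_def power2_eq_square)

definition trunc :: "real \<Rightarrow> real \<Rightarrow> real" where "trunc c u = (if c < \<bar>u\<bar> then u else 0)"

lemma trunc_measurable[measurable]: "trunc c \<in> borel_measurable borel"
  unfolding trunc_def[abs_def] by measurable

text \<open>Away from 0, \<open>l12\<close> dominates the absolute value up to a constant: between
  \<open>c\<close> and 1 one has \<open>\<bar>u\<bar> \<le> u\<^sup>2 / c\<close>, and above 1 the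
  two coincide.\<close>

lemma abs_trunc_le:
  assumes c: "0 < c" shows "\<bar>trunc c u\<bar> \<le> (1 + 1 / c) * l12 u"
proof (cases "c < \<bar>u\<bar>")
  case c': True
  show ?thesis
  proof (cases "\<bar>u\<bar> \<le> 1")
    case True
    have "\<bar>u\<bar> * c \<le> \<bar>u\<bar> * \<bar>u\<bar>" using c' by (intro mult_left_mono) auto
    then have "\<bar>u\<bar> \<le> 1 / c * u\<^sup>2" using c by (simp add: field_simps power2_eq_square)
    also have "\<dots> \<le> (1 + 1 / c) * u\<^sup>2" by (intro mult_right_mono) auto
    finally show ?thesis using True c' by (simp add: trunc_def l12_le_1)
  next
    case False
    have "1 * \<bar>u\<bar> \<le> (1 + 1 / c) * \<bar>u\<bar>" using c by (intro mult_right_mono) auto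
    then show ?thesis using False c' by (simp add: trunc_def l12_ge_1)
  qed
qed (use c in \<open>auto simp: trunc_def intro!: mult_nonneg_nonneg l12_nonneg\<close>)

section \<open>Compensated integrals over the full strip and their predictable localisation\<close>

context filtered_poisson
begin

lemma LF_pull_measurable:
  assumes "0 \<le> t" "f \<in> BP"
  shows "LF t (pull f) \<in> borel_measurable M"
  using LI_pull_measurable[OF box_sets[OF order_refl sets.top] assms(2), of t] by (simp add: LF_eq_LI[abs_def])

text \<open>Markov's inequality; \<open>NF\<close> and \<open>LF\<close> have equal expectations,
  whence the factor 2.\<close>

lemma jump_markov:
  assumes t: "0 \<le> t" and f: "f \<in> BP" and e: "0 < (e::real)"
  shows "outer_measure_of M {w \<in> space M. ennreal e < NF t (pull f) w + LF t (pull f) w} \<le> ennreal (2 / e) * (\<integral>\<^sup>+w. LF t (pull f) w \<partial>M)"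
proof -
  obtain h where h: "h \<in> borel_measurable M" "AE w in M. NF t (pull f) w = h w"
    "(\<integral>\<^sup>+w. h w \<partial>M) = (\<integral>\<^sup>+w. LF t (pull f) w \<partial>M)" using compensation_full[OF t f] by blast
  note [measurable] = h(1) LF_pull_measurable[OF t f]
  have "outer_measure_of M {w \<in> space M. ennreal e < NF t (pull f) w + LF t (pull f) w} \<le> outer_measure_of M {w \<in> space M. ennreal e < h w + LF t (pull f) w}"
    by (rule outer_measure_of_AE_mono) (use h(2) in auto)
  also have "\<dots> = emeasure M {w \<in> space M. ennreal e < h w + LF t (pull f) w}" by (intro outer_measure_of_eq) measurable
  also have "\<dots> \<le> emeasure M {w \<in> space M. 1 \<le> ennreal (1 / e) * (h w + LF t (pull f) w)}"
  proof (rule emeasure_mono)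
    show "{w \<in> space M. ennreal e < h w + LF t (pull f) w} \<subseteq> {w \<in> space M. 1 \<le> ennreal (1 / e) * (h w + LF t (pull f) w)}"
    proof (safe)
      fix w assume "ennreal e < h w + LF t (pull f) w"
      then have "ennreal (1 / e) * ennreal e \<le> ennreal (1 / e) * (h w + LF t (pull f) w)" by (intro mult_left_mono) auto
      moreover have "ennreal (1 / e) * ennreal e = 1" using e by (simp add: ennreal_mult[symmetric])
      ultimately show "1 \<le> ennreal (1 / e) * (h w + LF t (pull f) w)" by simp
    qed
  qed measurable
  also have "\<dots> \<le> ennreal (1 / e) * (\<integral>\<^sup>+w. (h w + LF t (pull f) w) * indicator (space M) w \<partial>M)"
    by (rule nn_integral_Markov_inequality) measurable
  also have "(\<integral>\<^sup>+w. (h w + LF t (pull f) w) * indicator (space M) w \<partial>M) = (\<integral>\<^sup>+w. h w + LF t (pull f) w \<partial>M)"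
    by (intro nn_integral_cong) simp
  also have "\<dots> = 2 * (\<integral>\<^sup>+w. LF t (pull f) w \<partial>M)"
    using h(3) by (subst nn_integral_add) (auto simp: mult_2)
  also have "ennreal (1 / e) * (2 * (\<integral>\<^sup>+w. LF t (pull f) w \<partial>M)) = ennreal (2 / e) * (\<integral>\<^sup>+w. LF t (pull f) w \<partial>M)"
  proof -
    have "ennreal (2 / e) = ennreal (1 / e) * ennreal 2" using e by (subst ennreal_mult[symmetric]) auto
    then show ?thesis by (simp add: mult.assoc)
  qed
  finally show ?thesis .
qed

definition CI :: "('a \<Rightarrow> real \<times> 'b \<Rightarrow> real) \<Rightarrow> real \<Rightarrow> 'a \<Rightarrow> real" where
  "CI f t w = (\<integral>p. indicator ({0<..t} \<times> UNIV) p * f w p \<partial>N w) - (\<integral>p. indicator ({0<..t} \<times> UNIV) p * f w p \<partial>L)"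

lemma strip_bound:
  assumes X: "sets X = sets L" and w: "h \<in> borel_measurable L" and g: "\<And>p. p \<in> space L \<Longrightarrow> ennreal \<bar>h p\<bar> \<le> g p"
    and fin: "(\<integral>\<^sup>+p\<in>{0<..T} \<times> UNIV. g p \<partial>X) < \<infinity>" and t: "t \<le> T"
  shows "integrable X (\<lambda>p. indicator ({0<..t} \<times> UNIV) p * h p)"
    "ennreal \<bar>\<integral>p. indicator ({0<..t} \<times> UNIV) p * h p \<partial>X\<bar> \<le> (\<integral>\<^sup>+p\<in>{0<..T} \<times> UNIV. g p \<partial>X)"
proof -
  have sp: "space X = space L" using X by (rule sets_eq_imp_space_eq)
  have m: "(\<lambda>p. indicator ({0<..t} \<times> UNIV) p * h p) \<in> borel_measurable X"
    unfolding measurable_cong_sets[OF X refl] using w by measurable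
  have le: "(\<integral>\<^sup>+p. ennreal (norm (indicator ({0<..t} \<times> UNIV) p * h p)) \<partial>X) \<le> (\<integral>\<^sup>+p\<in>{0<..T} \<times> UNIV. g p \<partial>X)"
  proof (rule nn_integral_mono)
    fix p assume "p \<in> space X"
    then have "ennreal \<bar>h p\<bar> \<le> g p" using g sp by simp
    then show "ennreal (norm (indicator ({0<..t} \<times> UNIV) p * h p)) \<le> g p * indicator ({0<..T} \<times> UNIV) p"
      using t by (cases p) (auto simp: indicator_def)
  qed
  then show i: "integrable X (\<lambda>p. indicator ({0<..t} \<times> UNIV) p * h p)"
    using le_less_trans[OF le fin] by (intro integrableI_bounded m) auto
  show "ennreal \<bar>\<integral>p. indicator ({0<..t} \<times> UNIV) p * h p \<partial>X\<bar> \<le> (\<integral>\<^sup>+p\<in>{0<..T} \<times> UNIV. g p \<partial>X)"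
    using order_trans[OF integral_norm_bound_ennreal[OF i] le] by simp
qed

lemma CI_bound:
  assumes w: "w \<in> space M" and f: "f w \<in> borel_measurable L" and g: "\<And>p. p \<in> space L \<Longrightarrow> ennreal \<bar>f w p\<bar> \<le> g w p"
    and fin: "NF T g w < \<infinity>" "LF T g w < \<infinity>" and t: "t \<le> T"
  shows "ennreal \<bar>CI f t w\<bar> \<le> NF T g w + LF T g w"
proof -
  note N = strip_bound(2)[OF sets_N[OF w] f g fin(1)[unfolded NF_def] t]
  note Lb = strip_bound(2)[OF refl f g fin(2)[unfolded LF_def] t]
  have "\<bar>CI f t w\<bar> \<le> \<bar>\<integral>p. indicator ({0<..t} \<times> UNIV) p * f w p \<partial>N w\<bar> + \<bar>\<integral>p. indicator ({0<..t} \<times> UNIV) p * f w p \<partial>L\<bar>"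
    unfolding CI_def by (rule abs_triangle_ineq4)
  then have "ennreal \<bar>CI f t w\<bar> \<le> ennreal \<bar>\<integral>p. indicator ({0<..t} \<times> UNIV) p * f w p \<partial>N w\<bar> + ennreal \<bar>\<integral>p. indicator ({0<..t} \<times> UNIV) p * f w p \<partial>L\<bar>"
    by (simp add: ennreal_plus[symmetric] ennreal_leI del: ennreal_plus)
  also have "\<dots> \<le> NF T g w + LF T g w" unfolding NF_def LF_def by (intro add_mono N Lb)
  finally show ?thesis .
qed

lemma CI_add:
  assumes w: "w \<in> space M" and f: "f w \<in> borel_measurable L" "f' w \<in> borel_measurable L"
    and g: "\<And>p. p \<in> space L \<Longrightarrow> ennreal \<bar>f w p\<bar> \<le> g w p" "\<And>p. p \<in> space L \<Longrightarrow> ennreal \<bar>f' w p\<bar> \<le> g w p"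
    and fin: "NF T g w < \<infinity>" "LF T g w < \<infinity>" and t: "t \<le> T"
  shows "CI (\<lambda>w p. f w p + f' w p) t w = CI f t w + CI f' t w"
proof -
  note N = strip_bound(1)[OF sets_N[OF w] f(1) g(1) fin(1)[unfolded NF_def] t] strip_bound(1)[OF sets_N[OF w] f(2) g(2) fin(1)[unfolded NF_def] t]
  note Lb = strip_bound(1)[OF refl f(1) g(1) fin(2)[unfolded LF_def] t] strip_bound(1)[OF refl f(2) g(2) fin(2)[unfolded LF_def] t]
  show ?thesis unfolding CI_def distrib_left using N Lb by simp
qed

text \<open>On a set of marks of finite intensity \<open>RI_maximal\<close> applies. The remaining
  marks are estimated in absolute value by \<open>jump_markov\<close>, and their share vanishes
  along the exhaustion by dominated convergence. The constant 8 arises from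
  \<open>2 * \<delta>\<close> against \<open>(e/2)\<^sup>2\<close>.\<close>

lemma CI_small_maximal:
  assumes f: "f \<in> BP" "\<And>x. \<bar>f x\<bar> \<le> (1::real)" and T: "0 \<le> T"
    and c: "\<And>w. w \<in> space M \<Longrightarrow> LF T (pull (\<lambda>x. ennreal \<bar>f x\<bar>)) w \<le> ennreal c"
    and q: "\<And>w. w \<in> space M \<Longrightarrow> LF T (pull (\<lambda>x. ennreal ((f x)\<^sup>2))) w \<le> ennreal \<delta>"
    and I: "finite I" "\<And>t. t \<in> I \<Longrightarrow> 0 \<le> t \<and> t \<le> T" and e: "0 < e" and \<delta>: "0 \<le> \<delta>"
  shows "outer_measure_of M {w \<in> space M. \<exists>t\<in>I. e < \<bar>CI (pull f) t w\<bar>} \<le> ennreal (8 * \<delta> / e\<^sup>2)"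
proof -
  obtain V where V: "\<And>m::nat. V m \<in> sets \<nu>" "\<And>m. emeasure \<nu> (V m) < \<infinity>" "incseq V" "(\<Union>m. V m) = space \<nu>"
    using exhaustion by blast
  let ?a = "\<lambda>x. ennreal \<bar>f x\<bar>"
  have am: "?a \<in> BP" using f(1) by measurable
  have Vm[measurable]: "(\<lambda>x. indicator (V m) (snd x) :: real) \<in> BP" for m
    using V(1)[of m] by measurable
  define u where "u m x = f x * (1 - indicator (V m) (snd x))" for m x
  define v where "v m x = f x * indicator (V m) (snd x)" for m x
  define g where "g m x = ennreal \<bar>u m x\<bar>" for m x
  have wm: "u m \<in> BP" "v m \<in> BP" for m
    unfolding u_def[abs_def] v_def[abs_def] using f(1) by measurable
  have gm: "g m \<in> BP" for m unfolding g_def[abs_def] using wm(1) by measurable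
  let ?A = "{w \<in> space M. \<exists>t\<in>I. e < \<bar>CI (pull f) t w\<bar>}"
  have fin: "AE w in M. NF T (pull ?a) w < \<infinity>"
  proof -
    obtain h where h: "h \<in> borel_measurable M" "AE w in M. NF T (pull ?a) w = h w"
      "(\<integral>\<^sup>+w. h w \<partial>M) = (\<integral>\<^sup>+w. LF T (pull ?a) w \<partial>M)" using compensation_full[OF T am] by blast
    have "(\<integral>\<^sup>+w. LF T (pull ?a) w \<partial>M) \<le> (\<integral>\<^sup>+w. ennreal c \<partial>M)" by (intro nn_integral_mono c)
    also have "\<dots> < \<infinity>" by (simp add: emeasure_space_1)
    finally have "AE w in M. h w \<noteq> \<infinity>" using h by (intro nn_integral_PInf_AE) auto
    with h(2) show ?thesis by eventually_elim (simp add: top.not_eq_extremum)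
  qed
  have bound: "outer_measure_of M ?A \<le> ennreal (8 * \<delta> / e\<^sup>2) + ennreal (4 / e) * (\<integral>\<^sup>+w. LF T (pull (g m)) w \<partial>M)" for m
  proof -
    let ?B = "{w \<in> space M. \<exists>t\<in>I. e/2 < \<bar>RI ({0<..t} \<times> V m) (pull f) w\<bar>}"
    let ?C = "{w \<in> space M. ennreal (e/2) < NF T (pull (g m)) w + LF T (pull (g m)) w}"
    note S = box_finite[OF order_refl V(1,2), of T m]
    have "outer_measure_of M ?A \<le> outer_measure_of M {w \<in> space M. w \<in> ?B \<or> w \<in> ?C}"
    proof (rule outer_measure_of_AE_mono)
      show "AE w in M. (\<exists>t\<in>I. e < \<bar>CI (pull f) t w\<bar>) \<longrightarrow> w \<in> ?B \<or> w \<in> ?C"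
        using AE_conjI[OF fin poisson_AE_finite[OF S]]
      proof (rule AE_mp, intro AE_I2 impI)
        fix w assume w: "w \<in> space M" and fn: "NF T (pull ?a) w < \<infinity> \<and> emeasure (N w) ({0<..T} \<times> V m) < \<infinity>" and "\<exists>t\<in>I. e < \<bar>CI (pull f) t w\<bar>"
        then obtain t where t: "t \<in> I" "e < \<bar>CI (pull f) t w\<bar>" by blast
        have tT: "0 \<le> t" "t \<le> T" using I(2)[OF t(1)] by auto
        have fl: "LF T (pull ?a) w < \<infinity>" using le_less_trans[OF c[OF w]] by simp
        have sec: "pull (v m) w \<in> borel_measurable L" "pull (u m) w \<in> borel_measurable L" using pull_section[OF wm(2) w] pull_section[OF wm(1) w] by auto
        have "pull f = (\<lambda>w p. pull (v m) w p + pull (u m) w p)" by (auto simp: fun_eq_iff v_def u_def algebra_simps)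
        then have "CI (pull f) t w = CI (\<lambda>w p. pull (v m) w p + pull (u m) w p) t w" by simp
        also have "\<dots> = CI (pull (v m)) t w + CI (pull (u m)) t w"
          by (rule CI_add[where f = "pull (v m)" and f' = "pull (u m)" and g = "pull ?a" and T = T])
             (use w sec fn fl tT in \<open>auto simp: v_def u_def indicator_def\<close>)
        also have "CI (pull (v m)) t w = RI ({0<..t} \<times> V m) (pull f) w"
        proof -
          have "indicator ({0<..t} \<times> UNIV) p * pull (v m) w p = indicator ({0<..t} \<times> V m) p * pull f w p" for p
            by (cases p) (auto simp: v_def indicator_def)
          moreover have "emeasure (N w) ({0<..t} \<times> V m) < \<infinity>"
          proof -
            have "{0<..t} \<times> V m \<subseteq> {0<..T} \<times> V m" using tT by auto
            then show ?thesis using le_less_trans[OF emeasure_mono conjunct2[OF fn]] S(1) w by simp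
          qed
          ultimately show ?thesis by (simp only: CI_def RI_def if_True)
        qed
        finally have CIeq: "CI (pull f) t w = RI ({0<..t} \<times> V m) (pull f) w + CI (pull (u m)) t w" .
        have gle: "NF T (pull (g m)) w \<le> NF T (pull ?a) w" "LF T (pull (g m)) w \<le> LF T (pull ?a) w"
          unfolding NF_def LF_def by (intro nn_integral_mono mult_right_mono; auto simp: g_def u_def indicator_def)+
        have "ennreal \<bar>CI (pull (u m)) t w\<bar> \<le> NF T (pull (g m)) w + LF T (pull (g m)) w"
          by (rule CI_bound[OF w, where f = "pull (u m)"])
             (use sec fn fl gle tT in \<open>auto simp: g_def intro: le_less_trans\<close>)
        then have *: "ennreal (e/2) < ennreal \<bar>CI (pull (u m)) t w\<bar> \<Longrightarrow> w \<in> ?C" using w by auto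
        show "w \<in> ?B \<or> w \<in> ?C"
        proof (cases "e/2 < \<bar>RI ({0<..t} \<times> V m) (pull f) w\<bar>")
          case True
          then show ?thesis using t(1) w by auto
        next
          case False
          then have "e/2 < \<bar>CI (pull (u m)) t w\<bar>" using t(2) CIeq by linarith
          then show ?thesis using * e by (simp add: ennreal_less_iff)
        qed
      qed
    qed
    also have "{w \<in> space M. w \<in> ?B \<or> w \<in> ?C} = ?B \<union> ?C" by auto
    also have "outer_measure_of M (?B \<union> ?C) \<le> outer_measure_of M ?B + outer_measure_of M ?C" by (rule outer_measure_of_Un_le) auto
    also have "\<dots> \<le> ennreal (2 * \<delta> / (e/2)\<^sup>2) + ennreal (2 / (e/2)) * (\<integral>\<^sup>+w. LF T (pull (g m)) w \<partial>M)"
    proof (intro add_mono)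
      show "outer_measure_of M ?B \<le> ennreal (2 * \<delta> / (e/2)\<^sup>2)"
      proof (rule RI_maximal[OF V(1,2) f I])
        fix w assume w: "w \<in> space M"
        have "LI ({0<..T} \<times> V m) (pull (\<lambda>x. ennreal ((f x)\<^sup>2))) w \<le> LF T (pull (\<lambda>x. ennreal ((f x)\<^sup>2))) w"
          unfolding LI_def LF_def by (intro nn_integral_mono mult_left_mono) (auto simp: indicator_def)
        then show "LI ({0<..T} \<times> V m) (pull (\<lambda>x. ennreal ((f x)\<^sup>2))) w \<le> ennreal \<delta>" using q[OF w] by (rule order_trans)
      qed (use e \<delta> in auto)
      show "outer_measure_of M ?C \<le> ennreal (2 / (e/2)) * (\<integral>\<^sup>+w. LF T (pull (g m)) w \<partial>M)"
        by (rule jump_markov[OF T gm]) (use e in simp)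
    qed
    finally show ?thesis by (simp add: power2_eq_square)
  qed
  have "(\<lambda>m. \<integral>\<^sup>+w. LF T (pull (g m)) w \<partial>M) \<longlonglongrightarrow> (\<integral>\<^sup>+w. 0 \<partial>M)"
  proof (rule nn_integral_dominated_convergence[where w = "\<lambda>w. ennreal c"])
    show "AE w in M. (\<lambda>m. LF T (pull (g m)) w) \<longlonglongrightarrow> 0"
    proof (rule AE_I2)
      fix w assume w: "w \<in> space M"
      have "(\<lambda>m. \<integral>\<^sup>+p. pull (g m) w p * indicator ({0<..T} \<times> UNIV) p \<partial>L) \<longlonglongrightarrow> (\<integral>\<^sup>+p. 0 \<partial>L)"
      proof (rule nn_integral_dominated_convergence[where w = "\<lambda>p. pull ?a w p * indicator ({0<..T} \<times> UNIV) p"])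
        show "(\<lambda>p. pull (g m) w p * indicator ({0<..T} \<times> UNIV) p) \<in> borel_measurable L" for m
          using pull_section[OF gm w] by measurable
        show "(\<lambda>p. pull ?a w p * indicator ({0<..T} \<times> UNIV) p) \<in> borel_measurable L"
          using pull_section[OF am w] by measurable
        show "(\<integral>\<^sup>+p. pull ?a w p * indicator ({0<..T} \<times> UNIV) p \<partial>L) < \<infinity>"
          using c[OF w] unfolding LF_def by (rule le_less_trans) simp
        show "AE p in L. pull (g m) w p * indicator ({0<..T} \<times> UNIV) p \<le> pull ?a w p * indicator ({0<..T} \<times> UNIV) p" for m
          by (intro AE_I2 mult_right_mono) (auto simp: g_def u_def indicator_def)
        show "AE p in L. (\<lambda>m. pull (g m) w p * indicator ({0<..T} \<times> UNIV) p) \<longlonglongrightarrow> 0"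
        proof (rule AE_I2)
          fix p assume "p \<in> space L"
          then have "snd p \<in> (\<Union>m. V m)" using V(4) by (auto simp: space_L)
          then obtain m0 where m0: "snd p \<in> V m0" by blast
          have "\<forall>\<^sub>F m in sequentially. pull (g m) w p * indicator ({0<..T} \<times> UNIV) p = 0"
            using eventually_ge_at_top[of m0]
          proof eventually_elim
            case (elim m)
            then have "snd p \<in> V m" using m0 V(3) by (auto simp: incseq_def)
            then show ?case by (simp add: g_def u_def)
          qed
          then show "(\<lambda>m. pull (g m) w p * indicator ({0<..T} \<times> UNIV) p) \<longlonglongrightarrow> 0" by (rule tendsto_eventually)
        qed
      qed simp
      then show "(\<lambda>m. LF T (pull (g m)) w) \<longlonglongrightarrow> 0" by (simp add: LF_def)
    qed
    show "AE w in M. LF T (pull (g m)) w \<le> ennreal c" for m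
    proof (rule AE_I2)
      fix w assume w: "w \<in> space M"
      have "LF T (pull (g m)) w \<le> LF T (pull ?a) w"
        unfolding LF_def by (intro nn_integral_mono mult_right_mono) (auto simp: g_def u_def indicator_def)
      then show "LF T (pull (g m)) w \<le> ennreal c" using c[OF w] by (rule order_trans)
    qed
    show "LF T (pull (g m)) \<in> borel_measurable M" for m by (rule LF_pull_measurable[OF T gm])
    show "(\<integral>\<^sup>+w. ennreal c \<partial>M) < \<infinity>" by (simp add: emeasure_space_1)
  qed auto
  then have "(\<lambda>m. ennreal (8 * \<delta> / e\<^sup>2) + ennreal (4 / e) * (\<integral>\<^sup>+w. LF T (pull (g m)) w \<partial>M)) \<longlonglongrightarrow> ennreal (8 * \<delta> / e\<^sup>2) + ennreal (4 / e) * 0"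
    by (intro tendsto_add tendsto_const ennreal_tendsto_cmult) auto
  from LIMSEQ_le_const[OF this] bound show ?thesis by auto
qed

text \<open>\<open>l12\<close> is the square for jumps up to 1 and the absolute value beyond. Jumps
  of the first kind are bounded through second moments, those of the second kind through first
  moments, which explains the two terms of the bound.\<close>

lemma CI_maximal:
  assumes f: "f \<in> BP" and T: "0 \<le> T"
    and c: "\<And>w. w \<in> space M \<Longrightarrow> LF T (pull (\<lambda>x. ennreal \<bar>f x\<bar>)) w \<le> ennreal c"
    and q: "\<And>w. w \<in> space M \<Longrightarrow> LF T (pull (\<lambda>x. ennreal (l12 (f x)))) w \<le> ennreal \<delta>"
    and I: "finite I" "\<And>t. t \<in> I \<Longrightarrow> 0 \<le> t \<and> t \<le> T" and e: "0 < e" and \<delta>: "0 \<le> \<delta>"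
  shows "outer_measure_of M {w \<in> space M. \<exists>t\<in>I. e < \<bar>CI (pull f) t w\<bar>} \<le> ennreal (32 * \<delta> / e\<^sup>2 + 4 * \<delta> / e)"
proof -
  define fs where "fs x = (if \<bar>f x\<bar> \<le> 1 then f x else 0)" for x
  define fb where "fb x = (if \<bar>f x\<bar> \<le> 1 then 0 else f x)" for x
  let ?a = "\<lambda>x. ennreal \<bar>f x\<bar>" and ?b = "\<lambda>x. ennreal \<bar>fb x\<bar>"
  note [measurable] = f
  have m: "fs \<in> BP" "fb \<in> BP" "?a \<in> BP"
    unfolding fs_def[abs_def] fb_def[abs_def] by measurable
  have bm: "?b \<in> BP" using m(2) by measurable
  let ?A = "{w \<in> space M. \<exists>t\<in>I. e < \<bar>CI (pull f) t w\<bar>}"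
  let ?B = "{w \<in> space M. \<exists>t\<in>I. e/2 < \<bar>CI (pull fs) t w\<bar>}"
  let ?C = "{w \<in> space M. ennreal (e/2) < NF T (pull ?b) w + LF T (pull ?b) w}"
  have fin: "AE w in M. NF T (pull ?a) w < \<infinity>"
  proof -
    obtain h where h: "h \<in> borel_measurable M" "AE w in M. NF T (pull ?a) w = h w"
      "(\<integral>\<^sup>+w. h w \<partial>M) = (\<integral>\<^sup>+w. LF T (pull ?a) w \<partial>M)" using compensation_full[OF T m(3)] by blast
    have "(\<integral>\<^sup>+w. LF T (pull ?a) w \<partial>M) \<le> (\<integral>\<^sup>+w. ennreal c \<partial>M)" by (intro nn_integral_mono c)
    also have "\<dots> < \<infinity>" by (simp add: emeasure_space_1)
    finally have "AE w in M. h w \<noteq> \<infinity>" using h by (intro nn_integral_PInf_AE) auto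
    with h(2) show ?thesis by eventually_elim (simp add: top.not_eq_extremum)
  qed
  have lb: "\<bar>fs x\<bar> \<le> \<bar>f x\<bar>" "\<bar>fb x\<bar> \<le> \<bar>f x\<bar>" "(fs x)\<^sup>2 \<le> l12 (f x)" "\<bar>fb x\<bar> \<le> l12 (f x)" "\<bar>fs x\<bar> \<le> 1" for x
    by (auto simp: fs_def fb_def l12_le_1 l12_ge_1 l12_nonneg)
  have "outer_measure_of M ?A \<le> outer_measure_of M {w \<in> space M. w \<in> ?B \<or> w \<in> ?C}"
  proof (rule outer_measure_of_AE_mono)
    show "AE w in M. (\<exists>t\<in>I. e < \<bar>CI (pull f) t w\<bar>) \<longrightarrow> w \<in> ?B \<or> w \<in> ?C"
      using fin
    proof (rule AE_mp, intro AE_I2 impI)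
      fix w assume w: "w \<in> space M" and fn: "NF T (pull ?a) w < \<infinity>" and "\<exists>t\<in>I. e < \<bar>CI (pull f) t w\<bar>"
      then obtain t where t: "t \<in> I" "e < \<bar>CI (pull f) t w\<bar>" by blast
      have tT: "0 \<le> t" "t \<le> T" using I(2)[OF t(1)] by auto
      have fl: "LF T (pull ?a) w < \<infinity>" using le_less_trans[OF c[OF w]] by simp
      note sec = pull_section[OF m(1) w] pull_section[OF m(2) w]
      have "pull f = (\<lambda>w p. pull fs w p + pull fb w p)" by (auto simp: fun_eq_iff fs_def fb_def)
      then have "CI (pull f) t w = CI (\<lambda>w p. pull fs w p + pull fb w p) t w" by simp
      also have "\<dots> = CI (pull fs) t w + CI (pull fb) t w"
        by (rule CI_add[where f = "pull fs" and f' = "pull fb" and g = "pull ?a" and T = T])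
           (use w sec fn fl tT lb in \<open>auto intro!: ennreal_leI\<close>)
      finally have CIeq: "CI (pull f) t w = CI (pull fs) t w + CI (pull fb) t w" .
      have gle: "NF T (pull ?b) w \<le> NF T (pull ?a) w" "LF T (pull ?b) w \<le> LF T (pull ?a) w"
        unfolding NF_def LF_def by (intro nn_integral_mono mult_right_mono ennreal_leI lb; simp)+
      have "ennreal \<bar>CI (pull fb) t w\<bar> \<le> NF T (pull ?b) w + LF T (pull ?b) w"
        by (rule CI_bound[OF w, where f = "pull fb"]) (use sec fn fl gle tT in \<open>auto intro: le_less_trans\<close>)
      then have *: "ennreal (e/2) < ennreal \<bar>CI (pull fb) t w\<bar> \<Longrightarrow> w \<in> ?C" using w by auto
      show "w \<in> ?B \<or> w \<in> ?C"
      proof (cases "e/2 < \<bar>CI (pull fs) t w\<bar>")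
        case True
        then show ?thesis using t(1) w by auto
      next
        case False
        then have "e/2 < \<bar>CI (pull fb) t w\<bar>" using t(2) CIeq by linarith
        then show ?thesis using * e by (simp add: ennreal_less_iff)
      qed
    qed
  qed
  also have "{w \<in> space M. w \<in> ?B \<or> w \<in> ?C} = ?B \<union> ?C" by auto
  also have "outer_measure_of M (?B \<union> ?C) \<le> outer_measure_of M ?B + outer_measure_of M ?C" by (rule outer_measure_of_Un_le) auto
  also have "\<dots> \<le> ennreal (8 * \<delta> / (e/2)\<^sup>2) + ennreal (2 / (e/2)) * ennreal \<delta>"
  proof (intro add_mono)
    show "outer_measure_of M ?B \<le> ennreal (8 * \<delta> / (e/2)\<^sup>2)"
    proof (rule CI_small_maximal[OF m(1) lb(5) T _ _ I])
      fix w assume w: "w \<in> space M"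
      have "LF T (pull (\<lambda>x. ennreal \<bar>fs x\<bar>)) w \<le> LF T (pull ?a) w"
        unfolding LF_def by (intro nn_integral_mono mult_right_mono ennreal_leI lb) simp
      then show "LF T (pull (\<lambda>x. ennreal \<bar>fs x\<bar>)) w \<le> ennreal c" using c[OF w] by (rule order_trans)
      have "LF T (pull (\<lambda>x. ennreal ((fs x)\<^sup>2))) w \<le> LF T (pull (\<lambda>x. ennreal (l12 (f x)))) w"
        unfolding LF_def by (intro nn_integral_mono mult_right_mono ennreal_leI lb) simp
      then show "LF T (pull (\<lambda>x. ennreal ((fs x)\<^sup>2))) w \<le> ennreal \<delta>" using q[OF w] by (rule order_trans)
    qed (use e \<delta> in auto)
    have "outer_measure_of M ?C \<le> ennreal (2 / (e/2)) * (\<integral>\<^sup>+w. LF T (pull ?b) w \<partial>M)"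
      by (rule jump_markov[OF T bm]) (use e in simp)
    also have "\<dots> \<le> ennreal (2 / (e/2)) * (\<integral>\<^sup>+w. ennreal \<delta> \<partial>M)"
    proof (intro mult_left_mono nn_integral_mono)
      fix w assume w: "w \<in> space M"
      have "LF T (pull ?b) w \<le> LF T (pull (\<lambda>x. ennreal (l12 (f x)))) w"
        unfolding LF_def by (intro nn_integral_mono mult_right_mono ennreal_leI lb) simp
      then show "LF T (pull ?b) w \<le> ennreal \<delta>" using q[OF w] by (rule order_trans)
    qed simp
    finally show "outer_measure_of M ?C \<le> ennreal (2 / (e/2)) * ennreal \<delta>" by (simp add: emeasure_space_1)
  qed
  also have "\<dots> = ennreal (32 * \<delta> / e\<^sup>2 + 4 * \<delta> / e)"
    using e \<delta> by (subst ennreal_plus) (auto simp: ennreal_mult[symmetric] power2_eq_square)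
  finally show ?thesis .
qed

lemma LF_mono_t: "s \<le> t \<Longrightarrow> LF s f w \<le> LF t f w"
  unfolding LF_def by (intro nn_integral_mono mult_left_mono) (auto simp: indicator_def)

lemma LF_adapted:
  assumes t: "0 \<le> t" and f: "f \<in> BP"
  shows "LF t (pull f) \<in> borel_measurable (F t)"
proof -
  have "(\<lambda>(w, p). pull f w p * indicator ({0<..t} \<times> UNIV) p) \<in> borel_measurable (F t \<Otimes>\<^sub>M L)"
    using predictable_measurable_F[OF t f] by (simp add: case_prod_unfold indicator_strip)
  from L.borel_measurable_nn_integral[OF this] show ?thesis by (simp add: LF_def[abs_def])
qed

lemma AE_L_time_neq: "0 < s \<Longrightarrow> AE p in L. fst p \<noteq> s"
proof -
  assume s: "0 < s"
  interpret v: sigma_finite_measure \<nu> by (rule sigma_finite_\<nu>)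
  have "{s} = {0<..} \<inter> {s}" using s by auto
  moreover have "{0<..} \<inter> {s} \<in> sets lebesgue_pos" by (auto simp: sets_restrict_space)
  ultimately have m: "{s} \<in> sets lebesgue_pos" by simp
  have "emeasure lebesgue_pos {s} = emeasure lborel {s}" by (rule emeasure_restrict_space) (use s in auto)
  then have "emeasure L ({s} \<times> space \<nu>) = 0" using v.emeasure_pair_measure_Times[OF m sets.top] by simp
  then have "{s} \<times> space \<nu> \<in> null_sets L" using m by (auto simp: null_sets_def)
  then show ?thesis by (rule AE_I') (use s in \<open>auto simp: space_L\<close>)
qed

text \<open>Looking strictly backwards, and at countably many times, makes the cut predictable. The
  part that is kept has size at most \<open>\<delta>\<close> on every path, while a path whose size
  stays within \<open>\<delta>\<close> up to \<open>t\<close> is not cut up to \<open>t\<close>: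
  this turns bounds on an event into bounds that hold everywhere.\<close>

lemma predictable_cut:
  fixes \<delta> :: ennreal
  assumes f: "f \<in> BP"
  defines "D \<equiv> {x \<in> space PS. \<forall>r\<in>\<rat>. 0 \<le> r \<and> r < fst x \<longrightarrow> LF r (pull f) (snd x) \<le> \<delta>}"
  shows "D \<in> sets PS"
    and "\<And>w. w \<in> space M \<Longrightarrow> LF T (pull (\<lambda>x. f x * indicator D (fst x))) w \<le> \<delta>"
    and "\<And>w s t. w \<in> space M \<Longrightarrow> 0 < s \<Longrightarrow> s \<le> t \<Longrightarrow> LF t (pull f) w \<le> \<delta> \<Longrightarrow> (s, w) \<in> D"
proof -
  have "D = space PS - (\<Union>r\<in>\<rat> \<inter> {0..}. {r<..} \<times> {w \<in> space M. \<not> LF r (pull f) w \<le> \<delta>})"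
    by (auto simp: D_def space_PS)
  also have "\<dots> \<in> sets PS"
  proof (intro sets.Diff sets.top sets.countable_UN'' countable_Int1 countable_rat)
    fix r :: real assume r: "r \<in> \<rat> \<inter> {0..}"
    have [measurable]: "LF r (pull f) \<in> borel_measurable (F r)" using r by (intro LF_adapted f) auto
    have "{w \<in> space (F r). \<not> LF r (pull f) w \<le> \<delta>} \<in> sets (F r)" by measurable
    then show "{r<..} \<times> {w \<in> space M. \<not> LF r (pull f) w \<le> \<delta>} \<in> sets PS"
      using r by (intro predictable_rect) (auto simp: space_F)
  qed
  finally show "D \<in> sets PS" .
  show "(s, w) \<in> D" if "w \<in> space M" "0 < s" "s \<le> t" "LF t (pull f) w \<le> \<delta>" for w s t
  proof -
    have "LF r (pull f) w \<le> \<delta>" if "r < s" for r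
      using LF_mono_t[of r t "pull f" w] that \<open>s \<le> t\<close> \<open>LF t (pull f) w \<le> \<delta>\<close> by simp
    then show ?thesis using that(1,2) by (auto simp: D_def space_PS)
  qed
  show "LF T (pull (\<lambda>x. f x * indicator D (fst x))) w \<le> \<delta>" if w: "w \<in> space M" for w
  proof -
    define P where "P = {s. 0 < s \<and> s \<le> T \<and> (s, w) \<in> D}"
    show ?thesis
    proof (cases "P = {}")
      case True
      have "LF T (pull (\<lambda>x. f x * indicator D (fst x))) w = (\<integral>\<^sup>+p. 0 \<partial>L)"
        unfolding LF_def by (intro nn_integral_cong) (use True in \<open>auto simp: P_def indicator_def\<close>)
      then show ?thesis by simp
    next
      case False
      then obtain s0 where s0: "s0 \<in> P" by blast
      have bdd: "bdd_above P" unfolding P_def by (rule bdd_aboveI[of _ T]) auto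
      \<comment> \<open>The supremum of the kept times of this path. The bound holds at the rational
        times \<open>r j\<close> that approach \<open>u\<close> from below, Fatou's lemma transfers
        it, and the time \<open>u\<close> itself has intensity 0.\<close>
      define u where "u = Sup P"
      have u: "s \<le> u" if "s \<in> P" for s unfolding u_def by (rule cSup_upper[OF that bdd])
      have u0: "0 < u" using u[OF s0] s0 by (auto simp: P_def)
      have "\<exists>r\<in>\<rat>. max 0 (u - 1 / real (Suc j)) < r \<and> r < u" for j
        by (rule Rats_dense_in_real) (use u0 in auto)
      then obtain r where r: "\<And>j. r j \<in> \<rat>" "\<And>j. max 0 (u - 1 / real (Suc j)) < r j" "\<And>j. r j < u" by metis
      have A: "LF (r j) (pull f) w \<le> \<delta>" for j
      proof -
        obtain s where s: "s \<in> P" "r j < s" using r(3)[of j] less_cSup_iff[OF False bdd] unfolding u_def by blast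
        have "0 \<le> r j" using r(2)[of j] by simp
        then show ?thesis using s r(1)[of j] by (auto simp: P_def D_def)
      qed
      have fw: "pull f w \<in> borel_measurable L" by (rule pull_section[OF f w])
      have "LF T (pull (\<lambda>x. f x * indicator D (fst x))) w \<le> (\<integral>\<^sup>+p. liminf (\<lambda>j. pull f w p * indicator ({0<..r j} \<times> UNIV) p) \<partial>L)"
        unfolding LF_def
      proof (rule nn_integral_mono_AE, rule AE_mp[OF AE_L_time_neq[OF u0]], intro AE_I2 impI)
        fix p assume "p \<in> space L" and pu: "fst p \<noteq> u"
        show "pull (\<lambda>x. f x * indicator D (fst x)) w p * indicator ({0<..T} \<times> UNIV) p \<le> liminf (\<lambda>j. pull f w p * indicator ({0<..r j} \<times> UNIV) p)"
        proof (cases "fst p \<in> P")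
          case True
          then have pu: "0 < fst p" "fst p < u" using u[OF True] pu by (auto simp: P_def)
          obtain j0 where j0: "1 / real (Suc j0) < u - fst p" using nat_approx_posE[of "u - fst p"] pu by auto
          have "\<forall>\<^sub>F j in sequentially. pull f w p \<le> pull f w p * indicator ({0<..r j} \<times> UNIV) p"
            using eventually_ge_at_top[of j0]
          proof eventually_elim
            case (elim j)
            have "1 / real (Suc j) \<le> 1 / real (Suc j0)" using elim by (simp add: frac_le)
            then have "fst p < r j" using r(2)[of j] j0 by linarith
            then show ?case using pu by (simp add: indicator_strip)
          qed
          then have "pull f w p \<le> liminf (\<lambda>j. pull f w p * indicator ({0<..r j} \<times> UNIV) p)" by (rule Liminf_bounded)
          then show ?thesis by (rule order_trans[rotated]) (auto simp: indicator_def)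
        next
          case False
          then show ?thesis by (cases p) (auto simp: P_def indicator_def)
        qed
      qed
      also have "\<dots> \<le> liminf (\<lambda>j. \<integral>\<^sup>+p. pull f w p * indicator ({0<..r j} \<times> UNIV) p \<partial>L)"
        by (rule nn_integral_liminf) (use fw in measurable)
      also have "\<dots> \<le> limsup (\<lambda>j. \<integral>\<^sup>+p. pull f w p * indicator ({0<..r j} \<times> UNIV) p \<partial>L)"
        by (rule Liminf_le_Limsup) simp
      also have "\<dots> \<le> \<delta>"
        by (rule Limsup_bounded) (use A in \<open>auto simp: LF_def\<close>)
      finally show ?thesis .
    qed
  qed
qed

text \<open>Two cuts make \<open>CI_maximal\<close> applicable: dropping jumps of size at most
  \<open>1 / real (Suc n)\<close> gives absolute integrability, and \<open>D\<close> enforces the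
  bound \<open>\<delta>\<close> on all paths. Where the bound holds anyway, \<open>D\<close> removes
  nothing and the truncated integral is unchanged. Halving \<open>e\<close> turns 32 and 4 into 128
  and 8.\<close>

lemma jump_maximal_finite:
  assumes K: "predictable M F \<nu> K"
    and I: "finite I" "\<And>t. t \<in> I \<Longrightarrow> 0 \<le> t" and e: "0 < e" and \<delta>: "0 \<le> \<delta>"
    and J: "\<And>t. t \<in> I \<Longrightarrow> tends_to_0_in_prob M (\<lambda>n w. ennreal \<bar>truncated_compensated_integral N \<nu> K (1 / real (Suc n)) t w - J t w\<bar>)"
  shows "outer_measure_of M {w \<in> space M. \<exists>t\<in>I. e < \<bar>J t w\<bar> \<and> LF t (\<lambda>w p. ennreal (l12 (K (fst p) (snd p) w))) w \<le> ennreal \<delta>} \<le> ennreal (128 * \<delta> / e\<^sup>2 + 8 * \<delta> / e)"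
proof -
  define k where "k x = K (fst (fst x)) (snd x) (snd (fst x))" for x :: "(real \<times> 'a) \<times> 'b"
  have km[measurable]: "k \<in> BP"
    using K unfolding predictable_def k_def[abs_def] by (simp add: case_prod_unfold)
  let ?q = "\<lambda>x. ennreal (l12 (k x))"
  have qm: "?q \<in> BP" by measurable
  have qpull: "(\<lambda>w p. ennreal (l12 (K (fst p) (snd p) w))) = pull ?q" by (simp add: k_def)
  define D where "D = {x \<in> space PS. \<forall>r\<in>\<rat>. 0 \<le> r \<and> r < fst x \<longrightarrow> LF r (pull ?q) (snd x) \<le> ennreal \<delta>}"
  note cut = predictable_cut[OF qm, where \<delta> = "ennreal \<delta>", folded D_def]
  define T where "T = Max (insert 0 I)"
  have T: "0 \<le> T" "\<And>t. t \<in> I \<Longrightarrow> 0 \<le> t \<and> t \<le> T" using I by (auto simp: T_def)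
  have [measurable]: "(\<lambda>x. fst x \<in> D) \<in> measurable (PS \<Otimes>\<^sub>M \<nu>) (count_space UNIV)"
    using measurable_compose[OF measurable_fst, of "\<lambda>x. x \<in> D" PS "count_space UNIV" \<nu>] cut(1) by simp
  define kn where "kn n x = (if 1 / real (Suc n) < \<bar>k x\<bar> \<and> fst x \<in> D then k x else 0)" for n x
  have knm: "kn n \<in> BP" for n unfolding kn_def[abs_def] by measurable
  have qn: "LF T (pull (\<lambda>x. ennreal (l12 (kn n x)))) w \<le> ennreal \<delta>" if "w \<in> space M" for n w
  proof -
    have "LF T (pull (\<lambda>x. ennreal (l12 (kn n x)))) w \<le> LF T (pull (\<lambda>x. ?q x * indicator D (fst x))) w"
      unfolding LF_def by (intro nn_integral_mono mult_right_mono) (auto simp: kn_def indicator_def l12_def)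
    also have "\<dots> \<le> ennreal \<delta>" by (rule cut(2)[OF that])
    finally show ?thesis .
  qed
  have cn: "LF T (pull (\<lambda>x. ennreal \<bar>kn n x\<bar>)) w \<le> ennreal (real (Suc (Suc n)) * \<delta>)" if w: "w \<in> space M" for n w
  proof -
    \<comment> \<open>The factor is the one in \<open>abs_trunc_le\<close> at level
      \<open>1 / real (Suc n)\<close>, namely \<open>1 + real (Suc n)\<close>.\<close>
    have le: "\<bar>kn n x\<bar> \<le> real (Suc (Suc n)) * l12 (kn n x)" for x
    proof -
      have "kn n x = 0 \<or> 1 / real (Suc n) < \<bar>kn n x\<bar>" by (auto simp: kn_def)
      then have "trunc (1 / real (Suc n)) (kn n x) = kn n x" by (auto simp: trunc_def)
      then show ?thesis using abs_trunc_le[of "1 / real (Suc n)" "kn n x"] by (simp add: algebra_simps)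
    qed
    have le': "ennreal \<bar>kn n x\<bar> \<le> ennreal (real (Suc (Suc n))) * ennreal (l12 (kn n x))" for x
    proof -
      have "ennreal (real (Suc (Suc n))) * ennreal (l12 (kn n x)) = ennreal (real (Suc (Suc n)) * l12 (kn n x))"
        by (rule ennreal_mult[symmetric]) (auto simp: l12_nonneg)
      then show ?thesis using ennreal_leI[OF le[of x]] by metis
    qed
    have qnm: "pull (\<lambda>x. ennreal (l12 (kn n x))) w \<in> borel_measurable L"
      using pull_section[OF _ w, of "\<lambda>x. ennreal (l12 (kn n x))"] knm by measurable
    have "LF T (pull (\<lambda>x. ennreal \<bar>kn n x\<bar>)) w \<le> (\<integral>\<^sup>+p. ennreal (real (Suc (Suc n))) * (pull (\<lambda>x. ennreal (l12 (kn n x))) w p * indicator ({0<..T} \<times> UNIV) p) \<partial>L)"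
      unfolding LF_def mult.assoc[symmetric]
      by (intro nn_integral_mono mult_right_mono le') simp
    also have "\<dots> = ennreal (real (Suc (Suc n))) * LF T (pull (\<lambda>x. ennreal (l12 (kn n x)))) w"
      unfolding LF_def by (rule nn_integral_cmult) (use qnm in measurable)
    also have "\<dots> \<le> ennreal (real (Suc (Suc n))) * ennreal \<delta>" by (intro mult_left_mono qn w) simp
    finally show ?thesis using \<delta> by (simp add: ennreal_mult)
  qed
  have eq: "truncated_compensated_integral N \<nu> K (1 / real (Suc n)) t w = CI (pull (kn n)) t w"
    if w: "w \<in> space M" and t: "LF t (pull ?q) w \<le> ennreal \<delta>" for n t w
  proof -
    have i: "indicator ({0<..t} \<times> UNIV) p *\<^sub>R (case p of (s, v) \<Rightarrow> if 1 / real (Suc n) < \<bar>K s v w\<bar> then K s v w else 0) =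
       indicator ({0<..t} \<times> UNIV) p * pull (kn n) w p" for p
    proof (cases "p \<in> {0<..t} \<times> UNIV")
      case True
      then have "(fst p, w) \<in> D" using cut(3)[OF w _ _ t, of "fst p"] by auto
      with True show ?thesis by (auto simp: kn_def k_def)
    qed simp
    show ?thesis unfolding truncated_compensated_integral_def CI_def jump_integral_def Let_def set_lebesgue_integral_def i ..
  qed
  let ?A = "{w \<in> space M. \<exists>t\<in>I. e < \<bar>J t w\<bar> \<and> LF t (pull ?q) w \<le> ennreal \<delta>}"
  have "outer_measure_of M ?A \<le> ennreal (128 * \<delta> / e\<^sup>2 + 8 * \<delta> / e) + ennreal r" if r: "0 < r" for r :: real
  proof -
    \<comment> \<open>The added 1 keeps the divisor positive when \<open>I\<close> is empty.\<close>
    define c where "c = real (card I) + 1"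
    have c: "0 < c" by (simp add: c_def)
    let ?C = "\<lambda>n t. {w \<in> space M. ennreal (e/2) < ennreal \<bar>truncated_compensated_integral N \<nu> K (1 / real (Suc n)) t w - J t w\<bar>}"
    have "\<forall>\<^sub>F n in sequentially. \<forall>t\<in>I. outer_measure_of M (?C n t) \<le> ennreal (r / c)"
      using I(1) by (intro eventually_ball_finite ballI tends_to_0_in_prob_eventually_le J) (use e r c in auto)
    then have "\<forall>\<^sub>F n in sequentially. outer_measure_of M ?A \<le> ennreal (128 * \<delta> / e\<^sup>2 + 8 * \<delta> / e) + ennreal r"
    proof eventually_elim
      case (elim n)
      let ?B = "{w \<in> space M. \<exists>t\<in>I. e/2 < \<bar>CI (pull (kn n)) t w\<bar>}"
      have "?A \<subseteq> ?B \<union> (\<Union>t\<in>I. ?C n t)"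
      proof (rule subsetI, rule ccontr)
        fix w assume a: "w \<in> ?A" and b: "w \<notin> ?B \<union> (\<Union>t\<in>I. ?C n t)"
        then obtain t where t: "t \<in> I" "e < \<bar>J t w\<bar>" "LF t (pull ?q) w \<le> ennreal \<delta>" and w: "w \<in> space M" by blast
        have "w \<notin> ?C n t" using b t(1) by blast
        then have "\<bar>CI (pull (kn n)) t w - J t w\<bar> \<le> e/2" using w e eq[OF w t(3), of n] by (simp add: not_less)
        moreover have "w \<notin> ?B" using b by blast
        then have "\<bar>CI (pull (kn n)) t w\<bar> \<le> e/2" using w t(1) by (auto simp: not_less)
        ultimately show False using t(2) by linarith
      qed
      then have "outer_measure_of M ?A \<le> outer_measure_of M (?B \<union> (\<Union>t\<in>I. ?C n t))" by (rule outer_measure_of_mono)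
      also have "\<dots> \<le> outer_measure_of M ?B + outer_measure_of M (\<Union>t\<in>I. ?C n t)" by (rule outer_measure_of_Un_le) auto
      also have "\<dots> \<le> ennreal (32 * \<delta> / (e/2)\<^sup>2 + 4 * \<delta> / (e/2)) + (\<Sum>t\<in>I. outer_measure_of M (?C n t))"
      proof (intro add_mono)
        show "outer_measure_of M ?B \<le> ennreal (32 * \<delta> / (e/2)\<^sup>2 + 4 * \<delta> / (e/2))"
          by (rule CI_maximal[OF knm T(1) cn qn I(1) T(2)]) (use e \<delta> in auto)
        show "outer_measure_of M (\<Union>t\<in>I. ?C n t) \<le> (\<Sum>t\<in>I. outer_measure_of M (?C n t))"
          by (rule outer_measure_of_UN_le[OF I(1)]) auto
      qed
      also have "\<dots> \<le> ennreal (32 * \<delta> / (e/2)\<^sup>2 + 4 * \<delta> / (e/2)) + (\<Sum>t\<in>I. ennreal (r / c))"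
        by (intro add_mono sum_mono order_refl) (use elim in auto)
      also have "(\<Sum>t\<in>I. ennreal (r / c)) = ennreal (\<Sum>t\<in>I. r / c)" using r c by (intro sum_ennreal) auto
      also have "(\<Sum>t\<in>I. r / c) \<le> r"
      proof -
        have "(\<Sum>t\<in>I. r / c) = real (card I) * (r / c)" by (simp del: times_divide_eq_right)
        also have "\<dots> \<le> c * (r / c)" by (intro mult_right_mono) (use r c in \<open>auto simp: c_def\<close>)
        finally show ?thesis using c by simp
      qed
      finally show ?case by (simp add: power2_eq_square ennreal_leI add_left_mono)
    qed
    then show ?thesis by simp
  qed
  then show ?thesis unfolding qpull by (rule ennreal_le_epsilon)
qed

lemma jump_maximal:
  assumes K: "predictable M F \<nu> K"
    and I: "countable I" "\<And>t. t \<in> I \<Longrightarrow> 0 \<le> t" and e: "0 < e" and \<delta>: "0 \<le> \<delta>"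
    and J: "\<And>t. t \<in> I \<Longrightarrow> tends_to_0_in_prob M (\<lambda>n w. ennreal \<bar>truncated_compensated_integral N \<nu> K (1 / real (Suc n)) t w - J t w\<bar>)"
  shows "outer_measure_of M {w \<in> space M. \<exists>t\<in>I. e < \<bar>J t w\<bar> \<and> LF t (\<lambda>w p. ennreal (l12 (K (fst p) (snd p) w))) w \<le> ennreal \<delta>} \<le> ennreal (128 * \<delta> / e\<^sup>2 + 8 * \<delta> / e)"
proof -
  let ?A = "\<lambda>t. {w\<in>space M. e < \<bar>J t w\<bar> \<and> LF t (\<lambda>w p. ennreal (l12 (K (fst p) (snd p) w))) w \<le> ennreal \<delta>}"
  have *: "{w\<in>space M. \<exists>t\<in>S. e < \<bar>J t w\<bar> \<and> LF t (\<lambda>w p. ennreal (l12 (K (fst p) (snd p) w))) w \<le> ennreal \<delta>} = (\<Union>t\<in>S. ?A t)" for S by blast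
  show ?thesis unfolding *
  proof (rule outer_measure_of_countable_union_le[OF I(1)])
    fix S assume "finite S" "S \<subseteq> I"
    then show "outer_measure_of M (\<Union>t\<in>S. ?A t) \<le> ennreal (128 * \<delta> / e\<^sup>2 + 8 * \<delta> / e)"
      unfolding *[symmetric] using I J by (intro jump_maximal_finite K e \<delta>) auto
  qed auto
qed

end

section \<open>Cadlag paths\<close>

lemma cadlag_right: "cadlag f \<Longrightarrow> 0 \<le> t \<Longrightarrow> (f \<longlongrightarrow> f t) (at_right t)"
  by (simp add: cadlag_def)

lemma cadlag_left: "cadlag f \<Longrightarrow> 0 < t \<Longrightarrow> (f \<longlongrightarrow> left_lim f t) (at_left t)"
  unfolding cadlag_def left_lim_def by (metis tendsto_Lim trivial_limit_at_left_real)

lemma cadlag_mult: "cadlag f \<Longrightarrow> cadlag g \<Longrightarrow> cadlag (\<lambda>t. f t * g t)"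
  unfolding cadlag_def[of "\<lambda>t. f t * g t"] by (blast intro: tendsto_mult cadlag_right cadlag_left)

lemma cadlag_diff: "cadlag f \<Longrightarrow> cadlag g \<Longrightarrow> cadlag (\<lambda>t. f t - g t)"
  unfolding cadlag_def[of "\<lambda>t. f t - g t"] by (blast intro: tendsto_diff cadlag_right cadlag_left)

lemma cadlag_const: "cadlag (\<lambda>t. c)"
  unfolding cadlag_def by auto

lemma cadlag_divide_const: "cadlag f \<Longrightarrow> cadlag (\<lambda>t. f t / c)"
  using cadlag_mult[OF _ cadlag_const[of "1 / c"]] by simp

text \<open>The one-sided limits bound the path on a neighbourhood of each time, and finitely many
  neighbourhoods cover \<open>{0..T}\<close>.\<close>

lemma cadlag_bounded:
  assumes f: "cadlag f"
  obtains C where "0 < C" "\<And>t. 0 \<le> t \<Longrightarrow> t \<le> T \<Longrightarrow> \<bar>f t\<bar> \<le> C"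
proof -
  have "\<exists>a b C. a < t \<and> t < b \<and> (\<forall>s. a < s \<and> s < b \<and> 0 \<le> s \<longrightarrow> \<bar>f s\<bar> \<le> C)" if t: "0 \<le> t" for t
  proof -
    have "\<forall>\<^sub>F s in at_right t. dist (f s) (f t) < 1" using cadlag_right[OF f t] by (rule tendstoD) simp
    then obtain b where b: "t < b" "\<And>s. t < s \<Longrightarrow> s < b \<Longrightarrow> dist (f s) (f t) < 1" unfolding eventually_at_right_field by blast
    have "\<exists>a l. a < t \<and> (\<forall>s. a < s \<and> s < t \<and> 0 \<le> s \<longrightarrow> dist (f s) l < 1)"
    proof (cases "t = 0")
      case True then show ?thesis by (intro exI[of _ "-1"]) auto
    next
      case False
      then have "\<forall>\<^sub>F s in at_left t. dist (f s) (left_lim f t) < 1" using t by (intro tendstoD[OF cadlag_left[OF f]]) auto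
      then obtain a where "a < t" "\<And>s. a < s \<Longrightarrow> s < t \<Longrightarrow> dist (f s) (left_lim f t) < 1" unfolding eventually_at_left_field by blast
      then show ?thesis by blast
    qed
    then obtain a l where a: "a < t" "\<And>s. a < s \<Longrightarrow> s < t \<Longrightarrow> 0 \<le> s \<Longrightarrow> dist (f s) l < 1" by blast
    show ?thesis
    proof (rule exI[of _ a], rule exI[of _ b], rule exI[of _ "\<bar>f t\<bar> + \<bar>l\<bar> + 1"], intro conjI allI impI)
      fix s assume s: "a < s \<and> s < b \<and> 0 \<le> s"
      consider "s < t" | "s = t" | "t < s" by linarith
      then show "\<bar>f s\<bar> \<le> \<bar>f t\<bar> + \<bar>l\<bar> + 1"
        by cases (use a(2)[of s] b(2)[of s] s in \<open>auto simp: dist_real_def\<close>)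
    qed (use a b in auto)
  qed
  then obtain a b C where abC: "\<And>t. 0 \<le> t \<Longrightarrow> a t < t" "\<And>t. 0 \<le> t \<Longrightarrow> t < b t" "\<And>t s. 0 \<le> t \<Longrightarrow> a t < s \<Longrightarrow> s < b t \<Longrightarrow> 0 \<le> s \<Longrightarrow> \<bar>f s\<bar> \<le> C t"
    by metis
  obtain I where I: "I \<subseteq> {0..T}" "finite I" "{0..T} \<subseteq> (\<Union>t\<in>I. {a t<..<b t})"
    by (rule compactE_image[of "{0..T}" "{0..T}" "\<lambda>t. {a t<..<b t}"]) (use abC in \<open>auto simp: Bex_def\<close>)
  have "\<bar>f t\<bar> \<le> (\<Sum>i\<in>I. \<bar>C i\<bar>) + 1" if t: "0 \<le> t" "t \<le> T" for t
  proof -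
    obtain i where i: "i \<in> I" "a i < t" "t < b i" using I(3) t by (auto simp: subset_iff)
    then have "\<bar>f t\<bar> \<le> C i" using abC(3)[of i t] I(1) t by auto
    also have "\<dots> \<le> \<bar>C i\<bar>" by simp
    also have "\<dots> \<le> (\<Sum>i\<in>I. \<bar>C i\<bar>)" by (rule member_le_sum) (use i I in auto)
    finally show ?thesis by simp
  qed
  moreover have "0 < (\<Sum>i\<in>I. \<bar>C i\<bar>) + 1" by (simp add: add_nonneg_pos sum_nonneg)
  ultimately show thesis by (rule that[rotated])
qed

lemma left_lim_le:
  assumes f: "cadlag f" and t: "0 < t" and le: "\<And>s. 0 \<le> s \<Longrightarrow> s < t \<Longrightarrow> f s \<le> c"
  shows "left_lim f t \<le> c"
proof (rule tendsto_upperbound[OF cadlag_left[OF f t]])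
  show "\<forall>\<^sub>F s in at_left t. f s \<le> c"
    unfolding eventually_at_left_field by (rule exI[of _ 0]) (use t le in auto)
qed simp

lemma left_lim_diff_le:
  assumes f: "cadlag f" and g: "cadlag g" and t: "0 < t" and le: "\<And>s. 0 \<le> s \<Longrightarrow> s < t \<Longrightarrow> \<bar>f s - g s\<bar> \<le> c"
  shows "\<bar>left_lim f t - left_lim g t\<bar> \<le> c"
proof (rule tendsto_upperbound)
  show "((\<lambda>s. \<bar>f s - g s\<bar>) \<longlongrightarrow> \<bar>left_lim f t - left_lim g t\<bar>) (at_left t)"
    by (intro tendsto_rabs tendsto_diff cadlag_left f g t)
  show "\<forall>\<^sub>F s in at_left t. \<bar>f s - g s\<bar> \<le> c"
    unfolding eventually_at_left_field by (rule exI[of _ 0]) (use t le in auto)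
qed simp

lemma right_limit_bound:
  fixes f :: "real \<Rightarrow> real"
  assumes f: "(f \<longlongrightarrow> f t) (at_right t)" and b: "t < b" and le: "\<And>q. q \<in> \<rat> \<Longrightarrow> t < q \<Longrightarrow> q < b \<Longrightarrow> \<bar>f q\<bar> \<le> c"
  shows "\<bar>f t\<bar> \<le> c"
proof (rule ccontr)
  assume "\<not> \<bar>f t\<bar> \<le> c"
  then have "c < \<bar>f t\<bar>" by simp
  from order_tendstoD(1)[OF tendsto_rabs[OF f] this] obtain b' where b': "t < b'" "\<And>s. t < s \<Longrightarrow> s < b' \<Longrightarrow> c < \<bar>f s\<bar>"
    unfolding eventually_at_right_field by blast
  obtain q where "q \<in> \<rat>" "t < q" "q < min b b'" using Rats_dense_in_real[of t "min b b'"] b b'(1) by auto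
  then show False using le[of q] b'(2)[of q] by auto
qed

section \<open>Drift integrals, Gronwall's inequality and the bootstrap\<close>

lemma bounded_interval_integrable:
  fixes f :: "real \<Rightarrow> real"
  assumes m: "meas_upto t f" and b: "\<And>s. 0 \<le> s \<Longrightarrow> s \<le> t \<Longrightarrow> \<bar>f s\<bar> \<le> C"
  shows "set_integrable lborel {0..t} f"
  unfolding set_integrable_def
proof (rule integrableI_bounded_set[where A = "{0..t}" and B = C])
  show "(\<lambda>s. indicat_real {0..t} s *\<^sub>R f s) \<in> borel_measurable lborel"
    using m by (simp add: meas_upto_def mult.commute)
  show "emeasure lborel {0..t} < \<infinity>" using emeasure_lborel_Icc_eq[of 0 t] by simp
qed (use b in \<open>auto intro!: AE_I2 simp: indicator_def\<close>)

lemma interval_integral_split: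
  fixes f :: "real \<Rightarrow> real"
  assumes "set_integrable lborel {0..t} f" "0 \<le> s" "s \<le> t"
  shows "(LINT r:{0..t}|lborel. f r) = (LINT r:{0..s}|lborel. f r) + (LINT r:{s<..t}|lborel. f r)"
    "set_integrable lborel {0..s} f" "set_integrable lborel {s<..t} f"
proof -
  show 1: "set_integrable lborel {0..s} f" "set_integrable lborel {s<..t} f"
    by (rule set_integrable_subset[OF assms(1)]; use assms in auto)+
  have "{0..t} = {0..s} \<union> {s<..t}" using assms by auto
  moreover have "(LINT r:{0..s} \<union> {s<..t}|lborel. f r) = (LINT r:{0..s}|lborel. f r) + (LINT r:{s<..t}|lborel. f r)"
    by (rule set_integral_Un) (use 1 in auto)
  ultimately show "(LINT r:{0..t}|lborel. f r) = (LINT r:{0..s}|lborel. f r) + (LINT r:{s<..t}|lborel. f r)" by simp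
qed

lemma interval_integral_increment:
  fixes f :: "real \<Rightarrow> real"
  assumes f: "set_integrable lborel {0..t} f" "\<And>r. 0 \<le> r \<Longrightarrow> r \<le> t \<Longrightarrow> \<bar>f r\<bar> \<le> C" and s: "0 \<le> s" "s \<le> t"
  shows "\<bar>(LINT r:{0..t}|lborel. f r) - (LINT r:{0..s}|lborel. f r)\<bar> \<le> C * (t - s)"
proof -
  note sp = interval_integral_split[OF f(1) s]
  have "\<bar>LINT r:{s<..t}|lborel. f r\<bar> \<le> (LINT r:{s<..t}|lborel. C)"
    unfolding set_lebesgue_integral_def real_norm_def[symmetric]
  proof (rule order_trans[OF integral_norm_bound integral_mono])
    show "integrable lborel (\<lambda>r. norm (indicator {s<..t} r *\<^sub>R f r))" using sp(3) unfolding set_integrable_def by (rule integrable_norm)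
    show "integrable lborel (\<lambda>r. indicator {s<..t} r *\<^sub>R C)" using s by (auto intro!: integrable_mult_left integrable_real_indicator simp: emeasure_lborel_Ioc)
    show "norm (indicator {s<..t} r *\<^sub>R f r) \<le> indicator {s<..t} r *\<^sub>R C" for r using f(2)[of r] s by (auto simp: indicator_def)
  qed
  also have "\<dots> = C * (t - s)" using s by (simp add: set_lebesgue_integral_def)
  finally show ?thesis unfolding sp(1) by simp
qed

lemma interval_integral_right_continuous:
  fixes f :: "real \<Rightarrow> real"
  assumes f: "set_integrable lborel {0..T} f" "\<And>r. 0 \<le> r \<Longrightarrow> r \<le> T \<Longrightarrow> \<bar>f r\<bar> \<le> C" and t: "0 \<le> t" "t < T"
  shows "((\<lambda>q. LINT r:{0..q}|lborel. f r) \<longlongrightarrow> (LINT r:{0..t}|lborel. f r)) (at_right t)"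
proof (rule Lim_null[THEN iffD2], rule Lim_null_comparison)
  show "\<forall>\<^sub>F q in at_right t. norm ((LINT r:{0..q}|lborel. f r) - (LINT r:{0..t}|lborel. f r)) \<le> C * (q - t)"
    unfolding eventually_at_right_field
  proof (intro exI[of _ T] conjI allI impI t)
    fix q assume q: "t < q" "q < T"
    have "set_integrable lborel {0..q} f" by (rule set_integrable_subset[OF f(1)]) (use q in auto)
    then show "norm ((LINT r:{0..q}|lborel. f r) - (LINT r:{0..t}|lborel. f r)) \<le> C * (q - t)"
      unfolding real_norm_def by (rule interval_integral_increment) (use f(2) q t in auto)
  qed
  have "((\<lambda>q. C * (q - t)) \<longlongrightarrow> C * (t - t)) (at_right t)" by (intro tendsto_intros)
  then show "((\<lambda>q. C * (q - t)) \<longlongrightarrow> 0) (at_right t)" by simp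
qed

text \<open>The pointwise bound is asked only before \<open>t\<close>, because in the bootstrap
  nothing is known at \<open>t\<close> yet; a single time does not contribute to the
  integral.\<close>

lemma drift_bound:
  fixes g r :: "real \<Rightarrow> real"
  assumes g: "set_integrable lborel {0..t} g" and r: "meas_upto t r" "\<And>s. 0 \<le> s \<Longrightarrow> s \<le> t \<Longrightarrow> \<bar>r s\<bar> \<le> C"
    and le: "\<And>s. 0 \<le> s \<Longrightarrow> s < t \<Longrightarrow> \<bar>g s\<bar> \<le> c * \<bar>r s\<bar> + a" and t: "0 \<le> t"
  shows "\<bar>LINT s:{0..t}|lborel. g s\<bar> \<le> c * (LINT s:{0..t}|lborel. \<bar>r s\<bar>) + a * t"
proof -
  have "set_integrable lborel {0..t} (\<lambda>s. \<bar>r s\<bar>)"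
    by (rule set_integrable_abs, rule bounded_interval_integrable[OF r(1), of C]) (use r in auto)
  then have ti: "set_integrable lborel {0..t} (\<lambda>s. c * \<bar>r s\<bar>)" by simp
  have ci: "set_integrable lborel {0..t} (\<lambda>s. a)"
    by (rule bounded_interval_integrable[OF meas_upto_borel, of _ _ "\<bar>a\<bar>"]) auto
  have "\<bar>LINT s:{0..t}|lborel. g s\<bar> \<le> (LINT s:{0..t}|lborel. \<bar>g s\<bar>)"
    using integral_norm_bound[of lborel "\<lambda>s. indicator {0..t} s *\<^sub>R g s"] by (simp add: set_lebesgue_integral_def abs_mult)
  also have "\<dots> \<le> (LINT s:{0..t}|lborel. c * \<bar>r s\<bar> + a)"
    unfolding set_lebesgue_integral_def
  proof (rule integral_mono_AE)
    show "integrable lborel (\<lambda>s. indicator {0..t} s *\<^sub>R \<bar>g s\<bar>)" using set_integrable_abs[OF g] by (simp add: set_integrable_def)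
    show "integrable lborel (\<lambda>s. indicator {0..t} s *\<^sub>R (c * \<bar>r s\<bar> + a))"
      using set_integral_add(1)[OF ti ci] by (simp add: set_integrable_def)
    show "AE s in lborel. indicator {0..t} s *\<^sub>R \<bar>g s\<bar> \<le> indicator {0..t} s *\<^sub>R (c * \<bar>r s\<bar> + a)"
      by (rule AE_mp[OF AE_lborel_singleton[of t]], intro AE_I2 impI) (use le in \<open>auto simp: indicator_def\<close>)
  qed
  also have "\<dots> = c * (LINT s:{0..t}|lborel. \<bar>r s\<bar>) + a * t"
    using set_integral_add(2)[OF ti ci] t by (simp add: set_lebesgue_integral_def)
  finally show ?thesis .
qed

text \<open>Gronwall's inequality through the weighted norm \<open>sup e\<^bsup>-2ct\<^esup> \<phi> t\<close>, in which the integral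
  operator is a contraction with factor \<open>1/2\<close>; this needs no differentiability.\<close>

lemma gronwall_bound:
  fixes \<phi> :: "real \<Rightarrow> real"
  assumes m: "meas_upto T \<phi>" and b: "\<And>t. 0 \<le> t \<Longrightarrow> t \<le> T \<Longrightarrow> 0 \<le> \<phi> t \<and> \<phi> t \<le> C"
    and c: "0 < c" and T: "0 \<le> T"
    and le: "\<And>t. 0 \<le> t \<Longrightarrow> t \<le> T \<Longrightarrow> \<phi> t \<le> \<eta> + c * (LINT s:{0..t}|lborel. \<phi> s)"
    and t: "0 \<le> t" "t \<le> T" and \<eta>: "0 \<le> \<eta>"
  shows "\<phi> t \<le> 2 * \<eta> * exp (2 * c * T)"
proof -
  define A where "A = (\<lambda>t. exp (- (2 * c * t)) * \<phi> t) ` {0..T}"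
  have bdd: "bdd_above A"
  proof (rule bdd_aboveI)
    fix x assume "x \<in> A"
    then obtain s where s: "0 \<le> s" "s \<le> T" "x = exp (- (2 * c * s)) * \<phi> s" by (auto simp: A_def)
    have "exp (- (2 * c * s)) \<le> 1" using s c by simp
    then have "x \<le> 1 * C" unfolding s(3) using b[OF s(1,2)] by (intro mult_mono) auto
    then show "x \<le> C" by simp
  qed
  define S where "S = Sup A"
  have Sup: "exp (- (2 * c * s)) * \<phi> s \<le> S" if "0 \<le> s" "s \<le> T" for s
    unfolding S_def by (rule cSup_upper[OF _ bdd]) (use that in \<open>auto simp: A_def\<close>)
  have S0: "0 \<le> S" using order_trans[OF _ Sup[of 0]] b[of 0] T by simp
  have ub: "\<phi> s \<le> S * exp (2 * c * s)" if "0 \<le> s" "s \<le> T" for s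
    using Sup[OF that] by (simp add: exp_minus field_simps)
  have "S \<le> \<eta> + S / 2"
    unfolding S_def
  proof (rule cSup_least)
    show "A \<noteq> {}" using T by (auto simp: A_def)
    fix x assume "x \<in> A"
    then obtain u where u: "0 \<le> u" "u \<le> T" "x = exp (- (2 * c * u)) * \<phi> u" by (auto simp: A_def)
    \<comment> \<open>Integrating the exponential majorant gains \<open>1 / (2 * c)\<close>, which
      against the constant \<open>c\<close> leaves the factor one half.\<close>
    have ex: "has_bochner_integral lborel (\<lambda>s. (S * exp (2 * c * s)) * indicator {0..u} s) (S * exp (2 * c * u) / (2 * c) - S * exp (2 * c * 0) / (2 * c))"
      by (rule has_bochner_integral_FTC_Icc_real) (use u c in \<open>auto intro!: derivative_eq_intros\<close>)
    have "set_integrable lborel {0..u} \<phi>"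
      by (rule bounded_interval_integrable[OF meas_upto_mono[OF m u(2)], of C]) (use b u in \<open>auto simp: abs_le_iff intro: order_trans\<close>)
    then have "(LINT s:{0..u}|lborel. \<phi> s) \<le> (LINT s|lborel. (S * exp (2 * c * s)) * indicator {0..u} s)"
      unfolding set_lebesgue_integral_def set_integrable_def
      by (rule integral_mono) (use ex ub u in \<open>auto simp: has_bochner_integral_iff indicator_def\<close>)
    also have "\<dots> = S * exp (2 * c * u) / (2 * c) - S / (2 * c)" using ex by (simp add: has_bochner_integral_iff)
    also have "\<dots> \<le> S * exp (2 * c * u) / (2 * c)" using S0 c by simp
    finally have "\<phi> u \<le> \<eta> + c * (S * exp (2 * c * u) / (2 * c))" using le[OF u(1,2)] c by (smt (verit) mult_left_mono)
    then have "\<phi> u \<le> \<eta> + S * exp (2 * c * u) / 2" using c by simp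
    then have "x \<le> exp (- (2 * c * u)) * (\<eta> + S * exp (2 * c * u) / 2)" unfolding u(3) by (intro mult_left_mono) auto
    also have "\<dots> = exp (- (2 * c * u)) * \<eta> + S / 2" by (simp add: distrib_left exp_minus field_simps)
    also have "\<dots> \<le> 1 * \<eta> + S / 2" using u c \<eta> by (intro add_right_mono mult_right_mono) auto
    finally show "x \<le> \<eta> + Sup A / 2" by (simp add: S_def)
  qed
  then have "S \<le> 2 * \<eta>" by simp
  have "\<phi> t \<le> S * exp (2 * c * t)" by (rule ub[OF t])
  also have "\<dots> \<le> (2 * \<eta>) * exp (2 * c * T)" using \<open>S \<le> 2 * \<eta>\<close> \<eta> t c S0 by (intro mult_mono) auto
  finally show ?thesis .
qed

text \<open>Let \<open>k\<close> be the infimum of the times with \<open>r > 1\<close>. The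
  hypothesis at \<open>k\<close> looks only at earlier times, so Gronwall's inequality gives
  \<open>r k < 1\<close> even if \<open>k\<close> is a jump time. Right-continuity then keeps
  \<open>r\<close> below 1 for a while after \<open>k\<close>, a contradiction.\<close>

lemma bootstrap_bound:
  fixes r :: "real \<Rightarrow> real"
  assumes r: "cadlag r" "meas_upto T r" and c: "0 < c" and T: "0 \<le> T" and \<eta>: "0 \<le> \<eta>" "2 * \<eta> * exp (2 * c * T) < 1"
    and le: "\<And>t. 0 \<le> t \<Longrightarrow> t \<le> T \<Longrightarrow> (\<And>s. 0 \<le> s \<Longrightarrow> s < t \<Longrightarrow> r s \<le> 1) \<Longrightarrow> \<bar>r t\<bar> \<le> \<eta> + c * (LINT s:{0..t}|lborel. \<bar>r s\<bar>)"
    and t: "0 \<le> t" "t \<le> T"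
  shows "\<bar>r t\<bar> \<le> 2 * \<eta> * exp (2 * c * T)"
proof -
  obtain C where C: "0 < C" "\<And>t. 0 \<le> t \<Longrightarrow> t \<le> T \<Longrightarrow> \<bar>r t\<bar> \<le> C" using cadlag_bounded[OF r(1), of T] by blast
  have m: "meas_upto T (\<lambda>s. \<bar>r s\<bar>)"
  proof -
    have [measurable]: "(\<lambda>s. r s * indicator {0..T} s) \<in> borel_measurable borel" using r(2) by (simp add: meas_upto_def)
    have "(\<lambda>s. \<bar>r s\<bar> * indicator {0..T} s) = (\<lambda>s. \<bar>r s * indicator {0..T} s\<bar>)" by (auto simp: indicator_def)
    then show ?thesis unfolding meas_upto_def by simp
  qed
  have main: "\<bar>r u\<bar> \<le> 2 * \<eta> * exp (2 * c * T)" if u: "0 \<le> u" "u \<le> T" "\<And>s. 0 \<le> s \<Longrightarrow> s < u \<Longrightarrow> r s \<le> 1" for u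
  proof -
    have "\<bar>r u\<bar> \<le> 2 * \<eta> * exp (2 * c * u)"
      by (rule gronwall_bound[where T = u and C = C, OF meas_upto_mono[OF m u(2)] _ c u(1)])
        (use C u \<eta> in \<open>auto intro!: le\<close>)
    also have "\<dots> \<le> 2 * \<eta> * exp (2 * c * T)" using u c \<eta> by (intro mult_left_mono) auto
    finally show ?thesis .
  qed
  have "r s \<le> 1" if s: "0 \<le> s" "s \<le> T" for s
  proof (rule ccontr)
    assume "\<not> r s \<le> 1"
    define B where "B = {s. 0 \<le> s \<and> s \<le> T \<and> 1 < r s}"
    have B: "s \<in> B" "bdd_below B" using s \<open>\<not> r s \<le> 1\<close> by (auto simp: B_def intro: bdd_belowI[of _ 0])
    define k where "k = Inf B"
    have k: "k \<le> b" if "b \<in> B" for b unfolding k_def by (rule cInf_lower[OF that B(2)])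
    have k0: "0 \<le> k" unfolding k_def by (rule cInf_greatest) (use B in \<open>auto simp: B_def\<close>)
    have kT: "k \<le> T" using k[OF B(1)] s by simp
    have before: "r s \<le> 1" if "0 \<le> s" "s < k" for s
      using k[of s] that kT by (auto simp: B_def not_less[symmetric])
    have rk: "\<bar>r k\<bar> < 1" using main[OF k0 kT before] \<eta>(2) by simp
    have "r k < 1" using rk by simp
    from order_tendstoD(2)[OF cadlag_right[OF r(1) k0] this] obtain b where b: "k < b" "\<And>s. k < s \<Longrightarrow> s < b \<Longrightarrow> r s < 1"
      unfolding eventually_at_right_field by blast
    have "b \<le> x" if "x \<in> B" for x
      using b(2)[of x] k[OF that] rk that by (cases "x = k") (auto simp: B_def not_less[symmetric])
    then have "b \<le> k" unfolding k_def by (intro cInf_greatest) (use B in auto)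
    with b show False by simp
  qed
  then show ?thesis using t by (intro main) auto
qed

text \<open>The identity serves as time change. Levels \<open>u < T\<close> contribute at most
  \<open>\<eta>\<close>; for \<open>u \<ge> T\<close> the distance is capped at 1 and the
  exponential weight has mass \<open>exp (- T)\<close>.\<close>

lemma skorokhod_dist_le:
  assumes T: "0 \<le> T" and \<eta>: "0 \<le> \<eta>" and le: "\<And>t. 0 \<le> t \<Longrightarrow> t \<le> T \<Longrightarrow> \<bar>f t - g t\<bar> \<le> \<eta>"
  shows "skorokhod_dist f g \<le> ennreal (\<eta> + exp (- T))"
proof -
  let ?\<tau> = "\<lambda>t::real. t"
  have "time_change_size ?\<tau> \<le> 0"
    unfolding time_change_size_def by (rule SUP_least) auto
  moreover have "(\<integral>\<^sup>+u\<in>{0..}. ennreal (exp (- u)) * (SUP t\<in>{0..}. ennreal (min 1 \<bar>f (min t u) - g (min (?\<tau> t) u)\<bar>)) \<partial>lborel) \<le> ennreal (\<eta> + exp (- T))"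
  proof -
    have e: "(\<integral>\<^sup>+u. ennreal (exp (- u)) * indicator {a..} u \<partial>lborel) = ennreal (exp (- a))" for a :: real
    proof -
      have "(\<integral>\<^sup>+u. ennreal (exp (- u)) * indicator {a..} u \<partial>lborel) = ennreal (0 - (- exp (- a)))"
      proof (rule nn_integral_FTC_atLeast)
        have "((\<lambda>x::real. - exp (- x)) \<longlongrightarrow> - 0) at_top"
          by (intro tendsto_minus filterlim_compose[OF exp_at_bot filterlim_uminus_at_bot_at_top])
        then show "((\<lambda>x::real. - exp (- x)) \<longlongrightarrow> 0) at_top" by simp
      qed (auto intro!: derivative_eq_intros)
      then show ?thesis by simp
    qed
    have "(\<integral>\<^sup>+u\<in>{0..}. ennreal (exp (- u)) * (SUP t\<in>{0..}. ennreal (min 1 \<bar>f (min t u) - g (min t u)\<bar>)) \<partial>lborel)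
      \<le> (\<integral>\<^sup>+u. ennreal \<eta> * (ennreal (exp (- u)) * indicator {0..} u) + ennreal (exp (- u)) * indicator {T..} u \<partial>lborel)"
    proof (rule nn_integral_mono)
      fix u :: real
      show "ennreal (exp (- u)) * (SUP t\<in>{0..}. ennreal (min 1 \<bar>f (min t u) - g (min t u)\<bar>)) * indicator {0..} u
        \<le> ennreal \<eta> * (ennreal (exp (- u)) * indicator {0..} u) + ennreal (exp (- u)) * indicator {T..} u"
      proof (cases "0 \<le> u \<and> u < T")
        case True
        have "(SUP t\<in>{0..}. ennreal (min 1 \<bar>f (min t u) - g (min t u)\<bar>)) \<le> ennreal \<eta>"
          by (rule SUP_least) (use True le in \<open>auto intro!: ennreal_leI simp: min_le_iff_disj\<close>)
        then have "ennreal (exp (- u)) * (SUP t\<in>{0..}. ennreal (min 1 \<bar>f (min t u) - g (min t u)\<bar>)) \<le> ennreal (exp (- u)) * ennreal \<eta>"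
          by (intro mult_left_mono) auto
        then show ?thesis using True by (simp add: mult.commute)
      next
        case False
        have "(SUP t\<in>{0..}. ennreal (min 1 \<bar>f (min t u) - g (min t u)\<bar>)) \<le> 1"
          by (rule SUP_least) (auto simp: ennreal_le_1)
        then have "ennreal (exp (- u)) * (SUP t\<in>{0..}. ennreal (min 1 \<bar>f (min t u) - g (min t u)\<bar>)) \<le> ennreal (exp (- u)) * 1"
          by (intro mult_left_mono) auto
        then have *: "ennreal (exp (- u)) * (SUP t\<in>{0..}. ennreal (min 1 \<bar>f (min t u) - g (min t u)\<bar>)) \<le> ennreal \<eta> * ennreal (exp (- u)) + ennreal (exp (- u))"
          by (simp add: add_increasing)
        consider "u < 0" | "0 \<le> u" "T \<le> u" using False by linarith
        then show ?thesis
        proof cases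
          case 1 then show ?thesis by simp
        next
          case 2 then show ?thesis using * by simp
        qed
      qed
    qed
    also have "\<dots> = ennreal \<eta> * ennreal (exp (- 0)) + ennreal (exp (- T))"
    proof -
      have "(\<integral>\<^sup>+u. ennreal \<eta> * (ennreal (exp (- u)) * indicator {0..} u) + ennreal (exp (- u)) * indicator {T..} u \<partial>lborel)
        = (\<integral>\<^sup>+u. ennreal \<eta> * (ennreal (exp (- u)) * indicator {0..} u) \<partial>lborel) + (\<integral>\<^sup>+u. ennreal (exp (- u)) * indicator {T..} u \<partial>lborel)"
        by (rule nn_integral_add) measurable
      also have "(\<integral>\<^sup>+u. ennreal \<eta> * (ennreal (exp (- u)) * indicator {0..} u) \<partial>lborel) = ennreal \<eta> * (\<integral>\<^sup>+u. ennreal (exp (- u)) * indicator {0..} u \<partial>lborel)"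
        by (rule nn_integral_cmult) measurable
      finally show ?thesis by (simp only: e)
    qed
    also have "\<dots> = ennreal (\<eta> + exp (- T))" using \<eta> by simp
    finally show ?thesis by simp
  qed
  moreover have "?\<tau> \<in> time_changes" by (auto simp: time_changes_def strict_mono_on_def)
  ultimately show ?thesis unfolding skorokhod_dist_def by (intro INF_lower2[of ?\<tau>]) (auto simp: le_zero_eq)
qed

section \<open>The setting of the stochastic equations\<close>

lemma ito_integral_has: "ito_integrable M F W H t \<Longrightarrow> has_ito_integral M F W H t (ito_integral M F W H t)"
  unfolding ito_integrable_def ito_integral_def
  by (rule someI_ex[where P = "has_ito_integral M F W H t"])

lemma compensated_integral_has:
  "compensated_integrable M F N \<nu> K t \<Longrightarrow> has_compensated_integral M F N \<nu> K t (compensated_integral M F N \<nu> K t)"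
  unfolding compensated_integrable_def compensated_integral_def
  by (rule someI_ex[where P = "has_compensated_integral M F N \<nu> K t"])

context filtered_poisson
begin

lemma LF_bound:
  assumes f: "f \<in> BP" and w: "w \<in> space M"
    and le: "\<And>s. 0 < s \<Longrightarrow> s \<le> t \<Longrightarrow> (\<integral>\<^sup>+v. f ((s, w), v) \<partial>\<nu>) \<le> g s"
  shows "LF t (pull f) w \<le> (\<integral>\<^sup>+s\<in>{0<..t}. g s \<partial>lborel)"
proof -
  interpret v: sigma_finite_measure \<nu> by (rule sigma_finite_\<nu>)
  have m: "(\<lambda>p. pull f w p * indicator ({0<..t} \<times> UNIV) p) \<in> borel_measurable L"
    using pull_section[OF f w] by measurable
  have "LF t (pull f) w = (\<integral>\<^sup>+s. (\<integral>\<^sup>+v. pull f w (s, v) * indicator ({0<..t} \<times> UNIV) (s, v) \<partial>\<nu>) \<partial>lebesgue_pos)"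
    unfolding LF_def by (rule v.nn_integral_fst[OF m, symmetric])
  also have "\<dots> \<le> (\<integral>\<^sup>+s. g s * indicator {0<..t} s \<partial>lebesgue_pos)"
  proof (rule nn_integral_mono)
    fix s :: real
    show "(\<integral>\<^sup>+v. pull f w (s, v) * indicator ({0<..t} \<times> UNIV) (s, v) \<partial>\<nu>) \<le> g s * indicator {0<..t} s"
      using le[of s] by (cases "0 < s \<and> s \<le> t") (auto simp: indicator_def)
  qed
  also have "\<dots> = (\<integral>\<^sup>+s. g s * indicator {0<..t} s * indicator {0<..} s \<partial>lborel)"
    by (rule nn_integral_restrict_space) simp
  also have "\<dots> = (\<integral>\<^sup>+s\<in>{0<..t}. g s \<partial>lborel)"
    by (intro nn_integral_cong) (auto simp: indicator_def)
  finally show ?thesis .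
qed

lemma predictable_l12:
  assumes "predictable M F \<nu> K"
  shows "(\<lambda>x. ennreal (l12 (K (fst (fst x)) (snd x) (snd (fst x))))) \<in> BP"
proof -
  have [measurable]: "(\<lambda>x. K (fst (fst x)) (snd x) (snd (fst x))) \<in> BP"
    using assms unfolding predictable_def by (simp add: case_prod_unfold)
  show ?thesis by measurable
qed

lemma LF_predictable_bound:
  assumes K: "predictable M F \<nu> K" and w: "w \<in> space M"
    and le: "\<And>s. 0 < s \<Longrightarrow> s \<le> t \<Longrightarrow> (\<integral>\<^sup>+v. ennreal (l12 (K s v w)) \<partial>\<nu>) \<le> g s"
  shows "LF t (\<lambda>w p. ennreal (l12 (K (fst p) (snd p) w))) w \<le> (\<integral>\<^sup>+s\<in>{0<..t}. g s \<partial>lborel)"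
  using LF_bound[OF predictable_l12[OF K] w, of t g] le by simp

end

lemma rate_strip_integral:
  assumes "sigma_finite_measure \<mu>" and h: "h \<in> borel_measurable \<mu>"
  shows "(\<integral>\<^sup>+v. indicator {a..b} (fst v) * h (snd v) \<partial>(lebesgue_pos \<Otimes>\<^sub>M \<mu>)) \<le> ennreal (b - a) * (\<integral>\<^sup>+\<xi>. h \<xi> \<partial>\<mu>)"
proof -
  interpret sigma_finite_measure \<mu> by fact
  have id: "(\<lambda>x::real. x) \<in> measurable lebesgue_pos borel" by (rule measurable_restrict_space1) simp
  have i: "(indicator {a..b} :: real \<Rightarrow> ennreal) \<in> borel_measurable lebesgue_pos"
    by (rule measurable_compose[OF id]) simp
  have m: "(\<lambda>v. indicator {a..b} (fst v) * h (snd v)) \<in> borel_measurable (lebesgue_pos \<Otimes>\<^sub>M \<mu>)"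
    by (intro borel_measurable_times_ennreal measurable_compose[OF measurable_fst i] measurable_compose[OF measurable_snd h])
  have "(\<integral>\<^sup>+u. indicator {a..b} u \<partial>lebesgue_pos) = (\<integral>\<^sup>+u. indicator {a..b} u * indicator {0<..} u \<partial>lborel)"
    by (rule nn_integral_restrict_space) simp
  also have "\<dots> \<le> (\<integral>\<^sup>+u. indicator {a..b} (u::real) \<partial>lborel)"
    by (intro nn_integral_mono) (auto simp: indicator_def)
  also have "\<dots> \<le> ennreal (b - a)" using emeasure_lborel_Icc_eq[of a b] by (auto split: if_splits)
  finally have le: "(\<integral>\<^sup>+u. indicator {a..b} u \<partial>lebesgue_pos) \<le> ennreal (b - a)" .
  have "(\<integral>\<^sup>+v. indicator {a..b} (fst v) * h (snd v) \<partial>(lebesgue_pos \<Otimes>\<^sub>M \<mu>)) = (\<integral>\<^sup>+u. (\<integral>\<^sup>+\<xi>. indicator {a..b} u * h \<xi> \<partial>\<mu>) \<partial>lebesgue_pos)"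
    using nn_integral_fst[OF m] by simp
  also have "\<dots> = (\<integral>\<^sup>+u. (\<integral>\<^sup>+\<xi>. h \<xi> \<partial>\<mu>) * indicator {a..b} u \<partial>lebesgue_pos)"
    by (intro nn_integral_cong) (simp add: nn_integral_cmult nn_integral_multc h mult.commute)
  also have "\<dots> = (\<integral>\<^sup>+\<xi>. h \<xi> \<partial>\<mu>) * (\<integral>\<^sup>+u. indicator {a..b} u \<partial>lebesgue_pos)"
    by (rule nn_integral_cmult[OF i])
  also have "\<dots> \<le> (\<integral>\<^sup>+\<xi>. h \<xi> \<partial>\<mu>) * ennreal (b - a)" by (rule mult_left_mono[OF le]) simp
  finally show ?thesis by (simp add: mult.commute)
qed

text \<open>The constants are the \<open>l12\<close>-masses of the jumps in the second coordinate,
  recorded as reals because they enter all bounds on the jump terms.\<close>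

locale affine_setting =
  fixes M :: "'a measure" and F :: "real \<Rightarrow> 'a measure"
    and B :: "nat \<Rightarrow> real \<Rightarrow> 'a \<Rightarrow> real"
    and N0 :: "'a \<Rightarrow> (real \<times> real \<times> real) measure"
    and N1 :: "'a \<Rightarrow> (real \<times> real \<times> real \<times> real) measure"
    and m \<mu> :: "(real \<times> real) measure"
    and c0 c1 :: real
  assumes basis: "stochastic_basis M F B N0 N1 m \<mu>"
    and m_D: "sigma_finite_on_D m" and \<mu>_D: "sigma_finite_on_D \<mu>"
    and c0: "0 \<le> c0" "(\<integral>\<^sup>+\<xi>. ennreal (l12 (snd \<xi>)) \<partial>m) = ennreal c0"
    and c1: "0 \<le> c1" "(\<integral>\<^sup>+\<xi>. ennreal (l12 (snd \<xi>)) \<partial>\<mu>) = ennreal c1"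
begin

lemma sigma_finite_m: "sigma_finite_measure m" and sigma_finite_\<mu>: "sigma_finite_measure \<mu>"
  using m_D \<mu>_D by (auto simp: sigma_finite_on_D_def)

lemma sigma_finite_rate: "sigma_finite_measure (lebesgue_pos \<Otimes>\<^sub>M \<mu>)"
proof -
  interpret sigma_finite_measure lebesgue_pos by (rule sigma_finite_lebesgue_pos)
  interpret v: sigma_finite_measure \<mu> by (rule sigma_finite_\<mu>)
  interpret pair_sigma_finite lebesgue_pos \<mu> ..
  show ?thesis ..
qed

lemma space_m: "space m \<noteq> {}" and space_\<mu>: "space \<mu> \<noteq> {}" and space_rate: "space (lebesgue_pos \<Otimes>\<^sub>M \<mu>) \<noteq> {}"
  using m_D \<mu>_D by (auto simp: sigma_finite_on_D_def D_all_def space_pair_measure space_restrict_space)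

sublocale B0: filtered_brownian M F "B 0" by (rule basis_filtered_brownian[OF basis]) simp
sublocale B1: filtered_brownian M F "B 1" by (rule basis_filtered_brownian[OF basis]) simp
sublocale B2: filtered_brownian M F "B 2" by (rule basis_filtered_brownian[OF basis]) simp
sublocale P0: filtered_poisson M F m N0 by (rule basis_filtered_poisson0[OF basis sigma_finite_m space_m])
sublocale P1: filtered_poisson M F "lebesgue_pos \<Otimes>\<^sub>M \<mu>" N1
  by (rule basis_filtered_poisson1[OF basis sigma_finite_rate space_rate])

lemma snd_measurable_D:
  assumes "sigma_finite_on_D \<rho>" shows "snd \<in> measurable \<rho> (borel :: real measure)"
proof -
  have "(snd :: real \<times> real \<Rightarrow> real) \<in> measurable (restrict_space borel D_all) borel" by (rule measurable_restrict_space1, subst borel_prod[symmetric], rule measurable_snd)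
  moreover have "sets \<rho> = sets (restrict_space borel D_all)" using assms by (simp add: sigma_finite_on_D_def)
  ultimately show ?thesis using measurable_cong_sets by blast
qed

text \<open>An integrand that is alive only for rates in a strip has size at most proportional to
  the width of the strip; through this, closeness of jump rates becomes smallness of
  integrals.\<close>

lemma rate_mass:
  assumes le: "\<And>u \<xi>. k (u, \<xi>) \<le> indicator {a..b} u * ennreal (l12 (snd \<xi>))"
  shows "(\<integral>\<^sup>+v. k v \<partial>(lebesgue_pos \<Otimes>\<^sub>M \<mu>)) \<le> ennreal (b - a) * ennreal c1"
proof -
  have h: "(\<lambda>\<xi>. ennreal (l12 (snd \<xi>))) \<in> borel_measurable \<mu>"
    by (rule measurable_compose[OF snd_measurable_D[OF \<mu>_D]]) simp
  have "(\<integral>\<^sup>+v. k v \<partial>(lebesgue_pos \<Otimes>\<^sub>M \<mu>)) \<le> (\<integral>\<^sup>+v. indicator {a..b} (fst v) * ennreal (l12 (snd (snd v))) \<partial>(lebesgue_pos \<Otimes>\<^sub>M \<mu>))"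
    by (rule nn_integral_mono) (use le in \<open>auto simp: split_paired_all\<close>)
  also have "\<dots> \<le> ennreal (b - a) * (\<integral>\<^sup>+\<xi>. ennreal (l12 (snd \<xi>)) \<partial>\<mu>)" by (rule rate_strip_integral[OF sigma_finite_\<mu> h])
  finally show ?thesis by (simp add: c1)
qed

lemma progressive_adapted:
  assumes "progressive F X" "0 \<le> t" shows "X t \<in> borel_measurable (F t)"
proof -
  have "(\<lambda>(s, w). X s w) \<in> borel_measurable (restrict_space borel {0..t} \<Otimes>\<^sub>M F t)"
    using assms by (auto simp: progressive_def)
  moreover have "t \<in> space (restrict_space borel {0..t})" using assms by (simp add: space_restrict_space)
  ultimately show ?thesis using measurable_compose[OF measurable_Pair1'] by fastforce
qed

text \<open>Rational times together with the end point: cadlag paths are determined there, and countably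
  many almost sure identities hold simultaneously.\<close>

definition Qt :: "real \<Rightarrow> real set" where "Qt T = insert T (\<rat> \<inter> {0..T})"

lemma Qt: "countable (Qt T)" "0 \<le> T \<Longrightarrow> q \<in> Qt T \<Longrightarrow> 0 \<le> q \<and> q \<le> T" "T \<in> Qt T"
  "q \<in> \<rat> \<Longrightarrow> 0 \<le> q \<Longrightarrow> q \<le> T \<Longrightarrow> q \<in> Qt T"
  by (auto simp: Qt_def intro: countable_subset[OF _ countable_rat])

text \<open>Before \<open>T\<close> the bound arrives along rational times just to the right; at
  \<open>T\<close>, where no such times are available, it is read off directly since
  \<open>T\<close> belongs to \<open>Qt T\<close>. Only times below \<open>b\<close> are consulted,
  so the bound may be proved on a short window.\<close>

lemma extend_from_Qt:
  fixes f :: "real \<Rightarrow> real"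
  assumes t: "0 \<le> t" "t \<le> T" and f: "t < T \<Longrightarrow> (f \<longlongrightarrow> f t) (at_right t)" and b: "t < b"
    and le: "\<And>q. q \<in> Qt T \<Longrightarrow> t \<le> q \<Longrightarrow> q < b \<Longrightarrow> \<bar>f q\<bar> \<le> c"
  shows "\<bar>f t\<bar> \<le> c"
proof (cases "t = T")
  case True then show ?thesis using le[of T] b Qt(3) by simp
next
  case False
  then have "t < T" using t by simp
  show ?thesis
    by (rule right_limit_bound[OF f[OF \<open>t < T\<close>], of "min b T"]) (use b \<open>t < T\<close> t in \<open>auto intro!: le Qt(4)\<close>)
qed

text \<open>Each path is bounded on \<open>{0..T}\<close>, so the events of exceeding
  \<open>n\<close> decrease to the empty set. Restricted to the times of \<open>Qt T\<close> they
  are measurable, and continuity from above applies.\<close>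

lemma cadlag_tight:
  assumes x: "cadlag_progressive M F x" and T: "0 \<le> T" and r: "0 < (r::real)"
  obtains n :: nat where "0 < n" "outer_measure_of M {w \<in> space M. \<exists>t\<in>{0..T}. real n < x t w} \<le> ennreal r"
proof -
  define A where "A n = {w \<in> space M. \<exists>q\<in>Qt T. real n < x q w}" for n
  have xm: "x q \<in> borel_measurable M" if "q \<in> Qt T" for q
    using x Qt(2)[OF T that] by (intro B0.measurable_F_M[OF progressive_adapted]) (auto simp: cadlag_progressive_def)
  have Am: "A n \<in> sets M" for n
  proof -
    have "A n = (\<Union>q\<in>Qt T. {w \<in> space M. real n < x q w})" by (auto simp: A_def)
    also have "\<dots> \<in> sets M" using xm by (intro sets.countable_UN'' Qt(1)) measurable
    finally show ?thesis .
  qed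
  have cad: "cadlag (\<lambda>t. x t w)" if "w \<in> space M" for w using x that by (simp add: cadlag_progressive_def)
  have dec: "decseq A" unfolding decseq_def A_def by (auto intro: less_le_trans) (meson le_less_trans of_nat_mono)
  have empty: "(\<Inter>n. A n) = {}"
  proof (rule equals0I)
    fix w assume a: "w \<in> (\<Inter>n. A n)"
    then have w: "w \<in> space M" by (auto simp: A_def)
    obtain C where C: "0 < C" "\<And>t. 0 \<le> t \<Longrightarrow> t \<le> T \<Longrightarrow> \<bar>x t w\<bar> \<le> C" using cadlag_bounded[OF cad[OF w], of T] by blast
    obtain n :: nat where n: "C < real n" using reals_Archimedean2 by blast
    have "w \<in> A n" using a by blast
    then obtain q where q: "q \<in> Qt T" "real n < x q w" by (auto simp: A_def)
    have "\<bar>x q w\<bar> \<le> C" using C(2) Qt(2)[OF T q(1)] by auto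
    then show False using n q(2) by linarith
  qed
  have "(\<lambda>n. emeasure M (A n)) \<longlonglongrightarrow> emeasure M (\<Inter>n. A n)"
    by (rule Lim_emeasure_decseq) (use Am dec in auto)
  then have "(\<lambda>n. emeasure M (A n)) \<longlonglongrightarrow> 0" by (simp add: empty)
  then have "\<forall>\<^sub>F n in sequentially. emeasure M (A n) < ennreal r" by (rule order_tendstoD) (use r in simp)
  then obtain n0 where n0: "\<And>n. n0 \<le> n \<Longrightarrow> emeasure M (A n) < ennreal r" unfolding eventually_sequentially by blast
  let ?n = "Suc n0"
  have "{w \<in> space M. \<exists>t\<in>{0..T}. real ?n < x t w} \<subseteq> A ?n"
  proof (rule subsetI, rule ccontr)
    fix w assume a: "w \<in> {w \<in> space M. \<exists>t\<in>{0..T}. real ?n < x t w}" and n: "w \<notin> A ?n"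
    then obtain t where t: "0 \<le> t" "t \<le> T" "real ?n < x t w" and w: "w \<in> space M" by auto
    \<comment> \<open>The positive part is used because \<open>extend_from_Qt\<close> speaks of
      absolute values, whereas only an upper bound of \<open>x\<close> is at stake.\<close>
    have "\<bar>max (x t w - real ?n) 0\<bar> \<le> 0"
    proof (rule extend_from_Qt[OF t(1,2), of "\<lambda>t. max (x t w - real ?n) 0" "t + 1"])
      show "((\<lambda>t. max (x t w - real ?n) 0) \<longlongrightarrow> max (x t w - real ?n) 0) (at_right t)"
        by (intro tendsto_max tendsto_diff tendsto_const cadlag_right[OF cad[OF w] t(1)])
      fix q assume "q \<in> Qt T"
      then show "\<bar>max (x q w - real ?n) 0\<bar> \<le> 0" using n w by (auto simp: A_def not_less)
    qed simp
    then show False using t(3) by simp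
  qed
  then have "outer_measure_of M {w \<in> space M. \<exists>t\<in>{0..T}. real ?n < x t w} \<le> outer_measure_of M (A ?n)" by (rule outer_measure_of_mono)
  also have "\<dots> \<le> ennreal r" using Am n0[of ?n] by simp
  finally show thesis using that[of ?n] by simp
qed

end

section \<open>The rescaled processes tend to one\<close>

lemma outer_measure_of_Un_bound:
  assumes "A \<subseteq> space M" "B \<subseteq> space M" "outer_measure_of M A \<le> p" "outer_measure_of M B \<le> q"
  shows "outer_measure_of M (A \<union> B) \<le> p + q"
  using order_trans[OF outer_measure_of_Un_le[OF assms(1,2)] add_mono[OF assms(3,4)]] .

lemma meas_upto_mult: "meas_upto t f \<Longrightarrow> meas_upto t g \<Longrightarrow> meas_upto t (\<lambda>s. f s * g s)"
proof -
  assume [unfolded meas_upto_def, measurable]: "meas_upto t f" "meas_upto t g"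
  have eq: "(\<lambda>s. (f s * g s) * indicator {0..t} s) = (\<lambda>s. (f s * indicator {0..t} s) * (g s * indicator {0..t} s))"
    by (auto simp: indicator_def)
  show ?thesis unfolding meas_upto_def eq by measurable
qed

lemma meas_upto_const: "meas_upto t (\<lambda>s. c)"
  by (rule meas_upto_borel) simp

lemma meas_upto_cmult: "meas_upto t f \<Longrightarrow> meas_upto t (\<lambda>s. c * f s)"
  using meas_upto_mult[OF meas_upto_const] .

lemma meas_upto_add: "meas_upto t f \<Longrightarrow> meas_upto t g \<Longrightarrow> meas_upto t (\<lambda>s. f s + g s)"
  using meas_upto_lin[of t f g 1 1] by simp

lemma meas_upto_diff: "meas_upto t f \<Longrightarrow> meas_upto t g \<Longrightarrow> meas_upto t (\<lambda>s. f s - g s)"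
  using meas_upto_lin[of t f g 1 "-1"] by simp

lemma meas_upto_divide: "meas_upto t f \<Longrightarrow> meas_upto t (\<lambda>s. f s / c)"
  using meas_upto_cmult[of t f "1 / c"] by simp

text \<open>Up to \<open>t\<close> the bound is 2, afterwards only the crude \<open>Y\<close>; a
  window of length at most \<open>1 / Y\<close> after \<open>t\<close> adds no more than
  \<open>c\<close>.\<close>

lemma two_level_integral:
  assumes c: "0 \<le> c" and t: "0 \<le> t" "t \<le> q" and Y: "0 \<le> Y" "Y * (q - t) \<le> 1"
  shows "(\<integral>\<^sup>+s\<in>{0..q}. ennreal (c * (if s < t then 2 else Y)) \<partial>lborel) \<le> ennreal (c * (2 * q + 1))"
proof -
  have "(\<integral>\<^sup>+s\<in>{0..q}. ennreal (c * (if s < t then 2 else Y)) \<partial>lborel) = (\<integral>\<^sup>+s. ennreal (c * 2) * indicator {0..<t} s + ennreal (c * Y) * indicator {t..q} s \<partial>lborel)"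
    by (intro nn_integral_cong) (use t in \<open>auto simp: indicator_def\<close>)
  also have "\<dots> = ennreal (c * 2) * ennreal t + ennreal (c * Y) * ennreal (q - t)"
    using t by (simp add: nn_integral_add nn_integral_cmult)
  also have "\<dots> = ennreal (c * 2 * t + c * (Y * (q - t)))"
    using c t Y by (simp add: ennreal_mult[symmetric] mult.assoc)
  also have "\<dots> \<le> ennreal (c * (2 * q + 1))"
  proof (rule ennreal_leI)
    have "c * (2 * t) + c * (Y * (q - t)) \<le> c * (2 * q) + c * 1" using c t Y by (intro add_mono mult_left_mono) auto
    then show "c * 2 * t + c * (Y * (q - t)) \<le> c * (2 * q + 1)" by (simp add: algebra_simps)
  qed
  finally show ?thesis .
qed

lemma l12_mono: "\<bar>x\<bar> \<le> \<bar>y\<bar> \<Longrightarrow> l12 x \<le> l12 y"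
  unfolding l12_def by (intro min.mono power_mono) auto

context affine_setting
begin

lemma mark_LF_bound:
  assumes K: "predictable M F m (mark_integrand E snd)" and w: "w \<in> space M" and t: "0 \<le> t"
  shows "P0.LF t (\<lambda>w p. ennreal (l12 (mark_integrand E snd (fst p) (snd p) w))) w \<le> ennreal (c0 * t)"
proof -
  have "P0.LF t (\<lambda>w p. ennreal (l12 (mark_integrand E snd (fst p) (snd p) w))) w \<le> (\<integral>\<^sup>+s\<in>{0<..t}. ennreal c0 \<partial>lborel)"
  proof (rule P0.LF_predictable_bound[OF K w])
    fix s :: real
    have "(\<integral>\<^sup>+v. ennreal (l12 (mark_integrand E snd s v w)) \<partial>m) \<le> (\<integral>\<^sup>+\<xi>. ennreal (l12 (snd \<xi>)) \<partial>m)"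
      by (intro nn_integral_mono ennreal_leI l12_mono) (auto simp: mark_integrand_def indicator_def)
    then show "(\<integral>\<^sup>+v. ennreal (l12 (mark_integrand E snd s v w)) \<partial>m) \<le> ennreal c0" by (simp add: c0)
  qed
  also have "\<dots> = ennreal (c0 * t)" using t c0 by (simp add: nn_integral_cmult_indicator ennreal_mult)
  finally show ?thesis .
qed

text \<open>The complement of the exceptional events of the five maximal inequalities. The size
  conditions stay as premises: whether they hold is decided later, path by path and time by
  time.\<close>

definition controlled where
  "controlled Q e \<delta> H0 I0 H1 I1 H2 I2 K0 J0 K1 J1 w \<longleftrightarrow> (\<forall>q\<in>Q.
    (sq_int q (\<lambda>s. H0 s w) \<le> ennreal \<delta> \<longrightarrow> \<bar>I0 q w\<bar> \<le> e) \<and> (sq_int q (\<lambda>s. H1 s w) \<le> ennreal \<delta> \<longrightarrow> \<bar>I1 q w\<bar> \<le> e) \<and>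
    (sq_int q (\<lambda>s. H2 s w) \<le> ennreal \<delta> \<longrightarrow> \<bar>I2 q w\<bar> \<le> e) \<and>
    (P0.LF q (\<lambda>w p. ennreal (l12 (K0 (fst p) (snd p) w))) w \<le> ennreal \<delta> \<longrightarrow> \<bar>J0 q w\<bar> \<le> e) \<and>
    (P1.LF q (\<lambda>w p. ennreal (l12 (K1 (fst p) (snd p) w))) w \<le> ennreal \<delta> \<longrightarrow> \<bar>J1 q w\<bar> \<le> e))"

text \<open>Each of the three Ito integrals costs \<open>16 * \<delta> / e\<^sup>2\<close> and each
  of the two jump integrals \<open>128 * \<delta> / e\<^sup>2 + 8 * \<delta> / e\<close>, which adds
  up to 304 and 16. In the applications \<open>S\<close> is a large deviation of a solution and
  \<open>R\<close> a large error at time 0.\<close>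

lemma five_integrals_bound:
  assumes Q: "countable Q" "\<And>q. q \<in> Q \<Longrightarrow> 0 \<le> q"
    and A: "\<And>t. 0 \<le> t \<Longrightarrow> B0.ito_approx H0 t (I0 t)" "\<And>t. 0 \<le> t \<Longrightarrow> B1.ito_approx H1 t (I1 t)" "\<And>t. 0 \<le> t \<Longrightarrow> B2.ito_approx H2 t (I2 t)"
    and K0: "predictable M F m K0"
      "\<And>t. 0 \<le> t \<Longrightarrow> tends_to_0_in_prob M (\<lambda>k w. ennreal \<bar>truncated_compensated_integral N0 m K0 (1 / real (Suc k)) t w - J0 t w\<bar>)"
    and K1: "predictable M F (lebesgue_pos \<Otimes>\<^sub>M \<mu>) K1"
      "\<And>t. 0 \<le> t \<Longrightarrow> tends_to_0_in_prob M (\<lambda>k w. ennreal \<bar>truncated_compensated_integral N1 (lebesgue_pos \<Otimes>\<^sub>M \<mu>) K1 (1 / real (Suc k)) t w - J1 t w\<bar>)"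
    and e: "0 < e" and d: "0 < \<delta>"
    and good: "AE w in M. controlled Q e \<delta> H0 I0 H1 I1 H2 I2 K0 J0 K1 J1 w \<longrightarrow> S w \<longrightarrow> R w"
  shows "outer_measure_of M {w \<in> space M. S w} \<le> outer_measure_of M {w \<in> space M. R w} + ennreal (304 * \<delta> / e\<^sup>2 + 16 * \<delta> / e)"
proof -
  let ?G0 = "{w\<in>space M. \<exists>t\<in>Q. e < \<bar>I0 t w\<bar> \<and> sq_int t (\<lambda>s. H0 s w) \<le> ennreal \<delta>}"
  let ?G1 = "{w\<in>space M. \<exists>t\<in>Q. e < \<bar>I1 t w\<bar> \<and> sq_int t (\<lambda>s. H1 s w) \<le> ennreal \<delta>}"
  let ?G2 = "{w\<in>space M. \<exists>t\<in>Q. e < \<bar>I2 t w\<bar> \<and> sq_int t (\<lambda>s. H2 s w) \<le> ennreal \<delta>}"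
  let ?G3 = "{w\<in>space M. \<exists>t\<in>Q. e < \<bar>J0 t w\<bar> \<and> P0.LF t (\<lambda>w p. ennreal (l12 (K0 (fst p) (snd p) w))) w \<le> ennreal \<delta>}"
  let ?G4 = "{w\<in>space M. \<exists>t\<in>Q. e < \<bar>J1 t w\<bar> \<and> P1.LF t (\<lambda>w p. ennreal (l12 (K1 (fst p) (snd p) w))) w \<le> ennreal \<delta>}"
  let ?U = "?G0 \<union> (?G1 \<union> (?G2 \<union> (?G3 \<union> ?G4)))" and ?R = "{w \<in> space M. R w}"
  have G0: "outer_measure_of M ?G0 \<le> ennreal (16 * \<delta> / e\<^sup>2)" by (rule B0.ito_maximal[OF Q A(1)[OF Q(2)] e d])
  have G1: "outer_measure_of M ?G1 \<le> ennreal (16 * \<delta> / e\<^sup>2)" by (rule B1.ito_maximal[OF Q A(2)[OF Q(2)] e d])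
  have G2: "outer_measure_of M ?G2 \<le> ennreal (16 * \<delta> / e\<^sup>2)" by (rule B2.ito_maximal[OF Q A(3)[OF Q(2)] e d])
  have G3: "outer_measure_of M ?G3 \<le> ennreal (128 * \<delta> / e\<^sup>2 + 8 * \<delta> / e)"
    by (rule P0.jump_maximal[OF K0(1) Q e less_imp_le[OF d] K0(2)[OF Q(2)]])
  have G4: "outer_measure_of M ?G4 \<le> ennreal (128 * \<delta> / e\<^sup>2 + 8 * \<delta> / e)"
    by (rule P1.jump_maximal[OF K1(1) Q e less_imp_le[OF d] K1(2)[OF Q(2)]])
  have "outer_measure_of M {w \<in> space M. S w} \<le> outer_measure_of M {w \<in> space M. w \<in> ?R \<union> ?U}"
  proof (rule outer_measure_of_AE_mono, rule AE_mp[OF good], intro AE_I2 impI, rule ccontr)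
    fix w assume w: "w \<in> space M" "S w" and n: "w \<notin> ?R \<union> ?U" and imp: "controlled Q e \<delta> H0 I0 H1 I1 H2 I2 K0 J0 K1 J1 w \<longrightarrow> S w \<longrightarrow> R w"
    have "\<not> R w" using n w by simp
    then show False using imp n w by (auto simp: controlled_def not_less)
  qed
  also have "{w \<in> space M. w \<in> ?R \<union> ?U} = ?R \<union> ?U" by blast
  also have "outer_measure_of M (?R \<union> ?U) \<le> outer_measure_of M ?R + (ennreal (16 * \<delta> / e\<^sup>2) + (ennreal (16 * \<delta> / e\<^sup>2) + (ennreal (16 * \<delta> / e\<^sup>2) +
     (ennreal (128 * \<delta> / e\<^sup>2 + 8 * \<delta> / e) + ennreal (128 * \<delta> / e\<^sup>2 + 8 * \<delta> / e)))))"
    by (intro outer_measure_of_Un_bound order_refl G0 G1 G2 G3 G4) auto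
  also have "ennreal (16 * \<delta> / e\<^sup>2) + (ennreal (16 * \<delta> / e\<^sup>2) + (ennreal (16 * \<delta> / e\<^sup>2) +
     (ennreal (128 * \<delta> / e\<^sup>2 + 8 * \<delta> / e) + ennreal (128 * \<delta> / e\<^sup>2 + 8 * \<delta> / e)))) = ennreal (304 * \<delta> / e\<^sup>2 + 16 * \<delta> / e)"
  proof -
    have p: "0 \<le> \<delta> / e\<^sup>2" "0 \<le> \<delta> / e" using d e by auto
    have "ennreal (16 * u) + (ennreal (16 * u) + (ennreal (16 * u) + (ennreal (128 * u + 8 * v) + ennreal (128 * u + 8 * v)))) = ennreal (304 * u + 16 * v)"
      if "0 \<le> u" "0 \<le> v" for u v :: real using that by (simp add: ennreal_plus[symmetric] del: ennreal_plus)
    from this[OF p] show ?thesis by simp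
  qed
  finally show ?thesis .
qed

text \<open>Divided by \<open>th\<close>, the equation for \<open>y / th - 1\<close> has the drift
  \<open>\<beta>22\<close> times the unknown up to a term of order \<open>1 / th\<close>, and its
  noise is small once each integral is at most \<open>e * th\<close>. The number
  \<open>\<delta>\<close> bounds the accumulated size of every integral while the ratio is at most
  2; its factor \<open>2 * T + 1\<close> is that of \<open>two_level_integral\<close> and the final
  1 makes it positive. Of the \<open>6 * e\<close> in \<open>\<eta>\<close>, five parts belong to
  the integrals and one to the initial error.\<close>

lemma rescaled_solution_bound:
  fixes x y :: "real \<Rightarrow> 'a \<Rightarrow> real"
  assumes x: "cadlag_progressive M F x" "nonneg_process M x"
    and y: "solves_y M F B N0 N1 m \<mu> th b2 \<beta>21 \<beta>22 \<sigma>0 \<sigma>21 \<sigma>22 E sg x y" "nonneg_process M y"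
    and th: "1 \<le> th" and b22: "\<beta>22 < 0" and sg: "\<bar>sg\<bar> = 1" and T: "0 \<le> T" and e: "0 < e" and n: "0 \<le> n"
  defines "\<eta> \<equiv> 6 * e + (\<bar>\<beta>21\<bar> * n + \<bar>b2\<bar>) * (2 * T + 1) / th"
    and "\<delta> \<equiv> (2 * \<sigma>0\<^sup>2 + 2 * n * \<sigma>21\<^sup>2 + 2 * n * \<sigma>22\<^sup>2 + c0 + n * c1) * (2 * T + 1) + 1"
  assumes small: "2 * \<eta> * exp (2 * \<bar>\<beta>22\<bar> * T) < 1"
  shows "outer_measure_of M {w \<in> space M. (\<forall>t\<in>{0..T}. x t w \<le> n) \<and> (\<exists>t\<in>{0..T}. 2 * \<eta> * exp (2 * \<bar>\<beta>22\<bar> * T) < \<bar>y t w / th - 1\<bar>)}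
    \<le> outer_measure_of M {w \<in> space M. e < \<bar>y 0 w / th - 1\<bar>} + ennreal (304 * \<delta> / (e * th)\<^sup>2 + 16 * \<delta> / (e * th))"
proof -
  define yt where "yt s w = y s w / th" for s w
  define H0 where "H0 s w = \<sigma>0 * sqrt (2 * yt s w)" for s w
  define H1 where "H1 s w = \<sigma>21 * sqrt (2 * x s w * yt s w)" for s w
  define H2 where "H2 s w = \<sigma>22 * sqrt (2 * x s w * yt s w)" for s w
  define K0 :: "real \<Rightarrow> real \<times> real \<Rightarrow> 'a \<Rightarrow> real" where "K0 = mark_integrand E snd"
  define K1 where "K1 = rate_integrand (\<lambda>s w. x s w * yt s w) E snd"
  define I0 where "I0 t = ito_integral M F (B 0) H0 t" for t
  define I1 where "I1 t = ito_integral M F (B 1) H1 t" for t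
  define I2 where "I2 t = ito_integral M F (B 2) H2 t" for t
  define J0 where "J0 t = compensated_integral M F N0 m K0 t" for t
  define J1 where "J1 t = compensated_integral M F N1 (lebesgue_pos \<Otimes>\<^sub>M \<mu>) K1 t" for t
  define g where "g s w = - th * \<beta>22 + \<beta>21 * x s w * yt s w + b2 * yt s w + \<beta>22 * y s w" for s w
  have th0: "0 < th" using th by simp
  have sol: "cadlag_progressive M F y"
    "\<And>t. 0 \<le> t \<Longrightarrow> ito_integrable M F (B 0) H0 t" "\<And>t. 0 \<le> t \<Longrightarrow> ito_integrable M F (B 1) H1 t" "\<And>t. 0 \<le> t \<Longrightarrow> ito_integrable M F (B 2) H2 t"
    "\<And>t. 0 \<le> t \<Longrightarrow> compensated_integrable M F N0 m K0 t" "\<And>t. 0 \<le> t \<Longrightarrow> compensated_integrable M F N1 (lebesgue_pos \<Otimes>\<^sub>M \<mu>) K1 t"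
    "\<And>t. 0 \<le> t \<Longrightarrow> AE w in M. y t w = y 0 w + (LINT s:{0..t}|lborel. g s w) + I0 t w + I1 t w + I2 t w + sg * J0 t w + sg * J1 t w"
    using y(1) unfolding solves_y_def Let_def yt_def[abs_def] H0_def[abs_def] H1_def[abs_def] H2_def[abs_def] K0_def K1_def g_def[abs_def] I0_def I1_def I2_def J0_def J1_def
    by blast+
  define Q where "Q = Qt T"
  have Q: "countable Q" "\<And>q. q \<in> Q \<Longrightarrow> 0 \<le> q" "\<And>q. q \<in> Q \<Longrightarrow> q \<le> T" using Qt(1,2)[of T] T by (auto simp: Q_def)
  have d: "0 < \<delta>" using n T c0 c1 by (auto simp: \<delta>_def intro!: add_nonneg_pos mult_nonneg_nonneg add_nonneg_nonneg)
  have eth: "0 < e * th" using e th0 by simp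
  have A0: "B0.ito_approx H0 t (I0 t)" if "0 \<le> t" for t unfolding I0_def by (rule B0.has_ito_integral_approx[OF ito_integral_has[OF sol(2)[OF that]] that])
  have A1: "B1.ito_approx H1 t (I1 t)" if "0 \<le> t" for t unfolding I1_def by (rule B1.has_ito_integral_approx[OF ito_integral_has[OF sol(3)[OF that]] that])
  have A2: "B2.ito_approx H2 t (I2 t)" if "0 \<le> t" for t unfolding I2_def by (rule B2.has_ito_integral_approx[OF ito_integral_has[OF sol(4)[OF that]] that])
  have c0s: "has_compensated_integral M F N0 m K0 t (J0 t)" if "0 \<le> t" for t
    unfolding J0_def by (rule compensated_integral_has[OF sol(5)[OF that]])
  have c1s: "has_compensated_integral M F N1 (lebesgue_pos \<Otimes>\<^sub>M \<mu>) K1 t (J1 t)" if "0 \<le> t" for t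
    unfolding J1_def by (rule compensated_integral_has[OF sol(6)[OF that]])
  have K0p: "predictable M F m K0" and K1p: "predictable M F (lebesgue_pos \<Otimes>\<^sub>M \<mu>) K1"
    using c0s[of 0] c1s[of 0] by (auto simp: has_compensated_integral_def)
  have l0: "tends_to_0_in_prob M (\<lambda>k w. ennreal \<bar>truncated_compensated_integral N0 m K0 (1 / real (Suc k)) t w - J0 t w\<bar>)" if "0 \<le> t" for t
    using c0s[OF that] by (simp add: has_compensated_integral_def)
  have l1: "tends_to_0_in_prob M (\<lambda>k w. ennreal \<bar>truncated_compensated_integral N1 (lebesgue_pos \<Otimes>\<^sub>M \<mu>) K1 (1 / real (Suc k)) t w - J1 t w\<bar>)" if "0 \<le> t" for t
    using c1s[OF that] by (simp add: has_compensated_integral_def)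
  have eqs: "AE w in M. \<forall>t\<in>Q. y t w = y 0 w + (LINT s:{0..t}|lborel. g s w) + I0 t w + I1 t w + I2 t w + sg * J0 t w + sg * J1 t w"
    using Q sol(7) by (simp add: AE_ball_countable)
  have xs: "cadlag (\<lambda>t. x t w)" "meas_upto T (\<lambda>s. x s w)" "\<And>t. 0 \<le> t \<Longrightarrow> 0 \<le> x t w" if "w \<in> space M" for w
    using x that T by (auto simp: cadlag_progressive_def nonneg_process_def B0.space_F intro: progressive_section)
  have ys: "cadlag (\<lambda>t. yt t w)" "meas_upto T (\<lambda>s. yt s w)" "\<And>t. 0 \<le> t \<Longrightarrow> 0 \<le> yt t w" if "w \<in> space M" for w
    using sol(1) y(2) that T th0 by (auto simp: yt_def cadlag_progressive_def nonneg_process_def B0.space_F intro!: progressive_section cadlag_divide_const meas_upto_divide)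
  let ?good = "controlled Q (e * th) \<delta> H0 I0 H1 I1 H2 I2 K0 J0 K1 J1"
  have key: "\<bar>y t w / th - 1\<bar> \<le> 2 * \<eta> * exp (2 * \<bar>\<beta>22\<bar> * T)"
    if w: "w \<in> space M" and eq: "\<forall>t\<in>Q. y t w = y 0 w + (LINT s:{0..t}|lborel. g s w) + I0 t w + I1 t w + I2 t w + sg * J0 t w + sg * J1 t w"
      and xn: "\<forall>t\<in>{0..T}. x t w \<le> n" and init: "\<bar>y 0 w / th - 1\<bar> \<le> e" and G: "?good w" and t: "0 \<le> t" "t \<le> T" for w t
  proof -
    define r where "r s = yt s w - 1" for s
    have rc: "cadlag r" unfolding r_def[abs_def] by (intro cadlag_diff cadlag_const ys w)
    have rm: "meas_upto T r" unfolding r_def[abs_def] by (intro meas_upto_diff meas_upto_const ys w)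
    obtain C where C: "0 < C" "\<And>t. 0 \<le> t \<Longrightarrow> t \<le> T \<Longrightarrow> \<bar>yt t w\<bar> \<le> C" using cadlag_bounded[OF ys(1)[OF w], of T] by blast
    \<comment> \<open>A crude bound that depends on the path. It matters only on a window of length
      \<open>1 / Y\<close>, so it leaves no trace in \<open>\<delta>\<close>.\<close>
    define Y where "Y = C + 2"
    have Y: "2 \<le> Y" "0 < Y" "\<And>t. 0 \<le> t \<Longrightarrow> t \<le> T \<Longrightarrow> yt t w \<le> Y" using C(1) by (auto simp: Y_def dest!: C(2))
    define A where "A = \<bar>\<beta>21\<bar> * n + \<bar>b2\<bar>"
    have A0: "0 \<le> A" using n by (simp add: A_def)
    have hA: "\<bar>\<beta>21 * x s w * yt s w + b2 * yt s w\<bar> \<le> A * yt s w" if "0 \<le> s" "s \<le> T" for s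
    proof -
      have "\<bar>\<beta>21 * x s w + b2\<bar> \<le> \<bar>\<beta>21\<bar> * x s w + \<bar>b2\<bar>" using abs_triangle_ineq[of "\<beta>21 * x s w" b2] xs(3)[OF w that(1)] by (simp add: abs_mult)
      also have "\<dots> \<le> A" unfolding A_def using xn that by (intro add_right_mono mult_left_mono) auto
      finally have "\<bar>\<beta>21 * x s w + b2\<bar> * yt s w \<le> A * yt s w" using ys(3)[OF w that(1)] by (rule mult_right_mono)
      then show ?thesis using ys(3)[OF w that(1)] by (simp add: abs_mult distrib_right[symmetric])
    qed
    \<comment> \<open>The large constant drift \<open>- th * \<beta>22\<close> and the term
      \<open>\<beta>22 * y\<close> combine to a multiple of the deviation of the ratio from
      1.\<close>
    have geq: "g s w = th * (\<beta>22 * r s) + (\<beta>21 * x s w * yt s w + b2 * yt s w)" for s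
      using th0 by (simp add: g_def r_def yt_def field_simps)
    have rb: "\<bar>r s\<bar> \<le> C + 1" if "0 \<le> s" "s \<le> T" for s using C(2)[OF that] by (auto simp: r_def)
    have gb: "\<bar>g s w\<bar> \<le> th * (\<bar>\<beta>22\<bar> * (C + 1)) + A * Y" if s: "0 \<le> s" "s \<le> T" for s
    proof -
      have "\<bar>g s w\<bar> \<le> \<bar>th * (\<beta>22 * r s)\<bar> + \<bar>\<beta>21 * x s w * yt s w + b2 * yt s w\<bar>" unfolding geq by (rule abs_triangle_ineq)
      also have "\<dots> \<le> th * (\<bar>\<beta>22\<bar> * (C + 1)) + A * Y"
        using th0 rb[OF s] order_trans[OF hA[OF s] mult_left_mono[OF Y(3)[OF s] A0]] by (intro add_mono) (auto simp: abs_mult intro!: mult_left_mono)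
      finally show ?thesis .
    qed
    have gm: "meas_upto T (\<lambda>s. g s w)" unfolding geq
      by (intro meas_upto_add meas_upto_mult meas_upto_const rm xs ys w)
    have gi: "set_integrable lborel {0..T} (\<lambda>s. g s w)" by (rule bounded_interval_integrable[OF gm gb])
    \<comment> \<open>The residual is right-continuous, being made of the solution and its drift,
      although it stands for the stochastic integrals; the identification with them is available at
      the times of \<open>Q\<close>.\<close>
    define R where "R q = yt q w - yt 0 w - (LINT s:{0..q}|lborel. g s w) / th" for q
    have Rr: "(R \<longlongrightarrow> R t) (at_right t)" if "0 \<le> t" "t < T" for t
      unfolding R_def using th0 by (intro tendsto_diff tendsto_const tendsto_divide cadlag_right[OF ys(1)[OF w] that(1)] interval_integral_right_continuous[OF gi gb that]) auto
    have RQ: "R q = (I0 q w + I1 q w + I2 q w + sg * J0 q w + sg * J1 q w) / th" if "q \<in> Q" for q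
      using eq[rule_format, OF that] th0 by (simp add: R_def yt_def field_simps)
    \<comment> \<open>At a time of the window after \<open>t\<close> the ratio has been at most 2
      before \<open>t\<close> and at most \<open>Y\<close> since; the accumulated sizes therefore
      stay below \<open>\<delta>\<close> and the control of the integrals applies.\<close>
    have Rb: "\<bar>R t\<bar> \<le> 5 * e" if t: "0 \<le> t" "t \<le> T" and before: "\<And>s. 0 \<le> s \<Longrightarrow> s < t \<Longrightarrow> r s \<le> 1" for t
    proof (rule extend_from_Qt[OF t, of R "t + 1 / Y"])
      show "t < t + 1 / Y" using Y by simp
      fix q assume "q \<in> Qt T" and q: "t \<le> q" "q < t + 1 / Y"
      then have qQ: "q \<in> Q" by (simp add: Q_def)
      have qT: "0 \<le> q" "q \<le> T" using Q qQ by auto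
      define \<beta> where "\<beta> s = (if s < t then 2 else Y)" for s
      have \<beta>: "yt s w \<le> \<beta> s" if "0 \<le> s" "s \<le> q" for s
        using before[of s] Y(3)[of s] that qT by (auto simp: \<beta>_def r_def)
      have \<beta>0: "0 \<le> \<beta> s" for s using Y by (simp add: \<beta>_def)
      have Yq: "Y * (q - t) \<le> 1" using q Y by (simp add: field_simps)
      have int\<beta>: "(\<integral>\<^sup>+s\<in>{0..q}. ennreal (c * \<beta> s) \<partial>lborel) \<le> ennreal (c * (2 * T + 1))" if "0 \<le> c" for c
      proof -
        have "(\<integral>\<^sup>+s\<in>{0..q}. ennreal (c * \<beta> s) \<partial>lborel) \<le> ennreal (c * (2 * q + 1))"
          unfolding \<beta>_def by (rule two_level_integral[OF that t(1) q(1) _ Yq]) (use Y in simp)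
        also have "\<dots> \<le> ennreal (c * (2 * T + 1))" using that qT by (intro ennreal_leI mult_left_mono) auto
        finally show ?thesis .
      qed
      have parts: "c * (2 * T + 1) \<le> \<delta>" if "c \<le> 2 * \<sigma>0\<^sup>2 + 2 * n * \<sigma>21\<^sup>2 + 2 * n * \<sigma>22\<^sup>2 + c0 + n * c1" for c
        unfolding \<delta>_def by (rule order_trans[OF mult_right_mono[OF that, of "2 * T + 1"]]) (use T in simp_all)
      have nn: "0 \<le> 2 * \<sigma>0\<^sup>2" "0 \<le> 2 * n * \<sigma>21\<^sup>2" "0 \<le> 2 * n * \<sigma>22\<^sup>2" "0 \<le> n * c1" using n c1 by auto
      have sq: "sq_int q (\<lambda>s. a * sqrt (2 * h s * yt s w)) \<le> ennreal \<delta>"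
        if h: "\<And>s. 0 \<le> s \<Longrightarrow> s \<le> q \<Longrightarrow> 0 \<le> h s \<and> h s \<le> b" and ab: "0 \<le> b" "2 * b * a\<^sup>2 \<le> 2 * \<sigma>0\<^sup>2 + 2 * n * \<sigma>21\<^sup>2 + 2 * n * \<sigma>22\<^sup>2 + c0 + n * c1" for a b :: real and h
      proof -
        have "sq_int q (\<lambda>s. a * sqrt (2 * h s * yt s w)) \<le> (\<integral>\<^sup>+s\<in>{0..q}. ennreal (2 * b * a\<^sup>2 * \<beta> s) \<partial>lborel)"
          unfolding sq_int_def
        proof (rule nn_integral_mono)
          fix s :: real
          show "ennreal ((a * sqrt (2 * h s * yt s w))\<^sup>2) * indicator {0..q} s \<le> ennreal (2 * b * a\<^sup>2 * \<beta> s) * indicator {0..q} s"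
          proof (cases "0 \<le> s \<and> s \<le> q")
            case True
            then have hs: "0 \<le> h s" "h s \<le> b" "0 \<le> yt s w" "yt s w \<le> \<beta> s" using h ys(3)[OF w] \<beta> by auto
            have "(a * sqrt (2 * h s * yt s w))\<^sup>2 = 2 * a\<^sup>2 * (h s * yt s w)" using hs by (simp add: power_mult_distrib)
            also have "\<dots> \<le> 2 * a\<^sup>2 * (b * \<beta> s)" using hs ab by (intro mult_left_mono mult_mono) auto
            finally have "(a * sqrt (2 * h s * yt s w))\<^sup>2 \<le> 2 * b * a\<^sup>2 * \<beta> s" by (simp add: mult_ac)
            then show ?thesis by (intro mult_right_mono ennreal_leI) auto
          qed (auto simp: indicator_def)
        qed
        also have "\<dots> \<le> ennreal (2 * b * a\<^sup>2 * (2 * T + 1))" by (rule int\<beta>) (use ab in simp)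
        also have "\<dots> \<le> ennreal \<delta>" by (rule ennreal_leI[OF parts[OF ab(2)]])
        finally show ?thesis .
      qed
      have s0: "sq_int q (\<lambda>s. H0 s w) \<le> ennreal \<delta>"
        using sq[of "\<lambda>s. 1" 1 \<sigma>0] nn c0 by (simp add: H0_def)
      have s1: "sq_int q (\<lambda>s. H1 s w) \<le> ennreal \<delta>"
        unfolding H1_def by (rule sq[of _ n]) (use xs(3)[OF w] xn nn c0 n qT in auto)
      have s2: "sq_int q (\<lambda>s. H2 s w) \<le> ennreal \<delta>"
        unfolding H2_def by (rule sq[of _ n]) (use xs(3)[OF w] xn nn c0 n qT in auto)
      have s3: "P0.LF q (\<lambda>w p. ennreal (l12 (K0 (fst p) (snd p) w))) w \<le> ennreal \<delta>"
      proof -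
        have "P0.LF q (\<lambda>w p. ennreal (l12 (K0 (fst p) (snd p) w))) w \<le> ennreal (c0 * q)"
          using mark_LF_bound[OF K0p[unfolded K0_def] w qT(1)] by (simp add: K0_def)
        also have "\<dots> \<le> ennreal (c0 * (2 * T + 1))" using c0 qT by (intro ennreal_leI mult_left_mono) auto
        also have "\<dots> \<le> ennreal \<delta>" by (rule ennreal_leI[OF parts]) (use nn in simp)
        finally show ?thesis .
      qed
      have s4: "P1.LF q (\<lambda>w p. ennreal (l12 (K1 (fst p) (snd p) w))) w \<le> ennreal \<delta>"
      proof -
        have "P1.LF q (\<lambda>w p. ennreal (l12 (K1 (fst p) (snd p) w))) w \<le> (\<integral>\<^sup>+s\<in>{0<..q}. ennreal (n * c1 * \<beta> s) \<partial>lborel)"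
        proof (rule P1.LF_predictable_bound[OF K1p w])
          fix s assume s: "0 < s" "s \<le> q"
          \<comment> \<open>Jump rates enter through left limits: for s below \<open>t\<close> all
            earlier values obey the bound 2, and in the window \<open>Y\<close> covers everything
            since \<open>2 \<le> Y\<close>.\<close>
          have ll: "left_lim (\<lambda>q. x q w * yt q w) s \<le> n * \<beta> s"
          proof (rule left_lim_le[OF cadlag_mult[OF xs(1)[OF w] ys(1)[OF w]] s(1)])
            fix u assume u: "0 \<le> u" "u < s"
            have "yt u w \<le> \<beta> s"
              using \<beta>[of u] u s Y(1) by (auto simp: \<beta>_def split: if_splits)
            then show "x u w * yt u w \<le> n * \<beta> s"
              using xs(3)[OF w u(1)] ys(3)[OF w u(1)] xn u s qT n by (intro mult_mono) auto
          qed
          have "(\<integral>\<^sup>+v. ennreal (l12 (K1 s v w)) \<partial>(lebesgue_pos \<Otimes>\<^sub>M \<mu>)) \<le> ennreal (n * \<beta> s - 0) * ennreal c1"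
          proof (rule rate_mass)
            fix u \<xi>
            show "ennreal (l12 (K1 s (u, \<xi>) w)) \<le> indicator {0..n * \<beta> s} u * ennreal (l12 (snd \<xi>))"
              using ll by (auto simp: K1_def rate_integrand_def indicator_def l12_def)
          qed
          also have "\<dots> = ennreal (n * c1 * \<beta> s)" using n c1 \<beta>0 by (simp add: ennreal_mult[symmetric] mult_ac)
          finally show "(\<integral>\<^sup>+v. ennreal (l12 (K1 s v w)) \<partial>(lebesgue_pos \<Otimes>\<^sub>M \<mu>)) \<le> ennreal (n * c1 * \<beta> s)" .
        qed
        also have "\<dots> \<le> (\<integral>\<^sup>+s\<in>{0..q}. ennreal (n * c1 * \<beta> s) \<partial>lborel)"
          by (intro nn_integral_mono mult_left_mono) (auto simp: indicator_def)
        also have "\<dots> \<le> ennreal (n * c1 * (2 * T + 1))" by (rule int\<beta>[OF nn(4)])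
        also have "\<dots> \<le> ennreal \<delta>" by (rule ennreal_leI[OF parts]) (use nn c0 in simp)
        finally show ?thesis .
      qed
      have "\<bar>I0 q w\<bar> \<le> e * th" "\<bar>I1 q w\<bar> \<le> e * th" "\<bar>I2 q w\<bar> \<le> e * th" "\<bar>J0 q w\<bar> \<le> e * th" "\<bar>J1 q w\<bar> \<le> e * th"
        using bspec[OF G[unfolded controlled_def] qQ] s0 s1 s2 s3 s4 by blast+
      moreover have "\<bar>sg * J0 q w\<bar> = \<bar>J0 q w\<bar>" "\<bar>sg * J1 q w\<bar> = \<bar>J1 q w\<bar>" using sg by (simp_all add: abs_mult)
      ultimately have "\<bar>I0 q w + I1 q w + I2 q w + sg * J0 q w + sg * J1 q w\<bar> \<le> 5 * e * th" by linarith
      then show "\<bar>R q\<bar> \<le> 5 * e" unfolding RQ[OF qQ] using th0 by (simp add: divide_le_eq)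
    qed (use Rr t in auto)
    have le: "\<bar>r t\<bar> \<le> \<eta> + \<bar>\<beta>22\<bar> * (LINT s:{0..t}|lborel. \<bar>r s\<bar>)"
      if t: "0 \<le> t" "t \<le> T" and before: "\<And>s. 0 \<le> s \<Longrightarrow> s < t \<Longrightarrow> r s \<le> 1" for t
    proof -
      have git: "set_integrable lborel {0..t} (\<lambda>s. g s w)" by (rule set_integrable_subset[OF gi]) (use t in auto)
      have "\<bar>LINT s:{0..t}|lborel. g s w\<bar> \<le> th * \<bar>\<beta>22\<bar> * (LINT s:{0..t}|lborel. \<bar>r s\<bar>) + A * 2 * t"
      proof (rule drift_bound[OF git meas_upto_mono[OF rm t(2)], of "C + 1"])
        fix s assume s: "0 \<le> s" "s < t"
        have "yt s w \<le> 2" using before[OF s] by (simp add: r_def)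
        then have "\<bar>\<beta>21 * x s w * yt s w + b2 * yt s w\<bar> \<le> A * 2"
          using A0 s t by (intro order_trans[OF hA mult_left_mono]) auto
        moreover have "\<bar>g s w\<bar> \<le> \<bar>th * (\<beta>22 * r s)\<bar> + \<bar>\<beta>21 * x s w * yt s w + b2 * yt s w\<bar>" unfolding geq by (rule abs_triangle_ineq)
        moreover have "\<bar>th * (\<beta>22 * r s)\<bar> = th * \<bar>\<beta>22\<bar> * \<bar>r s\<bar>" using th0 by (simp add: abs_mult)
        ultimately show "\<bar>g s w\<bar> \<le> th * \<bar>\<beta>22\<bar> * \<bar>r s\<bar> + A * 2" by linarith
      qed (use rb t in auto)
      then have "\<bar>LINT s:{0..t}|lborel. g s w\<bar> / th \<le> (th * \<bar>\<beta>22\<bar> * (LINT s:{0..t}|lborel. \<bar>r s\<bar>) + A * 2 * t) / th"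
        using th0 by (intro divide_right_mono) auto
      also have "\<dots> = \<bar>\<beta>22\<bar> * (LINT s:{0..t}|lborel. \<bar>r s\<bar>) + A * (2 * t) / th" using th0 by (simp add: field_simps)
      also have "\<dots> \<le> \<bar>\<beta>22\<bar> * (LINT s:{0..t}|lborel. \<bar>r s\<bar>) + A * (2 * T + 1) / th"
        using th0 A0 t by (intro add_left_mono divide_right_mono mult_left_mono) auto
      finally have D: "\<bar>(LINT s:{0..t}|lborel. g s w) / th\<bar> \<le> \<bar>\<beta>22\<bar> * (LINT s:{0..t}|lborel. \<bar>r s\<bar>) + A * (2 * T + 1) / th"
        using th0 by simp
      have "r t = R t + (LINT s:{0..t}|lborel. g s w) / th + (yt 0 w - 1)" by (simp add: R_def r_def)
      moreover have "\<bar>yt 0 w - 1\<bar> \<le> e" using init by (simp add: yt_def)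
      moreover have "\<bar>R t\<bar> \<le> 5 * e" by (rule Rb[OF t before])
      ultimately show ?thesis using D unfolding \<eta>_def A_def by linarith
    qed
    have \<eta>0: "0 \<le> \<eta>" using e A0 T th0 by (simp add: \<eta>_def A_def)
    have "\<bar>r t\<bar> \<le> 2 * \<eta> * exp (2 * \<bar>\<beta>22\<bar> * T)"
      by (rule bootstrap_bound[OF rc rm _ T \<eta>0 small le t]) (use b22 in auto)
    then show ?thesis by (simp add: r_def yt_def)
  qed
  show ?thesis
  proof (rule five_integrals_bound[OF Q(1,2) A0 A1 A2 K0p l0 K1p l1 eth d])
    show "AE w in M. ?good w \<longrightarrow> (\<forall>t\<in>{0..T}. x t w \<le> n) \<and> (\<exists>t\<in>{0..T}. 2 * \<eta> * exp (2 * \<bar>\<beta>22\<bar> * T) < \<bar>y t w / th - 1\<bar>) \<longrightarrow> e < \<bar>y 0 w / th - 1\<bar>"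
    proof (rule AE_mp[OF eqs], intro AE_I2 impI, rule ccontr)
      fix w assume w: "w \<in> space M" and eq: "\<forall>t\<in>Q. y t w = y 0 w + (LINT s:{0..t}|lborel. g s w) + I0 t w + I1 t w + I2 t w + sg * J0 t w + sg * J1 t w"
        and G: "?good w" and n: "\<not> e < \<bar>y 0 w / th - 1\<bar>"
        and a: "(\<forall>t\<in>{0..T}. x t w \<le> n) \<and> (\<exists>t\<in>{0..T}. 2 * \<eta> * exp (2 * \<bar>\<beta>22\<bar> * T) < \<bar>y t w / th - 1\<bar>)"
      from conjunct2[OF a] obtain t where t: "t \<in> {0..T}" "2 * \<eta> * exp (2 * \<bar>\<beta>22\<bar> * T) < \<bar>y t w / th - 1\<bar>" ..
      have "\<bar>y t w / th - 1\<bar> \<le> 2 * \<eta> * exp (2 * \<bar>\<beta>22\<bar> * T)"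
        by (rule key[OF w eq conjunct1[OF a] _ G]) (use n t in auto)
      then show False using t(2) by simp
    qed
  qed
qed

end

section \<open>Linearity of the stochastic integrals\<close>

lemma tends_to_0_in_prob_AE_cong:
  assumes X: "tends_to_0_in_prob M X" and eq: "AE w in M. \<forall>n. Y n w = X n w"
  shows "tends_to_0_in_prob M Y"
proof (rule tends_to_0_in_probI_bound)
  fix e r :: real assume e: "0 < e" and r: "0 < r"
  show "\<forall>\<^sub>F n in sequentially. outer_measure_of M {w \<in> space M. ennreal e < Y n w} \<le> ennreal r"
    using tends_to_0_in_prob_eventually_le[OF X e r]
  proof eventually_elim
    case (elim n)
    have "outer_measure_of M {w \<in> space M. ennreal e < Y n w} \<le> outer_measure_of M {w \<in> space M. ennreal e < X n w}"
      by (rule outer_measure_of_AE_mono, rule AE_mp[OF eq]) auto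
    then show ?case using elim by simp
  qed
qed

context filtered_brownian
begin

lemma ito_approx_combine:
  assumes "ito_approx H1 t J1" "ito_approx H2 t J2" "ito_approx H3 t J3"
  shows "ito_approx (\<lambda>s w. H1 s w - H2 s w - H3 s w) t (\<lambda>w. J1 w - J2 w - J3 w)"
  using ito_approx_lin[OF ito_approx_lin[OF assms(1,2), of 1 "-1"] assms(3), of 1 "-1"] by simp

end

context filtered_poisson
begin

text \<open>If the intensity integral is cut at level \<open>j\<close>, the expected mass is at most
  \<open>j\<close>, hence almost surely finite, and this for all \<open>j\<close> at once. On a path
  of finite intensity some level cuts nothing.\<close>

lemma AE_NF_finite:
  assumes f: "f \<in> BP" and t: "0 \<le> t" and fin: "AE w in M. LF t (pull f) w < \<infinity>"
  shows "AE w in M. NF t (pull f) w < \<infinity>"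
proof -
  define D where "D j = {x \<in> space PS. \<forall>r\<in>\<rat>. 0 \<le> r \<and> r < fst x \<longrightarrow> LF r (pull f) (snd x) \<le> of_nat j}" for j :: nat
  note cut = predictable_cut[OF f, where \<delta> = "of_nat j" for j, folded D_def]
  define fj where "fj j x = f x * indicator (D j) (fst x)" for j x
  have fjm: "fj j \<in> BP" for j unfolding fj_def[abs_def]
    by (intro borel_measurable_times_ennreal f measurable_compose[OF measurable_fst borel_measurable_indicator] cut(1))
  have "AE w in M. NF t (pull (fj j)) w < \<infinity>" for j
  proof -
    obtain h where h: "h \<in> borel_measurable M" "AE w in M. NF t (pull (fj j)) w = h w" "(\<integral>\<^sup>+w. h w \<partial>M) = (\<integral>\<^sup>+w. LF t (pull (fj j)) w \<partial>M)"
      using compensation_full[OF t fjm[of j]] .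
    have "(\<integral>\<^sup>+w. LF t (pull (fj j)) w \<partial>M) \<le> (\<integral>\<^sup>+w. of_nat j \<partial>M)"
      by (rule nn_integral_mono) (use cut(2)[of _ t j] in \<open>simp add: fj_def\<close>)
    also have "\<dots> < \<infinity>" by (simp add: emeasure_space_1 of_nat_less_top)
    finally have "AE w in M. h w \<noteq> \<infinity>" using h(3) by (intro nn_integral_PInf_AE[OF h(1)]) auto
    with h(2) show ?thesis by eventually_elim (simp add: top.not_eq_extremum)
  qed
  then have "AE w in M. \<forall>j. NF t (pull (fj j)) w < \<infinity>" by (simp add: AE_all_countable)
  with fin AE_space show ?thesis
  proof eventually_elim
    case (elim w)
    then obtain j :: nat where j: "LF t (pull f) w \<le> of_nat j" using ennreal_Ex_less_of_nat[of "LF t (pull f) w"] by (auto intro: less_imp_le)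
    have "NF t (pull f) w = NF t (pull (fj j)) w"
      unfolding NF_def
    proof (intro nn_integral_cong)
      fix p :: "real \<times> 'b"
      show "pull f w p * indicator ({0<..t} \<times> UNIV) p = pull (fj j) w p * indicator ({0<..t} \<times> UNIV) p"
        using cut(3)[OF elim(2) _ _ j, of "fst p"] by (cases p) (auto simp: fj_def indicator_def)
    qed
    then show ?case using elim by simp
  qed
qed

text \<open>The truncated integrals are Lebesgue integrals along paths, with value 0 by convention
  where integrability fails, so additivity has to be secured by integrability. Above the truncation
  level the integrand is dominated by a multiple of \<open>l12\<close>.\<close>

lemma trunc_integrable:
  assumes K: "has_compensated_integral M F N \<nu> K t J" and t: "0 \<le> t"
  shows "AE w in M. \<forall>n. integrable (N w) (\<lambda>p. indicator ({0<..t} \<times> UNIV) p * trunc (1 / real (Suc n)) (K (fst p) (snd p) w)) \<and>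
    integrable L (\<lambda>p. indicator ({0<..t} \<times> UNIV) p * trunc (1 / real (Suc n)) (K (fst p) (snd p) w))"
proof -
  define k where "k x = K (fst (fst x)) (snd x) (snd (fst x))" for x :: "(real \<times> 'a) \<times> 'b"
  have km: "k \<in> BP"
    using K unfolding has_compensated_integral_def predictable_def k_def[abs_def] by (simp add: case_prod_unfold)
  let ?q = "\<lambda>x. ennreal (l12 (k x))"
  have qm: "?q \<in> BP" using km by measurable
  have L: "AE w in M. LF t (pull ?q) w < \<infinity>" using K by (simp add: has_compensated_integral_def LF_def k_def)
  show ?thesis using L AE_NF_finite[OF qm t L] AE_space
  proof (eventually_elim, intro allI)
    case (elim w) fix n
    define c where "c = 1 / real (Suc n)"
    have c: "0 < c" by (simp add: c_def)
    let ?g = "\<lambda>p. ennreal (1 + 1 / c) * pull ?q w p"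
    have kw: "pull k w \<in> borel_measurable L" by (rule pull_section[OF km elim(3)])
    have qw: "pull ?q w \<in> borel_measurable L" by (rule pull_section[OF qm elim(3)])
    have fin: "(\<integral>\<^sup>+p\<in>{0<..t} \<times> UNIV. ?g p \<partial>X) < \<infinity>" if X: "sets X = sets L" "(\<integral>\<^sup>+p\<in>{0<..t} \<times> UNIV. pull ?q w p \<partial>X) < \<infinity>" for X
    proof -
      have "(\<lambda>p. pull ?q w p * indicator ({0<..t} \<times> UNIV) p) \<in> borel_measurable X"
        unfolding measurable_cong_sets[OF X(1) refl] using qw by measurable
      then have "(\<integral>\<^sup>+p\<in>{0<..t} \<times> UNIV. ?g p \<partial>X) = ennreal (1 + 1 / c) * (\<integral>\<^sup>+p\<in>{0<..t} \<times> UNIV. pull ?q w p \<partial>X)"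
        by (simp add: mult.assoc nn_integral_cmult)
      then show ?thesis using X(2) by (simp add: ennreal_mult_less_top)
    qed
    have tm: "(\<lambda>p. trunc c (K (fst p) (snd p) w)) \<in> borel_measurable L"
      using measurable_compose[OF kw trunc_measurable[of c]] by (simp add: k_def)
    have le: "ennreal \<bar>trunc c (K (fst p) (snd p) w)\<bar> \<le> ?g p" for p
      using ennreal_leI[OF abs_trunc_le[OF c, of "K (fst p) (snd p) w"]] c by (simp add: k_def ennreal_mult l12_nonneg)
    show "integrable (N w) (\<lambda>p. indicator ({0<..t} \<times> UNIV) p * trunc (1 / real (Suc n)) (K (fst p) (snd p) w)) \<and>
      integrable L (\<lambda>p. indicator ({0<..t} \<times> UNIV) p * trunc (1 / real (Suc n)) (K (fst p) (snd p) w))"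
      unfolding c_def[symmetric]
      by (intro conjI strip_bound(1)[OF sets_N[OF elim(3)] tm le fin[OF sets_N[OF elim(3)] elim(2)[unfolded NF_def]] order_refl]
        strip_bound(1)[OF refl tm le fin[OF refl elim(1)[unfolded LF_def]] order_refl])
  qed
qed

lemma truncated_eq_CI: "truncated_compensated_integral N \<nu> K c t w = CI (\<lambda>w p. trunc c (K (fst p) (snd p) w)) t w"
  unfolding truncated_compensated_integral_def CI_def jump_integral_def Let_def set_lebesgue_integral_def trunc_def
  by (simp add: case_prod_unfold)

text \<open>Truncation by jump size is not linear, so compensated integrals do not simply add up.
  The condition \<open>split\<close> will hold because each mark jumps in only one of the two
  halves.\<close>

lemma compensated_combine:
  assumes a: "has_compensated_integral M F N \<nu> Ka t Ja" and b: "has_compensated_integral M F N \<nu> Kb t Jb"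
    and c: "has_compensated_integral M F N \<nu> Kc t Jc" and t: "0 \<le> t"
    and split: "\<And>e s v w. 0 < e \<Longrightarrow> v \<in> space \<nu> \<Longrightarrow>
      trunc e (Ka s v w + Kb s v w - Kc s v w) = trunc e (Ka s v w) + trunc e (Kb s v w) - trunc e (Kc s v w)"
  shows "tends_to_0_in_prob M (\<lambda>n w. ennreal \<bar>truncated_compensated_integral N \<nu> (\<lambda>s v w. Ka s v w + Kb s v w - Kc s v w) (1 / real (Suc n)) t w - (Ja w + Jb w - Jc w)\<bar>)"
proof -
  let ?T = "\<lambda>K n. truncated_compensated_integral N \<nu> K (1 / real (Suc n)) t"
  let ?K = "\<lambda>s v w. Ka s v w + Kb s v w - Kc s v w"
  have lim: "tends_to_0_in_prob M (\<lambda>n w. ennreal \<bar>?T Ka n w - Ja w\<bar>)" "tends_to_0_in_prob M (\<lambda>n w. ennreal \<bar>?T Kb n w - Jb w\<bar>)"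
    "tends_to_0_in_prob M (\<lambda>n w. ennreal \<bar>?T Kc n w - Jc w\<bar>)"
    using a b c by (simp_all add: has_compensated_integral_def)
  have ab: "tends_to_0_in_prob M (\<lambda>n w. ennreal \<bar>(?T Ka n w + ?T Kb n w) - (Ja w + Jb w)\<bar>)"
    by (rule tends_to_0_in_prob_combine[OF lim(1,2), of 1])
      (simp_all add: ennreal_plus[symmetric] ennreal_leI del: ennreal_plus)
  have abc: "tends_to_0_in_prob M (\<lambda>n w. ennreal \<bar>(?T Ka n w + ?T Kb n w - ?T Kc n w) - (Ja w + Jb w - Jc w)\<bar>)"
    by (rule tends_to_0_in_prob_combine[OF ab lim(3), of 1])
      (simp_all add: ennreal_plus[symmetric] ennreal_leI del: ennreal_plus)
  have "AE w in M. \<forall>n. ?T ?K n w = ?T Ka n w + ?T Kb n w - ?T Kc n w"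
    using trunc_integrable[OF a t] trunc_integrable[OF b t] trunc_integrable[OF c t] AE_space
  proof (eventually_elim, intro allI)
    case (elim w) fix n
    let ?t = "\<lambda>K p. indicator ({0<..t} \<times> UNIV) p * trunc (1 / real (Suc n)) (K (fst p) (snd p) w)"
    have sp: "integral\<^sup>L X (?t ?K) = integral\<^sup>L X (\<lambda>p. ?t Ka p + ?t Kb p - ?t Kc p)" if "space X = space L" for X
      by (rule Bochner_Integration.integral_cong) (use that in \<open>auto simp: space_L split algebra_simps\<close>)
    have "integral\<^sup>L X (?t ?K) = integral\<^sup>L X (?t Ka) + integral\<^sup>L X (?t Kb) - integral\<^sup>L X (?t Kc)"
      if "space X = space L" "integrable X (?t Ka)" "integrable X (?t Kb)" "integrable X (?t Kc)" for X
      unfolding sp[OF that(1)] using that(2-) by simp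
    then show "?T ?K n w = ?T Ka n w + ?T Kb n w - ?T Kc n w"
      unfolding truncated_eq_CI CI_def using elim sets_eq_imp_space_eq[OF sets_N[OF elim(4)]] by simp
  qed
  then show ?thesis by (intro tends_to_0_in_prob_AE_cong[OF abc]) (elim AE_mp, auto)
qed

end

section \<open>The difference to the limit process\<close>

lemma cadlag_add: "cadlag f \<Longrightarrow> cadlag g \<Longrightarrow> cadlag (\<lambda>t. f t + g t)"
  unfolding cadlag_def[of "\<lambda>t. f t + g t"] by (blast intro: tendsto_add cadlag_right cadlag_left)

lemma cadlag_set_integrable:
  assumes "cadlag f" "meas_upto T f"
  shows "set_integrable lborel {0..T} f"
proof -
  obtain C where "0 < C" "\<And>t. 0 \<le> t \<Longrightarrow> t \<le> T \<Longrightarrow> \<bar>f t\<bar> \<le> C" using cadlag_bounded[OF assms(1), of T] by blast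
  then show ?thesis by (intro bounded_interval_integrable[OF assms(2)])
qed

lemma sq_int_bound:
  assumes "\<And>s. 0 \<le> s \<Longrightarrow> s \<le> t \<Longrightarrow> (f s)\<^sup>2 \<le> c" "0 \<le> t" "0 \<le> c"
  shows "sq_int t f \<le> ennreal (c * t)"
proof -
  have "sq_int t f \<le> (\<integral>\<^sup>+s\<in>{0..t}. ennreal c \<partial>lborel)"
    unfolding sq_int_def by (intro nn_integral_mono) (use assms in \<open>auto simp: indicator_def intro!: ennreal_leI\<close>)
  then show ?thesis using assms by (simp add: nn_integral_cmult_indicator ennreal_mult)
qed

lemma abs_sqrt_minus_1_le: "0 \<le> y \<Longrightarrow> \<bar>sqrt y - 1\<bar> \<le> \<bar>y - 1\<bar>"
proof -
  assume y: "0 \<le> y"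
  have "y - 1 = (sqrt y - 1) * (sqrt y + 1)" using y by (simp add: algebra_simps)
  then have "\<bar>y - 1\<bar> = \<bar>sqrt y - 1\<bar> * \<bar>sqrt y + 1\<bar>" by (metis abs_mult)
  then have "\<bar>y - 1\<bar> = \<bar>sqrt y - 1\<bar> * (sqrt y + 1)" using y by simp
  moreover have "\<bar>sqrt y - 1\<bar> * 1 \<le> \<bar>sqrt y - 1\<bar> * (sqrt y + 1)" using y by (intro mult_left_mono) auto
  ultimately show ?thesis by simp
qed

text \<open>The difference is \<open>sqrt (2 * h)\<close> times
  \<open>a * (sqrt u - 1) - b * (sqrt v - 1)\<close>, and a square root is at least as close to 1 as
  its argument. Since \<open>\<zeta> \<le> 1\<close>, one of the two powers of
  \<open>\<zeta>\<close> is given away, so that this error is linear in \<open>\<zeta>\<close> like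
  that of the jump rates.\<close>

lemma diffusion_difference:
  assumes h: "0 \<le> h" "h \<le> n" and u: "0 \<le> u" "\<bar>u - 1\<bar> \<le> \<zeta>" and v: "0 \<le> v" "\<bar>v - 1\<bar> \<le> \<zeta>" and \<zeta>: "0 \<le> \<zeta>" "\<zeta> \<le> 1"
  shows "(a * sqrt (2 * h * u) - b * sqrt (2 * h * v) - (a - b) * sqrt (2 * h))\<^sup>2 \<le> 2 * n * (\<bar>a\<bar> + \<bar>b\<bar>)\<^sup>2 * \<zeta>"
proof -
  define d where "d = a * (sqrt u - 1) - b * (sqrt v - 1)"
  have "a * sqrt (2 * h * u) - b * sqrt (2 * h * v) - (a - b) * sqrt (2 * h) = sqrt (2 * h) * d"
    unfolding d_def by (simp add: real_sqrt_mult algebra_simps)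
  then have "(a * sqrt (2 * h * u) - b * sqrt (2 * h * v) - (a - b) * sqrt (2 * h))\<^sup>2 = 2 * h * d\<^sup>2"
    using h by (simp add: power_mult_distrib)
  also have "\<dots> \<le> 2 * n * ((\<bar>a\<bar> + \<bar>b\<bar>)\<^sup>2 * \<zeta>)"
  proof (rule mult_mono)
    have "\<bar>d\<bar> \<le> \<bar>a\<bar> * \<bar>sqrt u - 1\<bar> + \<bar>b\<bar> * \<bar>sqrt v - 1\<bar>" unfolding d_def by (metis abs_mult abs_triangle_ineq4)
    also have "\<dots> \<le> \<bar>a\<bar> * \<zeta> + \<bar>b\<bar> * \<zeta>"
      using abs_sqrt_minus_1_le[OF u(1)] abs_sqrt_minus_1_le[OF v(1)] u v by (intro add_mono mult_left_mono) auto
    finally have "\<bar>d\<bar>\<^sup>2 \<le> ((\<bar>a\<bar> + \<bar>b\<bar>) * \<zeta>)\<^sup>2" by (intro power_mono) (auto simp: distrib_right)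
    also have "\<dots> \<le> (\<bar>a\<bar> + \<bar>b\<bar>)\<^sup>2 * \<zeta>"
      unfolding power_mult_distrib using \<zeta> by (intro mult_left_mono) (auto simp: power2_eq_square mult_left_le)
    finally show "d\<^sup>2 \<le> (\<bar>a\<bar> + \<bar>b\<bar>)\<^sup>2 * \<zeta>" by simp
  qed (use h \<zeta> in auto)
  finally show ?thesis by (simp add: mult.assoc)
qed

text \<open>Each mark contributes to only one of the two halves, and with the same jump as in the limit
  equation.\<close>

lemma D_halves:
  obtains d :: real where "\<bar>d\<bar> \<le> \<bar>snd \<xi>\<bar>" "indicator D_all \<xi> * snd \<xi> = d"
    "indicator D_plus \<xi> * snd \<xi> = d \<and> indicator D_minus \<xi> * snd \<xi> = 0 \<or> indicator D_plus \<xi> * snd \<xi> = 0 \<and> indicator D_minus \<xi> * snd \<xi> = d"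
proof (cases "\<xi> \<in> D_all")
  case False
  then have "\<xi> \<notin> D_plus" "\<xi> \<notin> D_minus" by (auto simp: D_plus_def D_minus_def D_all_def)
  then show thesis using False by (intro that[of 0]) auto
next
  case True
  then have "\<xi> \<in> D_plus \<longleftrightarrow> 0 \<le> snd \<xi>" "\<xi> \<in> D_minus \<longleftrightarrow> snd \<xi> \<le> 0" by (auto simp: D_plus_def D_minus_def D_all_def)
  then show thesis using True by (intro that[of "snd \<xi>"]) (auto simp: indicator_def)
qed

text \<open>The numbers \<open>a\<close>, \<open>b\<close>, \<open>c\<close> will be indicators
  telling whether a point lies below the three jump rates. At each mark one half contributes
  nothing, so the combination is the jump times a difference of two such numbers, that is times 0, 1
  or -1.\<close>

lemma
  fixes a b c :: real
  assumes abc: "a = 0 \<or> a = 1" "b = 0 \<or> b = 1" "c = 0 \<or> c = 1"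
  shows trunc_split: "0 < e \<Longrightarrow> trunc e (a * indicator D_plus \<xi> * snd \<xi> + b * indicator D_minus \<xi> * snd \<xi> - c * indicator D_all \<xi> * snd \<xi>)
      = trunc e (a * indicator D_plus \<xi> * snd \<xi>) + trunc e (b * indicator D_minus \<xi> * snd \<xi>) - trunc e (c * indicator D_all \<xi> * snd \<xi>)"
    and D_halves_le: "\<bar>a * indicator D_plus \<xi> * snd \<xi> + b * indicator D_minus \<xi> * snd \<xi> - c * indicator D_all \<xi> * snd \<xi>\<bar> \<le> \<bar>snd \<xi>\<bar>"
proof -
  obtain d where d: "\<bar>d\<bar> \<le> \<bar>snd \<xi>\<bar>" "indicator D_all \<xi> * snd \<xi> = d"
    "indicator D_plus \<xi> * snd \<xi> = d \<and> indicator D_minus \<xi> * snd \<xi> = 0 \<or> indicator D_plus \<xi> * snd \<xi> = 0 \<and> indicator D_minus \<xi> * snd \<xi> = d"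
    using D_halves .
  have aux: "0 < e \<Longrightarrow> trunc e (a * p + b * q - c * d) = trunc e (a * p) + trunc e (b * q) - trunc e (c * d)" "\<bar>a * p + b * q - c * d\<bar> \<le> \<bar>d\<bar>"
    if "p = d \<and> q = 0 \<or> p = 0 \<and> q = d" for p q
    using that abc by (elim disjE conjE; simp add: trunc_def)+
  show "0 < e \<Longrightarrow> trunc e (a * indicator D_plus \<xi> * snd \<xi> + b * indicator D_minus \<xi> * snd \<xi> - c * indicator D_all \<xi> * snd \<xi>)
      = trunc e (a * indicator D_plus \<xi> * snd \<xi>) + trunc e (b * indicator D_minus \<xi> * snd \<xi>) - trunc e (c * indicator D_all \<xi> * snd \<xi>)"
    unfolding mult.assoc d(2) by (rule aux(1)[OF d(3)])
  show "\<bar>a * indicator D_plus \<xi> * snd \<xi> + b * indicator D_minus \<xi> * snd \<xi> - c * indicator D_all \<xi> * snd \<xi>\<bar> \<le> \<bar>snd \<xi>\<bar>"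
    unfolding mult.assoc d(2) by (rule order_trans[OF aux(2)[OF d(3)] d(1)])
qed

lemma D_halves_sum: "a * indicator D_plus \<xi> * snd \<xi> + a * indicator D_minus \<xi> * snd \<xi> - a * indicator D_all \<xi> * snd \<xi> = 0"
  unfolding mult.assoc by (rule D_halves[of \<xi>]) (auto simp: algebra_simps)

lemma predictable_combine:
  assumes "predictable M F \<nu> Ka" "predictable M F \<nu> Kb" "predictable M F \<nu> Kc"
  shows "predictable M F \<nu> (\<lambda>s v w. Ka s v w + Kb s v w - Kc s v w)"
  using assms unfolding predictable_def case_prod_unfold by (intro borel_measurable_diff borel_measurable_add)

context affine_setting
begin

text \<open>For the difference \<open>yp - ym - z\<close> the drift is \<open>\<beta>22\<close>
  times the unknown up to a multiple of \<open>\<zeta>\<close>, the squared diffusion coefficients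
  and the width of the strip in which the jumps disagree are of order \<open>\<zeta>\<close>, and
  the \<open>N0\<close> terms cancel. Hence \<open>\<delta>\<close> is a multiple of
  \<open>\<zeta>\<close>. In \<open>\<eta>\<close> the five integrals and the initial error account
  for \<open>6 * e\<close>, the drift error for the rest.\<close>

lemma limit_difference_bound:
  fixes x yp ym z :: "real \<Rightarrow> 'a \<Rightarrow> real"
  assumes x: "cadlag_progressive M F x" "nonneg_process M x"
    and yp: "solves_y M F B N0 N1 m \<mu> th b2p \<beta>21p \<beta>22 \<sigma>0p \<sigma>21p \<sigma>22p D_plus 1 x yp" "nonneg_process M yp"
    and ym: "solves_y M F B N0 N1 m \<mu> th b2m \<beta>21m \<beta>22 \<sigma>0m \<sigma>21m \<sigma>22m D_minus (- 1) x ym" "nonneg_process M ym"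
    and z: "solves_z M F B N0 N1 m \<mu> (b2p - b2m) (\<beta>21p - \<beta>21m) \<beta>22 (\<sigma>0p - \<sigma>0m) (\<sigma>21p - \<sigma>21m) (\<sigma>22p - \<sigma>22m) x z0 z"
    and th: "1 \<le> th" and b22: "\<beta>22 < 0" and T: "0 \<le> T" and e: "0 < e" and n: "0 \<le> n" and \<zeta>: "0 < \<zeta>" "\<zeta> \<le> 1"
  defines "\<eta> \<equiv> 6 * e + (\<bar>b2p\<bar> + \<bar>b2m\<bar> + n * (\<bar>\<beta>21p\<bar> + \<bar>\<beta>21m\<bar>)) * \<zeta> * T"
    and "\<delta> \<equiv> ((2 * (\<bar>\<sigma>0p\<bar> + \<bar>\<sigma>0m\<bar>)\<^sup>2 + 2 * n * (\<bar>\<sigma>21p\<bar> + \<bar>\<sigma>21m\<bar>)\<^sup>2 + 2 * n * (\<bar>\<sigma>22p\<bar> + \<bar>\<sigma>22m\<bar>)\<^sup>2 + 2 * n * c1) * T + 1) * \<zeta>"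
  shows "outer_measure_of M {w \<in> space M.
      (\<forall>t\<in>{0..T}. x t w \<le> n \<and> \<bar>yp t w / th - 1\<bar> \<le> \<zeta> \<and> \<bar>ym t w / th - 1\<bar> \<le> \<zeta>) \<and>
      (\<exists>t\<in>{0..T}. 2 * \<eta> * exp (2 * \<bar>\<beta>22\<bar> * T) < \<bar>yp t w - ym t w - z t w\<bar>)}
    \<le> outer_measure_of M {w \<in> space M. e < \<bar>yp 0 w - ym 0 w - z0 w\<bar>} + ennreal (304 * \<delta> / e\<^sup>2 + 16 * \<delta> / e)"
proof -
  define up um where "up s w = yp s w / th" and "um s w = ym s w / th" for s w
  define H0p H0m H0z where "H0p s w = \<sigma>0p * sqrt (2 * up s w)" and "H0m s w = \<sigma>0m * sqrt (2 * um s w)" and "H0z s w = sqrt 2 * (\<sigma>0p - \<sigma>0m)"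
    for s :: real and w :: 'a
  define H1p H1m H1z where "H1p s w = \<sigma>21p * sqrt (2 * x s w * up s w)" and "H1m s w = \<sigma>21m * sqrt (2 * x s w * um s w)"
    and "H1z s w = (\<sigma>21p - \<sigma>21m) * sqrt (2 * x s w)" for s w
  define H2p H2m H2z where "H2p s w = \<sigma>22p * sqrt (2 * x s w * up s w)" and "H2m s w = \<sigma>22m * sqrt (2 * x s w * um s w)"
    and "H2z s w = (\<sigma>22p - \<sigma>22m) * sqrt (2 * x s w)" for s w
  define K0p K0m K0z :: "real \<Rightarrow> real \<times> real \<Rightarrow> 'a \<Rightarrow> real" where
    "K0p = mark_integrand D_plus snd" and "K0m = mark_integrand D_minus snd" and "K0z = mark_integrand D_all snd"
  define K1p K1m K1z where "K1p = rate_integrand (\<lambda>s w. x s w * up s w) D_plus snd" and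
    "K1m = rate_integrand (\<lambda>s w. x s w * um s w) D_minus snd" and "K1z = rate_integrand x D_all snd"
  let ?\<nu> = "lebesgue_pos \<Otimes>\<^sub>M \<mu>"
  define gp gm gz where "gp s w = - th * \<beta>22 + \<beta>21p * x s w * up s w + b2p * up s w + \<beta>22 * yp s w"
    and "gm s w = - th * \<beta>22 + \<beta>21m * x s w * um s w + b2m * um s w + \<beta>22 * ym s w"
    and "gz s w = (b2p - b2m) + (\<beta>21p - \<beta>21m) * x s w + \<beta>22 * z s w" for s w
  define IB where "IB i H = ito_integral M F (B i) H" for i H
  define J0 where "J0 K = compensated_integral M F N0 m K" for K
  define J1 where "J1 K = compensated_integral M F N1 ?\<nu> K" for K
  have th0: "0 < th" using th by simp
  have ps: "cadlag_progressive M F yp"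
    "\<And>t. 0 \<le> t \<Longrightarrow> ito_integrable M F (B 0) H0p t" "\<And>t. 0 \<le> t \<Longrightarrow> ito_integrable M F (B 1) H1p t" "\<And>t. 0 \<le> t \<Longrightarrow> ito_integrable M F (B 2) H2p t"
    "\<And>t. 0 \<le> t \<Longrightarrow> compensated_integrable M F N0 m K0p t" "\<And>t. 0 \<le> t \<Longrightarrow> compensated_integrable M F N1 ?\<nu> K1p t"
    "\<And>t. 0 \<le> t \<Longrightarrow> AE w in M. yp t w = yp 0 w + (LINT s:{0..t}|lborel. gp s w) + IB 0 H0p t w + IB 1 H1p t w + IB 2 H2p t w + 1 * J0 K0p t w + 1 * J1 K1p t w"
    using yp(1) unfolding solves_y_def Let_def up_def[abs_def] H0p_def[abs_def] H1p_def[abs_def] H2p_def[abs_def] K0p_def K1p_def gp_def[abs_def] IB_def J0_def J1_def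
    by blast+
  have ms: "cadlag_progressive M F ym"
    "\<And>t. 0 \<le> t \<Longrightarrow> ito_integrable M F (B 0) H0m t" "\<And>t. 0 \<le> t \<Longrightarrow> ito_integrable M F (B 1) H1m t" "\<And>t. 0 \<le> t \<Longrightarrow> ito_integrable M F (B 2) H2m t"
    "\<And>t. 0 \<le> t \<Longrightarrow> compensated_integrable M F N0 m K0m t" "\<And>t. 0 \<le> t \<Longrightarrow> compensated_integrable M F N1 ?\<nu> K1m t"
    "\<And>t. 0 \<le> t \<Longrightarrow> AE w in M. ym t w = ym 0 w + (LINT s:{0..t}|lborel. gm s w) + IB 0 H0m t w + IB 1 H1m t w + IB 2 H2m t w + - 1 * J0 K0m t w + - 1 * J1 K1m t w"
    using ym(1) unfolding solves_y_def Let_def um_def[abs_def] H0m_def[abs_def] H1m_def[abs_def] H2m_def[abs_def] K0m_def K1m_def gm_def[abs_def] IB_def J0_def J1_def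
    by blast+
  have zs: "cadlag_progressive M F z"
    "\<And>t. 0 \<le> t \<Longrightarrow> ito_integrable M F (B 0) H0z t" "\<And>t. 0 \<le> t \<Longrightarrow> ito_integrable M F (B 1) H1z t" "\<And>t. 0 \<le> t \<Longrightarrow> ito_integrable M F (B 2) H2z t"
    "\<And>t. 0 \<le> t \<Longrightarrow> compensated_integrable M F N0 m K0z t" "\<And>t. 0 \<le> t \<Longrightarrow> compensated_integrable M F N1 ?\<nu> K1z t"
    "\<And>t. 0 \<le> t \<Longrightarrow> AE w in M. z t w = z0 w + (LINT s:{0..t}|lborel. gz s w) + IB 0 H0z t w + IB 1 H1z t w + IB 2 H2z t w + J0 K0z t w + J1 K1z t w"
    using z unfolding solves_z_def Let_def H0z_def[abs_def] H1z_def[abs_def] H2z_def[abs_def] K0z_def K1z_def gz_def[abs_def] IB_def J0_def J1_def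
    by blast+
  define H0 H1 H2 where "H0 s w = H0p s w - H0m s w - H0z s w" and "H1 s w = H1p s w - H1m s w - H1z s w" and "H2 s w = H2p s w - H2m s w - H2z s w" for s w
  define K0 K1 where "K0 s v w = K0p s v w + K0m s v w - K0z s v w" and "K1 s v' w = K1p s v' w + K1m s v' w - K1z s v' w" for s v v' w
  define I0 I1 I2 where "I0 t w = IB 0 H0p t w - IB 0 H0m t w - IB 0 H0z t w" and "I1 t w = IB 1 H1p t w - IB 1 H1m t w - IB 1 H1z t w"
    and "I2 t w = IB 2 H2p t w - IB 2 H2m t w - IB 2 H2z t w" for t w
  \<comment> \<open>The equation of \<open>ym\<close> carries its jump integrals with the factor -1,
    so subtracting it adds the integrals over \<open>D_minus\<close>.\<close>
  define S0 S1 where "S0 t w = J0 K0p t w + J0 K0m t w - J0 K0z t w" and "S1 t w = J1 K1p t w + J1 K1m t w - J1 K1z t w" for t w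
  define Q where "Q = Qt T"
  have Q: "countable Q" "\<And>q. q \<in> Q \<Longrightarrow> 0 \<le> q" "\<And>q. q \<in> Q \<Longrightarrow> q \<le> T" using Qt(1,2)[of T] T by (auto simp: Q_def)
  have d: "0 < \<delta>" using n T c1 \<zeta> by (auto simp: \<delta>_def intro!: add_nonneg_pos mult_pos_pos mult_nonneg_nonneg add_nonneg_nonneg)
  have A0: "B0.ito_approx H0 t (I0 t)" if "0 \<le> t" for t unfolding I0_def[abs_def] H0_def[abs_def] IB_def
    by (intro B0.ito_approx_combine B0.has_ito_integral_approx ito_integral_has ps ms zs that)
  have A1: "B1.ito_approx H1 t (I1 t)" if "0 \<le> t" for t unfolding I1_def[abs_def] H1_def[abs_def] IB_def
    by (intro B1.ito_approx_combine B1.has_ito_integral_approx ito_integral_has ps ms zs that)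
  have A2: "B2.ito_approx H2 t (I2 t)" if "0 \<le> t" for t unfolding I2_def[abs_def] H2_def[abs_def] IB_def
    by (intro B2.ito_approx_combine B2.has_ito_integral_approx ito_integral_has ps ms zs that)
  have c0h: "has_compensated_integral M F N0 m K t (J0 K t)" if "compensated_integrable M F N0 m K t" for K t
    unfolding J0_def by (rule compensated_integral_has[OF that])
  have c1h: "has_compensated_integral M F N1 ?\<nu> K t (J1 K t)" if "compensated_integrable M F N1 ?\<nu> K t" for K t
    unfolding J1_def by (rule compensated_integral_has[OF that])
  have pr0: "predictable M F m K" if "compensated_integrable M F N0 m K 0" for K
    using c0h[OF that] by (simp add: has_compensated_integral_def)
  have pr1: "predictable M F ?\<nu> K" if "compensated_integrable M F N1 ?\<nu> K 0" for K
    using c1h[OF that] by (simp add: has_compensated_integral_def)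
  have K0p: "predictable M F m K0" and K1p: "predictable M F ?\<nu> K1"
    unfolding K0_def[abs_def] K1_def[abs_def] by (intro predictable_combine pr0 pr1 ps ms zs order_refl)+
  have S0l: "tends_to_0_in_prob M (\<lambda>k w. ennreal \<bar>truncated_compensated_integral N0 m K0 (1 / real (Suc k)) t w - S0 t w\<bar>)" if t: "0 \<le> t" for t
    unfolding K0_def[abs_def] S0_def
  proof (rule P0.compensated_combine[OF c0h[OF ps(5)[OF t]] c0h[OF ms(5)[OF t]] c0h[OF zs(5)[OF t]] t])
    fix e s v w
    show "trunc e (K0p s v w + K0m s v w - K0z s v w) = trunc e (K0p s v w) + trunc e (K0m s v w) - trunc e (K0z s v w)" if "0 < e"
      using trunc_split[of 1 1 1 e v] that by (simp add: K0p_def K0m_def K0z_def mark_integrand_def)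
  qed
  have S1l: "tends_to_0_in_prob M (\<lambda>k w. ennreal \<bar>truncated_compensated_integral N1 ?\<nu> K1 (1 / real (Suc k)) t w - S1 t w\<bar>)" if t: "0 \<le> t" for t
    unfolding K1_def[abs_def] S1_def
  proof (rule P1.compensated_combine[OF c1h[OF ps(6)[OF t]] c1h[OF ms(6)[OF t]] c1h[OF zs(6)[OF t]] t])
    fix e s v w
    show "trunc e (K1p s v w + K1m s v w - K1z s v w) = trunc e (K1p s v w) + trunc e (K1m s v w) - trunc e (K1z s v w)" if "0 < e"
      unfolding K1p_def K1m_def K1z_def rate_integrand_def case_prod_unfold
      by (rule trunc_split) (use that in \<open>auto simp: indicator_def\<close>)
  qed
  define W where "W t w = yp t w - ym t w - z t w" for t w
  let ?eq = "\<lambda>w t. W t w = yp 0 w - ym 0 w - z0 w + ((LINT s:{0..t}|lborel. gp s w) - (LINT s:{0..t}|lborel. gm s w) - (LINT s:{0..t}|lborel. gz s w)) +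
    (I0 t w + I1 t w + I2 t w + S0 t w + S1 t w)"
  have eqs: "AE w in M. \<forall>t\<in>Q. ?eq w t"
  proof (subst AE_ball_countable[OF Q(1)], rule ballI)
    fix t assume "t \<in> Q"
    then have t: "0 \<le> t" by (rule Q)
    show "AE w in M. ?eq w t"
      using ps(7)[OF t] ms(7)[OF t] zs(7)[OF t]
      by eventually_elim (simp add: W_def I0_def I1_def I2_def S0_def S1_def)
  qed
  let ?good = "controlled Q e \<delta> H0 I0 H1 I1 H2 I2 K0 S0 K1 S1"
  have key: "\<bar>W t w\<bar> \<le> 2 * \<eta> * exp (2 * \<bar>\<beta>22\<bar> * T)"
    if w: "w \<in> space M" and eq: "\<forall>t\<in>Q. ?eq w t"
      and bd: "\<forall>t\<in>{0..T}. x t w \<le> n \<and> \<bar>up t w - 1\<bar> \<le> \<zeta> \<and> \<bar>um t w - 1\<bar> \<le> \<zeta>"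
      and init: "\<bar>yp 0 w - ym 0 w - z0 w\<bar> \<le> e" and G: "?good w" and t: "0 \<le> t" "t \<le> T" for w t
  proof -
    have cad: "cadlag (\<lambda>t. x t w)" "cadlag (\<lambda>t. yp t w)" "cadlag (\<lambda>t. ym t w)" "cadlag (\<lambda>t. z t w)"
      using x(1) ps(1) ms(1) zs(1) w by (auto simp: cadlag_progressive_def)
    have cadu: "cadlag (\<lambda>t. up t w)" "cadlag (\<lambda>t. um t w)" unfolding up_def um_def by (intro cadlag_divide_const cad)+
    have mea: "meas_upto T (\<lambda>t. x t w)" "meas_upto T (\<lambda>t. yp t w)" "meas_upto T (\<lambda>t. ym t w)" "meas_upto T (\<lambda>t. z t w)"
      using x(1) ps(1) ms(1) zs(1) w T by (auto simp: cadlag_progressive_def B0.space_F intro: progressive_section)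
    have meau: "meas_upto T (\<lambda>t. up t w)" "meas_upto T (\<lambda>t. um t w)" unfolding up_def um_def by (intro meas_upto_divide mea)+
    have x0: "0 \<le> x s w" and up0: "0 \<le> up s w" and um0: "0 \<le> um s w" if "0 \<le> s" for s
      using x(2) yp(2) ym(2) w that th0 by (auto simp: nonneg_process_def up_def um_def)
    have xn: "x s w \<le> n" and upz: "\<bar>up s w - 1\<bar> \<le> \<zeta>" and umz: "\<bar>um s w - 1\<bar> \<le> \<zeta>" if "0 \<le> s" "s \<le> T" for s
      using bd that by auto
    have gc: "cadlag (\<lambda>s. gp s w)" "cadlag (\<lambda>s. gm s w)" "cadlag (\<lambda>s. gz s w)"
      unfolding gp_def gm_def gz_def by (intro cadlag_add cadlag_mult cadlag_const cad cadu)+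
    have gmm: "meas_upto T (\<lambda>s. gp s w)" "meas_upto T (\<lambda>s. gm s w)" "meas_upto T (\<lambda>s. gz s w)"
      unfolding gp_def gm_def gz_def by (intro meas_upto_add meas_upto_mult meas_upto_const mea meau)+
    define g where "g s = gp s w - gm s w - gz s w" for s
    define A where "A = \<bar>b2p\<bar> + \<bar>b2m\<bar> + n * (\<bar>\<beta>21p\<bar> + \<bar>\<beta>21m\<bar>)"
    have A0: "0 \<le> A" using n by (simp add: A_def)
    have gcad: "cadlag g" and gmea: "meas_upto T g" unfolding g_def[abs_def] by (intro cadlag_diff meas_upto_diff gc gmm)+
    note gi = cadlag_set_integrable[OF gcad gmea]
    obtain Cg where Cg: "0 < Cg" "\<And>t. 0 \<le> t \<Longrightarrow> t \<le> T \<Longrightarrow> \<bar>g t\<bar> \<le> Cg" using cadlag_bounded[OF gcad, of T] by blast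
    have Wc: "cadlag (\<lambda>t. W t w)" and Wm: "meas_upto T (\<lambda>t. W t w)" unfolding W_def by (intro cadlag_diff meas_upto_diff cad mea)+
    obtain CW where CW: "0 < CW" "\<And>t. 0 \<le> t \<Longrightarrow> t \<le> T \<Longrightarrow> \<bar>W t w\<bar> \<le> CW" using cadlag_bounded[OF Wc, of T] by blast
    have gsplit: "(LINT s:{0..q}|lborel. gp s w) - (LINT s:{0..q}|lborel. gm s w) - (LINT s:{0..q}|lborel. gz s w) = (LINT s:{0..q}|lborel. g s)"
      if "q \<le> T" for q
    proof -
      note i = cadlag_set_integrable[OF gc(1) meas_upto_mono[OF gmm(1) that]] cadlag_set_integrable[OF gc(2) meas_upto_mono[OF gmm(2) that]]
        cadlag_set_integrable[OF gc(3) meas_upto_mono[OF gmm(3) that]]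
      show ?thesis unfolding g_def using set_integral_diff[OF set_integral_diff(1)[OF i(1,2)] i(3)] set_integral_diff[OF i(1,2)] by simp
    qed
    have gb: "\<bar>g s\<bar> \<le> \<bar>\<beta>22\<bar> * \<bar>W s w\<bar> + A * \<zeta>" if s: "0 \<le> s" "s \<le> T" for s
    proof -
      \<comment> \<open>The terms \<open>- th * \<beta>22\<close> cancel between the halves. With
        both ratios equal to 1 the remaining coefficients would give exactly the drift of
        \<open>z\<close>, so only the deviations of the ratios from 1 survive.\<close>
      have "g s = \<beta>22 * W s w + ((\<beta>21p * x s w + b2p) * (up s w - 1) - (\<beta>21m * x s w + b2m) * (um s w - 1))"
        using th0 by (simp add: g_def gp_def gm_def gz_def W_def algebra_simps)
      moreover have "\<bar>(\<beta>21 * x s w + b2) * (u - 1)\<bar> \<le> (\<bar>\<beta>21\<bar> * n + \<bar>b2\<bar>) * \<zeta>" if "\<bar>u - 1\<bar> \<le> \<zeta>" for \<beta>21 b2 u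
      proof -
        have "\<bar>\<beta>21 * x s w + b2\<bar> \<le> \<bar>\<beta>21\<bar> * x s w + \<bar>b2\<bar>" using abs_triangle_ineq[of "\<beta>21 * x s w" b2] x0[OF s(1)] by (simp add: abs_mult)
        also have "\<dots> \<le> \<bar>\<beta>21\<bar> * n + \<bar>b2\<bar>" using xn[OF s] by (intro add_right_mono mult_left_mono) auto
        finally show ?thesis unfolding abs_mult using that n by (intro mult_mono) auto
      qed
      note this[OF upz[OF s], of \<beta>21p b2p] this[OF umz[OF s], of \<beta>21m b2m]
      ultimately have "\<bar>g s\<bar> \<le> \<bar>\<beta>22 * W s w\<bar> + (\<bar>\<beta>21p\<bar> * n + \<bar>b2p\<bar>) * \<zeta> + (\<bar>\<beta>21m\<bar> * n + \<bar>b2m\<bar>) * \<zeta>" by linarith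
      also have "\<dots> = \<bar>\<beta>22\<bar> * \<bar>W s w\<bar> + A * \<zeta>" by (simp add: A_def abs_mult algebra_simps)
      finally show ?thesis .
    qed
    define R where "R q = W q w - (yp 0 w - ym 0 w - z0 w) - (LINT s:{0..q}|lborel. g s)" for q
    have Rr: "(R \<longlongrightarrow> R t) (at_right t)" if "0 \<le> t" "t < T" for t
      unfolding R_def by (intro tendsto_diff tendsto_const cadlag_right[OF Wc that(1)] interval_integral_right_continuous[OF gi Cg(2) that])
    \<comment> \<open>Here the ratios are close to 1 on all of \<open>{0..T}\<close> by assumption,
      so no short window is needed and \<open>t + 1\<close> is an arbitrary choice.\<close>
    have Rb: "\<bar>R t\<bar> \<le> 5 * e" if t: "0 \<le> t" "t \<le> T" for t
    proof (rule extend_from_Qt[OF t, of R "t + 1"])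
      fix q assume "q \<in> Qt T"
      then have qQ: "q \<in> Q" by (simp add: Q_def)
      have qT: "0 \<le> q" "q \<le> T" using Q qQ by auto
      have RQ: "R q = I0 q w + I1 q w + I2 q w + S0 q w + S1 q w"
        using eq[rule_format, OF qQ] by (simp add: R_def gsplit[OF qT(2)])
      have parts: "ennreal (c * \<zeta> * q) \<le> ennreal \<delta>"
        if "c \<le> 2 * (\<bar>\<sigma>0p\<bar> + \<bar>\<sigma>0m\<bar>)\<^sup>2 + 2 * n * (\<bar>\<sigma>21p\<bar> + \<bar>\<sigma>21m\<bar>)\<^sup>2 + 2 * n * (\<bar>\<sigma>22p\<bar> + \<bar>\<sigma>22m\<bar>)\<^sup>2 + 2 * n * c1" "0 \<le> c" for c
      proof (rule ennreal_leI)
        have "c * q \<le> (2 * (\<bar>\<sigma>0p\<bar> + \<bar>\<sigma>0m\<bar>)\<^sup>2 + 2 * n * (\<bar>\<sigma>21p\<bar> + \<bar>\<sigma>21m\<bar>)\<^sup>2 + 2 * n * (\<bar>\<sigma>22p\<bar> + \<bar>\<sigma>22m\<bar>)\<^sup>2 + 2 * n * c1) * T"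
          using that qT by (intro mult_mono) auto
        also have "\<dots> \<le> \<dots> + 1" by simp
        finally have "c * q * \<zeta> \<le> \<delta>" unfolding \<delta>_def using \<zeta> by (intro mult_right_mono) auto
        then show "c * \<zeta> * q \<le> \<delta>" by (simp add: mult_ac)
      qed
      have nn: "0 \<le> 2 * (\<bar>\<sigma>0p\<bar> + \<bar>\<sigma>0m\<bar>)\<^sup>2" "0 \<le> 2 * n * (\<bar>\<sigma>21p\<bar> + \<bar>\<sigma>21m\<bar>)\<^sup>2" "0 \<le> 2 * n * (\<bar>\<sigma>22p\<bar> + \<bar>\<sigma>22m\<bar>)\<^sup>2" "0 \<le> 2 * n * c1" using n c1 by auto
      have s0: "sq_int q (\<lambda>s. H0 s w) \<le> ennreal \<delta>"
      proof (rule order_trans[OF sq_int_bound parts[of "2 * (\<bar>\<sigma>0p\<bar> + \<bar>\<sigma>0m\<bar>)\<^sup>2"]])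
        fix s assume "0 \<le> s" "s \<le> q"
        then show "(H0 s w)\<^sup>2 \<le> 2 * (\<bar>\<sigma>0p\<bar> + \<bar>\<sigma>0m\<bar>)\<^sup>2 * \<zeta>"
          using diffusion_difference[of 1 1 "up s w" \<zeta> "um s w" \<sigma>0p \<sigma>0m] up0 um0 upz umz \<zeta> qT
          by (simp add: H0_def H0p_def H0m_def H0z_def mult.commute)
      qed (use nn \<zeta> qT in auto)
      have s1: "sq_int q (\<lambda>s. H1 s w) \<le> ennreal \<delta>"
      proof (rule order_trans[OF sq_int_bound parts[of "2 * n * (\<bar>\<sigma>21p\<bar> + \<bar>\<sigma>21m\<bar>)\<^sup>2"]])
        fix s assume s: "0 \<le> s" "s \<le> q"
        then have sT: "s \<le> T" using qT by simp
        show "(H1 s w)\<^sup>2 \<le> 2 * n * (\<bar>\<sigma>21p\<bar> + \<bar>\<sigma>21m\<bar>)\<^sup>2 * \<zeta>"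
          unfolding H1_def H1p_def H1m_def H1z_def
          by (rule diffusion_difference[OF x0[OF s(1)] xn[OF s(1) sT] up0[OF s(1)] upz[OF s(1) sT] um0[OF s(1)] umz[OF s(1) sT] less_imp_le[OF \<zeta>(1)] \<zeta>(2)])
      qed (use nn \<zeta> qT in auto)
      have s2: "sq_int q (\<lambda>s. H2 s w) \<le> ennreal \<delta>"
      proof (rule order_trans[OF sq_int_bound parts[of "2 * n * (\<bar>\<sigma>22p\<bar> + \<bar>\<sigma>22m\<bar>)\<^sup>2"]])
        fix s assume s: "0 \<le> s" "s \<le> q"
        then have sT: "s \<le> T" using qT by simp
        show "(H2 s w)\<^sup>2 \<le> 2 * n * (\<bar>\<sigma>22p\<bar> + \<bar>\<sigma>22m\<bar>)\<^sup>2 * \<zeta>"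
          unfolding H2_def H2p_def H2m_def H2z_def
          by (rule diffusion_difference[OF x0[OF s(1)] xn[OF s(1) sT] up0[OF s(1)] upz[OF s(1) sT] um0[OF s(1)] umz[OF s(1) sT] less_imp_le[OF \<zeta>(1)] \<zeta>(2)])
      qed (use nn \<zeta> qT in auto)
      have s3: "P0.LF q (\<lambda>w p. ennreal (l12 (K0 (fst p) (snd p) w))) w \<le> ennreal \<delta>"
      proof -
        \<comment> \<open>The \<open>N0\<close> terms of the two halves involve no ratio, so
          together they match the limit equation exactly.\<close>
        have "K0 s v w = 0" for s v
          using D_halves_sum[of 1 v] unfolding K0_def K0p_def K0m_def K0z_def mark_integrand_def mult_1 .
        then have z: "ennreal (l12 (K0 s v w)) = 0" for s v by (simp only: l12_def) simp
        have "P0.LF q (\<lambda>w p. ennreal (l12 (K0 (fst p) (snd p) w))) w = 0" unfolding P0.LF_def z by simp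
        then show ?thesis by simp
      qed
      have s4: "P1.LF q (\<lambda>w p. ennreal (l12 (K1 (fst p) (snd p) w))) w \<le> ennreal \<delta>"
      proof -
        have "P1.LF q (\<lambda>w p. ennreal (l12 (K1 (fst p) (snd p) w))) w \<le> (\<integral>\<^sup>+s\<in>{0<..q}. ennreal (2 * n * c1 * \<zeta>) \<partial>lborel)"
        proof (rule P1.LF_predictable_bound[OF K1p w])
          fix s assume s: "0 < s" "s \<le> q"
          let ?x = "left_lim (\<lambda>q. x q w) s"
          have ll: "\<bar>left_lim (\<lambda>q. x q w * u q w) s - ?x\<bar> \<le> n * \<zeta>"
            if u: "cadlag (\<lambda>q. u q w)" "\<And>r. 0 \<le> r \<Longrightarrow> r \<le> T \<Longrightarrow> \<bar>u r w - 1\<bar> \<le> \<zeta>" for u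
          proof (rule left_lim_diff_le[OF cadlag_mult[OF cad(1) u(1)] cad(1) s(1)])
            fix r assume r: "0 \<le> r" "r < s"
            have "x r w * u r w - x r w = x r w * (u r w - 1)" by (simp add: algebra_simps)
            then have "\<bar>x r w * u r w - x r w\<bar> = x r w * \<bar>u r w - 1\<bar>" using x0[OF r(1)] by (simp add: abs_mult)
            also have "\<dots> \<le> n * \<zeta>" using x0[OF r(1)] xn[of r] u(2)[of r] r s qT n by (intro mult_mono) auto
            finally show "\<bar>x r w * u r w - x r w\<bar> \<le> n * \<zeta>" .
          qed
          note lp = ll[of up, OF cadu(1) upz] and lm = ll[of um, OF cadu(2) umz]
          have "(\<integral>\<^sup>+v. ennreal (l12 (K1 s v w)) \<partial>?\<nu>) \<le> ennreal ((?x + n * \<zeta>) - (?x - n * \<zeta>)) * ennreal c1"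
          proof (rule rate_mass)
            fix u \<xi>
            \<comment> \<open>All three rates lie within \<open>n * \<zeta>\<close> of the left
              limit of \<open>x\<close>. Outside this strip \<open>u\<close> is on the same side of
              all of them and the halves reproduce the jump of the limit; inside, what remains is at
              most one jump of the mark.\<close>
            show "ennreal (l12 (K1 s (u, \<xi>) w)) \<le> indicator {?x - n * \<zeta>..?x + n * \<zeta>} u * ennreal (l12 (snd \<xi>))"
            proof (cases "u \<in> {?x - n * \<zeta>..?x + n * \<zeta>}")
              case True
              have "\<bar>K1 s (u, \<xi>) w\<bar> \<le> \<bar>snd \<xi>\<bar>"
                unfolding K1_def K1p_def K1m_def K1z_def rate_integrand_def case_prod_conv
                by (rule D_halves_le) (auto simp: indicator_def)
              from ennreal_leI[OF l12_mono[OF this]] show ?thesis using True by simp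
            next
              case False
              then have u: "(u \<le> left_lim (\<lambda>q. x q w * up q w) s) = (u \<le> ?x)" "(u \<le> left_lim (\<lambda>q. x q w * um q w) s) = (u \<le> ?x)" using lp lm by auto
              have "(indicator {0<..left_lim (\<lambda>q. x q w * up q w) s} u :: real) = indicator {0<..?x} u"
                "(indicator {0<..left_lim (\<lambda>q. x q w * um q w) s} u :: real) = indicator {0<..?x} u"
                using u by (auto simp: indicator_def)
              then have "K1 s (u, \<xi>) w = 0"
                unfolding K1_def K1p_def K1m_def K1z_def rate_integrand_def case_prod_conv by (simp only: D_halves_sum)
              then show ?thesis by (simp add: l12_def)
            qed
          qed
          also have "\<dots> = ennreal (2 * n * c1 * \<zeta>)" using n c1 \<zeta> by (simp add: ennreal_mult[symmetric] mult_ac)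
          finally show "(\<integral>\<^sup>+v. ennreal (l12 (K1 s v w)) \<partial>?\<nu>) \<le> ennreal (2 * n * c1 * \<zeta>)" .
        qed
        also have "\<dots> = ennreal (2 * n * c1 * \<zeta> * q)" using qT n c1 \<zeta> by (simp add: nn_integral_cmult_indicator ennreal_mult)
        also have "\<dots> \<le> ennreal \<delta>" by (rule parts) (use nn in auto)
        finally show ?thesis .
      qed
      have "\<bar>I0 q w\<bar> \<le> e" "\<bar>I1 q w\<bar> \<le> e" "\<bar>I2 q w\<bar> \<le> e" "\<bar>S0 q w\<bar> \<le> e" "\<bar>S1 q w\<bar> \<le> e"
        using bspec[OF G[unfolded controlled_def] qQ] s0 s1 s2 s3 s4 by blast+
      then show "\<bar>R q\<bar> \<le> 5 * e" unfolding RQ by linarith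
    qed (use Rr t in auto)
    have \<eta>0: "0 \<le> \<eta>" using e A0 T \<zeta> by (simp add: \<eta>_def A_def)
    have Wa: "meas_upto T (\<lambda>s. \<bar>W s w\<bar>)"
    proof -
      have "(\<lambda>s. \<bar>W s w * indicator {0..T} s\<bar>) \<in> borel_measurable borel" using Wm unfolding meas_upto_def by measurable
      then show ?thesis unfolding meas_upto_def by (simp add: abs_mult)
    qed
    have le: "\<bar>W t w\<bar> \<le> \<eta> + \<bar>\<beta>22\<bar> * (LINT s:{0..t}|lborel. \<bar>W s w\<bar>)" if t: "0 \<le> t" "t \<le> T" for t
    proof -
      have git: "set_integrable lborel {0..t} g" by (rule set_integrable_subset[OF gi]) (use t in auto)
      have "\<bar>LINT s:{0..t}|lborel. g s\<bar> \<le> \<bar>\<beta>22\<bar> * (LINT s:{0..t}|lborel. \<bar>W s w\<bar>) + A * \<zeta> * t"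
        by (rule drift_bound[OF git meas_upto_mono[OF Wm t(2)] CW(2)]) (use gb t in auto)
      also have "\<dots> \<le> \<bar>\<beta>22\<bar> * (LINT s:{0..t}|lborel. \<bar>W s w\<bar>) + A * \<zeta> * T"
        using A0 \<zeta> t by (intro add_left_mono mult_left_mono) auto
      finally have D: "\<bar>LINT s:{0..t}|lborel. g s\<bar> \<le> \<bar>\<beta>22\<bar> * (LINT s:{0..t}|lborel. \<bar>W s w\<bar>) + A * \<zeta> * T" .
      have "W t w = R t + (LINT s:{0..t}|lborel. g s) + (yp 0 w - ym 0 w - z0 w)" by (simp add: R_def)
      then show ?thesis using Rb[OF t] D init unfolding \<eta>_def A_def by linarith
    qed
    show ?thesis
      by (rule gronwall_bound[OF Wa _ _ T le t \<eta>0, of CW]) (use b22 CW in auto)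
  qed
  show ?thesis
    unfolding W_def[symmetric] up_def[symmetric] um_def[symmetric]
  proof (rule five_integrals_bound[OF Q(1,2) A0 A1 A2 K0p S0l K1p S1l e d])
    show "AE w in M. ?good w \<longrightarrow> (\<forall>t\<in>{0..T}. x t w \<le> n \<and> \<bar>up t w - 1\<bar> \<le> \<zeta> \<and> \<bar>um t w - 1\<bar> \<le> \<zeta>) \<and>
      (\<exists>t\<in>{0..T}. 2 * \<eta> * exp (2 * \<bar>\<beta>22\<bar> * T) < \<bar>W t w\<bar>) \<longrightarrow> e < \<bar>yp 0 w - ym 0 w - z0 w\<bar>"
    proof (rule AE_mp[OF eqs], intro AE_I2 impI, rule ccontr)
      fix w assume w: "w \<in> space M" and eq: "\<forall>t\<in>Q. ?eq w t" and G: "?good w" and n: "\<not> e < \<bar>yp 0 w - ym 0 w - z0 w\<bar>"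
        and a: "(\<forall>t\<in>{0..T}. x t w \<le> n \<and> \<bar>up t w - 1\<bar> \<le> \<zeta> \<and> \<bar>um t w - 1\<bar> \<le> \<zeta>) \<and> (\<exists>t\<in>{0..T}. 2 * \<eta> * exp (2 * \<bar>\<beta>22\<bar> * T) < \<bar>W t w\<bar>)"
      from conjunct2[OF a] obtain t where t: "t \<in> {0..T}" "2 * \<eta> * exp (2 * \<bar>\<beta>22\<bar> * T) < \<bar>W t w\<bar>" ..
      have "\<bar>W t w\<bar> \<le> 2 * \<eta> * exp (2 * \<bar>\<beta>22\<bar> * T)"
        by (rule key[OF w eq conjunct1[OF a] _ G]) (use n t in auto)
      then show False using t(2) by simp
    qed
  qed
qed

end

section \<open>Passage to the limit\<close>

lemma markov_outer_measure:
  assumes f: "f \<in> borel_measurable M" and c: "(\<integral>\<^sup>+w. ennreal (f w) \<partial>M) \<le> ennreal c" and e: "0 < e"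
  shows "outer_measure_of M {w \<in> space M. e < f w} \<le> ennreal (c / e)"
proof -
  have "outer_measure_of M {w \<in> space M. e < f w} \<le> outer_measure_of M {w \<in> space M. 1 \<le> ennreal (1 / e) * ennreal (f w)}"
  proof (rule outer_measure_of_mono, safe)
    fix w assume "e < f w"
    then have "1 \<le> 1 / e * f w" using e by (simp add: field_simps)
    then have "ennreal 1 \<le> ennreal (1 / e * f w)" by (rule ennreal_leI)
    also have "\<dots> = ennreal (1 / e) * ennreal (f w)" by (rule ennreal_mult) (use e \<open>e < f w\<close> in auto)
    finally show "1 \<le> ennreal (1 / e) * ennreal (f w)" by simp
  qed
  also have "\<dots> = emeasure M ({w \<in> space M. 1 \<le> ennreal (1 / e) * ennreal (f w)})"
    using f by (intro outer_measure_of_eq) measurable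
  also have "\<dots> \<le> ennreal (1 / e) * (\<integral>\<^sup>+w\<in>space M. ennreal (f w) \<partial>M)"
    using f by (intro nn_integral_Markov_inequality) auto
  also have "(\<integral>\<^sup>+w\<in>space M. ennreal (f w) \<partial>M) = (\<integral>\<^sup>+w. ennreal (f w) \<partial>M)" by (intro nn_integral_cong) simp
  also have "ennreal (1 / e) * (\<integral>\<^sup>+w. ennreal (f w) \<partial>M) \<le> ennreal (1 / e) * ennreal c" by (intro mult_left_mono c) simp
  also have "\<dots> = ennreal (c / e)" using e by (simp add: ennreal_mult'[symmetric])
  finally show ?thesis .
qed

context affine_setting
begin

text \<open>In \<open>rescaled_solution_bound\<close> everything except the initial error and the
  part \<open>6 * e\<close> of \<open>\<eta>\<close> carries a power of
  \<open>1 / \<theta> k\<close>; so \<open>e\<close> is fixed first and \<open>k\<close> is taken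
  large afterwards.\<close>

lemma rescaled_solutions_tend_to_1:
  fixes x :: "real \<Rightarrow> 'a \<Rightarrow> real" and y :: "nat \<Rightarrow> real \<Rightarrow> 'a \<Rightarrow> real"
  assumes x: "cadlag_progressive M F x" "nonneg_process M x"
    and y: "\<forall>\<^sub>F k in sequentially. solves_y M F B N0 N1 m \<mu> (\<theta> k) b2 \<beta>21 \<beta>22 \<sigma>0 \<sigma>21 \<sigma>22 E sg x (y k) \<and> nonneg_process M (y k)"
    and init: "\<And>e r :: real. 0 < e \<Longrightarrow> 0 < r \<Longrightarrow>
      \<forall>\<^sub>F k in sequentially. outer_measure_of M {w \<in> space M. e < \<bar>y k 0 w / \<theta> k - 1\<bar>} \<le> ennreal r"
    and \<theta>: "\<And>k. 1 \<le> \<theta> k" "filterlim \<theta> at_top sequentially"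
    and b22: "\<beta>22 < 0" and sg: "\<bar>sg\<bar> = 1" and T: "0 \<le> T" and n: "0 \<le> n" and \<zeta>: "0 < \<zeta>" "\<zeta> \<le> 1" and r: "0 < (r::real)"
  shows "\<forall>\<^sub>F k in sequentially. outer_measure_of M {w \<in> space M. (\<forall>t\<in>{0..T}. x t w \<le> n) \<and> (\<exists>t\<in>{0..T}. \<zeta> < \<bar>y k t w / \<theta> k - 1\<bar>)} \<le> ennreal r"
proof -
  define X where "X = exp (2 * \<bar>\<beta>22\<bar> * T)"
  have X: "0 < X" by (simp add: X_def)
  \<comment> \<open>Makes \<open>2 * (6 * e) * X\<close> equal to \<open>\<zeta> / 4\<close>, which
    leaves room for the part of \<open>\<eta>\<close> that vanishes with
    \<open>1 / \<theta> k\<close>.\<close>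
  define e where "e = \<zeta> / (48 * X)"
  have e: "0 < e" using \<zeta> X by (simp add: e_def)
  define P where "P = (\<bar>\<beta>21\<bar> * n + \<bar>b2\<bar>) * (2 * T + 1)"
  define \<delta> where "\<delta> = (2 * \<sigma>0\<^sup>2 + 2 * n * \<sigma>21\<^sup>2 + 2 * n * \<sigma>22\<^sup>2 + c0 + n * c1) * (2 * T + 1) + 1"
  have v: "(\<lambda>k. inverse (\<theta> k)) \<longlonglongrightarrow> 0" by (rule tendsto_inverse_0_at_top[OF \<theta>(2)])
  have "(\<lambda>k. 304 * \<delta> / e\<^sup>2 * (inverse (\<theta> k))\<^sup>2 + 16 * \<delta> / e * inverse (\<theta> k)) \<longlonglongrightarrow> 304 * \<delta> / e\<^sup>2 * 0\<^sup>2 + 16 * \<delta> / e * 0"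
    by (intro tendsto_intros v)
  then have "\<forall>\<^sub>F k in sequentially. 304 * \<delta> / e\<^sup>2 * (inverse (\<theta> k))\<^sup>2 + 16 * \<delta> / e * inverse (\<theta> k) < r / 2"
    by (rule order_tendstoD) (use r in simp)
  moreover have "(\<lambda>k. 2 * X * P * inverse (\<theta> k)) \<longlonglongrightarrow> 2 * X * P * 0" by (intro tendsto_intros v)
  then have "\<forall>\<^sub>F k in sequentially. 2 * X * P * inverse (\<theta> k) < \<zeta> / 4" by (rule order_tendstoD) (use \<zeta> in simp)
  moreover have "\<forall>\<^sub>F k in sequentially. outer_measure_of M {w \<in> space M. e < \<bar>y k 0 w / \<theta> k - 1\<bar>} \<le> ennreal (r / 2)"
    by (rule init) (use e r in auto)
  ultimately show ?thesis using y
  proof eventually_elim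
    case (elim k)
    define \<eta> where "\<eta> = 6 * e + (\<bar>\<beta>21\<bar> * n + \<bar>b2\<bar>) * (2 * T + 1) / \<theta> k"
    have "2 * \<eta> * X = 12 * e * X + 2 * X * P * inverse (\<theta> k)" by (simp add: \<eta>_def P_def algebra_simps divide_inverse)
    also have "12 * e * X = \<zeta> / 4" using X by (simp add: e_def)
    finally have \<eta>: "2 * \<eta> * X < \<zeta>" "2 * \<eta> * X < 1" using elim(2) \<zeta> by auto
    have err: "304 * \<delta> / (e * \<theta> k)\<^sup>2 + 16 * \<delta> / (e * \<theta> k) = 304 * \<delta> / e\<^sup>2 * (inverse (\<theta> k))\<^sup>2 + 16 * \<delta> / e * inverse (\<theta> k)"
      by (simp add: power_mult_distrib divide_inverse power_inverse)
    have "outer_measure_of M {w \<in> space M. (\<forall>t\<in>{0..T}. x t w \<le> n) \<and> (\<exists>t\<in>{0..T}. \<zeta> < \<bar>y k t w / \<theta> k - 1\<bar>)}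
      \<le> outer_measure_of M {w \<in> space M. (\<forall>t\<in>{0..T}. x t w \<le> n) \<and> (\<exists>t\<in>{0..T}. 2 * \<eta> * X < \<bar>y k t w / \<theta> k - 1\<bar>)}"
      by (rule outer_measure_of_mono) (use \<eta>(1) in \<open>auto intro: less_trans\<close>)
    also have "\<dots> \<le> outer_measure_of M {w \<in> space M. e < \<bar>y k 0 w / \<theta> k - 1\<bar>} + ennreal (304 * \<delta> / (e * \<theta> k)\<^sup>2 + 16 * \<delta> / (e * \<theta> k))"
      unfolding X_def \<eta>_def \<delta>_def
      by (rule rescaled_solution_bound[OF x conjunct1[OF elim(4)] conjunct2[OF elim(4)] \<theta>(1) b22 sg T e n]) (use \<eta>(2) in \<open>simp add: X_def \<eta>_def\<close>)
    also have "\<dots> \<le> ennreal (r / 2) + ennreal (r / 2)"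
      by (intro add_mono elim(3) ennreal_leI, subst err) (rule less_imp_le[OF elim(1)])
    also have "\<dots> = ennreal r" using r by (simp add: ennreal_plus[symmetric] del: ennreal_plus)
    finally show ?case .
  qed
qed

end

theorem theorem7p2:
  fixes M :: "'a measure" and F :: "real \<Rightarrow> 'a measure"
    and B :: "nat \<Rightarrow> real \<Rightarrow> 'a \<Rightarrow> real"
    and N0 :: "'a \<Rightarrow> (real \<times> real \<times> real) measure"
    and N1 :: "'a \<Rightarrow> (real \<times> real \<times> real \<times> real) measure"
    and a :: real and \<alpha> :: "real^2^2" and b :: "real \<times> real" and \<beta> :: "real^2^2"
    and m \<mu> :: "(real \<times> real) measure"
    and \<sigma>0 \<sigma>0p \<sigma>0m :: real and \<sigma> :: "real^2^2"
    and \<sigma>21p \<sigma>21m \<sigma>22p \<sigma>22m b2p b2m \<beta>21p \<beta>21m :: real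
    and \<theta> :: "nat \<Rightarrow> real"
    and x :: "real \<Rightarrow> 'a \<Rightarrow> real"
    and yp ym zp zm zk :: "nat \<Rightarrow> real \<Rightarrow> 'a \<Rightarrow> real"
    and zp0 zm0 :: "'a \<Rightarrow> real"
    and z :: "real \<Rightarrow> 'a \<Rightarrow> real"
  assumes params: "admissible a \<alpha> b \<beta> m \<mu>"
    and beta22: "\<beta> $ 2 $ 2 < 0"
    and m_fin: "(\<integral>\<^sup>+\<xi>. ennreal \<bar>snd \<xi>\<bar> \<partial>m) < \<infinity>"
    and basis: "stochastic_basis M F B N0 N1 m \<mu>"
    and sigma0: "\<sigma>0 = sqrt a"
    and sigma: "\<alpha> = \<sigma> ** transpose \<sigma>"
    and sigma0_dec: "\<sigma>0 = \<sigma>0p - \<sigma>0m"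
    and sigma21_dec: "\<sigma> $ 2 $ 1 = \<sigma>21p - \<sigma>21m"
    and sigma22_dec: "\<sigma> $ 2 $ 2 = \<sigma>22p - \<sigma>22m"
    and b2_dec: "snd b = b2p - b2m"
    and beta21_dec: "\<beta> $ 2 $ 1 = \<beta>21p - \<beta>21m"
    and theta_ge: "\<And>k. 1 \<le> \<theta> k"
    and theta_lim: "filterlim \<theta> at_top sequentially"
    and x0: "x 0 \<in> borel_measurable (F 0)"
    and x_nonneg: "nonneg_process M x"
    and x_sol: "solves_x M F B N0 N1 \<mu> (fst b) (\<beta> $ 1 $ 1) (\<sigma> $ 1 $ 1) (\<sigma> $ 1 $ 2) x"
    and yp: "\<And>k. (\<integral>\<xi>. \<bar>snd \<xi>\<bar> \<partial>m) \<le> - \<theta> k * \<beta> $ 2 $ 2 \<Longrightarrow>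
          yp k 0 \<in> borel_measurable (F 0) \<and> nonneg_process M (yp k) \<and>
          solves_y M F B N0 N1 m \<mu> (\<theta> k) b2p \<beta>21p (\<beta> $ 2 $ 2) \<sigma>0p \<sigma>21p \<sigma>22p D_plus 1 x (yp k)"
    and ym: "\<And>k. (\<integral>\<xi>. \<bar>snd \<xi>\<bar> \<partial>m) \<le> - \<theta> k * \<beta> $ 2 $ 2 \<Longrightarrow>
          ym k 0 \<in> borel_measurable (F 0) \<and> nonneg_process M (ym k) \<and>
          solves_y M F B N0 N1 m \<mu> (\<theta> k) b2m \<beta>21m (\<beta> $ 2 $ 2) \<sigma>0m \<sigma>21m \<sigma>22m D_minus (- 1) x (ym k)"
    and zp_def: "\<And>k t \<omega>. zp k t \<omega> = yp k t \<omega> - \<theta> k"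
    and zm_def: "\<And>k t \<omega>. zm k t \<omega> = ym k t \<omega> - \<theta> k"
    and zk_def: "\<And>k t \<omega>. zk k t \<omega> = zp k t \<omega> - zm k t \<omega>"
    and zp0: "zp0 \<in> borel_measurable (F 0)"
    and zm0: "zm0 \<in> borel_measurable (F 0)"
    and z0_integrable: "(\<integral>\<^sup>+\<omega>. ennreal (\<bar>zp0 \<omega>\<bar> + \<bar>zm0 \<omega>\<bar>) \<partial>M) < \<infinity>"
    and z0_lim: "(\<lambda>k. \<integral>\<^sup>+\<omega>. ennreal (\<bar>zp k 0 \<omega> - zp0 \<omega>\<bar> + \<bar>zm k 0 \<omega> - zm0 \<omega>\<bar>) \<partial>M) \<longlonglongrightarrow> 0"
    and z_sol: "solves_z M F B N0 N1 m \<mu> (snd b) (\<beta> $ 2 $ 1) (\<beta> $ 2 $ 2) \<sigma>0 (\<sigma> $ 2 $ 1) (\<sigma> $ 2 $ 2)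
          x (\<lambda>\<omega>. zp0 \<omega> - zm0 \<omega>) z"
  shows "converges_in_prob_skorokhod M zk z"
proof -
  define c0 c1 where "c0 = enn2real (\<integral>\<^sup>+\<xi>. ennreal (l12 (snd \<xi>)) \<partial>m)" and "c1 = enn2real (\<integral>\<^sup>+\<xi>. ennreal (l12 (snd \<xi>)) \<partial>\<mu>)"
  have "(\<integral>\<^sup>+\<xi>. ennreal (l12 (snd \<xi>)) \<partial>m) \<le> (\<integral>\<^sup>+\<xi>. ennreal (l1 (fst \<xi>) + l12 (snd \<xi>)) \<partial>m)"
    by (intro nn_integral_mono ennreal_leI) (simp add: l1_def)
  then have fin0: "(\<integral>\<^sup>+\<xi>. ennreal (l12 (snd \<xi>)) \<partial>m) < \<infinity>"
    by (rule le_less_trans) (use params in \<open>simp add: admissible_def\<close>)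
  have "(\<integral>\<^sup>+\<xi>. ennreal (l12 (snd \<xi>)) \<partial>\<mu>) \<le> (\<integral>\<^sup>+\<xi>. ennreal (l12 (fst \<xi>) + l12 (snd \<xi>)) \<partial>\<mu>)"
    by (intro nn_integral_mono ennreal_leI) (simp add: l12_nonneg)
  then have fin1: "(\<integral>\<^sup>+\<xi>. ennreal (l12 (snd \<xi>)) \<partial>\<mu>) < \<infinity>"
    by (rule le_less_trans) (use params in \<open>simp add: admissible_def\<close>)
  interpret affine_setting M F B N0 N1 m \<mu> c0 c1
    by standard (use params basis fin0 fin1 in \<open>simp_all add: admissible_def c0_def c1_def\<close>)
  have xc: "cadlag_progressive M F x" using x_sol by (simp add: solves_x_def Let_def)
  let ?b = "\<beta> $ 2 $ 2"
  have "\<forall>\<^sub>F k in sequentially. (\<integral>\<xi>. \<bar>snd \<xi>\<bar> \<partial>m) / - ?b \<le> \<theta> k" using theta_lim unfolding filterlim_at_top by blast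
  \<comment> \<open>The assumptions on \<open>yp k\<close> and \<open>ym k\<close> speak only of
    such \<open>k\<close>, so statements about them hold eventually.\<close>
  then have large: "\<forall>\<^sub>F k in sequentially. (\<integral>\<xi>. \<bar>snd \<xi>\<bar> \<partial>m) \<le> - \<theta> k * ?b"
    by (rule eventually_mono) (use beta22 in \<open>simp add: field_simps\<close>)
  note ev = eventually_mono[OF large]
  have zm0M[measurable]: "zp0 \<in> borel_measurable M" "zm0 \<in> borel_measurable M" using zp0 zm0 by (auto intro: B0.measurable_F_M)
  \<comment> \<open>\<open>D k\<close> tends to 0 in mean and \<open>C\<close> is integrable. Their
    sum dominates the initial distance of \<open>yp k\<close> and of \<open>ym k\<close> from
    \<open>\<theta> k\<close>, which is therefore negligible after division by
    \<open>\<theta> k\<close>.\<close>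
  define D C where "D k w = \<bar>zp k 0 w - zp0 w\<bar> + \<bar>zm k 0 w - zm0 w\<bar>" and "C w = \<bar>zp0 w\<bar> + \<bar>zm0 w\<bar>" for k w
  have Dm: "D k \<in> borel_measurable M" if "yp k 0 \<in> borel_measurable (F 0)" "ym k 0 \<in> borel_measurable (F 0)" for k
  proof -
    have [measurable]: "yp k 0 \<in> borel_measurable M" "ym k 0 \<in> borel_measurable M" using that by (auto intro: B0.measurable_F_M)
    show ?thesis unfolding D_def[abs_def] zp_def zm_def by measurable
  qed
  have Cm[measurable]: "C \<in> borel_measurable M" unfolding C_def[abs_def] by measurable
  have Dlim: "(\<lambda>k. \<integral>\<^sup>+w. ennreal (D k w) \<partial>M) \<longlonglongrightarrow> 0" using z0_lim by (simp add: D_def)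
  have small: "\<forall>\<^sub>F k in sequentially. outer_measure_of M {w \<in> space M. e < D k w} \<le> ennreal r" if e: "0 < e" and r: "0 < r" for e r :: real
  proof -
    have "\<forall>\<^sub>F k in sequentially. (\<integral>\<^sup>+w. ennreal (D k w) \<partial>M) < ennreal (r * e)" by (rule order_tendstoD(2)[OF Dlim]) (use e r in simp)
    with large show ?thesis
    proof eventually_elim
      case (elim k)
      have "outer_measure_of M {w \<in> space M. e < D k w} \<le> ennreal (r * e / e)"
        by (rule markov_outer_measure[OF Dm less_imp_le[OF elim(2)] e]) (use yp[OF elim(1)] ym[OF elim(1)] in auto)
      then show ?case using e by simp
    qed
  qed
  have init: "\<forall>\<^sub>F k in sequentially. outer_measure_of M {w \<in> space M. e < \<bar>y k 0 w / \<theta> k - 1\<bar>} \<le> ennreal r"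
    if e: "0 < e" and r: "0 < r" and y: "\<And>k w. \<bar>y k 0 w - \<theta> k\<bar> \<le> D k w + C w" for e r :: real and y :: "nat \<Rightarrow> real \<Rightarrow> 'a \<Rightarrow> real"
  proof -
    \<comment> \<open>Markov's inequality for \<open>C\<close> at level
      \<open>e * \<theta> k / 2\<close> costs \<open>2 * c / (e * \<theta> k)\<close>, which is at
      most \<open>r / 2\<close> once \<open>\<theta> k\<close> reaches
      \<open>4 * c / (e * r)\<close>.\<close>
    define c where "c = enn2real (\<integral>\<^sup>+w. ennreal (C w) \<partial>M)"
    have c: "(\<integral>\<^sup>+w. ennreal (C w) \<partial>M) = ennreal c" using z0_integrable by (simp add: c_def C_def)
    have c0: "0 \<le> c" by (simp add: c_def)
    have "\<forall>\<^sub>F k in sequentially. 4 * c / (e * r) + 1 \<le> \<theta> k" using theta_lim unfolding filterlim_at_top by blast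
    with small[of "e/2" "r/2"] e r have "\<forall>\<^sub>F k in sequentially. outer_measure_of M {w \<in> space M. e / 2 < D k w} \<le> ennreal (r / 2) \<and> 4 * c / (e * r) + 1 \<le> \<theta> k"
      by (intro eventually_conj) auto
    then show ?thesis
    proof (rule eventually_mono)
      fix k assume k: "outer_measure_of M {w \<in> space M. e / 2 < D k w} \<le> ennreal (r / 2) \<and> 4 * c / (e * r) + 1 \<le> \<theta> k"
      have th: "1 \<le> \<theta> k" by (rule theta_ge)
      have eth: "0 < e * \<theta> k / 2" using e th by simp
      have "{w \<in> space M. e < \<bar>y k 0 w / \<theta> k - 1\<bar>} \<subseteq> {w \<in> space M. e / 2 < D k w} \<union> {w \<in> space M. e * \<theta> k / 2 < C w}"
      proof (rule subsetI, rule ccontr)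
        fix w assume a: "w \<in> {w \<in> space M. e < \<bar>y k 0 w / \<theta> k - 1\<bar>}" and n: "w \<notin> {w \<in> space M. e / 2 < D k w} \<union> {w \<in> space M. e * \<theta> k / 2 < C w}"
        have "y k 0 w / \<theta> k - 1 = (y k 0 w - \<theta> k) / \<theta> k" using th by (simp add: diff_divide_distrib)
        then have "\<bar>y k 0 w / \<theta> k - 1\<bar> = \<bar>y k 0 w - \<theta> k\<bar> / \<theta> k" using th by (simp only: abs_divide)
        then have "e * \<theta> k < \<bar>y k 0 w - \<theta> k\<bar>" using a th by (simp add: field_simps)
        moreover have "D k w \<le> e / 2" "C w \<le> e * \<theta> k / 2" using a n by auto
        moreover have "e / 2 * 1 \<le> e / 2 * \<theta> k" using e th by (intro mult_left_mono) auto
        ultimately show False using y[of k w] by simp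
      qed
      then have "outer_measure_of M {w \<in> space M. e < \<bar>y k 0 w / \<theta> k - 1\<bar>} \<le> outer_measure_of M ({w \<in> space M. e / 2 < D k w} \<union> {w \<in> space M. e * \<theta> k / 2 < C w})"
        by (rule outer_measure_of_mono)
      also have "\<dots> \<le> ennreal (r / 2) + ennreal (r / 2)"
      proof (intro outer_measure_of_Un_bound)
        have "outer_measure_of M {w \<in> space M. e * \<theta> k / 2 < C w} \<le> ennreal (c / (e * \<theta> k / 2))"
          by (rule markov_outer_measure[OF Cm _ eth]) (simp add: c)
        also have "\<dots> \<le> ennreal (r / 2)"
        proof (rule ennreal_leI)
          have "4 * c / (e * r) \<le> \<theta> k" using k by simp
          then have "4 * c \<le> \<theta> k * (e * r)" using e r by (simp add: pos_divide_le_eq)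
          then show "c / (e * \<theta> k / 2) \<le> r / 2" using eth e th by (simp add: field_simps)
        qed
        finally show "outer_measure_of M {w \<in> space M. e * \<theta> k / 2 < C w} \<le> ennreal (r / 2)" .
      qed (use k in auto)
      also have "\<dots> = ennreal r" using r by (simp add: ennreal_plus[symmetric] del: ennreal_plus)
      finally show "outer_measure_of M {w \<in> space M. e < \<bar>y k 0 w / \<theta> k - 1\<bar>} \<le> ennreal r" .
    qed
  qed
  show ?thesis
    unfolding converges_in_prob_skorokhod_def
  proof (rule tends_to_0_in_probI_bound)
    fix e r :: real assume e: "0 < e" and r: "0 < r"
    \<comment> \<open>Times beyond \<open>T\<close> contribute at most \<open>exp (- T)\<close>,
      hence at most \<open>e / 4\<close>, to the Skorokhod distance; the minimum with 1 keeps
      \<open>T\<close> nonnegative.\<close>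
    define T where "T = - ln (min (e / 4) 1)"
    have T: "0 \<le> T" "exp (- T) \<le> e / 4" using e by (auto simp: T_def)
    \<comment> \<open>The order of the choices matters: \<open>T\<close> depends on
      \<open>e\<close>, the level \<open>n\<close> on \<open>T\<close> and \<open>r\<close>, then
      \<open>d\<close> and \<open>\<zeta>\<close> on all of these, and \<open>k\<close> comes last.
      Four exceptional events receive \<open>r / 4\<close> each.\<close>
    obtain n0 :: nat where n0: "outer_measure_of M {w \<in> space M. \<exists>t\<in>{0..T}. real n0 < x t w} \<le> ennreal (r / 4)"
      using cadlag_tight[OF xc T(1), of "r / 4"] r by auto
    define n where "n = real n0"
    have n: "0 \<le> n" by (simp add: n_def)
    define X where "X = exp (2 * \<bar>?b\<bar> * T)"
    have X: "0 < X" by (simp add: X_def)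
    define A where "A = \<bar>b2p\<bar> + \<bar>b2m\<bar> + n * (\<bar>\<beta>21p\<bar> + \<bar>\<beta>21m\<bar>)"
    have A: "0 \<le> A" using n by (simp add: A_def)
    define S where "S = (2 * (\<bar>\<sigma>0p\<bar> + \<bar>\<sigma>0m\<bar>)\<^sup>2 + 2 * n * (\<bar>\<sigma>21p\<bar> + \<bar>\<sigma>21m\<bar>)\<^sup>2 + 2 * n * (\<bar>\<sigma>22p\<bar> + \<bar>\<sigma>22m\<bar>)\<^sup>2 + 2 * n * c1) * T + 1"
    have S: "0 < S" using n T c1(1) unfolding S_def by (intro add_nonneg_pos mult_nonneg_nonneg add_nonneg_nonneg) auto
    \<comment> \<open>Makes \<open>12 * d * X\<close>, the share of the integrals and of the initial
      error in the final bound, equal to \<open>e / 4\<close>.\<close>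
    define d where "d = e / (48 * X)"
    have d: "0 < d" using e X by (simp add: d_def)
    define G where "G = S * (304 / d\<^sup>2 + 16 / d)"
    have G: "0 < G" using S d by (simp add: G_def add_pos_pos)
    \<comment> \<open>The second entry bounds the drift error by another \<open>e / 4\<close>. The
      third bounds the error probability in \<open>limit_difference_bound\<close>, which is
      \<open>\<zeta> * G\<close>, by \<open>r / 8\<close>.\<close>
    define \<zeta> where "\<zeta> = min 1 (min (e / (8 * X * (A * T + 1))) (r / 8 / G))"
    have AT: "0 < A * T + 1" using A T by (simp add: add_nonneg_pos)
    have \<zeta>: "0 < \<zeta>" "\<zeta> \<le> 1" "\<zeta> \<le> e / (8 * X * (A * T + 1))" "\<zeta> \<le> r / 8 / G" using e X AT r G by (auto simp: \<zeta>_def)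
    define \<eta> where "\<eta> = 6 * d + A * \<zeta> * T"
    have \<eta>0: "0 \<le> \<eta>" using d A \<zeta> T by (simp add: \<eta>_def)
    have "2 * \<eta> * X = 12 * d * X + 2 * X * (A * T) * \<zeta>" by (simp add: \<eta>_def algebra_simps)
    also have "\<dots> \<le> 12 * d * X + 2 * X * (A * T + 1) * \<zeta>" using X \<zeta> by (intro add_left_mono mult_right_mono mult_left_mono) auto
    also have "\<dots> \<le> e / 4 + e / 4"
    proof (rule add_mono)
      show "12 * d * X \<le> e / 4" using X by (simp add: d_def)
      have p: "0 < 8 * X * (A * T + 1)" using X AT by simp
      have "8 * X * (A * T + 1) * \<zeta> \<le> e" using \<zeta>(3) p by (simp add: pos_le_divide_eq mult.commute)
      then show "2 * X * (A * T + 1) * \<zeta> \<le> e / 4" by simp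
    qed
    finally have \<eta>: "2 * \<eta> * X \<le> e / 2" by simp
    have err: "304 * (S * \<zeta>) / d\<^sup>2 + 16 * (S * \<zeta>) / d \<le> r / 8"
    proof -
      have "304 * (S * \<zeta>) / d\<^sup>2 + 16 * (S * \<zeta>) / d = \<zeta> * G" by (simp add: G_def algebra_simps)
      also have "\<dots> \<le> r / 8" using \<zeta>(4) G by (simp add: pos_le_divide_eq)
      finally show ?thesis .
    qed
    have "\<forall>\<^sub>F k in sequentially. outer_measure_of M {w \<in> space M. (\<forall>t\<in>{0..T}. x t w \<le> n) \<and> (\<exists>t\<in>{0..T}. \<zeta> < \<bar>yp k t w / \<theta> k - 1\<bar>)} \<le> ennreal (r / 4)"
    proof (rule rescaled_solutions_tend_to_1[OF xc x_nonneg _ _ theta_ge theta_lim beta22 _ T(1) n \<zeta>(1,2)])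
      show "\<forall>\<^sub>F k in sequentially. solves_y M F B N0 N1 m \<mu> (\<theta> k) b2p \<beta>21p ?b \<sigma>0p \<sigma>21p \<sigma>22p D_plus 1 x (yp k) \<and> nonneg_process M (yp k)"
        by (rule ev) (use yp in blast)
      show "\<forall>\<^sub>F k in sequentially. outer_measure_of M {w \<in> space M. e < \<bar>yp k 0 w / \<theta> k - 1\<bar>} \<le> ennreal r" if "0 < e" "0 < r" for e r
        by (rule init[OF that]) (simp add: D_def C_def zp_def)
    qed (use r in auto)
    moreover have "\<forall>\<^sub>F k in sequentially. outer_measure_of M {w \<in> space M. (\<forall>t\<in>{0..T}. x t w \<le> n) \<and> (\<exists>t\<in>{0..T}. \<zeta> < \<bar>ym k t w / \<theta> k - 1\<bar>)} \<le> ennreal (r / 4)"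
    proof (rule rescaled_solutions_tend_to_1[OF xc x_nonneg _ _ theta_ge theta_lim beta22 _ T(1) n \<zeta>(1,2)])
      show "\<forall>\<^sub>F k in sequentially. solves_y M F B N0 N1 m \<mu> (\<theta> k) b2m \<beta>21m ?b \<sigma>0m \<sigma>21m \<sigma>22m D_minus (- 1) x (ym k) \<and> nonneg_process M (ym k)"
        by (rule ev) (use ym in blast)
      show "\<forall>\<^sub>F k in sequentially. outer_measure_of M {w \<in> space M. e < \<bar>ym k 0 w / \<theta> k - 1\<bar>} \<le> ennreal r" if "0 < e" "0 < r" for e r
        by (rule init[OF that]) (simp add: D_def C_def zm_def)
    qed (use r in auto)
    moreover have "\<forall>\<^sub>F k in sequentially. outer_measure_of M {w \<in> space M. d < D k w} \<le> ennreal (r / 8)"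
      by (rule small) (use d r in auto)
    ultimately show "\<forall>\<^sub>F k in sequentially. outer_measure_of M {w \<in> space M. ennreal e < skorokhod_dist (\<lambda>t. zk k t w) (\<lambda>t. z t w)} \<le> ennreal r"
      using large
    proof eventually_elim
      case (elim k)
      note ypk = yp[OF elim(4)] and ymk = ym[OF elim(4)]
      let ?X = "{w \<in> space M. \<exists>t\<in>{0..T}. real n0 < x t w}"
      let ?P = "{w \<in> space M. (\<forall>t\<in>{0..T}. x t w \<le> n) \<and> (\<exists>t\<in>{0..T}. \<zeta> < \<bar>yp k t w / \<theta> k - 1\<bar>)}"
      let ?M = "{w \<in> space M. (\<forall>t\<in>{0..T}. x t w \<le> n) \<and> (\<exists>t\<in>{0..T}. \<zeta> < \<bar>ym k t w / \<theta> k - 1\<bar>)}"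
      let ?W = "{w \<in> space M. (\<forall>t\<in>{0..T}. x t w \<le> n \<and> \<bar>yp k t w / \<theta> k - 1\<bar> \<le> \<zeta> \<and> \<bar>ym k t w / \<theta> k - 1\<bar> \<le> \<zeta>) \<and>
        (\<exists>t\<in>{0..T}. 2 * \<eta> * X < \<bar>yp k t w - ym k t w - z t w\<bar>)}"
      \<comment> \<open>The scale \<open>\<theta> k\<close> drops out of the difference of the two
        initial values, so their distance to the initial value of \<open>z\<close> is at most
        \<open>D k\<close>.\<close>
      have "outer_measure_of M ?W \<le> outer_measure_of M {w \<in> space M. d < \<bar>yp k 0 w - ym k 0 w - (zp0 w - zm0 w)\<bar>} + ennreal (304 * (S * \<zeta>) / d\<^sup>2 + 16 * (S * \<zeta>) / d)"
        unfolding \<eta>_def X_def A_def S_def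
        by (rule limit_difference_bound[OF xc x_nonneg conjunct2[OF conjunct2[OF ypk]] conjunct1[OF conjunct2[OF ypk]] conjunct2[OF conjunct2[OF ymk]] conjunct1[OF conjunct2[OF ymk]]
            z_sol[unfolded b2_dec beta21_dec sigma0_dec sigma21_dec sigma22_dec] theta_ge beta22 T(1) d n \<zeta>(1,2)])
      also have "\<dots> \<le> ennreal (r / 8) + ennreal (r / 8)"
      proof (intro add_mono ennreal_leI err)
        have "outer_measure_of M {w \<in> space M. d < \<bar>yp k 0 w - ym k 0 w - (zp0 w - zm0 w)\<bar>} \<le> outer_measure_of M {w \<in> space M. d < D k w}"
          by (rule outer_measure_of_mono) (auto simp: D_def zp_def zm_def)
        then show "outer_measure_of M {w \<in> space M. d < \<bar>yp k 0 w - ym k 0 w - (zp0 w - zm0 w)\<bar>} \<le> ennreal (r / 8)" using elim(3) by (rule order_trans)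
      qed
      also have "\<dots> = ennreal (r / 4)" using r by (simp add: ennreal_plus[symmetric] del: ennreal_plus)
      finally have W: "outer_measure_of M ?W \<le> ennreal (r / 4)" .
      \<comment> \<open>Off the four exceptional events the two paths differ by at most
        \<open>e / 2\<close> up to \<open>T\<close>, and the tail adds at most
        \<open>e / 4\<close>.\<close>
      have "{w \<in> space M. ennreal e < skorokhod_dist (\<lambda>t. zk k t w) (\<lambda>t. z t w)} \<subseteq> ?X \<union> (?P \<union> (?M \<union> ?W))"
      proof (rule subsetI, rule ccontr)
        fix w assume a: "w \<in> {w \<in> space M. ennreal e < skorokhod_dist (\<lambda>t. zk k t w) (\<lambda>t. z t w)}" and no: "w \<notin> ?X \<union> (?P \<union> (?M \<union> ?W))"
        then have w: "w \<in> space M" by simp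
        have "w \<notin> ?X" using no by blast
        then have xn: "\<forall>t\<in>{0..T}. x t w \<le> n" using w by (auto simp: n_def not_less)
        have "w \<notin> ?P" "w \<notin> ?M" using no by blast+
        then have "\<forall>t\<in>{0..T}. \<bar>yp k t w / \<theta> k - 1\<bar> \<le> \<zeta>" "\<forall>t\<in>{0..T}. \<bar>ym k t w / \<theta> k - 1\<bar> \<le> \<zeta>" using w xn by (auto simp: not_less)
        with xn have all: "\<forall>t\<in>{0..T}. x t w \<le> n \<and> \<bar>yp k t w / \<theta> k - 1\<bar> \<le> \<zeta> \<and> \<bar>ym k t w / \<theta> k - 1\<bar> \<le> \<zeta>" by blast
        have "w \<notin> ?W" using no by blast
        then have "\<forall>t\<in>{0..T}. \<bar>yp k t w - ym k t w - z t w\<bar> \<le> 2 * \<eta> * X" using w all by (auto simp: not_less)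
        then have le: "\<bar>zk k t w - z t w\<bar> \<le> e / 2" if "0 \<le> t" "t \<le> T" for t
          using that \<eta> by (force simp: zk_def zp_def zm_def)
        have "skorokhod_dist (\<lambda>t. zk k t w) (\<lambda>t. z t w) \<le> ennreal (e / 2 + exp (- T))"
          by (rule skorokhod_dist_le[OF T(1) _ le]) (use e in auto)
        also have "\<dots> \<le> ennreal e" using T e by (intro ennreal_leI) simp
        finally show False using a by (simp add: not_less[symmetric])
      qed
      then have "outer_measure_of M {w \<in> space M. ennreal e < skorokhod_dist (\<lambda>t. zk k t w) (\<lambda>t. z t w)} \<le> outer_measure_of M (?X \<union> (?P \<union> (?M \<union> ?W)))"
        by (rule outer_measure_of_mono)
      also have "\<dots> \<le> ennreal (r / 4) + (ennreal (r / 4) + (ennreal (r / 4) + ennreal (r / 4)))"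
        by (intro outer_measure_of_Un_bound n0 elim W) auto
      also have "\<dots> = ennreal r" using r by (simp add: ennreal_plus[symmetric] del: ennreal_plus)
      finally show ?case .
    qed
  qed
qed

end
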